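(* Let $\delta>0$ and $0<\theta\le(C_{inv,0}^2C_u^2)^{-1}$. The discrete bilinear form $a_h(\cdot,\cdot)$ is uniformly bounded on $V_{0h,*}\times V_{0h}$, i.e. there exists a positive constant $\mu_b$ that does not depend on $h$ such that $$|a_h(u,v_h)|\le\mu_b\|u\|_{h,*}\|v_h\|_h\qquad\forall u\in V_{0h,*},\ \forall v_h\in V_{0h},$$ with $\mu_b=\max\{\delta^{-1}C_{inv,0}^{-2}/2,\ 4+\delta^{-1}/2\}^{1/2}$.
   Context: **Domain.** Let $d\in\{1,2,3\}$, $T>0$, and let $Q=\{(x,t): t\in(0,T),\ x\in\Omega(t)\}\subset\mathbb{R}^{d+1}$ (written $\Omega(t)\times(0,T)$) be a bounded Lipschitz space-time domain, with $\Omega(t)\subset\mathbb{R}^d$ a possibly moving spatial domain. Its boundary is $\partial Q=\Sigma\cup\Sigma_0\cup\Sigma_T$, with lateral boundary $\Sigma=\partial\Omega(t)\times(0,T)$ (i.e. $x\in\partial\Omega(t)$, $0<t<T$), bottom $\Sigma_0=\Omega(0)\times\{0\}$ and top $\Sigma_T=\Omega(T)\times\{T\}$. $\nabla_x$ is the gradient in the spatial variables and $\partial_t$ the time derivative. $H^{1,1}_{0,\underline 0}(Q)=\{u\in L_2(Q):\nabla_x u\in[L_2(Q)]^d,\ \partial_t u\in L_2(Q),\ u=0\text{ on }\Sigma,\ u=0\text{ on }\Sigma_0\}$ and $H^{1,0}_0(Q)=\{u\in L_2(Q):\nabla_x u\in[L_2(Q)]^d,\ u=0\text{ on }\Sigma\}$.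 **Mesh.** $\mathcal K_h=\{K_1,\dots,K_N\}$ is a decomposition of $Q$ into non-degenerate $(d+1)$-simplices, $h_K$ is the diameter of $K$, $h=\max_K h_K$. The family of meshes is quasi-uniform: there is $C_u>0$ independent of $h$ with $h_K\le h\le C_u h_K$ for all $K\in\mathcal K_h$. For a polynomial degree $p\ge1$, $V_h=\{v_h\in C^0(\overline Q): v_h|_K\in\mathbb P_p(K)\ \forall K\in\mathcal K_h\}$, where $\mathbb P_p$ denotes polynomials of degree $\le p$, $V_{0h}=V_h\cap H^{1,1}_{0,\underline 0}(Q)$, and $V_{0h,*}=H^{1,0}_0(Q)\cap H^2(Q)+V_{0h}$. $C_{inv,0}>0$ is a constant, independent of $h$ and $K$, for which the inverse inequality $\|v_h\|_{L_2(\partial K)}\le C_{inv,0}h_K^{-1/2}\|v_h\|_{L_2(K)}$ holds for all $v_h\in V_h$ and all $K\in\mathcal K_h$. **Facets, jumps, averages.** An interior facet is $F_{ij}=\overline K_i\cap\overline K_j$, $i\ne j$, when this set is a $d$-dimensional facet; $\mathcal F_I$ is the set of all interior facets. Let $\mathbf n_i=(\mathbf n_{i,x},n_{i,t})$ be the outer unit normal of $K_i$ on $F_{ij}$, and $\mathbf n_j=-\mathbf n_i$. With $v_i,v_j$ (resp. $\mathbf q_i,\mathbf q_j$) the traces from $K_i,K_j$ of a scalar $v$ (resp. vector $\mathbf q$): $[\![v]\!]_x=v_i\mathbf n_{i,x}+v_j\mathbf n_{j,x}$; $[\![\mathbf q]\!]_t=\mathbf q_i n_{i,t}+\mathbf q_j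 n_{j,t}$; $\{\mathbf q\}=\tfrac12(\mathbf q_i+\mathbf q_j)$; $\{\mathbf q\}^{up}=\mathbf q_i$ if $n_{i,t}\ge0$ and $\{\mathbf q\}^{up}=\mathbf q_j$ if $n_{i,t}<0$. **Bilinear form.** For constants $\theta,\delta>0$, $$\begin{aligned}a_h(w,v_h)=&\int_Q\big(\partial_t w(v_h+\theta h\,\partial_t v_h)+\nabla_x w\cdot\nabla_x v_h\big)dx\,dt-\theta h\sum_{K\in\mathcal K_h}\int_K\partial_t\nabla_x w\cdot\nabla_x v_h\,dx\,dt+\theta h\int_{\Sigma_T}\nabla_x w\cdot\nabla_x v_h\,ds\\&+\theta h\sum_{F_{ij}\in\mathcal F_I}\int_{F_{ij}}\Big(\{\nabla_x w\}^{up}\cdot[\![\nabla_x v_h]\!]_t-\{\nabla_x w\}\cdot[\![\partial_t v_h]\!]_x+\{\nabla_x v_h\}\cdot[\![\partial_t w]\!]_x+\delta[\![\partial_t w]\!]_x\cdot[\![\partial_t v_h]\!]_x\Big)ds.\end{aligned}$$ **Norms.** $$\|v\|_h^2=\|\nabla_x v\|^2_{L_2(Q)}+\theta h\|\partial_t v\|^2_{L_2(Q)}+\tfrac12\|v\|^2_{L_2(\Sigma_T)}+\tfrac{\theta h}2\|\nabla_x v\|^2_{L_2(\Sigma_T)}+\tfrac{\theta h}2\sum_{F_{ij}\in\mathcal F_I}\|[\![\nabla_x v]\!]_t\|^2_{L_2(F_{ij})}+\delta\theta h\sum_{F_{ij}\in\mathcal F_I}\|[\![\partial_t v]\!]_x\|^2_{L_2(F_{ij})},$$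 $$\begin{aligned}\|v\|_{h,*}^2=&\|\nabla_x v\|^2_{L_2(Q)}+\theta h\|\partial_t v\|^2_{L_2(Q)}+\tfrac12\|v\|^2_{L_2(\Sigma_T)}+\theta h\|\nabla_x v\|^2_{L_2(\Sigma_T)}+\theta h\sum_{F_{ij}\in\mathcal F_I}\|[\![\nabla_x v]\!]_t\|^2_{L_2(F_{ij})}+\delta\theta h\sum_{F_{ij}\in\mathcal F_I}\|[\![\partial_t v]\!]_x\|^2_{L_2(F_{ij})}\\&+(\theta h)^{-1}\|v\|^2_{L_2(Q)}+(\theta h)^2\|\partial_t\nabla_x v\|^2_{L_2(Q)}+\theta h\sum_{F_{ij}\in\mathcal F_I}\|\{\nabla_x v\}^{up}\|^2_{L_2(F_{ij})}+\sum_{i=1}^N h_{K_i}\|\partial_t v\|^2_{L_2(\partial K_i)}.\end{aligned}$$ Here $\|\partial_t\nabla_x v\|^2_{L_2(Q)}$ is understood elementwise, $\sum_{K}\|\partial_t\nabla_x v\|^2_{L_2(K)}$, and in $\|\partial_t v\|_{L_2(\partial K_i)}$ the trace is taken from inside $K_i$. *)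

theory Defs
  imports "HOL-Analysis.Analysis"
begin

section \<open>Surface measure\<close>

definition hyperplanes :: "'a::euclidean_space set set" where
  "hyperplanes = {H. \<exists>n c. norm n = 1 \<and> H = {y. n \<bullet> y = c}}"

definition unit_normal :: "'a::euclidean_space set \<Rightarrow> 'a" where
  "unit_normal H = (SOME n. norm n = 1 \<and> (\<exists>c. H = {y. n \<bullet> y = c}))"

definition cylinder_over :: "'a::euclidean_space set \<Rightarrow> 'a set \<Rightarrow> 'a set" where
  "cylinder_over H A = {y + s *\<^sub>R unit_normal H | y s. y \<in> A \<inter> H \<and> 0 \<le> s \<and> s \<le> 1}"

text \<open>
  The codimension-one surface measure on polyhedral sets. On one hyperplane \<open>H\<close> the measure of a
  Borel set is the Lebesgue measure of the cylinder of height one over it, hence it is the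
  Lebesgue measure of \<open>H\<close> (the normalised Hausdorff measure). The contributions of all hyperplanes
  are added; two different hyperplanes intersect in a set of measure zero, so on a subset
  of countably many hyperplanes this is the Hausdorff measure of codimension one. All surfaces used
  below (boundaries of simplices and of a domain decomposed into simplices) are of this kind.
  The lemma \<open>emeasure_surface_measure\<close> shows that the set function is indeed a measure.
\<close>

definition surface_measure :: "'a::euclidean_space measure" where
  "surface_measure =
     measure_of UNIV (sets borel)
       (\<lambda>A. \<integral>\<^sup>+H. emeasure lborel (cylinder_over H A) \<partial>count_space hyperplanes)"

abbreviation surface_on :: "'a::euclidean_space set \<Rightarrow> 'a measure" where
  "surface_on \<Gamma> \<equiv> restrict_space surface_measure \<Gamma>"

lemma sets_surface_measure [simp, measurable_cong]: "sets surface_measure = sets borel"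
  unfolding surface_measure_def by (simp add: sets.sigma_sets_eq[of borel, simplified])

lemma space_surface_measure [simp]: "space surface_measure = UNIV"
  unfolding surface_measure_def by simp

lemma unit_normal:
  assumes "H \<in> hyperplanes"
  shows "norm (unit_normal H) = 1" and "\<exists>c. H = {y. unit_normal H \<bullet> y = c}"
proof -
  have "\<exists>n. norm n = 1 \<and> (\<exists>c. H = {y. n \<bullet> y = c})"
    using assms unfolding hyperplanes_def by blast
  from someI_ex[OF this]
  show "norm (unit_normal H) = 1" and "\<exists>c. H = {y. unit_normal H \<bullet> y = c}"
    unfolding unit_normal_def by auto
qed

lemma cylinder_over_eq:
  fixes n :: "'a::euclidean_space"
  assumes n: "unit_normal H = n" "norm n = 1" and H: "H = {y. n \<bullet> y = c}"
  shows "cylinder_over H A = {y. y - (n \<bullet> y - c) *\<^sub>R n \<in> A \<and> 0 \<le> n \<bullet> y - c \<and> n \<bullet> y - c \<le> 1}"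
proof -
  have nn: "n \<bullet> n = 1" using n by (simp add: dot_square_norm)
  show ?thesis
  proof (intro set_eqI iffI)
    fix z assume "z \<in> cylinder_over H A"
    then obtain y s where *: "z = y + s *\<^sub>R n" "y \<in> A" "y \<in> H" "0 \<le> s" "s \<le> 1"
      unfolding cylinder_over_def n(1) by blast
    have "n \<bullet> y = c" using *(3) H by blast
    then have "n \<bullet> z - c = s" using *(1) nn by (simp add: inner_add_right)
    then show "z \<in> {y. y - (n \<bullet> y - c) *\<^sub>R n \<in> A \<and> 0 \<le> n \<bullet> y - c \<and> n \<bullet> y - c \<le> 1}"
      using * by simp
  next
    fix z assume z: "z \<in> {y. y - (n \<bullet> y - c) *\<^sub>R n \<in> A \<and> 0 \<le> n \<bullet> y - c \<and> n \<bullet> y - c \<le> 1}"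
    define s where "s = n \<bullet> z - c"
    have "n \<bullet> (z - s *\<^sub>R n) = c" unfolding s_def using nn by (simp add: inner_diff_right)
    then have "z - s *\<^sub>R n \<in> A \<inter> H" using z H by (simp add: s_def)
    moreover have "z = (z - s *\<^sub>R n) + s *\<^sub>R n" by simp
    moreover have "0 \<le> s" "s \<le> 1" using z by (simp_all add: s_def)
    ultimately show "z \<in> cylinder_over H A"
      unfolding cylinder_over_def n(1) by blast
  qed
qed

lemma emeasure_surface_measure:
  fixes A :: "'a::euclidean_space set"
  assumes "A \<in> sets borel"
  shows "emeasure surface_measure A =
           (\<integral>\<^sup>+H. emeasure lborel (cylinder_over H A) \<partial>count_space hyperplanes)"
proof (rule emeasure_measure_of[OF surface_measure_def])
  let ?\<mu> = "\<lambda>A::'a set. \<integral>\<^sup>+H. emeasure lborel (cylinder_over H A) \<partial>count_space hyperplanes"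
  show "sets borel \<subseteq> Pow UNIV" by simp
  show "A \<in> sets surface_measure" using assms by simp
  have "cylinder_over H {} = {}" for H :: "'a set"
    by (auto simp: cylinder_over_def)
  then show "positive (sets surface_measure) ?\<mu>"
    by (simp add: positive_def)
  show "countably_additive (sets surface_measure) ?\<mu>"
  proof (rule countably_additiveI)
    fix B :: "nat \<Rightarrow> 'a set"
    assume B: "range B \<subseteq> sets surface_measure" and disj: "disjoint_family B"
    have "(\<Sum>i. emeasure lborel (cylinder_over H (B i))) =
          emeasure lborel (cylinder_over H (\<Union>i. B i))" if H: "H \<in> hyperplanes" for H
    proof -
      define n where "n = unit_normal H"
      obtain c where c: "H = {y. n \<bullet> y = c}" and n: "norm n = 1"
        using unit_normal[OF H] unfolding n_def by blast
      note eq = cylinder_over_eq[OF n_def[symmetric] n c]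
      have "cylinder_over H (B i) \<in> sets lborel" for i
      proof -
        have [measurable]: "B i \<in> sets borel" using B by auto
        show ?thesis unfolding eq by measurable
      qed
      moreover have "disjoint_family (\<lambda>i. cylinder_over H (B i))"
        using disj unfolding disjoint_family_on_def eq by blast
      moreover have "(\<Union>i. cylinder_over H (B i)) = cylinder_over H (\<Union>i. B i)"
        unfolding eq by blast
      ultimately show ?thesis
        by (subst suminf_emeasure) auto
    qed
    then have "?\<mu> (\<Union>i. B i) =
        (\<integral>\<^sup>+H. (\<Sum>i. emeasure lborel (cylinder_over H (B i))) \<partial>count_space hyperplanes)"
      by (intro nn_integral_cong) simp
    also have "\<dots> = (\<Sum>i. ?\<mu> (B i))"
      by (rule nn_integral_suminf) simp
    finally show "(\<Sum>i. ?\<mu> (B i)) = ?\<mu> (\<Union>i. B i)" ..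
  qed
qed

section \<open>Square integrability, weak derivatives and traces\<close>

definition L2 :: "'a measure \<Rightarrow> ('a \<Rightarrow> real) set" where
  "L2 M = {f. f \<in> borel_measurable M \<and> integrable M (\<lambda>x. (f x)\<^sup>2)}"

definition L2_norm_sq :: "'a measure \<Rightarrow> ('a \<Rightarrow> 'b::real_normed_vector) \<Rightarrow> real" where
  "L2_norm_sq M f = (\<integral>x. (norm (f x))\<^sup>2 \<partial>M)"

definition deriv_along :: "'a \<Rightarrow> ('a::euclidean_space \<Rightarrow> real) \<Rightarrow> 'a \<Rightarrow> real" where
  "deriv_along b f x = frechet_derivative f (at x) b"

primrec times_cont_differentiable :: "nat \<Rightarrow> ('a::euclidean_space \<Rightarrow> real) \<Rightarrow> bool" where
  "times_cont_differentiable 0 f \<longleftrightarrow> continuous_on UNIV f"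
| "times_cont_differentiable (Suc k) f \<longleftrightarrow>
     (\<forall>x. f differentiable (at x)) \<and>
     (\<forall>b\<in>Basis. times_cont_differentiable k (deriv_along b f))"

definition smooth :: "('a::euclidean_space \<Rightarrow> real) \<Rightarrow> bool" where
  "smooth f \<longleftrightarrow> (\<forall>k. times_cont_differentiable k f)"

definition test_functions :: "'a::euclidean_space set \<Rightarrow> ('a \<Rightarrow> real) set" where
  "test_functions G =
     {\<phi>. smooth \<phi> \<and> compact (closure {x. \<phi> x \<noteq> 0}) \<and> closure {x. \<phi> x \<noteq> 0} \<subseteq> G}"

definition is_weak_deriv ::
  "'a::euclidean_space set \<Rightarrow> 'a \<Rightarrow> ('a \<Rightarrow> real) \<Rightarrow> ('a \<Rightarrow> real) \<Rightarrow> bool" where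
  "is_weak_deriv G b u g \<longleftrightarrow>
     (\<forall>\<phi>\<in>test_functions G.
        (\<integral>x. u x * deriv_along b \<phi> x \<partial>lebesgue_on G) = - (\<integral>x. g x * \<phi> x \<partial>lebesgue_on G))"

definition has_L2_weak_deriv :: "'a::euclidean_space set \<Rightarrow> 'a \<Rightarrow> ('a \<Rightarrow> real) \<Rightarrow> bool" where
  "has_L2_weak_deriv G b u \<longleftrightarrow> (\<exists>g\<in>L2 (lebesgue_on G). is_weak_deriv G b u g)"

text \<open>The chosen representative is determined up to null sets of \<open>G\<close>.\<close>

definition weak_deriv ::
  "'a::euclidean_space set \<Rightarrow> 'a \<Rightarrow> ('a \<Rightarrow> real) \<Rightarrow> ('a \<Rightarrow> real)" where
  "weak_deriv G b u = (SOME g. g \<in> L2 (lebesgue_on G) \<and> is_weak_deriv G b u g)"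

text \<open>
  \<open>sobolev D G\<close> is the space of functions in \<open>L2\<close> whose weak derivatives in the directions \<open>D\<close>
  are in \<open>L2\<close>: \<open>D = Basis\<close> gives \<open>H\<^sup>1(G)\<close>, the spatial directions give the anisotropic space
  \<open>H\<^sup>1\<^sup>,\<^sup>0(G)\<close>.
\<close>

definition sobolev :: "'a set \<Rightarrow> 'a::euclidean_space set \<Rightarrow> ('a \<Rightarrow> real) set" where
  "sobolev D G = {u \<in> L2 (lebesgue_on G). \<forall>b\<in>D. has_L2_weak_deriv G b u}"

definition sobolev2 :: "'a::euclidean_space set \<Rightarrow> ('a \<Rightarrow> real) set" where
  "sobolev2 G = {u \<in> sobolev Basis G. \<forall>b\<in>Basis. weak_deriv G b u \<in> sobolev Basis G}"

text \<open>
  Traces are the continuous extension of the restriction map from functions that are smooth up to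
  the boundary: \<open>g\<close> is the trace of \<open>u\<close> on \<open>\<Gamma>\<close> if \<open>u\<close> is a limit in \<open>sobolev D G\<close> of functions
  that are smooth on the whole space and whose restrictions to \<open>\<Gamma>\<close> converge to \<open>g\<close> in \<open>L2\<close>.
\<close>

definition has_trace ::
  "'a set \<Rightarrow> 'a::euclidean_space set \<Rightarrow> ('a \<Rightarrow> real) \<Rightarrow> 'a set \<Rightarrow> ('a \<Rightarrow> real) \<Rightarrow> bool" where
  "has_trace D G u \<Gamma> g \<longleftrightarrow>
     u \<in> sobolev D G \<and> g \<in> L2 (surface_on \<Gamma>) \<and>
     (\<exists>\<phi> :: nat \<Rightarrow> 'a \<Rightarrow> real.
        (\<forall>n. smooth (\<phi> n)) \<and>
        (\<lambda>n. L2_norm_sq (lebesgue_on G) (\<lambda>x. \<phi> n x - u x)) \<longlonglongrightarrow> 0 \<and>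
        (\<forall>b\<in>D. (\<lambda>n. L2_norm_sq (lebesgue_on G)
                      (\<lambda>x. deriv_along b (\<phi> n) x - weak_deriv G b u x)) \<longlonglongrightarrow> 0) \<and>
        (\<lambda>n. L2_norm_sq (surface_on \<Gamma>) (\<lambda>x. \<phi> n x - g x)) \<longlonglongrightarrow> 0)"

text \<open>The trace on \<open>\<partial>K\<close> of a function that is \<open>H\<^sup>1\<close> in the interior of \<open>K\<close>, taken from inside.\<close>

definition trace :: "'a::euclidean_space set \<Rightarrow> ('a \<Rightarrow> real) \<Rightarrow> ('a \<Rightarrow> real)" where
  "trace K u = (SOME g. has_trace Basis (interior K) u (frontier K) g)"

section \<open>Space-time domains\<close>

text \<open>A point of space-time is a pair \<open>(x, t)\<close>; the spatial dimension \<open>d\<close> is \<open>CARD('d)\<close>.\<close>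

type_synonym 'd spacetime = "(real ^ 'd) \<times> real"

definition e_x :: "'d::finite \<Rightarrow> 'd spacetime" where
  "e_x i = (axis i 1, 0)"

definition e_t :: "'d::finite spacetime" where
  "e_t = (0, 1)"

definition Q_dom :: "(real \<Rightarrow> (real ^ 'd) set) \<Rightarrow> real \<Rightarrow> 'd::finite spacetime set" where
  "Q_dom \<Omega> T = {(x, t). 0 < t \<and> t < T \<and> x \<in> \<Omega> t}"

definition Sigma_lat :: "(real \<Rightarrow> (real ^ 'd) set) \<Rightarrow> real \<Rightarrow> 'd::finite spacetime set" where
  "Sigma_lat \<Omega> T = {(x, t). 0 < t \<and> t < T \<and> x \<in> frontier (\<Omega> t)}"

definition Sigma_bot :: "(real \<Rightarrow> (real ^ 'd) set) \<Rightarrow> 'd::finite spacetime set" where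
  "Sigma_bot \<Omega> = \<Omega> 0 \<times> {0}"

definition Sigma_top :: "(real \<Rightarrow> (real ^ 'd) set) \<Rightarrow> real \<Rightarrow> 'd::finite spacetime set" where
  "Sigma_top \<Omega> T = \<Omega> T \<times> {T}"

text \<open>Locally, after a rigid motion, the set is the region above the graph of a Lipschitz function:
  \<open>\<gamma>\<close> is evaluated at the projection of \<open>y\<close> to the orthogonal complement of \<open>\<nu>\<close>.\<close>

definition lipschitz_boundary :: "'a::euclidean_space set \<Rightarrow> bool" where
  "lipschitz_boundary G \<longleftrightarrow>
     (\<forall>z\<in>frontier G. \<exists>r>0. \<exists>\<nu> L. \<exists>\<gamma> :: 'a \<Rightarrow> real.
        norm \<nu> = 1 \<and> L-lipschitz_on UNIV \<gamma> \<and>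
        G \<inter> ball z r = {y \<in> ball z r. \<nu> \<bullet> y > \<gamma> (y - (\<nu> \<bullet> y) *\<^sub>R \<nu>)})"

text \<open>
  The slices \<open>\<Omega>(t)\<close> are open, so the edges of \<open>\<partial>Q\<close> at the times \<open>0\<close> and \<open>T\<close> do not belong to
  \<open>\<Sigma> \<union> \<Sigma>\<^sub>0 \<union> \<Sigma>\<^sub>T\<close>; the decomposition of \<open>\<partial>Q\<close> into these three parts therefore holds up
  to a set of surface measure zero.
\<close>

definition space_time_domain :: "(real \<Rightarrow> (real ^ 'd::finite) set) \<Rightarrow> real \<Rightarrow> bool" where
  "space_time_domain \<Omega> T \<longleftrightarrow>
     (\<forall>t\<in>{0..T}. open (\<Omega> t)) \<and>
     open (Q_dom \<Omega> T) \<and> connected (Q_dom \<Omega> T) \<and> Q_dom \<Omega> T \<noteq> {} \<and>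
     bounded (Q_dom \<Omega> T) \<and> lipschitz_boundary (Q_dom \<Omega> T) \<and>
     Sigma_lat \<Omega> T \<union> Sigma_bot \<Omega> \<union> Sigma_top \<Omega> T \<subseteq> frontier (Q_dom \<Omega> T) \<and>
     frontier (Q_dom \<Omega> T) - (Sigma_lat \<Omega> T \<union> Sigma_bot \<Omega> \<union> Sigma_top \<Omega> T)
       \<in> null_sets surface_measure"

text \<open>\<open>H\<^sup>1\<^sup>,\<^sup>1\<close> with zero lateral and initial values, and \<open>H\<^sup>1\<^sup>,\<^sup>0\<close> with zero lateral values.\<close>

definition H11_00 :: "(real \<Rightarrow> (real ^ 'd) set) \<Rightarrow> real \<Rightarrow> ('d::finite spacetime \<Rightarrow> real) set" where
  "H11_00 \<Omega> T =
     {u. has_trace (range e_x \<union> {e_t}) (Q_dom \<Omega> T) u (Sigma_lat \<Omega> T) (\<lambda>_. 0) \<and>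
         has_trace (range e_x \<union> {e_t}) (Q_dom \<Omega> T) u (Sigma_bot \<Omega>) (\<lambda>_. 0)}"

definition H10_0 :: "(real \<Rightarrow> (real ^ 'd) set) \<Rightarrow> real \<Rightarrow> ('d::finite spacetime \<Rightarrow> real) set" where
  "H10_0 \<Omega> T = {u. has_trace (range e_x) (Q_dom \<Omega> T) u (Sigma_lat \<Omega> T) (\<lambda>_. 0)}"

section \<open>Meshes and finite element spaces\<close>

text \<open>A mesh is the list of its elements \<open>K\<^sub>1, \<dots>, K\<^sub>N\<close>, which are closed simplices.\<close>

type_synonym 'd mesh = "'d spacetime set list"

definition decomposition :: "'d::finite spacetime set \<Rightarrow> 'd mesh \<Rightarrow> bool" where
  "decomposition Q \<K> \<longleftrightarrow>
     (\<forall>K\<in>set \<K>. (int CARD('d) + 1) simplex K) \<and>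
     \<Union>(set \<K>) = closure Q \<and>
     (\<forall>i<length \<K>. \<forall>j<length \<K>. i \<noteq> j \<longrightarrow> interior (\<K> ! i) \<inter> interior (\<K> ! j) = {})"

definition mesh_size :: "'d::finite mesh \<Rightarrow> real" where
  "mesh_size \<K> = Max (diameter ` set \<K>)"

definition quasi_uniform :: "real \<Rightarrow> 'd::finite mesh \<Rightarrow> bool" where
  "quasi_uniform C \<K> \<longleftrightarrow>
     (\<forall>K\<in>set \<K>. diameter K \<le> mesh_size \<K> \<and> mesh_size \<K> \<le> C * diameter K)"

definition polynomials :: "nat \<Rightarrow> ('a::euclidean_space \<Rightarrow> real) set" where
  "polynomials p =
     {f. \<exists>c. f = (\<lambda>y. \<Sum>\<alpha> | (\<forall>b. b \<notin> Basis \<longrightarrow> \<alpha> b = 0) \<and> (\<Sum>b\<in>Basis. \<alpha> b) \<le> p.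
                      c \<alpha> * (\<Prod>b\<in>Basis. (y \<bullet> b) ^ \<alpha> b))}"

definition V_h :: "'d::finite spacetime set \<Rightarrow> nat \<Rightarrow> 'd mesh \<Rightarrow> ('d spacetime \<Rightarrow> real) set" where
  "V_h Q p \<K> =
     {v. continuous_on (closure Q) v \<and> (\<forall>K\<in>set \<K>. \<exists>q\<in>polynomials p. \<forall>y\<in>K. v y = q y)}"

definition V_0h ::
  "(real \<Rightarrow> (real ^ 'd) set) \<Rightarrow> real \<Rightarrow> nat \<Rightarrow> 'd::finite mesh \<Rightarrow> ('d spacetime \<Rightarrow> real) set" where
  "V_0h \<Omega> T p \<K> = V_h (Q_dom \<Omega> T) p \<K> \<inter> H11_00 \<Omega> T"

definition V_0h_star ::
  "(real \<Rightarrow> (real ^ 'd) set) \<Rightarrow> real \<Rightarrow> nat \<Rightarrow> 'd::finite mesh \<Rightarrow> ('d spacetime \<Rightarrow> real) set" where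
  "V_0h_star \<Omega> T p \<K> =
     {(\<lambda>y. z y + v y) | z v. z \<in> H10_0 \<Omega> T \<inter> sobolev2 (Q_dom \<Omega> T) \<and> v \<in> V_0h \<Omega> T p \<K>}"

definition inverse_inequality :: "real \<Rightarrow> 'd::finite spacetime set \<Rightarrow> nat \<Rightarrow> 'd mesh \<Rightarrow> bool" where
  "inverse_inequality C Q p \<K> \<longleftrightarrow>
     (\<forall>v\<in>V_h Q p \<K>. \<forall>K\<in>set \<K>.
        sqrt (L2_norm_sq (surface_on (frontier K)) v)
          \<le> C * diameter K powr (-1/2) * sqrt (L2_norm_sq (lebesgue_on K) v))"

section \<open>Facets, jumps and averages\<close>

text \<open>
  Each interior facet \<open>F\<^sub>i\<^sub>j = K\<^sub>i \<inter> K\<^sub>j\<close> is represented once, by the pair \<open>(K\<^sub>i, K\<^sub>j)\<close> with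
  \<open>i < j\<close>. The order only matters for the upwind value on facets with \<open>n\<^sub>i\<^sub>,\<^sub>t = 0\<close>.
\<close>

definition interior_facets :: "'d::finite mesh \<Rightarrow> ('d spacetime set \<times> 'd spacetime set) set" where
  "interior_facets \<K> =
     {(\<K> ! i, \<K> ! j) | i j. i < j \<and> j < length \<K> \<and>
        (\<K> ! i \<inter> \<K> ! j) facet_of (\<K> ! i) \<and> (\<K> ! i \<inter> \<K> ! j) facet_of (\<K> ! j)}"

definition outer_normal :: "'a::euclidean_space set \<Rightarrow> 'a set \<Rightarrow> 'a" where
  "outer_normal K F = (THE n. norm n = 1 \<and> (\<forall>x\<in>K. \<forall>y\<in>F. n \<bullet> (x - y) \<le> 0))"

definition grad_x :: "'d::finite spacetime set \<Rightarrow> ('d spacetime \<Rightarrow> real) \<Rightarrow> 'd spacetime \<Rightarrow> real ^ 'd"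
  where "grad_x G w y = (\<chi> i. weak_deriv G (e_x i) w y)"

definition d_t :: "'d::finite spacetime set \<Rightarrow> ('d spacetime \<Rightarrow> real) \<Rightarrow> 'd spacetime \<Rightarrow> real" where
  "d_t G w = weak_deriv G e_t w"

text \<open>\<open>\<partial>\<^sub>t\<nabla>\<^sub>x w\<close> inside the element \<open>K\<close>, where \<open>\<nabla>\<^sub>x w\<close> is the weak gradient on \<open>Q\<close>.\<close>

definition d_t_grad_x ::
  "'d::finite spacetime set \<Rightarrow> 'd spacetime set \<Rightarrow> ('d spacetime \<Rightarrow> real) \<Rightarrow> 'd spacetime \<Rightarrow> real ^ 'd"
  where "d_t_grad_x Q K w y = (\<chi> i. d_t (interior K) (\<lambda>z. grad_x Q w z $ i) y)"

definition trace_vec ::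
  "'d::finite spacetime set \<Rightarrow> ('d spacetime \<Rightarrow> real ^ 'd) \<Rightarrow> 'd spacetime \<Rightarrow> real ^ 'd" where
  "trace_vec K q y = (\<chi> i. trace K (\<lambda>z. q z $ i) y)"

definition jump_x ::
  "'d::finite spacetime set \<Rightarrow> 'd spacetime set \<Rightarrow> ('d spacetime \<Rightarrow> real) \<Rightarrow> 'd spacetime \<Rightarrow> real ^ 'd"
  where
  "jump_x K K' v y =
     trace K v y *\<^sub>R fst (outer_normal K (K \<inter> K')) +
     trace K' v y *\<^sub>R fst (outer_normal K' (K \<inter> K'))"

definition jump_t ::
  "'d::finite spacetime set \<Rightarrow> 'd spacetime set \<Rightarrow> ('d spacetime \<Rightarrow> real ^ 'd) \<Rightarrow>
     'd spacetime \<Rightarrow> real ^ 'd" where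
  "jump_t K K' q y =
     snd (outer_normal K (K \<inter> K')) *\<^sub>R trace_vec K q y +
     snd (outer_normal K' (K \<inter> K')) *\<^sub>R trace_vec K' q y"

definition average ::
  "'d::finite spacetime set \<Rightarrow> 'd spacetime set \<Rightarrow> ('d spacetime \<Rightarrow> real ^ 'd) \<Rightarrow>
     'd spacetime \<Rightarrow> real ^ 'd" where
  "average K K' q y = (1/2) *\<^sub>R (trace_vec K q y + trace_vec K' q y)"

definition upwind ::
  "'d::finite spacetime set \<Rightarrow> 'd spacetime set \<Rightarrow> ('d spacetime \<Rightarrow> real ^ 'd) \<Rightarrow>
     'd spacetime \<Rightarrow> real ^ 'd" where
  "upwind K K' q y =
     (if snd (outer_normal K (K \<inter> K')) \<ge> 0 then trace_vec K q y else trace_vec K' q y)"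

section \<open>The bilinear form and the norms\<close>

text \<open>
  The integrals over \<open>\<Sigma>\<^sub>T\<close> are split into the parts \<open>\<partial>K \<inter> \<Sigma>\<^sub>T\<close>, on which the traces from \<open>K\<close> are
  used; \<open>\<nabla>\<^sub>x v\<close> has traces only elementwise when \<open>v\<close> is piecewise polynomial.
\<close>

definition a_h ::
  "(real \<Rightarrow> (real ^ 'd) set) \<Rightarrow> real \<Rightarrow> real \<Rightarrow> real \<Rightarrow> 'd::finite mesh \<Rightarrow>
     ('d spacetime \<Rightarrow> real) \<Rightarrow> ('d spacetime \<Rightarrow> real) \<Rightarrow> real" where
  "a_h \<Omega> T \<theta> \<delta> \<K> w v =
     (let Q = Q_dom \<Omega> T; h = mesh_size \<K>;
          gw = grad_x Q w; gv = grad_x Q v; dw = d_t Q w; dv = d_t Q v in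
      (\<integral>y. dw y * (v y + \<theta> * h * dv y) + gw y \<bullet> gv y \<partial>lebesgue_on Q)
      - \<theta> * h * (\<Sum>K\<in>set \<K>. \<integral>y. d_t_grad_x Q K w y \<bullet> gv y \<partial>lebesgue_on K)
      + \<theta> * h * (\<Sum>K\<in>set \<K>.
          \<integral>y. trace_vec K gw y \<bullet> trace_vec K gv y \<partial>surface_on (frontier K \<inter> Sigma_top \<Omega> T))
      + \<theta> * h * (\<Sum>(K, K')\<in>interior_facets \<K>.
          \<integral>y. upwind K K' gw y \<bullet> jump_t K K' gv y
              - average K K' gw y \<bullet> jump_x K K' dv y
              + average K K' gv y \<bullet> jump_x K K' dw y
              + \<delta> * (jump_x K K' dw y \<bullet> jump_x K K' dv y) \<partial>surface_on (K \<inter> K')))"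

definition norm_h ::
  "(real \<Rightarrow> (real ^ 'd) set) \<Rightarrow> real \<Rightarrow> real \<Rightarrow> real \<Rightarrow> 'd::finite mesh \<Rightarrow>
     ('d spacetime \<Rightarrow> real) \<Rightarrow> real" where
  "norm_h \<Omega> T \<theta> \<delta> \<K> v =
     (let Q = Q_dom \<Omega> T; h = mesh_size \<K>; gv = grad_x Q v; dv = d_t Q v in
      sqrt (L2_norm_sq (lebesgue_on Q) gv
        + \<theta> * h * L2_norm_sq (lebesgue_on Q) dv
        + 1/2 * (\<Sum>K\<in>set \<K>.
            L2_norm_sq (surface_on (frontier K \<inter> Sigma_top \<Omega> T)) (trace K v))
        + \<theta> * h / 2 * (\<Sum>K\<in>set \<K>.
            L2_norm_sq (surface_on (frontier K \<inter> Sigma_top \<Omega> T)) (trace_vec K gv))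
        + \<theta> * h / 2 * (\<Sum>(K, K')\<in>interior_facets \<K>.
            L2_norm_sq (surface_on (K \<inter> K')) (jump_t K K' gv))
        + \<delta> * \<theta> * h * (\<Sum>(K, K')\<in>interior_facets \<K>.
            L2_norm_sq (surface_on (K \<inter> K')) (jump_x K K' dv))))"

definition norm_h_star ::
  "(real \<Rightarrow> (real ^ 'd) set) \<Rightarrow> real \<Rightarrow> real \<Rightarrow> real \<Rightarrow> 'd::finite mesh \<Rightarrow>
     ('d spacetime \<Rightarrow> real) \<Rightarrow> real" where
  "norm_h_star \<Omega> T \<theta> \<delta> \<K> v =
     (let Q = Q_dom \<Omega> T; h = mesh_size \<K>; gv = grad_x Q v; dv = d_t Q v in
      sqrt (L2_norm_sq (lebesgue_on Q) gv
        + \<theta> * h * L2_norm_sq (lebesgue_on Q) dv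
        + 1/2 * (\<Sum>K\<in>set \<K>.
            L2_norm_sq (surface_on (frontier K \<inter> Sigma_top \<Omega> T)) (trace K v))
        + \<theta> * h * (\<Sum>K\<in>set \<K>.
            L2_norm_sq (surface_on (frontier K \<inter> Sigma_top \<Omega> T)) (trace_vec K gv))
        + \<theta> * h * (\<Sum>(K, K')\<in>interior_facets \<K>.
            L2_norm_sq (surface_on (K \<inter> K')) (jump_t K K' gv))
        + \<delta> * \<theta> * h * (\<Sum>(K, K')\<in>interior_facets \<K>.
            L2_norm_sq (surface_on (K \<inter> K')) (jump_x K K' dv))
        + inverse (\<theta> * h) * L2_norm_sq (lebesgue_on Q) v
        + (\<theta> * h)\<^sup>2 * (\<Sum>K\<in>set \<K>. L2_norm_sq (lebesgue_on K) (d_t_grad_x Q K v))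
        + \<theta> * h * (\<Sum>(K, K')\<in>interior_facets \<K>.
            L2_norm_sq (surface_on (K \<inter> K')) (upwind K K' gv))
        + (\<Sum>K\<in>set \<K>. diameter K * L2_norm_sq (surface_on (frontier K)) (trace K dv))))"

end

theory Submission
  imports Defs
begin

text \<open>
  Integrating \<open>\<partial>\<^sub>tu v\<^sub>h\<close> by parts in time leaves \<open>u \<partial>\<^sub>tv\<^sub>h\<close> and a term on \<open>\<Sigma>\<^sub>T\<close> only. Across an interior
  facet with normal \<open>n\<close> both gradients jump by a multiple of \<open>n\<close>: the \<open>H\<^sup>2\<close> part of \<open>u\<close> has no jump, and
  continuous piecewise polynomials have no tangential one. Hence the interface terms collapse to
  \<open>{\<nabla>v\<^sub>h}\<^sup>u\<^sup>p\<close> times the jump of \<open>\<partial>\<^sub>tu\<close>, plus the \<open>\<delta>\<close>-term. The inverse inequality and the bound on \<open>\<theta>\<close> give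
  \<open>\<theta>h \<Sum>\<parallel>{\<nabla>v\<^sub>h}\<^sup>u\<^sup>p\<parallel>\<^sup>2 \<le> \<parallel>\<nabla>v\<^sub>h\<parallel>\<^sup>2\<close>, and \<open>J \<le> 2 C\<^sub>i\<^sub>n\<^sub>v\<^sup>-\<^sup>2 \<Sum>h\<^sub>K \<parallel>\<partial>\<^sub>tu\<parallel>\<^sup>2\<close> on the element boundaries for
  \<open>J = \<theta>h \<Sum>\<parallel>\<lbrakk>\<partial>\<^sub>tu\<rbrakk>\<^sub>x\<parallel>\<^sup>2\<close>. As \<open>J\<close> occurs twice in the norm of \<open>u\<close>, a weighted Cauchy--Schwarz inequality
  yields the stated constant.

  Traces on a polytope rest on the divergence theorem, which is obtained from Lipschitz cutoffs concentrated on
  thin layers along the facets, and on the density of smooth functions in \<open>H\<^sup>1\<close> of a bounded convex open set.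
\<close>

section \<open>Smooth functions\<close>

text \<open>The norm of \<open>v\<close> has no \<open>L2(Q)\<close> term, so the product of the
  time derivative of \<open>u\<close> with \<open>v\<close> cannot be estimated as it stands; moving
  the derivative onto \<open>v\<close> balances the weight \<open>1/(\<theta>h)\<close> against
  \<open>\<theta>h\<close>. The collapse of the interface terms is an exact identity. Let the
  gradients of \<open>u\<close> and \<open>v\<close> jump by \<open>c n\<close> and
  \<open>d n\<close>, where \<open>n = (m, \<tau>)\<close>. Then both jumps of \<open>v\<close>
  equal \<open>d \<tau> m\<close>, and the upwind value minus the average of the gradient of
  \<open>u\<close>, tested with it, gives \<open>sgn \<tau> c d \<tau> |m|^2 / 2\<close>. This is
  what turns the average of the gradient of \<open>v\<close> into its upwind value. The obstacle is
  regularity. Weak derivatives and traces are chosen representatives, so each identity holds almost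
  everywhere only. Traces are built on single elements, whose convexity gives approximations smooth
  up to the boundary. Elements may meet along parts of facets, so boundary terms inside
  \<open>Q\<close> are not paired facet by facet: they cancel because a weak derivative on
  \<open>Q\<close> has no surface part. The 4 in the constant pays for the factors 1/2 of the terms
  on the top.\<close>

lemma deriv_along_eq:
  "(f has_derivative D) (at x) \<Longrightarrow> deriv_along b f x = D b"
  unfolding deriv_along_def by (metis frechet_derivative_at)

text \<open>Level \<open>Suc k\<close> does not mention continuity of \<open>f\<close> itself, so at
  the bottom the descent rests on differentiability implying continuity.\<close>

lemma times_cont_differentiable_Suc_D:
  "times_cont_differentiable (Suc k) f \<Longrightarrow> times_cont_differentiable k f"
proof (induction k arbitrary: f)
  case 0
  then show ?case
    by (auto simp: continuous_on_eq_continuous_at differentiable_imp_continuous_within)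
next
  case (Suc k)
  show ?case
    unfolding times_cont_differentiable.simps(2)
    using Suc.prems Suc.IH times_cont_differentiable.simps(2) by blast
qed

lemma times_cont_differentiable_const: "times_cont_differentiable k (\<lambda>x. c)"
proof (induction k arbitrary: c)
  case (Suc k)
  have "deriv_along b (\<lambda>x. c) = (\<lambda>x. 0)" for b :: 'a
    by (rule ext, rule deriv_along_eq[where D="\<lambda>h. 0"]) simp
  then show ?case using Suc by simp
qed simp

lemma deriv_along_add:
  assumes "f differentiable (at x)" "g differentiable (at x)"
  shows "deriv_along b (\<lambda>x. f x + g x) x = deriv_along b f x + deriv_along b g x"
  using assms unfolding frechet_derivative_works deriv_along_def[of b f] deriv_along_def[of b g]
  by (intro deriv_along_eq has_derivative_add)

lemma deriv_along_mult:
  assumes "f differentiable (at x)" "g differentiable (at x)"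
  shows "deriv_along b (\<lambda>x. f x * g x) x = f x * deriv_along b g x + deriv_along b f x * g x"
  using assms unfolding frechet_derivative_works deriv_along_def[of b f] deriv_along_def[of b g]
  by (intro deriv_along_eq has_derivative_mult)

lemma deriv_along_comp_affine:
  assumes "f differentiable (at (a *\<^sub>R x + c))"
  shows "deriv_along b (\<lambda>x. f (a *\<^sub>R x + c)) x = a * deriv_along b f (a *\<^sub>R x + c)"
proof -
  have "(f has_derivative frechet_derivative f (at (a *\<^sub>R x + c))) (at (a *\<^sub>R x + c))"
    using assms frechet_derivative_works by blast
  moreover have "((\<lambda>x. a *\<^sub>R x + c) has_derivative (\<lambda>h. a *\<^sub>R h)) (at x)"
    by (auto intro!: derivative_eq_intros)
  ultimately have "((\<lambda>x. f (a *\<^sub>R x + c)) has_derivative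
      (\<lambda>h. frechet_derivative f (at (a *\<^sub>R x + c)) (a *\<^sub>R h))) (at x)"
    by (rule has_derivative_compose[rotated])
  from deriv_along_eq[OF this] show ?thesis
    unfolding deriv_along_def
    using linear_frechet_derivative[OF assms] by (simp add: linear_cmul)
qed

lemma times_cont_differentiable_add:
  "times_cont_differentiable k f \<Longrightarrow> times_cont_differentiable k g \<Longrightarrow>
   times_cont_differentiable k (\<lambda>x. f x + g x)"
proof (induction k arbitrary: f g)
  case (Suc k)
  then have "deriv_along b (\<lambda>x. f x + g x) = (\<lambda>x. deriv_along b f x + deriv_along b g x)" for b
    by (intro ext deriv_along_add) simp_all
  with Suc show ?case by (auto intro!: differentiable_add)
qed (auto intro: continuous_intros)

lemma times_cont_differentiable_mult:
  "times_cont_differentiable k f \<Longrightarrow> times_cont_differentiable k g \<Longrightarrow>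
   times_cont_differentiable k (\<lambda>x. f x * g x)"
proof (induction k arbitrary: f g)
  case (Suc k)
  then have eq: "deriv_along b (\<lambda>x. f x * g x) =
      (\<lambda>x. f x * deriv_along b g x + deriv_along b f x * g x)" for b
    by (intro ext deriv_along_mult) simp_all
  have "times_cont_differentiable k f" "times_cont_differentiable k g"
    using Suc.prems times_cont_differentiable_Suc_D by blast+
  then have "times_cont_differentiable k (deriv_along b (\<lambda>x. f x * g x))" if "b \<in> Basis" for b
    unfolding eq using Suc that by (intro times_cont_differentiable_add Suc.IH) auto
  with Suc.prems show ?case by (auto intro!: differentiable_mult)
qed (auto intro: continuous_intros)

lemma times_cont_differentiable_comp_affine:
  "times_cont_differentiable k f \<Longrightarrow> times_cont_differentiable k (\<lambda>x. f (a *\<^sub>R x + c))"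
proof (induction k arbitrary: f)
  case 0
  then show ?case
    by (auto intro!: continuous_on_compose2[of UNIV f] continuous_intros)
next
  case (Suc k)
  have *: "(\<lambda>x. f (a *\<^sub>R x + c)) differentiable (at x)" for x
    using Suc.prems
    by (intro differentiable_compose[where f=f and g="\<lambda>x. a *\<^sub>R x + c"]) (auto intro!: derivative_intros)
  have "deriv_along b (\<lambda>x. f (a *\<^sub>R x + c)) = (\<lambda>x. a * deriv_along b f (a *\<^sub>R x + c))" for b
    using Suc.prems by (intro ext deriv_along_comp_affine) simp
  then show ?case
    using Suc * by (auto intro!: times_cont_differentiable_mult times_cont_differentiable_const)
qed

lemma smooth_const [simp]: "smooth (\<lambda>x. c)"
  unfolding smooth_def using times_cont_differentiable_const by blast

lemma smooth_add: "smooth f \<Longrightarrow> smooth g \<Longrightarrow> smooth (\<lambda>x. f x + g x)"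
  unfolding smooth_def using times_cont_differentiable_add by blast

lemma smooth_mult: "smooth f \<Longrightarrow> smooth g \<Longrightarrow> smooth (\<lambda>x. f x * g x)"
  unfolding smooth_def using times_cont_differentiable_mult by blast

lemma smooth_comp_affine: "smooth f \<Longrightarrow> smooth (\<lambda>x. f (a *\<^sub>R x + c))"
  unfolding smooth_def using times_cont_differentiable_comp_affine by blast

lemma smooth_diff: "smooth f \<Longrightarrow> smooth g \<Longrightarrow> smooth (\<lambda>x. f x - g x)"
  using smooth_add[of f "\<lambda>x. (-1) * g x"] smooth_mult[of "\<lambda>x. -1" g] by simp

lemma smooth_sum: "(\<And>i. i \<in> I \<Longrightarrow> smooth (f i)) \<Longrightarrow> smooth (\<lambda>x. \<Sum>i\<in>I. f i x)"
  by (induction I rule: infinite_finite_induct) (auto intro: smooth_add)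

lemma smooth_prod: "(\<And>i. i \<in> I \<Longrightarrow> smooth (f i)) \<Longrightarrow> smooth (\<lambda>x. \<Prod>i\<in>I. f i x)"
  by (induction I rule: infinite_finite_induct) (auto intro: smooth_mult)

lemma smooth_power: "smooth f \<Longrightarrow> smooth (\<lambda>x. f x ^ n)"
  by (induction n) (auto intro: smooth_mult)

lemma smooth_deriv_along: "smooth f \<Longrightarrow> b \<in> Basis \<Longrightarrow> smooth (deriv_along b f)"
  unfolding smooth_def using times_cont_differentiable.simps(2) by blast

lemma smooth_differentiable: "smooth f \<Longrightarrow> f differentiable (at x)"
  unfolding smooth_def using times_cont_differentiable.simps(2) by blast

lemma smooth_continuous_on: "smooth f \<Longrightarrow> continuous_on A f"
  unfolding smooth_def using times_cont_differentiable.simps(1) continuous_on_subset by blast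

lemma smooth_borel_measurable: "smooth f \<Longrightarrow> f \<in> borel_measurable borel"
  using smooth_continuous_on[of f UNIV] by (simp add: borel_measurable_continuous_onI)

lemma smooth_inner: "smooth (\<lambda>x::'a::euclidean_space. x \<bullet> c)"
proof -
  have d: "((\<lambda>x. x \<bullet> c) has_derivative (\<lambda>h. h \<bullet> c)) (at x)" for x
    by (auto intro!: derivative_eq_intros)
  have "deriv_along b (\<lambda>x. x \<bullet> c) = (\<lambda>x. b \<bullet> c)" for b
    by (intro ext deriv_along_eq[OF d])
  moreover have "(\<lambda>x. x \<bullet> c) differentiable (at x)" for x
    using d differentiableI by blast
  ultimately have "times_cont_differentiable (Suc k) (\<lambda>x. x \<bullet> c)" for k
    by (simp add: times_cont_differentiable_const)
  then show ?thesis
    unfolding smooth_def using times_cont_differentiable_Suc_D by blast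
qed

text \<open>Smoothness controls derivatives in basis directions only; this expansion leads from them
  to the Frechet derivative, and thereby to mean value estimates and chain rules.\<close>

lemma deriv_along_linear_on_Basis:
  assumes "f differentiable (at x)"
  shows "(f has_derivative (\<lambda>h. \<Sum>b\<in>Basis. (h \<bullet> b) * deriv_along b f x)) (at x)"
proof -
  have lin: "linear (frechet_derivative f (at x))"
    using assms linear_frechet_derivative by blast
  have "frechet_derivative f (at x) h = (\<Sum>b\<in>Basis. (h \<bullet> b) * deriv_along b f x)" for h
    by (subst euclidean_representation[of h, symmetric], subst linear_sum[OF lin])
       (simp add: linear_cmul[OF lin] deriv_along_def)
  then have "frechet_derivative f (at x) = (\<lambda>h. \<Sum>b\<in>Basis. (h \<bullet> b) * deriv_along b f x)"
    by blast
  then show ?thesis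
    using assms frechet_derivative_works by metis
qed

lemmas smooth_has_derivative = deriv_along_linear_on_Basis[OF smooth_differentiable]

lemma deriv_along_diff:
  assumes "smooth f" "smooth g"
  shows "deriv_along b (\<lambda>x. f x - g x) x = deriv_along b f x - deriv_along b g x"
proof -
  have "(f has_derivative frechet_derivative f (at x)) (at x)"
    "(g has_derivative frechet_derivative g (at x)) (at x)"
    using assms smooth_differentiable frechet_derivative_works by blast+
  then have "((\<lambda>x. f x - g x) has_derivative
      (\<lambda>h. frechet_derivative f (at x) h - frechet_derivative g (at x) h)) (at x)"
    by (rule has_derivative_diff)
  from deriv_along_eq[OF this] show ?thesis unfolding deriv_along_def .
qed

subsection \<open>Bump functions\<close>

text \<open>The functions \<open>p(1/t) exp(-1/t)\<close>, extended by zero. Carrying the polynomial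
  along makes the family closed under differentiation, so smoothness at 0 needs no formula for
  higher derivatives.\<close>

definition flat :: "real poly \<Rightarrow> real \<Rightarrow> real" where
  "flat p t = (if t > 0 then poly p (1/t) * exp (- (1/t)) else 0)"

lemma poly_times_exp_minus_tendsto_0: "((\<lambda>x::real. poly p x * exp (- x)) \<longlongrightarrow> 0) at_top"
proof -
  have "((\<lambda>x::real. \<Sum>i\<le>degree p. coeff p i * (x ^ i / exp x)) \<longlongrightarrow> (\<Sum>i\<le>degree p. coeff p i * 0)) at_top"
    by (intro tendsto_intros tendsto_power_div_exp_0)
  moreover have "(\<lambda>x::real. \<Sum>i\<le>degree p. coeff p i * (x ^ i / exp x)) = (\<lambda>x. poly p x * exp (- x))"
    by (rule ext) (simp add: poly_altdef sum_distrib_right exp_minus divide_inverse mult.assoc)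
  ultimately show ?thesis by simp
qed

text \<open>With \<open>s = 1/t\<close> the derivative of \<open>p(s) exp(-s)\<close> in
  \<open>t\<close> is \<open>s^2 (p(s) - p'(s)) exp(-s)\<close>, and \<open>[:0,0,1:]\<close> is
  \<open>s^2\<close>. At 0 the right difference quotient is \<open>s p(s) exp(-s)\<close>, which
  vanishes as \<open>s\<close> grows.\<close>

lemma DERIV_flat:
  "(flat p has_real_derivative flat ([:0,0,1:] * (p - pderiv p)) t) (at t)"
proof -
  consider "t > 0" | "t < 0" | "t = 0" by linarith
  then show ?thesis
  proof cases
    case 1
    have "((\<lambda>t. poly p (1/t) * exp (- (1/t))) has_real_derivative
        flat ([:0,0,1:] * (p - pderiv p)) t) (at t)"
      using 1 by (auto intro!: derivative_eq_intros simp: flat_def field_simps power2_eq_square)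
    then show ?thesis
      by (rule has_field_derivative_transform_within_open[of _ _ _ "{0<..}"])
        (use 1 in \<open>auto simp: flat_def\<close>)
  next
    case 2
    have "((\<lambda>t. 0) has_real_derivative flat ([:0,0,1:] * (p - pderiv p)) t) (at t)"
      using 2 by (simp add: flat_def)
    then show ?thesis
      by (rule has_field_derivative_transform_within_open[of _ _ _ "{..<0}"])
        (use 2 in \<open>auto simp: flat_def\<close>)
  next
    case 3
    have "((\<lambda>h. flat p h / h) \<longlongrightarrow> 0) (at_right 0)"
    proof -
      have "((\<lambda>h::real. poly ([:0,1:] * p) (inverse h) * exp (- inverse h)) \<longlongrightarrow> 0) (at_right 0)"
        by (rule filterlim_compose[OF poly_times_exp_minus_tendsto_0 filterlim_inverse_at_top_right])
      then show ?thesis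
      proof (rule Lim_transform_eventually)
        show "\<forall>\<^sub>F h in at_right 0. poly ([:0,1:] * p) (inverse h) * exp (- inverse h) = flat p h / h"
          by (auto simp: eventually_at_filter flat_def field_simps)
      qed
    qed
    moreover have "((\<lambda>h. flat p h / h) \<longlongrightarrow> 0) (at_left 0)"
    proof (rule Lim_transform_eventually[OF tendsto_const])
      show "\<forall>\<^sub>F h in at_left 0. 0 = flat p h / h"
        by (auto simp: eventually_at_filter flat_def)
    qed
    ultimately have "((\<lambda>h. flat p h / h) \<longlongrightarrow> 0) (at 0)"
      by (rule filterlim_split_at[rotated])
    moreover have "flat p 0 = 0" "flat q 0 = 0" for q by (simp_all add: flat_def)
    ultimately show ?thesis
      unfolding DERIV_def 3 by simp
  qed
qed

text \<open>Each differentiation changes \<open>p\<close> and splits off the constant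
  \<open>\<alpha> * (b \<bullet> c)\<close>, so the induction over the order has to range over all
  \<open>p\<close>.\<close>

lemma smooth_flat: "smooth (\<lambda>x::'a::euclidean_space. flat p (\<alpha> * (x \<bullet> c) + \<beta>))"
proof -
  have d: "((\<lambda>x::'a. flat p (\<alpha> * (x \<bullet> c) + \<beta>)) has_derivative
     (\<lambda>h. flat ([:0,0,1:] * (p - pderiv p)) (\<alpha> * (x \<bullet> c) + \<beta>) * (\<alpha> * (h \<bullet> c)))) (at x)" for x p
  proof -
    have 1: "((\<lambda>x. \<alpha> * (x \<bullet> c) + \<beta>) has_derivative (\<lambda>h. \<alpha> * (h \<bullet> c))) (at x)"
      by (auto intro!: derivative_eq_intros)
    show ?thesis
      using has_derivative_compose[OF 1 DERIV_flat[unfolded has_field_derivative_def]] by simp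
  qed
  have eq: "deriv_along b (\<lambda>x. flat p (\<alpha> * (x \<bullet> c) + \<beta>)) =
     (\<lambda>x. (\<alpha> * (b \<bullet> c)) * flat ([:0,0,1:] * (p - pderiv p)) (\<alpha> * (x \<bullet> c) + \<beta>))" for b and p
    by (rule ext, rule trans[OF deriv_along_eq[OF d]]) simp
  have "times_cont_differentiable k (\<lambda>x::'a. flat p (\<alpha> * (x \<bullet> c) + \<beta>))" for k
  proof (induction k arbitrary: p)
    case 0
    show ?case
      using d has_derivative_continuous continuous_on_eq_continuous_at open_UNIV
      by (metis times_cont_differentiable.simps(1))
  next
    case (Suc k)
    show ?case
      unfolding times_cont_differentiable.simps(2) eq
      using d Suc
      by (auto intro!: differentiableI times_cont_differentiable_mult times_cont_differentiable_const)
  qed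
  then show ?thesis unfolding smooth_def by blast
qed

text \<open>For \<open>k > 0\<close> a smooth function with values in \<open>[0,1]\<close> that is
  positive exactly on the open box. Growing \<open>k\<close> steepens it, and the limit is the
  indicator of the box.\<close>

definition bump :: "'a::euclidean_space \<Rightarrow> 'a \<Rightarrow> real \<Rightarrow> 'a \<Rightarrow> real" where
  "bump l u k x = (\<Prod>b\<in>Basis. flat 1 (k * (x \<bullet> b) + - (k * (l \<bullet> b))) * flat 1 (- k * (x \<bullet> b) + k * (u \<bullet> b)))"

lemma smooth_bump: "smooth (bump l u k)"
  unfolding bump_def[abs_def] by (intro smooth_prod smooth_mult smooth_flat)

lemma flat_1: "flat 1 t \<ge> 0" "flat 1 t \<le> 1" "flat 1 t > 0 \<longleftrightarrow> t > 0"
  by (auto simp: flat_def)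

lemma bump_nonneg: "bump l u k x \<ge> 0"
  unfolding bump_def by (intro prod_nonneg) (simp add: flat_1)

lemma bump_le_1: "bump l u k x \<le> 1"
  unfolding bump_def by (intro prod_le_1) (simp add: flat_1 mult_le_one)

lemma bump_nonzero_iff:
  assumes "k > 0" shows "bump l u k x \<noteq> 0 \<longleftrightarrow> x \<in> box l u"
proof -
  have f: "flat 1 t \<noteq> 0 \<longleftrightarrow> t > 0" for t by (simp add: flat_def)
  have 1: "k * (x \<bullet> b) + - (k * (l \<bullet> b)) > 0 \<longleftrightarrow> l \<bullet> b < x \<bullet> b"
    "- k * (x \<bullet> b) + k * (u \<bullet> b) > 0 \<longleftrightarrow> x \<bullet> b < u \<bullet> b" for b
    using assms by (simp_all add: algebra_simps)
  show ?thesis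
    unfolding bump_def by (simp add: prod_zero_iff f box_def) (use assms in auto)
qed

lemma bump_tendsto_1:
  assumes "x \<in> box l u" shows "(\<lambda>n. bump l u (real (Suc n)) x) \<longlonglongrightarrow> 1"
proof -
  have *: "(\<lambda>n. flat 1 (real (Suc n) * t)) \<longlonglongrightarrow> 1" if "t > 0" for t
  proof -
    have "(\<lambda>n. exp (- ((1/t) * inverse (real (Suc n))))) \<longlonglongrightarrow> exp (- ((1/t) * 0))"
      by (intro tendsto_intros LIMSEQ_inverse_real_of_nat)
    moreover have "(\<lambda>n. flat 1 (real (Suc n) * t)) = (\<lambda>n. exp (- ((1/t) * inverse (real (Suc n)))))"
      using that by (auto simp: flat_def divide_inverse mult_ac)
    ultimately show ?thesis by simp
  qed
  have "(\<lambda>n. bump l u (real (Suc n)) x) \<longlonglongrightarrow> (\<Prod>b\<in>(Basis::'a set). 1 * 1)"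
    unfolding bump_def
  proof (intro tendsto_intros)
    fix b :: 'a assume b: "b \<in> Basis"
    have e: "k * (x \<bullet> b) + - (k * (l \<bullet> b)) = k * (x \<bullet> b - l \<bullet> b)"
      "- k * (x \<bullet> b) + k * (u \<bullet> b) = k * (u \<bullet> b - x \<bullet> b)" for k :: real
      by (simp_all add: algebra_simps)
    show "(\<lambda>n. flat 1 (real (Suc n) * (x \<bullet> b) + - (real (Suc n) * (l \<bullet> b)))) \<longlonglongrightarrow> 1"
      unfolding e by (rule *) (use assms b in \<open>auto simp: box_def\<close>)
    show "(\<lambda>n. flat 1 (- real (Suc n) * (x \<bullet> b) + real (Suc n) * (u \<bullet> b))) \<longlonglongrightarrow> 1"
      unfolding e by (rule *) (use assms b in \<open>auto simp: box_def\<close>)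
  qed
  then show ?thesis by simp
qed

lemma bump_test_function:
  assumes "k > 0" "cbox l u \<subseteq> G" shows "bump l u k \<in> test_functions G"
proof -
  have "{x. bump l u k x \<noteq> 0} = box l u" using bump_nonzero_iff[OF assms(1)] by auto
  moreover have "closure (box l u) \<subseteq> cbox l u"
    by (intro closure_minimal box_subset_cbox closed_cbox)
  ultimately show ?thesis
    using assms(2) smooth_bump bounded_subset[OF bounded_cbox]
    by (auto simp: test_functions_def compact_eq_bounded_closed)
qed

subsection \<open>Polynomials\<close>

definition multi_indices :: "nat \<Rightarrow> ('a::euclidean_space \<Rightarrow> nat) set" where
  "multi_indices p = {\<alpha>. (\<forall>b. b \<notin> Basis \<longrightarrow> \<alpha> b = 0) \<and> (\<Sum>b\<in>Basis. \<alpha> b) \<le> p}"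

lemma polynomials_alt:
  "polynomials p = {f. \<exists>c. f = (\<lambda>y. \<Sum>\<alpha>\<in>multi_indices p. c \<alpha> * (\<Prod>b\<in>Basis. (y \<bullet> b) ^ \<alpha> b))}"
  unfolding polynomials_def multi_indices_def by simp

lemma finite_multi_indices: "finite (multi_indices p :: ('a::euclidean_space \<Rightarrow> nat) set)"
proof (rule finite_subset)
  show "finite {f. \<forall>x::'a. (x \<in> Basis \<longrightarrow> f x \<in> {..p}) \<and> (x \<notin> Basis \<longrightarrow> f x = 0)}"
    by (rule finite_set_of_finite_funs) auto
  show "multi_indices p \<subseteq> {f. \<forall>x::'a. (x \<in> Basis \<longrightarrow> f x \<in> {..p}) \<and> (x \<notin> Basis \<longrightarrow> f x = 0)}"
    unfolding multi_indices_def
    by (auto intro: order_trans[OF member_le_sum[of _ Basis]])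
qed

lemma monomial_in_polynomials:
  assumes "\<alpha> \<in> multi_indices p"
  shows "(\<lambda>y. k * (\<Prod>b\<in>Basis. (y \<bullet> b) ^ \<alpha> b)) \<in> polynomials p"
  unfolding polynomials_alt
proof (safe, rule exI)
  show "(\<lambda>y. k * (\<Prod>b\<in>Basis. (y \<bullet> b) ^ \<alpha> b)) =
    (\<lambda>y. \<Sum>\<beta>\<in>multi_indices p. (if \<beta> = \<alpha> then k else 0) * (\<Prod>b\<in>Basis. (y \<bullet> b) ^ \<beta> b))"
    using assms by (simp add: finite_multi_indices if_distrib[of "\<lambda>c. c * _"] sum.delta cong: if_cong)
qed

lemma polynomials_add:
  assumes "f \<in> polynomials p" "g \<in> polynomials p"
  shows "(\<lambda>y. f y + g y) \<in> polynomials p"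
proof -
  obtain c d where "f = (\<lambda>y. \<Sum>\<alpha>\<in>multi_indices p. c \<alpha> * (\<Prod>b\<in>Basis. (y \<bullet> b) ^ \<alpha> b))"
    "g = (\<lambda>y. \<Sum>\<alpha>\<in>multi_indices p. d \<alpha> * (\<Prod>b\<in>Basis. (y \<bullet> b) ^ \<alpha> b))"
    using assms unfolding polynomials_alt by blast
  then have "(\<lambda>y. f y + g y) = (\<lambda>y. \<Sum>\<alpha>\<in>multi_indices p. (c \<alpha> + d \<alpha>) * (\<Prod>b\<in>Basis. (y \<bullet> b) ^ \<alpha> b))"
    by (simp add: sum.distrib distrib_right)
  then show ?thesis unfolding polynomials_alt by (auto intro!: exI[of _ "\<lambda>\<alpha>. c \<alpha> + d \<alpha>"])
qed

lemma polynomials_sum: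
  "finite I \<Longrightarrow> (\<And>i. i \<in> I \<Longrightarrow> f i \<in> polynomials p) \<Longrightarrow> (\<lambda>y. \<Sum>i\<in>I. f i y) \<in> polynomials p"
proof (induction I rule: finite_induct)
  case empty
  have "(\<lambda>b. 0) \<in> multi_indices p" by (simp add: multi_indices_def)
  from monomial_in_polynomials[OF this, of 0] show ?case by simp
qed (auto intro: polynomials_add)

lemma polynomials_smooth:
  assumes "f \<in> polynomials p" shows "smooth f"
proof -
  obtain c where f: "f = (\<lambda>y. \<Sum>\<alpha>\<in>multi_indices p. c \<alpha> * (\<Prod>b\<in>Basis. (y \<bullet> b) ^ \<alpha> b))"
    using assms unfolding polynomials_alt by blast
  show ?thesis unfolding f by (intro smooth_sum smooth_mult smooth_prod smooth_power smooth_inner) simp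
qed

text \<open>The degree bound is kept rather than lowered: derivatives of local polynomials are thus
  admissible in the inverse inequality of the same degree.\<close>

lemma polynomials_deriv_along:
  fixes f :: "'a::euclidean_space \<Rightarrow> real"
  assumes f: "f \<in> polynomials p" and b: "b \<in> Basis"
  shows "deriv_along b f \<in> polynomials p"
proof -
  obtain c where f: "f = (\<lambda>y. \<Sum>\<alpha>\<in>multi_indices p. c \<alpha> * (\<Prod>b\<in>Basis. (y \<bullet> b) ^ \<alpha> b))"
    using assms unfolding polynomials_alt by blast
  define D where "D \<alpha> y h = (\<Sum>i\<in>Basis. (real (\<alpha> i) * (y \<bullet> i) ^ (\<alpha> i - 1) * (h \<bullet> i)) *
     (\<Prod>j\<in>Basis - {i}. (y \<bullet> j) ^ \<alpha> j))" for \<alpha> :: "'a \<Rightarrow> nat" and y h :: 'a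
  have pw: "((\<lambda>y. (y \<bullet> i) ^ n) has_derivative (\<lambda>h. real n * (y \<bullet> i) ^ (n - 1) * (h \<bullet> i))) (at y)"
    for n and i y :: 'a
    by (auto intro!: derivative_eq_intros simp: mult_ac)
  have "((\<lambda>y. \<Prod>i\<in>Basis. (y \<bullet> i) ^ \<alpha> i) has_derivative D \<alpha> y) (at y)" for \<alpha> and y :: 'a
    unfolding D_def[abs_def] by (intro has_derivative_prod pw)
  then have "(f has_derivative (\<lambda>h. \<Sum>\<alpha>\<in>multi_indices p. c \<alpha> * D \<alpha> y h)) (at y)" for y
    unfolding f by (intro has_derivative_sum has_derivative_mult_right)
  then have eq: "deriv_along b f = (\<lambda>y. \<Sum>\<alpha>\<in>multi_indices p. c \<alpha> * D \<alpha> y b)"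
    by (intro ext deriv_along_eq)
  have "(\<lambda>y. c \<alpha> * D \<alpha> y b) \<in> polynomials p" if "\<alpha> \<in> multi_indices p" for \<alpha>
  proof -
    \<comment> \<open>The exponent of \<open>b\<close> drops by one. If it is 0, truncated
      subtraction leaves it alone, but then the factor \<open>real (\<alpha> b)\<close> removes the
      monomial.\<close>
    define \<beta> where "\<beta> = \<alpha>(b := \<alpha> b - 1)"
    have "(\<Sum>b\<in>Basis. \<beta> b) \<le> (\<Sum>b\<in>Basis. \<alpha> b)" by (intro sum_mono) (simp add: \<beta>_def)
    then have \<beta>: "\<beta> \<in> multi_indices p"
      using that b by (auto simp: multi_indices_def \<beta>_def)
    have "D \<alpha> y b = real (\<alpha> b) * (\<Prod>i\<in>Basis. (y \<bullet> i) ^ \<beta> i)" for y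
    proof -
      have "D \<alpha> y b = (\<Sum>i\<in>Basis. if i = b then real (\<alpha> b) * (y \<bullet> b) ^ (\<alpha> b - 1) * (\<Prod>j\<in>Basis - {b}. (y \<bullet> j) ^ \<alpha> j) else 0)"
        unfolding D_def using b by (intro sum.cong) (auto simp: inner_Basis)
      also have "\<dots> = real (\<alpha> b) * (y \<bullet> b) ^ \<beta> b * (\<Prod>j\<in>Basis - {b}. (y \<bullet> j) ^ \<beta> j)"
        using b by (simp add: \<beta>_def)
      also have "\<dots> = real (\<alpha> b) * (\<Prod>i\<in>Basis. (y \<bullet> i) ^ \<beta> i)"
        using b by (simp add: prod.remove[of Basis b])
      finally show ?thesis .
    qed
    then show ?thesis
      using monomial_in_polynomials[OF \<beta>, of "c \<alpha> * real (\<alpha> b)"] by (simp add: mult.assoc)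
  qed
  then show ?thesis unfolding eq by (intro polynomials_sum finite_multi_indices)
qed

section \<open>The fundamental lemma of the calculus of variations\<close>

lemma test_functions_smooth: "\<phi> \<in> test_functions G \<Longrightarrow> smooth \<phi>"
  by (simp add: test_functions_def)

text \<open>Boxes are an intersection-stable generator of the Borel sets, so the measures with
  densities \<open>max 0 f\<close> and \<open>max 0 (- f)\<close> coincide. Hence \<open>f\<close>
  integrates to zero over all Borel sets, in particular over those where it is positive or negative.
  Only the sets of \<open>M\<close> are fixed, so that Lebesgue and surface measure are both
  covered.\<close>

lemma AE_eq_0_if_integral_box_eq_0:
  fixes f :: "'a::euclidean_space \<Rightarrow> real"
  assumes sets: "sets M = sets borel" and f: "integrable M f"
    and box: "\<And>l u. (\<integral>x. indicator (box l u) x * f x \<partial>M) = 0"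
  shows "AE x in M. f x = 0"
proof -
  have [measurable_cong]: "sets M = sets borel" by (rule sets)
  have [measurable]: "f \<in> borel_measurable M" using f by auto
  have ip: "integrable M (\<lambda>x. max 0 (f x))" "integrable M (\<lambda>x. max 0 (- f x))"
    using f by auto
  define P where "P = density M (\<lambda>x. ennreal (max 0 (f x)))"
  define N where "N = density M (\<lambda>x. ennreal (max 0 (- f x)))"
  have em: "emeasure (density M (\<lambda>x. ennreal (g x))) A = ennreal (\<integral>x. indicator A x * g x \<partial>M)"
    if "integrable M g" "\<And>x. g x \<ge> 0" "A \<in> sets borel" for g A
  proof -
    have [measurable]: "A \<in> sets M" "g \<in> borel_measurable M" using that sets by auto
    have "emeasure (density M (\<lambda>x. ennreal (g x))) A = (\<integral>\<^sup>+x. ennreal (indicator A x * g x) \<partial>M)"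
      by (subst emeasure_density) (auto intro!: nn_integral_cong split: split_indicator)
    also have "\<dots> = ennreal (\<integral>x. indicator A x * g x \<partial>M)"
      using that integrable_mult_indicator[of A M g] by (intro nn_integral_eq_integral) auto
    finally show ?thesis .
  qed
  have diff: "(\<integral>x. indicator A x * max 0 (f x) \<partial>M) - (\<integral>x. indicator A x * max 0 (- f x) \<partial>M) =
      (\<integral>x. indicator A x * f x \<partial>M)" if "A \<in> sets borel" for A
  proof -
    have [measurable]: "A \<in> sets M" using that sets by auto
    have "(\<integral>x. indicator A x * max 0 (f x) \<partial>M) - (\<integral>x. indicator A x * max 0 (- f x) \<partial>M) =
      (\<integral>x. indicator A x * max 0 (f x) - indicator A x * max 0 (- f x) \<partial>M)"
      using integrable_mult_indicator[of A M, OF _ ip(1)] integrable_mult_indicator[of A M, OF _ ip(2)]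
      by (subst Bochner_Integration.integral_diff) auto
    also have "\<dots> = (\<integral>x. indicator A x * f x \<partial>M)"
      by (intro Bochner_Integration.integral_cong refl) (auto split: split_indicator)
    finally show ?thesis .
  qed
  have "P = N"
  proof (rule measure_eqI_generator_eq)
    let ?E = "range (\<lambda>(a, b). box a b::'a set)"
    show "Int_stable ?E"
      by (auto simp: Int_stable_def box_Int_box)
    show "?E \<subseteq> Pow UNIV" "sets P = sigma_sets UNIV ?E" "sets N = sigma_sets UNIV ?E"
      using sets by (simp_all add: borel_eq_box P_def N_def)
    \<comment> \<open>Finiteness on these boxes comes from integrability of \<open>f\<close>; the
      surface measure itself is not finite on boxes.\<close>
    let ?A = "\<lambda>n::nat. box (- (real n *\<^sub>R One)) (real n *\<^sub>R One) :: 'a set"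
    show "range ?A \<subseteq> ?E" "(\<Union>i. ?A i) = UNIV"
      unfolding UN_box_eq_UNIV by auto
    show "emeasure P (?A i) \<noteq> \<infinity>" for i
      unfolding P_def by (subst em[OF ip(1)]) auto
    show "emeasure P X = emeasure N X" if "X \<in> ?E" for X
    proof -
      obtain l u where "X = box l u" using \<open>X \<in> ?E\<close> by auto
      then show ?thesis
        unfolding P_def N_def using diff[of X] box[of l u]
        by (subst em[OF ip(1)], simp, simp, subst em[OF ip(2)]) auto
    qed
  qed
  have "(\<integral>x. indicator A x * f x \<partial>M) = 0" if A: "A \<in> sets M" for A
  proof -
    have "A \<in> sets borel" using A sets by simp
    moreover have "emeasure P A = emeasure N A" using \<open>P = N\<close> by simp
    ultimately have "ennreal (\<integral>x. indicator A x * max 0 (f x) \<partial>M) = ennreal (\<integral>x. indicator A x * max 0 (- f x) \<partial>M)"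
      unfolding P_def N_def using em[OF ip(1), of A] em[OF ip(2), of A] by simp
    then have "(\<integral>x. indicator A x * max 0 (f x) \<partial>M) = (\<integral>x. indicator A x * max 0 (- f x) \<partial>M)"
      by (subst (asm) ennreal_inj) (auto intro!: integral_nonneg_AE)
    then show ?thesis using diff[OF \<open>A \<in> sets borel\<close>] by simp
  qed
  note int0 = this
  have "AE x in M. max 0 (f x) = 0"
  proof (subst integral_nonneg_eq_0_iff_AE[OF ip(1), symmetric])
    have "(\<integral>x. max 0 (f x) \<partial>M) = (\<integral>x. indicator {x\<in>space M. f x > 0} x * f x \<partial>M)"
      by (intro Bochner_Integration.integral_cong refl) (auto simp: indicator_def)
    then show "(\<integral>x. max 0 (f x) \<partial>M) = 0" by (simp add: int0)
  qed simp
  moreover have "AE x in M. max 0 (- f x) = 0"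
  proof (subst integral_nonneg_eq_0_iff_AE[OF ip(2), symmetric])
    have "(\<integral>x. max 0 (- f x) \<partial>M) = - (\<integral>x. indicator {x\<in>space M. f x < 0} x * f x \<partial>M)"
      by (subst Bochner_Integration.integral_minus[symmetric])
        (intro Bochner_Integration.integral_cong refl, auto simp: indicator_def)
    then show "(\<integral>x. max 0 (- f x) \<partial>M) = 0" by (simp add: int0)
  qed simp
  ultimately show ?thesis by eventually_elim (simp add: max_def split: if_splits)
qed

text \<open>Bumps converge boundedly to the indicator of a box, so \<open>f\<close> has integral
  zero over every box whose closed version lies in \<open>G\<close>. Inside one such box the
  previous lemma applies, and by Lindelof countably many of them cover \<open>G\<close>.\<close>

lemma AE_eq_0_if_integral_test_functions_eq_0:
  fixes f :: "'a::euclidean_space \<Rightarrow> real"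
  assumes sets: "sets M = sets borel" and f: "integrable M f" and "open G"
    and test: "\<And>\<phi>. \<phi> \<in> test_functions G \<Longrightarrow> (\<integral>x. f x * \<phi> x \<partial>M) = 0"
  shows "AE x in M. x \<in> G \<longrightarrow> f x = 0"
proof -
  have [measurable_cong]: "sets M = sets borel" by (rule sets)
  have [measurable]: "f \<in> borel_measurable M" using f by auto
  have box0: "(\<integral>x. indicator (box l u) x * f x \<partial>M) = 0" if "cbox l u \<subseteq> G" for l u
  proof -
    have [measurable]: "bump l u k \<in> borel_measurable borel" for k
      by (intro smooth_borel_measurable smooth_bump)
    have "(\<lambda>n. \<integral>x. f x * bump l u (real (Suc n)) x \<partial>M) \<longlonglongrightarrow> (\<integral>x. indicator (box l u) x * f x \<partial>M)"
    proof (rule integral_dominated_convergence[where w="\<lambda>x. norm (f x)"])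
      show "AE x in M. (\<lambda>n. f x * bump l u (real (Suc n)) x) \<longlonglongrightarrow> indicator (box l u) x * f x"
      proof (intro AE_I2)
        fix x
        show "(\<lambda>n. f x * bump l u (real (Suc n)) x) \<longlonglongrightarrow> indicator (box l u) x * f x"
        proof (cases "x \<in> box l u")
          case True
          then show ?thesis using tendsto_mult[OF tendsto_const[of "f x"] bump_tendsto_1[OF True]] by simp
        next
          case False
          then have "bump l u (real (Suc n)) x = 0" for n using bump_nonzero_iff[of "real (Suc n)"] by auto
          then show ?thesis using False by simp
        qed
      qed
      show "AE x in M. norm (f x * bump l u (real (Suc n)) x) \<le> norm (f x)" for n
        by (auto simp: abs_mult bump_nonneg bump_le_1 intro!: AE_I2 mult_right_le_one_le simp del: of_nat_Suc)
    qed (use f in \<open>auto simp del: of_nat_Suc\<close>)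
    moreover have "(\<integral>x. f x * bump l u (real (Suc n)) x \<partial>M) = 0" for n
      by (intro test bump_test_function that) simp
    ultimately show ?thesis by (simp add: LIMSEQ_const_iff)
  qed
  have ae: "AE x in M. indicator (box l u) x * f x = 0" if "cbox l u \<subseteq> G" for l u
  proof (rule AE_eq_0_if_integral_box_eq_0[OF sets])
    show "integrable M (\<lambda>x. indicator (box l u) x * f x)"
      using integrable_mult_indicator[OF _ f, of "box l u"] by simp
    fix a b
    obtain c d where cd: "box a b \<inter> box l u = box c d"
      unfolding box_Int_box by blast
    have e: "indicator (box a b) x * (indicator (box l u) x * f x) = indicator (box c d) x * f x" for x
      unfolding cd[symmetric] by (simp split: split_indicator)
    moreover have "(\<integral>x. indicator (box c d) x * f x \<partial>M) = 0"
    \<comment> \<open>A nonempty open box has \<open>cbox c d\<close> as its closure, which keeps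
      the closed box inside \<open>G\<close>; an empty one contributes nothing.\<close>
    proof (cases "box c d = {}")
      case False
      then have "cbox c d = closure (box c d)" by (simp add: closure_box)
      also have "\<dots> \<subseteq> cbox l u"
        using cd by (intro closure_minimal closed_cbox order_trans[OF _ box_subset_cbox]) blast
      finally show ?thesis using that by (intro box0) blast
    qed simp
    ultimately show "(\<integral>x. indicator (box a b) x * (indicator (box l u) x * f x) \<partial>M) = 0" by (simp only: e)
  qed
  define \<D> where "\<D> = {box l u | l u. cbox l u \<subseteq> G}"
  obtain \<D>' where \<D>': "\<D>' \<subseteq> \<D>" "countable \<D>'" "\<Union>\<D>' = \<Union>\<D>"
    by (rule Lindelof[of \<D>]) (auto simp: \<D>_def)
  have "AE x in M. \<forall>B\<in>\<D>'. indicator B x * f x = 0"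
    using ae \<D>' by (subst AE_ball_countable) (auto simp: \<D>_def)
  then show ?thesis
  proof (eventually_elim, intro impI)
    fix x assume 0: "\<forall>B\<in>\<D>'. indicator B x * f x = 0" and "x \<in> G"
    obtain l u where "x \<in> box l u" "cbox l u \<subseteq> G"
      using open_contains_cbox[OF \<open>open G\<close> \<open>x \<in> G\<close>] by metis
    then have "x \<in> \<Union>\<D>'" unfolding \<D>'(3) \<D>_def by blast
    then show "f x = 0" using 0 by (auto simp: indicator_def)
  qed
qed

section \<open>The surface measure on hyperplanes\<close>

lemma hyperplanesI: "norm n = 1 \<Longrightarrow> {y. n \<bullet> y = c} \<in> hyperplanes"
  unfolding hyperplanes_def by blast

lemma closed_hyperplanes: "H \<in> hyperplanes \<Longrightarrow> closed H"
  unfolding hyperplanes_def by (auto intro: closed_hyperplane)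

lemma null_sets_hyperplane: "n \<noteq> 0 \<Longrightarrow> {y::'a::euclidean_space. n \<bullet> y = c} \<in> null_sets lborel"
  using negligible_hyperplane[of n c]
  by (simp add: negligible_iff_null_sets null_sets_completion_iff)

lemma unit_vectors_eq_if_proportional:
  fixes n w :: "'a::real_inner"
  assumes "norm n = 1" "norm w = 1" and m: "n = (n \<bullet> w) *\<^sub>R w"
  shows "w = n \<or> w = - n"
proof -
  have "1 = \<bar>n \<bullet> w\<bar> * norm w"
    using assms(1) by (subst (asm) m) simp
  then have "\<bar>n \<bullet> w\<bar> = 1" using assms(2) by simp
  then have "n \<bullet> w = 1 \<or> n \<bullet> w = - 1" by linarith
  then show ?thesis using m by (metis minus_minus scaleR_minus1_left scaleR_one)
qed

text \<open>The part \<open>v\<close> of \<open>w\<close> orthogonal to \<open>n\<close> is a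
  direction inside the first hyperplane, hence inside the second, hence orthogonal to
  \<open>w\<close>; so \<open>v\<close> is orthogonal to itself. The sign is all that remains
  free.\<close>

lemma hyperplane_eq_normal:
  fixes n w :: "'a::euclidean_space"
  assumes n: "norm n = 1" and w: "norm w = 1" and eq: "{y. n \<bullet> y = c} = {y. w \<bullet> y = d}"
  shows "(w = n \<and> d = c) \<or> (w = - n \<and> d = - c)"
proof -
  have nn: "n \<bullet> n = 1" "w \<bullet> w = 1" using n w by (simp_all add: dot_square_norm)
  define y0 where "y0 = c *\<^sub>R n"
  have y0: "n \<bullet> y0 = c" using nn by (simp add: y0_def)
  define v where "v = w - (n \<bullet> w) *\<^sub>R n"
  have nv: "n \<bullet> v = 0" using nn by (simp add: v_def inner_diff_right)
  have "y0 \<in> {y. n \<bullet> y = c}" "y0 + v \<in> {y. n \<bullet> y = c}" using y0 nv by (simp_all add: inner_add_right)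
  then have "w \<bullet> v = 0" and d: "w \<bullet> y0 = d" unfolding eq by (auto simp: inner_add_right)
  then have "v \<bullet> v = 0" using nv by (simp add: v_def inner_diff_left inner_diff_right inner_commute)
  then have "w = (w \<bullet> n) *\<^sub>R n" by (simp add: v_def inner_commute)
  then have "n = w \<or> n = - w" by (rule unit_vectors_eq_if_proportional[OF w n])
  then show ?thesis using d y0 by auto
qed

text \<open>Removing from \<open>n\<close> its component along \<open>w\<close> gives a vector
  \<open>m\<close> that is constant along the axis of the cylinder. If \<open>m\<close> is nonzero,
  the cylinder over \<open>H \<inter> H'\<close> lies in a hyperplane normal to \<open>m\<close>; if
  \<open>m = 0\<close>, the hyperplanes are parallel and disjoint.\<close>

lemma null_cylinder_over_Int:
  fixes H H' :: "'a::euclidean_space set"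
  assumes "H \<in> hyperplanes" "H' \<in> hyperplanes" "H \<noteq> H'" "A \<subseteq> H"
  shows "emeasure lborel (cylinder_over H' A) = 0"
proof -
  define w where "w = unit_normal H'"
  obtain d where w: "norm w = 1" and H': "H' = {y. w \<bullet> y = d}"
    using unit_normal[OF assms(2)] unfolding w_def by blast
  obtain n c where n: "norm n = 1" and H: "H = {y. n \<bullet> y = c}"
    using assms(1) unfolding hyperplanes_def by blast
  define m where "m = n - (n \<bullet> w) *\<^sub>R w"
  have ww: "w \<bullet> w = 1" using w by (simp add: dot_square_norm)
  show ?thesis
  proof (cases "m = 0")
    case True
    then have "n = (n \<bullet> w) *\<^sub>R w" by (simp add: m_def)
    then have "w = n \<or> w = - n" by (rule unit_vectors_eq_if_proportional[OF n w])
    then have "H \<inter> H' = {}" using assms(3) H H' by auto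
    then have "cylinder_over H' A = {}" using assms(4) unfolding cylinder_over_def by blast
    then show ?thesis by simp
  next
    case False
    have sub: "cylinder_over H' A \<subseteq> {x. m \<bullet> x = c - (n \<bullet> w) * d}"
    proof
      fix x assume "x \<in> cylinder_over H' A"
      then obtain y s where *: "x = y + s *\<^sub>R w" "y \<in> H" "y \<in> H'"
        using assms(4) unfolding cylinder_over_def w_def by blast
      then have "n \<bullet> y = c" "w \<bullet> y = d" using H H' by auto
      then show "x \<in> {x. m \<bullet> x = c - (n \<bullet> w) * d}"
        using *(1) ww by (simp add: m_def inner_diff_left inner_add_right algebra_simps)
    qed
    then show ?thesis
      using null_sets_hyperplane[OF False, of "c - (n \<bullet> w) * d"] emeasure_mono[OF sub, of lborel]
      by (simp add: null_sets_def)
  qed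
qed

text \<open>All other hyperplanes contribute zero, so the uncountable sum in the surface measure
  reduces to a single term.\<close>

lemma emeasure_surface_hyperplane:
  assumes H: "H \<in> hyperplanes" and A: "A \<in> sets borel" "A \<subseteq> H"
  shows "emeasure surface_measure A = emeasure lborel (cylinder_over H A)"
proof -
  have "emeasure surface_measure A =
      (\<integral>\<^sup>+H. emeasure lborel (cylinder_over H A) \<partial>count_space hyperplanes)"
    by (rule emeasure_surface_measure[OF A(1)])
  also have "\<dots> = (\<Sum>H'\<in>{H}. emeasure lborel (cylinder_over H' A))"
    using null_cylinder_over_Int[OF H _ _ A(2)] H by (intro nn_integral_count_space') auto
  finally show ?thesis by simp
qed

lemma null_sets_surface_Int:
  fixes H H' :: "'a::euclidean_space set"
  assumes "H \<in> hyperplanes" "H' \<in> hyperplanes" "H \<noteq> H'"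
  shows "H \<inter> H' \<in> null_sets surface_measure"
proof -
  have "H \<inter> H' \<in> sets borel" using assms closed_hyperplanes by (intro borel_closed closed_Int) auto
  moreover have "emeasure surface_measure (H \<inter> H') = 0"
    using null_cylinder_over_Int[OF assms(2,1), of "H \<inter> H'"] assms calculation
    by (subst emeasure_surface_hyperplane[OF assms(1)]) auto
  ultimately show ?thesis by auto
qed

lemma nn_integral_lborel_translate:
  fixes a :: "'a::euclidean_space"
  assumes [measurable]: "f \<in> borel_measurable borel"
  shows "(\<integral>\<^sup>+x. f (a + x) \<partial>lborel) = (\<integral>\<^sup>+x. f x \<partial>lborel)"
  by (subst (2) lborel_distr_plus[of a, symmetric]) (simp add: nn_integral_distr)

text \<open>For a unit vector \<open>n\<close> this is the orthogonal projection onto the hyperplane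
  with normal \<open>n\<close> and offset \<open>c\<close>.\<close>

definition hproj :: "'a::euclidean_space \<Rightarrow> real \<Rightarrow> 'a \<Rightarrow> 'a" where
  "hproj n c x = x - (n \<bullet> x - c) *\<^sub>R n"

lemma borel_measurable_hproj [measurable]: "hproj n c \<in> borel \<rightarrow>\<^sub>M borel"
  unfolding hproj_def[abs_def] by measurable

lemma hproj_hyperplane: "norm n = 1 \<Longrightarrow> n \<bullet> hproj n c x = c"
  by (simp add: hproj_def inner_diff_right dot_square_norm)

text \<open>Surface integrals over a hyperplane are turned into volume integrals over a layer of
  thickness \<open>1/m\<close>, exactly and for every \<open>m\<close>: layers of equal thickness
  over the same base have equal volume, and \<open>m\<close> of them fill the cylinder of height
  one. The layer lies on the side where \<open>n \<bullet> x < c\<close>, that is, inside a polytope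
  with outer normal \<open>n\<close>.\<close>

lemma surface_measure_slab:
  fixes n :: "'a::euclidean_space"
  assumes n: "norm n = 1" and m: "m > 0"
  shows "density surface_measure (indicator {y. n \<bullet> y = c}) =
    distr (density lborel (\<lambda>x. ennreal (real m) * indicator {x. - (1 / real m) \<le> n \<bullet> x - c \<and> n \<bullet> x - c < 0} x))
      borel (hproj n c)" (is "?L = ?R")
proof (rule measure_eqI)
  let ?H = "{y. n \<bullet> y = c}"
  have nn: "n \<bullet> n = 1" using n by (simp add: dot_square_norm)
  fix A assume "A \<in> sets ?L"
  then have [measurable]: "A \<in> sets borel" by simp
  \<comment> \<open>The volume of the part over \<open>A\<close> between the signed heights
    \<open>a\<close> and \<open>b\<close>. Half-open intervals make it additive without
    overlap.\<close>
  define J where "J a b = emeasure lborel {x. hproj n c x \<in> A \<and> a \<le> n \<bullet> x - c \<and> n \<bullet> x - c < b}" for a b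
  have J_translate: "J (a + r) (b + r) = J a b" for a b r
  proof -
    have "J (a + r) (b + r) = (\<integral>\<^sup>+x. indicator {x. hproj n c x \<in> A \<and> a + r \<le> n \<bullet> x - c \<and> n \<bullet> x - c < b + r} x \<partial>lborel)"
      unfolding J_def by (subst nn_integral_indicator) simp_all
    also have "\<dots> = (\<integral>\<^sup>+x. indicator {x. hproj n c x \<in> A \<and> a + r \<le> n \<bullet> x - c \<and> n \<bullet> x - c < b + r} (r *\<^sub>R n + x) \<partial>lborel)"
      by (subst nn_integral_lborel_translate) simp_all
    also have "\<dots> = (\<integral>\<^sup>+x. indicator {x. hproj n c x \<in> A \<and> a \<le> n \<bullet> x - c \<and> n \<bullet> x - c < b} x \<partial>lborel)"
    proof (intro nn_integral_cong)
      fix x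
      have "hproj n c (r *\<^sub>R n + x) = hproj n c x"
        by (simp add: hproj_def inner_add_right nn algebra_simps)
      moreover have "a + r \<le> n \<bullet> (r *\<^sub>R n + x) - c \<longleftrightarrow> a \<le> n \<bullet> x - c"
        "n \<bullet> (r *\<^sub>R n + x) - c < b + r \<longleftrightarrow> n \<bullet> x - c < b"
        by (auto simp: inner_add_right nn)
      ultimately show "indicator {x. hproj n c x \<in> A \<and> a + r \<le> n \<bullet> x - c \<and> n \<bullet> x - c < b + r} (r *\<^sub>R n + x)
        = (indicator {x. hproj n c x \<in> A \<and> a \<le> n \<bullet> x - c \<and> n \<bullet> x - c < b} x :: ennreal)"
        by (simp add: indicator_def)
    qed
    also have "\<dots> = J a b"
      unfolding J_def by (subst nn_integral_indicator) simp_all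
    finally show ?thesis .
  qed
  have J_add: "J a d = J a b + J b d" if "a \<le> b" "b \<le> d" for a b d
  proof -
    have "{x. hproj n c x \<in> A \<and> a \<le> n \<bullet> x - c \<and> n \<bullet> x - c < d} =
      {x. hproj n c x \<in> A \<and> a \<le> n \<bullet> x - c \<and> n \<bullet> x - c < b} \<union> {x. hproj n c x \<in> A \<and> b \<le> n \<bullet> x - c \<and> n \<bullet> x - c < d}"
      using that by auto
    then show ?thesis unfolding J_def by (simp only:) (intro plus_emeasure[symmetric], auto)
  qed
  have J_mult: "J 0 (real k / real m) = of_nat k * J 0 (1 / real m)" for k
  proof (induction k)
    case 0
    show ?case by (simp add: J_def Collect_conj_eq[symmetric] not_less[symmetric])
  next
    case (Suc k)
    have "J 0 (real (Suc k) / real m) = J 0 (real k / real m) + J (real k / real m) (real (Suc k) / real m)"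
      using m by (intro J_add) (auto simp: field_simps)
    also have "J (real k / real m) (real (Suc k) / real m) = J 0 (1 / real m)"
      using J_translate[of 0 "real k / real m" "1 / real m"] by (simp add: add_divide_distrib add.commute)
    finally show ?case using Suc by (simp add: distrib_right add.commute)
  qed
  \<comment> \<open>The cylinder is cut into \<open>m\<close> layers, and each is moved to the
    heights between \<open>- 1/m\<close> and 0.\<close>
  have J01: "J 0 1 = ennreal (real m) * J (- (1 / real m)) 0"
    using J_mult[of m] m J_translate[of 0 "- (1 / real m)" "1 / real m"] by (simp add: ennreal_of_nat_eq_real_of_nat)
  have cyl: "emeasure lborel (cylinder_over ?H (A \<inter> ?H)) = J 0 1"
  proof -
    define w where "w = unit_normal ?H"
    obtain d where w: "norm w = 1" and H: "?H = {y. w \<bullet> y = d}"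
      using unit_normal[OF hyperplanesI[OF n]] unfolding w_def by blast
    have cyl: "cylinder_over ?H (A \<inter> ?H) = {y. y - (w \<bullet> y - d) *\<^sub>R w \<in> A \<inter> ?H \<and> 0 \<le> w \<bullet> y - d \<and> w \<bullet> y - d \<le> 1}"
      by (rule cylinder_over_eq[OF w_def[symmetric] w H])
    \<comment> \<open>The cylinder has closed ends and \<open>J\<close> half-open ones; they differ
      by part of a hyperplane.\<close>
    have null: "AE x in lborel. n \<bullet> x - c \<noteq> r" for r
    proof -
      have "n \<noteq> 0" using n by auto
      from null_sets_hyperplane[OF this, of "c + r"] show ?thesis
        by (intro AE_I'[of "{y. n \<bullet> y = c + r}"]) auto
    qed
    \<comment> \<open>The chosen unit normal may be \<open>n\<close> or \<open>- n\<close>. In the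
      second case the cylinder lies below the hyperplane, and a shift by one repairs this.\<close>
    consider "w = n" "d = c" | "w = - n" "d = - c" using hyperplane_eq_normal[OF n w H] by blast
    then show ?thesis
    proof cases
      case 1
      have "cylinder_over ?H (A \<inter> ?H) = {x. hproj n c x \<in> A \<and> 0 \<le> n \<bullet> x - c \<and> n \<bullet> x - c \<le> 1}"
        unfolding cyl 1 by (auto simp: hproj_def[symmetric] hproj_hyperplane[OF n])
      also have "emeasure lborel \<dots> = J 0 1" unfolding J_def
      proof (rule emeasure_eq_AE)
        show "AE x in lborel. (x \<in> {x. hproj n c x \<in> A \<and> 0 \<le> n \<bullet> x - c \<and> n \<bullet> x - c \<le> 1}) =
          (x \<in> {x. hproj n c x \<in> A \<and> 0 \<le> n \<bullet> x - c \<and> n \<bullet> x - c < 1})"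
          using null[of 1] by eventually_elim auto
      qed measurable
      finally show ?thesis .
    next
      case 2
      have "y - (w \<bullet> y - d) *\<^sub>R w = hproj n c y" for y
        unfolding 2 by (simp add: hproj_def scaleR_left_diff_distrib)
      then have "cylinder_over ?H (A \<inter> ?H) = {x. hproj n c x \<in> A \<and> -1 \<le> n \<bullet> x - c \<and> n \<bullet> x - c \<le> 0}"
        unfolding cyl 2 by (auto simp: hproj_hyperplane[OF n])
      also have "emeasure lborel \<dots> = J (-1) 0" unfolding J_def
      proof (rule emeasure_eq_AE)
        show "AE x in lborel. (x \<in> {x. hproj n c x \<in> A \<and> -1 \<le> n \<bullet> x - c \<and> n \<bullet> x - c \<le> 0}) =
          (x \<in> {x. hproj n c x \<in> A \<and> -1 \<le> n \<bullet> x - c \<and> n \<bullet> x - c < 0})"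
          using null[of 0] by eventually_elim auto
      qed measurable
      also have "\<dots> = J 0 1" using J_translate[of "-1" 1 0] by simp
      finally show ?thesis .
    qed
  qed
  have "emeasure ?L A = emeasure surface_measure (A \<inter> ?H)"
    by (subst emeasure_density) (auto simp: nn_integral_indicator[symmetric] indicator_inter_arith mult.commute simp del: nn_integral_indicator intro!: nn_integral_cong)
  also have "\<dots> = J 0 1"
    unfolding cyl[symmetric] by (intro emeasure_surface_hyperplane hyperplanesI n) auto
  also have "\<dots> = emeasure ?R A"
  proof -
    have "emeasure ?R A = emeasure (density lborel (\<lambda>x. ennreal (real m) * indicator {x. - (1 / real m) \<le> n \<bullet> x - c \<and> n \<bullet> x - c < 0} x)) (hproj n c -` A)"
      by (subst emeasure_distr) auto
    also have "\<dots> = (\<integral>\<^sup>+x. ennreal (real m) * indicator {x. hproj n c x \<in> A \<and> - (1 / real m) \<le> n \<bullet> x - c \<and> n \<bullet> x - c < 0} x \<partial>lborel)"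
      using measurable_sets[OF borel_measurable_hproj \<open>A \<in> sets borel\<close>, of n c]
      by (subst emeasure_density) (auto intro!: nn_integral_cong simp: indicator_def)
    also have "\<dots> = ennreal (real m) * J (- (1 / real m)) 0"
      unfolding J_def by (subst nn_integral_cmult_indicator) simp_all
    finally show ?thesis unfolding J01 by simp
  qed
  finally show "emeasure ?L A = emeasure ?R A" .
qed simp

lemma emeasure_surface_bounded_finite:
  fixes A :: "'a::euclidean_space set"
  assumes "A \<in> sets borel" "A \<subseteq> H" "H \<in> hyperplanes" "bounded A"
  shows "emeasure surface_measure A < \<infinity>"
proof -
  obtain B where B: "\<And>x. x \<in> A \<Longrightarrow> norm x \<le> B" using assms(4) bounded_iff by metis
  have "bounded (cylinder_over H A)"
  proof (rule boundedI)
    fix x assume "x \<in> cylinder_over H A"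
    then obtain y s where *: "x = y + s *\<^sub>R unit_normal H" "y \<in> A" "0 \<le> s" "s \<le> 1"
      unfolding cylinder_over_def by blast
    have "norm x \<le> norm y + norm (s *\<^sub>R unit_normal H)" unfolding *(1) by (rule norm_triangle_ineq)
    also have "\<dots> \<le> B + 1" using * B[of y] unit_normal(1)[OF assms(3)] by (intro add_mono) auto
    finally show "norm x \<le> B + 1" .
  qed
  then show ?thesis
    unfolding emeasure_surface_hyperplane[OF assms(3,1,2)] by (rule emeasure_bounded_finite)
qed

section \<open>The divergence theorem on polytopes\<close>

text \<open>Translation invariance gives every difference quotient integral zero. The Lipschitz
  bound and the bounded support dominate the quotients, so the almost everywhere derivative inherits
  this; no continuity of \<open>g\<close> enters.\<close>

lemma integral_directional_derivative_eq_0: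
  fixes G g :: "'a::euclidean_space \<Rightarrow> real"
  assumes G[measurable]: "G \<in> borel_measurable borel" and g[measurable]: "g \<in> borel_measurable borel"
    and intG: "integrable lborel G"
    and lip: "\<And>x s. 0 < s \<Longrightarrow> s \<le> 1 \<Longrightarrow> \<bar>G (x + s *\<^sub>R b) - G x\<bar> \<le> L * s"
    and supp: "\<And>x s. 0 < s \<Longrightarrow> s \<le> 1 \<Longrightarrow> x \<notin> cball 0 R \<Longrightarrow> G (x + s *\<^sub>R b) = G x"
    and deriv: "AE x in lborel. ((\<lambda>s. G (x + s *\<^sub>R b)) has_real_derivative g x) (at 0)"
  shows "(\<integral>x. g x \<partial>lborel) = 0"
proof -
  define s where "s j = inverse (real (Suc j))" for j
  have s: "0 < s j" "s j \<le> 1" "s \<longlonglongrightarrow> 0" for j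
    unfolding s_def using LIMSEQ_inverse_real_of_nat by (auto simp: field_simps)
  define q where "q j x = (G (x + s j *\<^sub>R b) - G x) / s j" for j x
  have tr: "integrable lborel (\<lambda>x. G (x + a))" "(\<integral>x. G (x + a) \<partial>lborel) = (\<integral>x. G x \<partial>lborel)" for a
  proof -
    have "integrable (distr lborel borel ((+) a)) G" using intG by (simp add: lborel_distr_plus)
    then show "integrable lborel (\<lambda>x. G (x + a))" by (subst (asm) integrable_distr_eq) (auto simp: add.commute)
    show "(\<integral>x. G (x + a) \<partial>lborel) = (\<integral>x. G x \<partial>lborel)"
      by (subst (2) lborel_distr_plus[of a, symmetric]) (simp add: integral_distr add.commute)
  qed
  have "(\<lambda>j. \<integral>x. q j x \<partial>lborel) \<longlonglongrightarrow> (\<integral>x. g x \<partial>lborel)"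
  proof (rule integral_dominated_convergence[where w="\<lambda>x. \<bar>L\<bar> * indicator (cball 0 R) x"])
    show "integrable lborel (\<lambda>x::'a. \<bar>L\<bar> * indicator (cball 0 R) x)"
      using integrable_real_indicator[of "cball (0::'a) R" lborel] emeasure_bounded_finite[of "cball (0::'a) R"]
      by (intro integrable_mult_right) auto
    show "AE x in lborel. (\<lambda>j. q j x) \<longlonglongrightarrow> g x"
      using deriv
    proof eventually_elim
      case (elim x)
      then have "((\<lambda>h. (G (x + h *\<^sub>R b) - G x) / h) \<longlongrightarrow> g x) (at 0)"
        unfolding DERIV_def by simp
      moreover have "filterlim s (at 0) sequentially"
        unfolding filterlim_at using s(1,3) by (auto simp: less_imp_neq[symmetric] intro!: always_eventually)
      ultimately show ?case unfolding q_def by (rule filterlim_compose)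
    qed
    show "AE x in lborel. norm (q j x) \<le> \<bar>L\<bar> * indicator (cball 0 R) x" for j
    proof (intro AE_I2)
      fix x
      have "\<bar>q j x\<bar> = \<bar>G (x + s j *\<^sub>R b) - G x\<bar> / s j"
        unfolding q_def using s(1)[of j] by simp
      also have "\<dots> \<le> L"
        using lip[of "s j" x] s(1,2)[of j] by (simp add: field_simps)
      finally have "\<bar>q j x\<bar> \<le> \<bar>L\<bar>" by linarith
      then show "norm (q j x) \<le> \<bar>L\<bar> * indicator (cball 0 R) x"
        using supp[of "s j" x] s(1,2)[of j] by (auto simp: q_def indicator_def)
    qed
  qed (auto simp: q_def)
  moreover have "(\<integral>x. q j x \<partial>lborel) = 0" for j
    unfolding q_def using tr intG by simp
  ultimately show ?thesis by (simp add: LIMSEQ_const_iff)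
qed

text \<open>A cutoff in the signed distance \<open>t\<close> to a facet plane, negative inside: it
  is 1 up to \<open>- 1/k\<close>, 0 from 0 on, and linear in between.\<close>

definition ramp :: "nat \<Rightarrow> real \<Rightarrow> real" where
  "ramp k t = max 0 (min 1 (- (real k * t)))"

lemma ramp_bounds: "0 \<le> ramp k t" "ramp k t \<le> 1" "\<bar>ramp k t\<bar> \<le> 1"
  by (auto simp: ramp_def)

lemma borel_measurable_ramp [measurable]: "ramp k \<in> borel_measurable borel"
  unfolding ramp_def[abs_def] by measurable

lemma ramp_lipschitz: "\<bar>ramp k s - ramp k t\<bar> \<le> real k * \<bar>s - t\<bar>"
proof -
  have "\<bar>ramp k s - ramp k t\<bar> \<le> \<bar>real k * s - real k * t\<bar>"
    by (auto simp: ramp_def max_def min_def)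
  then show ?thesis by (simp add: right_diff_distrib[symmetric] abs_mult)
qed

lemma ramp_eq_0_iff: "k > 0 \<Longrightarrow> ramp k t = 0 \<longleftrightarrow> t \<ge> 0"
proof -
  assume "k > 0"
  then have "real k * t \<ge> 0 \<longleftrightarrow> t \<ge> 0" by (simp add: zero_le_mult_iff)
  moreover have "max 0 (min 1 (- r)) = 0 \<longleftrightarrow> r \<ge> 0" for r :: real by (auto simp: max_def min_def)
  ultimately show "ramp k t = 0 \<longleftrightarrow> t \<ge> 0" unfolding ramp_def by simp
qed

lemma ramp_eq_1: "k > 0 \<Longrightarrow> t \<le> - (1 / real k) \<Longrightarrow> ramp k t = 1"
  unfolding ramp_def by (auto simp: max_def min_def field_simps)

lemma DERIV_ramp:
  assumes k: "k > 0" and t: "t \<noteq> 0" "t \<noteq> - (1 / real k)"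
  shows "(ramp k has_real_derivative - (real k * indicator {x. - (1 / real k) \<le> x \<and> x < 0} t)) (at t)"
proof -
  consider "t > 0" | "- (1 / real k) < t" "t < 0" | "t < - (1 / real k)" using t by linarith
  then show ?thesis
  proof cases
    case 1
    have "((\<lambda>t. 0) has_real_derivative - (real k * indicator {x. - (1 / real k) \<le> x \<and> x < 0} t)) (at t)"
      using 1 by simp
    then show ?thesis
      by (rule has_field_derivative_transform_within_open[of _ _ _ "{0<..}"])
        (use 1 k ramp_eq_0_iff[OF k] in \<open>auto\<close>)
  next
    case 2
    have "((\<lambda>t. - (real k * t)) has_real_derivative - (real k * indicator {x. - (1 / real k) \<le> x \<and> x < 0} t)) (at t)"
      using 2 by (auto intro!: derivative_eq_intros)
    then show ?thesis
      by (rule has_field_derivative_transform_within_open[of _ _ _ "{- (1 / real k)<..<0}"])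
        (use 2 k in \<open>auto simp: ramp_def max_def min_def field_simps mult_le_0_iff\<close>)
  next
    case 3
    then have "t < 0" using k by (smt (verit) divide_nonneg_nonneg of_nat_0_le_iff)
    then have "((\<lambda>t. 1) has_real_derivative - (real k * indicator {x. - (1 / real k) \<le> x \<and> x < 0} t)) (at t)"
      using 3 by simp
    then show ?thesis
      by (rule has_field_derivative_transform_within_open[of _ _ _ "{..<- (1 / real k)}"])
        (use 3 k in \<open>auto simp: ramp_eq_1\<close>)
  qed
qed

lemma smooth_bounded_lipschitz_on_cball:
  fixes f :: "'a::euclidean_space \<Rightarrow> real"
  assumes f: "smooth f"
  obtains M L where "\<And>x. x \<in> cball 0 R \<Longrightarrow> \<bar>f x\<bar> \<le> M" "0 \<le> M"
    "\<And>x y. x \<in> cball 0 R \<Longrightarrow> y \<in> cball 0 R \<Longrightarrow> \<bar>f x - f y\<bar> \<le> L * norm (x - y)" "0 \<le> L"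
proof -
  have bd: "\<exists>B\<ge>0. \<forall>x\<in>cball 0 R. \<bar>g x\<bar> \<le> B" if "smooth g" for g :: "'a \<Rightarrow> real"
  proof -
    have "compact (g ` cball 0 R)"
      by (intro compact_continuous_image smooth_continuous_on that compact_cball)
    then have "bounded (g ` cball 0 R)" by (rule compact_imp_bounded)
    then obtain B where "\<forall>x\<in>cball 0 R. \<bar>g x\<bar> \<le> B" unfolding bounded_iff by auto
    then show ?thesis by (intro exI[of _ "max 0 B"]) auto
  qed
  obtain M where M: "M \<ge> 0" "\<forall>x\<in>cball 0 R. \<bar>f x\<bar> \<le> M" using bd[OF f] by blast
  have "\<forall>b\<in>Basis. \<exists>B\<ge>0. \<forall>x\<in>cball 0 R. \<bar>deriv_along b f x\<bar> \<le> B"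
    using bd smooth_deriv_along[OF f] by blast
  then obtain C where C: "\<And>b. b \<in> Basis \<Longrightarrow> C b \<ge> 0" "\<And>b x. b \<in> Basis \<Longrightarrow> x \<in> cball 0 R \<Longrightarrow> \<bar>deriv_along b f x\<bar> \<le> C b"
    by metis
  define L where "L = (\<Sum>b\<in>Basis. C b)"
  have L0: "L \<ge> 0" unfolding L_def by (intro sum_nonneg C)
  have "\<bar>f x - f y\<bar> \<le> L * norm (x - y)" if "x \<in> cball 0 R" "y \<in> cball 0 R" for x y
  proof -
    have "norm (f x - f y) \<le> L * norm (x - y)"
    proof (rule differentiable_bound[of "cball 0 R" f "\<lambda>x h. \<Sum>b\<in>Basis. (h \<bullet> b) * deriv_along b f x"])
      fix z assume z: "z \<in> cball (0::'a) R"
      show "(f has_derivative (\<lambda>h. \<Sum>b\<in>Basis. (h \<bullet> b) * deriv_along b f z)) (at z within cball 0 R)"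
        by (rule has_derivative_at_withinI[OF smooth_has_derivative[OF f]])
      show "onorm (\<lambda>h. \<Sum>b\<in>Basis. (h \<bullet> b) * deriv_along b f z) \<le> L"
      proof (rule onorm_le)
        fix h :: 'a
        have "norm (\<Sum>b\<in>Basis. (h \<bullet> b) * deriv_along b f z) \<le> (\<Sum>b\<in>Basis. norm h * C b)"
          using C z by (intro sum_norm_le) (auto simp: abs_mult intro!: mult_mono Basis_le_norm)
        then show "norm (\<Sum>b\<in>Basis. (h \<bullet> b) * deriv_along b f z) \<le> L * norm h"
          by (simp add: L_def sum_distrib_left[symmetric] mult.commute[of "sum C Basis"])
      qed
    qed (use that in auto)
    then show ?thesis by simp
  qed
  with M L0 show ?thesis using that by blast
qed

text \<open>The derivative of \<open>f\<close> times the cutoff integrates to zero, so the volume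
  term equals a sum of layer terms. By the slab identity, \<open>k\<close> times a layer integral is
  a surface integral up to two errors: moving points to the plane, and a neighbourhood of the
  intersections with other planes. Distinctness of the planes makes these intersections
  null.\<close>

lemma divergence_theorem_halfspaces:
  fixes n :: "'i \<Rightarrow> 'a::euclidean_space" and c :: "'i \<Rightarrow> real"
  assumes fin: "finite I" and n: "\<And>i. i \<in> I \<Longrightarrow> norm (n i) = 1"
    and distinct: "\<And>i j. i \<in> I \<Longrightarrow> j \<in> I \<Longrightarrow> i \<noteq> j \<Longrightarrow> {y. n i \<bullet> y = c i} \<noteq> {y. n j \<bullet> y = c j}"
    and K: "K = {x. \<forall>i\<in>I. n i \<bullet> x \<le> c i}" and bd: "bounded K"
    and f: "smooth f" and b: "b \<in> Basis"
  shows "(\<integral>x. indicator K x * deriv_along b f x \<partial>lborel) =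
    (\<Sum>i\<in>I. (n i \<bullet> b) * (\<integral>y. indicator {y. n i \<bullet> y = c i} y * (indicator K y * f y) \<partial>surface_measure))"
proof -
  define l where "l i x = n i \<bullet> x - c i" for i x
  define S where "S i k = {x. - (1 / real k) \<le> l i x \<and> l i x < 0}" for i k
  define P where "P J k x = (\<Prod>i\<in>J. ramp k (l i x))" for J k x
  have [measurable]: "l i \<in> borel_measurable borel" for i unfolding l_def[abs_def] by measurable
  have [measurable]: "P J k \<in> borel_measurable borel" for J k unfolding P_def[abs_def] by measurable
  have [measurable]: "f \<in> borel_measurable borel" "deriv_along b f \<in> borel_measurable borel"
    using f b by (auto intro: smooth_borel_measurable smooth_deriv_along)
  have "closed K" unfolding K by (auto intro!: closed_Collect_all closed_Collect_imp closed_halfspace_le simp: Ball_def)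
  then have [measurable]: "K \<in> sets borel" by simp
  obtain R where R: "R > 0" "\<And>x. x \<in> K \<Longrightarrow> norm x \<le> R"
    using bd bounded_pos by metis
  obtain M L where M: "\<And>x. x \<in> cball 0 (R + 1) \<Longrightarrow> \<bar>f x\<bar> \<le> M" "0 \<le> M"
    and L: "\<And>x y. x \<in> cball 0 (R + 1) \<Longrightarrow> y \<in> cball 0 (R + 1) \<Longrightarrow> \<bar>f x - f y\<bar> \<le> L * norm (x - y)" "0 \<le> L"
    using smooth_bounded_lipschitz_on_cball[OF f, of "R + 1"] by metis
  obtain M' L' where M': "\<And>x. x \<in> cball 0 (R + 1) \<Longrightarrow> \<bar>deriv_along b f x\<bar> \<le> M'" "0 \<le> M'"
    using smooth_bounded_lipschitz_on_cball[OF smooth_deriv_along[OF f b], of "R + 1"] by metis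
  have P01: "0 \<le> P J k x" "P J k x \<le> 1" for J k x
    unfolding P_def by (auto intro!: prod_nonneg prod_le_1 simp: ramp_bounds)
  have PK: "P I k x = 0" if notin: "x \<notin> K" and "k > 0" for k x
  proof -
    obtain i where "i \<in> I" "l i x > 0" using notin by (auto simp: K l_def not_le)
    then show ?thesis unfolding P_def using fin that ramp_eq_0_iff[of k "l i x"] by (auto intro!: prod_zero)
  qed
  have null_l: "AE x in lborel. l i x \<noteq> r" if "i \<in> I" for i r
  proof -
    have "n i \<noteq> 0" using n[OF that] by auto
    from null_sets_hyperplane[OF this, of "c i + r"] show ?thesis
      by (intro AE_I'[of "{y. n i \<bullet> y = c i + r}"]) (auto simp: l_def)
  qed
  have int_ball: "integrable lborel (\<lambda>x::'a. a * indicator (cball 0 r) x)" for a r :: real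
    using integrable_real_indicator[of "cball (0::'a) r" lborel] emeasure_bounded_finite[of "cball (0::'a) r"]
    by (intro integrable_mult_right) auto
  have int_bd: "integrable lborel g" if "g \<in> borel_measurable borel" "\<And>x. \<bar>g x\<bar> \<le> a * indicator (cball 0 r) x"
    for g :: "'a \<Rightarrow> real" and a r
    using that by (intro Bochner_Integration.integrable_bound[OF int_ball[of a r]]) (auto intro!: AE_I2 order_trans[OF _ abs_ge_self])
  \<comment> \<open>Approximate the indicator of \<open>K\<close> by the Lipschitz cutoff \<open>P I k\<close>, whose derivative lives on
     layers of thickness \<open>1/k\<close> along the facets.\<close>
  have cutoff: "(\<integral>x. deriv_along b f x * P I k x \<partial>lborel) =
     (\<Sum>i\<in>I. (n i \<bullet> b) * (real k * (\<integral>x. indicator (S i k) x * (f x * P (I - {i}) k x) \<partial>lborel)))" if k: "k > 0" for k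
  proof -
    \<comment> \<open>The contribution of the product rule in which the ramp of the facet
      \<open>i\<close> is differentiated.\<close>
    define T where "T i x = real k * (n i \<bullet> b) * (indicator (S i k) x * (f x * P (I - {i}) k x))" for i x
    define g where "g x = deriv_along b f x * P I k x - (\<Sum>i\<in>I. T i x)" for x
    have [measurable]: "S i k \<in> sets borel" for i unfolding S_def by measurable
    have [measurable]: "T i \<in> borel_measurable borel" for i unfolding T_def[abs_def] by measurable
    \<comment> \<open>A point of the layer \<open>S i k\<close> satisfies constraint
      \<open>i\<close> strictly. If it is outside \<open>K\<close>, another constraint fails, and
      its ramp is among the remaining factors and vanishes.\<close>
    have SK: "indicator (S i k) x * (f x * P (I - {i}) k x) = 0" if notin: "x \<notin> K" and "i \<in> I" for i x
    proof (cases "l i x < 0")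
      case True
      obtain j where "j \<in> I" "l j x > 0" using notin by (auto simp: K l_def not_le)
      then show ?thesis
        using True ramp_eq_0_iff[OF k, of "l j x"] fin unfolding P_def by (auto intro!: prod_zero bexI[of _ j])
    qed (simp add: S_def)
    have T_bd: "\<bar>T i x\<bar> \<le> (real k * \<bar>n i \<bullet> b\<bar> * M) * indicator (cball 0 R) x" if "i \<in> I" for i x
    proof (cases "x \<in> K")
      case True
      have "\<bar>indicator (S i k) x * (f x * P (I - {i}) k x)\<bar> \<le> 1 * (M * 1)"
        unfolding abs_mult using P01[of "I - {i}" k x] M(1)[of x] M(2) R(2)[OF True]
        by (intro mult_mono) (auto simp: indicator_def)
      then have "\<bar>T i x\<bar> \<le> \<bar>real k * (n i \<bullet> b)\<bar> * M"
        unfolding T_def by (subst abs_mult) (intro mult_left_mono, auto)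
      then show ?thesis using R(2)[OF True] by (simp add: abs_mult)
    next
      case False
      have "T i x = 0" unfolding T_def SK[OF False that] by simp
      then show ?thesis using M(2) by simp
    qed
    have intT: "integrable lborel (T i)" if "i \<in> I" for i
      using T_bd[OF that] by (intro int_bd) auto
    have bdP: "\<bar>h x * P I k x\<bar> \<le> B * indicator (cball 0 R) x"
      if "\<And>x. x \<in> cball 0 (R + 1) \<Longrightarrow> \<bar>h x\<bar> \<le> B" "0 \<le> B" for h B x
    proof (cases "x \<in> K")
      case True
      have "\<bar>h x\<bar> * \<bar>P I k x\<bar> \<le> B * 1"
        using that R(2)[OF True] P01[of I k x] by (intro mult_mono) auto
      then show ?thesis using R(2)[OF True] by (simp add: abs_mult)
    qed (use PK k that in auto)
    have intP: "integrable lborel (\<lambda>x. deriv_along b f x * P I k x)" "integrable lborel (\<lambda>x. f x * P I k x)"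
      by (rule int_bd[OF _ bdP[of "deriv_along b f" M', OF M']], measurable)
        (rule int_bd[OF _ bdP[of f M, OF M]], measurable)
    have Plip: "\<bar>P I k x - P I k y\<bar> \<le> (real (card I) * real k) * norm (x - y)" for x y
    proof -
      have "norm (P I k x - P I k y) \<le> (\<Sum>i\<in>I. norm (ramp k (l i x) - ramp k (l i y)))"
        unfolding P_def by (intro norm_prod_diff) (auto simp: ramp_bounds)
      also have "\<dots> \<le> (\<Sum>i\<in>I. real k * norm (x - y))"
      proof (intro sum_mono)
        fix i assume i: "i \<in> I"
        have "l i x - l i y = n i \<bullet> (x - y)" by (simp add: l_def inner_diff_right)
        then have "\<bar>l i x - l i y\<bar> \<le> norm (x - y)" using Cauchy_Schwarz_ineq2[of "n i" "x - y"] n[OF i] by simp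
        then show "norm (ramp k (l i x) - ramp k (l i y)) \<le> real k * norm (x - y)"
          using ramp_lipschitz[of k "l i x" "l i y"] mult_left_mono[of _ _ "real k"] by fastforce
      qed
      finally show ?thesis by simp
    qed
    have "(\<integral>x. g x \<partial>lborel) = 0"
    proof (rule integral_directional_derivative_eq_0[of "\<lambda>x. f x * P I k x" g b "L + M * (real (card I) * real k)" "R + 1"])
      fix x s assume s: "0 < s" "s \<le> (1::real)"
      have ns: "norm (s *\<^sub>R b) = s" using s b by simp
      show "\<bar>f (x + s *\<^sub>R b) * P I k (x + s *\<^sub>R b) - f x * P I k x\<bar> \<le> (L + M * (real (card I) * real k)) * s"
      proof (cases "x \<in> K \<or> x + s *\<^sub>R b \<in> K")
        case True
        have "norm x \<le> norm (x + s *\<^sub>R b) + norm (s *\<^sub>R b)"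
          by (metis add_diff_cancel norm_triangle_ineq4)
        then have in_ball: "x \<in> cball 0 (R + 1)" "x + s *\<^sub>R b \<in> cball 0 (R + 1)"
          using True R(2)[of x] R(2)[of "x + s *\<^sub>R b"] norm_triangle_ineq[of x "s *\<^sub>R b"] ns s by auto
        have "\<bar>f (x + s *\<^sub>R b) * P I k (x + s *\<^sub>R b) - f x * P I k x\<bar>
          = \<bar>(f (x + s *\<^sub>R b) - f x) * P I k (x + s *\<^sub>R b) + f x * (P I k (x + s *\<^sub>R b) - P I k x)\<bar>"
          by (simp add: algebra_simps)
        also have "\<dots> \<le> \<bar>f (x + s *\<^sub>R b) - f x\<bar> * \<bar>P I k (x + s *\<^sub>R b)\<bar> + \<bar>f x\<bar> * \<bar>P I k (x + s *\<^sub>R b) - P I k x\<bar>"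
          unfolding abs_mult[symmetric] by (rule abs_triangle_ineq)
        also have "\<dots> \<le> (L * s) * 1 + M * ((real (card I) * real k) * s)"
          using L(1)[OF in_ball(2,1)] L(2) M(1)[OF in_ball(1)] M(2) P01[of I k] Plip[of "x + s *\<^sub>R b" x] ns s
          by (intro add_mono mult_mono) auto
        finally show ?thesis by (simp add: algebra_simps)
      next
        case False
        then show ?thesis using PK[OF _ k] L(2) M(2) s by auto
      qed
      show "f (x + s *\<^sub>R b) * P I k (x + s *\<^sub>R b) = f x * P I k x" if "x \<notin> cball 0 (R + 1)"
      proof -
        have "norm x \<le> norm (x + s *\<^sub>R b) + norm (s *\<^sub>R b)"
          by (metis add_diff_cancel norm_triangle_ineq4)
        then have "x \<notin> K" "x + s *\<^sub>R b \<notin> K" using that R(2)[of x] R(2)[of "x + s *\<^sub>R b"] ns s by auto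
        then show ?thesis using PK[OF _ k] by auto
      qed
    next
      \<comment> \<open>Away from the kinks of the finitely many ramps the product is
        differentiable; the kinks form hyperplanes.\<close>
      have "AE x in lborel. \<forall>i\<in>I. l i x \<noteq> 0 \<and> l i x \<noteq> - (1 / real k)"
        using fin null_l by (intro AE_finite_allI) (auto intro: AE_conjI)
      then show "AE x in lborel. ((\<lambda>s. f (x + s *\<^sub>R b) * P I k (x + s *\<^sub>R b)) has_real_derivative g x) (at 0)"
      proof eventually_elim
        case (elim x)
        have 1: "((\<lambda>s. x + s *\<^sub>R b) has_derivative (\<lambda>s. s *\<^sub>R b)) (at 0)"
          by (auto intro!: derivative_eq_intros)
        have 2: "(f has_derivative (\<lambda>h. \<Sum>b'\<in>Basis. (h \<bullet> b') * deriv_along b' f x)) (at (x + 0 *\<^sub>R b))"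
          using smooth_has_derivative[OF f, of x] by simp
        have "((\<lambda>s. f (x + s *\<^sub>R b)) has_derivative (\<lambda>s. \<Sum>b'\<in>Basis. ((s *\<^sub>R b) \<bullet> b') * deriv_along b' f x)) (at 0)"
          by (rule has_derivative_compose[OF 1 2])
        moreover have "(\<Sum>b'\<in>Basis. ((s *\<^sub>R b) \<bullet> b') * deriv_along b' f x) = deriv_along b f x * s" for s
          using b by (simp add: inner_Basis if_distrib[of "\<lambda>r. _ * r * _"] if_distrib[of "\<lambda>r. r * _"] sum.delta' cong: if_cong)
        ultimately have df: "((\<lambda>s. f (x + s *\<^sub>R b)) has_real_derivative deriv_along b f x) (at 0)"
          unfolding has_field_derivative_def by simp
        have dl: "((\<lambda>s. ramp k (l i (x + s *\<^sub>R b))) has_real_derivative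
            - (real k * indicator (S i k) x) * (n i \<bullet> b)) (at 0)" if "i \<in> I" for i
        proof -
          have "((\<lambda>s. l i (x + s *\<^sub>R b)) has_real_derivative (n i \<bullet> b)) (at 0)"
            unfolding l_def inner_add_right inner_scaleR_right by (auto intro!: derivative_eq_intros)
          moreover have "(ramp k has_real_derivative - (real k * indicator (S i k) x)) (at (l i (x + 0 *\<^sub>R b)))"
            using DERIV_ramp[OF k, of "l i x"] elim that by (simp add: S_def indicator_def)
          ultimately show ?thesis by (rule DERIV_chain2[rotated])
        qed
        have "((\<lambda>s. \<Prod>i\<in>I. ramp k (l i (x + s *\<^sub>R b))) has_derivative
           (\<lambda>y. \<Sum>i\<in>I. (- (real k * indicator (S i k) x) * (n i \<bullet> b) * y) * (\<Prod>j\<in>I - {i}. ramp k (l j (x + 0 *\<^sub>R b))))) (at 0)"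
          using dl unfolding has_field_derivative_def by (intro has_derivative_prod)
        moreover have "(\<Sum>i\<in>I. (- (real k * indicator (S i k) x) * (n i \<bullet> b) * y) * (\<Prod>j\<in>I - {i}. ramp k (l j (x + 0 *\<^sub>R b))))
          = (- (\<Sum>i\<in>I. real k * (n i \<bullet> b) * (indicator (S i k) x * P (I - {i}) k x))) * y" for y
          unfolding P_def sum_negf[symmetric] sum_distrib_right by (intro sum.cong) auto
        ultimately have dP: "((\<lambda>s. P I k (x + s *\<^sub>R b)) has_real_derivative
            - (\<Sum>i\<in>I. real k * (n i \<bullet> b) * (indicator (S i k) x * P (I - {i}) k x))) (at 0)"
          unfolding has_field_derivative_def P_def by (simp only:)
        have T_eq: "(\<Sum>i\<in>I. real k * (n i \<bullet> b) * (indicator (S i k) x * P (I - {i}) k x)) * f x = (\<Sum>i\<in>I. T i x)"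
          unfolding sum_distrib_right T_def by (intro sum.cong) auto
        have "g x = deriv_along b f x * P I k (x + 0 *\<^sub>R b) +
            (- (\<Sum>i\<in>I. real k * (n i \<bullet> b) * (indicator (S i k) x * P (I - {i}) k x))) * f (x + 0 *\<^sub>R b)"
          unfolding g_def using T_eq by simp
        then show ?case using DERIV_mult[OF df dP] by simp
      qed
    qed (use intP in \<open>auto simp: g_def[abs_def]\<close>)
    moreover have "(\<integral>x. g x \<partial>lborel) = (\<integral>x. deriv_along b f x * P I k x \<partial>lborel) - (\<Sum>i\<in>I. \<integral>x. T i x \<partial>lborel)"
      unfolding g_def using intT intP by (subst Bochner_Integration.integral_diff) auto
    ultimately have "(\<integral>x. deriv_along b f x * P I k x \<partial>lborel) = (\<Sum>i\<in>I. \<integral>x. T i x \<partial>lborel)" by simp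
    also have "\<dots> = (\<Sum>i\<in>I. (n i \<bullet> b) * (real k * (\<integral>x. indicator (S i k) x * (f x * P (I - {i}) k x) \<partial>lborel)))"
      unfolding T_def by (intro sum.cong) auto
    finally show ?thesis .
  qed
  have lim_lhs: "(\<lambda>k. \<integral>x. deriv_along b f x * P I (Suc k) x \<partial>lborel) \<longlonglongrightarrow> (\<integral>x. indicator K x * deriv_along b f x \<partial>lborel)"
  proof (rule integral_dominated_convergence[where w="\<lambda>x. M' * indicator (cball 0 R) x"])
    show "integrable lborel (\<lambda>x::'a. M' * indicator (cball 0 R) x)" by (rule int_ball)
    have "AE x in lborel. \<forall>i\<in>I. l i x \<noteq> 0"
      using fin null_l by (intro AE_finite_allI) auto
    then show "AE x in lborel. (\<lambda>k. deriv_along b f x * P I (Suc k) x) \<longlonglongrightarrow> indicator K x * deriv_along b f x"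
    proof eventually_elim
      case (elim x)
      show ?case
      proof (cases "x \<in> K")
        case True
        have "(\<lambda>k. P I (Suc k) x) \<longlonglongrightarrow> (\<Prod>i\<in>I. 1)"
          unfolding P_def
        proof (intro tendsto_intros)
          fix i assume "i \<in> I"
          then have neg: "l i x < 0" using True elim unfolding K l_def by force
          have "\<forall>\<^sub>F k in sequentially. 1 / real (Suc k) < - l i x"
            using neg LIMSEQ_inverse_real_of_nat by (intro order_tendstoD(2)[of _ 0]) (auto simp: inverse_eq_divide)
          then have "\<forall>\<^sub>F k in sequentially. ramp (Suc k) (l i x) = 1"
            by eventually_elim (intro ramp_eq_1, auto)
          then show "(\<lambda>k. ramp (Suc k) (l i x)) \<longlonglongrightarrow> 1"
            by (rule tendsto_eventually)
        qed
        then have "(\<lambda>k. deriv_along b f x * P I (Suc k) x) \<longlonglongrightarrow> deriv_along b f x * 1"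
          by (intro tendsto_intros) simp
        then show ?thesis using True by simp
      next
        case False
        then show ?thesis using PK[OF False] by simp
      qed
    qed
    show "AE x in lborel. norm (deriv_along b f x * P I (Suc k) x) \<le> M' * indicator (cball 0 R) x" for k
    proof (intro AE_I2)
      fix x
      show "norm (deriv_along b f x * P I (Suc k) x) \<le> M' * indicator (cball 0 R) x"
      proof (cases "x \<in> K")
        case True
        then have "\<bar>deriv_along b f x\<bar> * \<bar>P I (Suc k) x\<bar> \<le> M' * 1"
          using M' R(2)[OF True] P01[of I "Suc k" x] by (intro mult_mono) auto
        then show ?thesis using R(2)[OF True] by (simp add: abs_mult)
      qed (use PK M' in auto)
    qed
  qed measurable
  have lim_rhs: "(\<lambda>k. real (Suc k) * (\<integral>x. indicator (S i (Suc k)) x * (f x * P (I - {i}) (Suc k) x) \<partial>lborel)) \<longlonglongrightarrow>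
     (\<integral>y. indicator {y. n i \<bullet> y = c i} y * (indicator K y * f y) \<partial>surface_measure)" if i: "i \<in> I" for i
  proof -
    let ?H = "{y. n i \<bullet> y = c i}"
    let ?p = "hproj (n i) (c i)"
    have H: "?H \<in> hyperplanes" by (rule hyperplanesI[OF n[OF i]])
    have [measurable]: "S i k \<in> sets borel" for k unfolding S_def by measurable
    define B where "B = cball (0::'a) (R + 1)"
    \<comment> \<open>Points close to the plane of another facet. The width 2 in units of the layer
      thickness is one unit for the distance to the projection and one for the ramp to reach
      1.\<close>
    define A where "A k = {y \<in> B. \<exists>j\<in>I - {i}. \<bar>l j y\<bar> \<le> 2 / real (Suc k)}" for k
    have [measurable]: "B \<in> sets borel" unfolding B_def by simp
    have "A k = B \<inter> (\<Union>j\<in>I - {i}. {y. \<bar>l j y\<bar> \<le> 2 / real (Suc k)})" for k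
      by (auto simp: A_def)
    then have [measurable]: "A k \<in> sets borel" for k
      using fin by (simp only:) (intro sets.Int sets.finite_UN, auto)
    have fin_BH: "emeasure surface_measure (B \<inter> ?H) < \<infinity>"
      unfolding B_def by (intro emeasure_surface_bounded_finite[OF _ _ H] bounded_Int) auto
    have int_BH: "integrable surface_measure (indicator (B \<inter> ?H) :: 'a \<Rightarrow> real)"
      using fin_BH by (intro integrable_real_indicator) auto
    have bound_int: "integrable surface_measure (\<lambda>y. indicator ?H y * g y)"
      if [measurable]: "g \<in> borel_measurable borel" and "\<And>y. \<bar>g y\<bar> \<le> C * indicator B y" for g :: "'a \<Rightarrow> real" and C
    proof (rule Bochner_Integration.integrable_bound[OF integrable_mult_right[OF int_BH, of C]])
      show "AE x in surface_measure. norm (indicator ?H x * g x) \<le> norm (C * indicator (B \<inter> ?H) x)"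
      proof (intro AE_I2)
        fix x
        show "norm (indicator ?H x * g x) \<le> norm (C * indicator (B \<inter> ?H) x)"
          using that(2)[of x] by (auto simp: indicator_def split: if_splits)
      qed
    qed measurable
    have slab: "integrable lborel (\<lambda>x. indicator (S i k) x * g (?p x))"
      "(\<integral>y. indicator ?H y * g y \<partial>surface_measure) = real k * (\<integral>x. indicator (S i k) x * g (?p x) \<partial>lborel)"
      if [measurable]: "g \<in> borel_measurable borel" and "integrable surface_measure (\<lambda>y. indicator ?H y * g y)" "k > 0"
      for g :: "'a \<Rightarrow> real" and k
    proof -
      note eq = surface_measure_slab[OF n[OF i] that(3), of "c i"]
      have S_eq: "indicator {x. - (1 / real k) \<le> n i \<bullet> x - c i \<and> n i \<bullet> x - c i < 0} x = (indicator (S i k) x :: ennreal)" for x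
        by (simp add: S_def l_def)
      have e: "ennreal (real k) * indicator (S i k) x = ennreal (real k * indicator (S i k) x)" for x
        by (simp add: indicator_def)
      have ind: "(indicator ?H :: 'a \<Rightarrow> ennreal) = (\<lambda>x. ennreal (indicator ?H x))" by (auto simp: indicator_def)
      have "integrable (density surface_measure (indicator ?H)) g"
        unfolding ind using that by (subst integrable_density) auto
      then have "integrable (density lborel (\<lambda>x. ennreal (real k * indicator (S i k) x))) (\<lambda>x. g (?p x))"
        unfolding eq S_eq e by (subst (asm) integrable_distr_eq) auto
      then have "integrable lborel (\<lambda>x. (real k * indicator (S i k) x) *\<^sub>R g (?p x))"
        by (subst (asm) integrable_density) auto
      then have *: "integrable lborel (\<lambda>x. real k * (indicator (S i k) x * g (?p x)))" by (simp add: mult.assoc)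
      show "integrable lborel (\<lambda>x. indicator (S i k) x * g (?p x))"
        using * that(3) by simp
      have "(\<integral>y. indicator ?H y * g y \<partial>surface_measure) = integral\<^sup>L (density surface_measure (indicator ?H)) g"
        unfolding ind by (subst integral_density) auto
      also have "\<dots> = integral\<^sup>L (density lborel (\<lambda>x. ennreal (real k * indicator (S i k) x))) (\<lambda>x. g (?p x))"
        unfolding eq S_eq e by (subst integral_distr) auto
      also have "\<dots> = (\<integral>x. real k * (indicator (S i k) x * g (?p x)) \<partial>lborel)"
        by (subst integral_density) (auto simp: mult.assoc)
      finally show "(\<integral>y. indicator ?H y * g y \<partial>surface_measure) = real k * (\<integral>x. indicator (S i k) x * g (?p x) \<partial>lborel)"
        by simp
    qed
    have KB: "K \<subseteq> B" using R unfolding B_def by force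
    have int_f: "integrable surface_measure (\<lambda>y. indicator ?H y * (indicator K y * f y))"
      using KB M by (intro bound_int[of _ M]) (auto simp: indicator_def B_def)
    \<comment> \<open>\<open>L / real (Suc k)\<close> bounds the change of \<open>f\<close> from a
      point of the layer to its projection; near the other planes the cutoff gives no control, and
      only the bound \<open>M\<close> of \<open>f\<close> is left.\<close>
    define E where "E k y = L / real (Suc k) * indicator B y + M * indicator (A k) y" for k y
    have [measurable]: "E k \<in> borel_measurable borel" for k unfolding E_def[abs_def] by measurable
    have int_E: "integrable surface_measure (\<lambda>y. indicator ?H y * E k y)" for k
    proof (rule bound_int[of _ "L / real (Suc k) + M"])
      fix y
      have "0 \<le> E k y" "E k y \<le> (L / real (Suc k) + M) * indicator B y"
        using L(2) M(2) by (auto simp: E_def A_def indicator_def)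
      then show "\<bar>E k y\<bar> \<le> (L / real (Suc k) + M) * indicator B y" by linarith
    qed measurable
    have pt: "\<bar>f x * P (I - {i}) (Suc k) x - indicator K (?p x) * f (?p x)\<bar> \<le> E k (?p x)"
      if x: "x \<in> S i (Suc k)" for x k
    proof -
      let ?k = "real (Suc k)"
      define p where "p = ?p x"
      have lx: "- (1 / ?k) \<le> l i x" "l i x < 0" using x by (auto simp: S_def)
      have xp: "norm (x - p) \<le> 1 / ?k"
        using lx n[OF i] by (simp add: p_def hproj_def l_def)
      have li: "l i p = 0" unfolding p_def l_def by (simp add: hproj_hyperplane[OF n[OF i]])
      have lj: "\<bar>l j x - l j p\<bar> \<le> 1 / ?k" if "j \<in> I" for j
      proof -
        have "l j x - l j p = n j \<bullet> (x - p)" by (simp add: l_def inner_diff_right)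
        then show ?thesis using Cauchy_Schwarz_ineq2[of "n j" "x - p"] n[OF that] xp by simp
      qed
      have k1: "0 < 1 / ?k" "1 / ?k \<le> 1" "2 / ?k = 1 / ?k + 1 / ?k" by auto
      have Pz: "P (I - {i}) (Suc k) x = 0 \<longleftrightarrow> (\<exists>j\<in>I - {i}. 0 \<le> l j x)"
        unfolding P_def using fin by (simp add: ramp_eq_0_iff)
      have "\<bar>f x * P (I - {i}) (Suc k) x - indicator K p * f p\<bar> \<le> E k p"
      proof (cases "\<exists>j\<in>I - {i}. 0 \<le> l j x")
        case True
        then obtain j where j: "j \<in> I" "j \<noteq> i" "0 \<le> l j x" by blast
        show ?thesis
        proof (cases "p \<in> K")
          case pK: True
          then have "l j p \<le> 0" using j unfolding K l_def by auto
          then have "\<bar>l j p\<bar> \<le> 2 / ?k" using lj[OF j(1)] j(3) k1 by linarith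
          then have "p \<in> A k" using pK KB j by (auto simp: A_def)
          then have "E k p \<ge> M" using L(2) by (simp add: E_def)
          moreover have "\<bar>f p\<bar> \<le> M" using M(1)[of p] pK KB by (auto simp: B_def)
          ultimately show ?thesis using True Pz pK by simp
        next
          case False
          then show ?thesis using True Pz L(2) M(2) by (simp add: E_def)
        qed
      next
        case False
        then have neg: "l j x < 0" if "j \<in> I" for j
          using that lx False by (cases "j = i") (simp, force simp: not_le)
        have xK: "x \<in> K" unfolding K using neg by (force simp: l_def)
        have "norm p \<le> norm x + norm (x - p)"
          by (metis norm_minus_commute norm_triangle_sub)
        then have "norm p \<le> R + 1" using R(2)[OF xK] xp k1 by linarith
        then have pB: "p \<in> B" by (simp add: B_def)
        have xB: "x \<in> B" using xK KB by auto
        have "\<bar>f x * P (I - {i}) (Suc k) x - indicator K p * f p\<bar> =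
          \<bar>(f x - f p) * P (I - {i}) (Suc k) x + f p * (P (I - {i}) (Suc k) x - indicator K p)\<bar>"
          by (simp add: algebra_simps)
        also have "\<dots> \<le> \<bar>f x - f p\<bar> * \<bar>P (I - {i}) (Suc k) x\<bar> + \<bar>f p\<bar> * \<bar>P (I - {i}) (Suc k) x - indicator K p\<bar>"
          unfolding abs_mult[symmetric] by (rule abs_triangle_ineq)
        also have "\<dots> \<le> (L * (1 / ?k)) * 1 + M * indicator (A k) p"
        proof (intro add_mono mult_mono)
          show "\<bar>f x - f p\<bar> \<le> L * (1 / ?k)"
            using L(1)[of x p] xB pB mult_left_mono[OF xp L(2)] by (auto simp: B_def)
          show "\<bar>f p\<bar> \<le> M" using M(1) pB by (simp add: B_def)
          show "\<bar>P (I - {i}) (Suc k) x - indicator K p\<bar> \<le> indicator (A k) p"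
          proof (cases "p \<in> A k")
            case True
            then show ?thesis using P01[of "I - {i}" "Suc k" x] by (auto simp: indicator_def)
          next
            case False
            have far: "l j p < - (2 / ?k)" if "j \<in> I" "j \<noteq> i" for j
            proof -
              have "\<bar>l j p\<bar> > 2 / ?k" using False that pB by (auto simp: A_def not_le simp del: of_nat_Suc)
              moreover have "l j p < 1 / ?k" using lj[OF that(1)] neg[OF that(1)] by linarith
              ultimately show ?thesis using k1 by linarith
            qed
            have "ramp (Suc k) (l j x) = 1" if "j \<in> I - {i}" for j
              using far[of j] lj[of j] that k1 by (intro ramp_eq_1) auto
            then have "P (I - {i}) (Suc k) x = 1" unfolding P_def by simp
            moreover have "l j p \<le> 0" if "j \<in> I" for j
              using far[OF that] li k1 by (cases "j = i") (simp, linarith)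
            then have "p \<in> K" unfolding K by (auto simp: l_def)
            ultimately show ?thesis by simp
          qed
        qed (use P01 L(2) M(2) in auto)
        also have "\<dots> = E k p" using pB by (simp add: E_def)
        finally show ?thesis .
      qed
      then show ?thesis unfolding p_def .
    qed
    have err: "\<bar>real (Suc k) * (\<integral>x. indicator (S i (Suc k)) x * (f x * P (I - {i}) (Suc k) x) \<partial>lborel)
       - (\<integral>y. indicator ?H y * (indicator K y * f y) \<partial>surface_measure)\<bar> \<le>
       (\<integral>y. indicator ?H y * E k y \<partial>surface_measure)" for k
    proof -
      have [measurable]: "(\<lambda>x. indicator (S i (Suc k)) x * (f x * P (I - {i}) (Suc k) x)) \<in> borel_measurable borel" by measurable
      have i2: "integrable lborel (\<lambda>x. indicator (S i (Suc k)) x * (indicator K (?p x) * f (?p x)))"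
        using int_f by (intro slab(1)[of "\<lambda>y. indicator K y * f y" "Suc k"]) auto
      have i3: "integrable lborel (\<lambda>x. indicator (S i (Suc k)) x * E k (?p x))"
        by (intro slab(1)) (use int_E in auto)
      have b: "\<bar>indicator (S i (Suc k)) x * (f x * P (I - {i}) (Suc k) x) - indicator (S i (Suc k)) x * (indicator K (?p x) * f (?p x))\<bar>
         \<le> indicator (S i (Suc k)) x * E k (?p x)" for x
        using pt[of x k] by (auto simp: indicator_def)
      have i4: "integrable lborel (\<lambda>x. indicator (S i (Suc k)) x * (f x * P (I - {i}) (Suc k) x) - indicator (S i (Suc k)) x * (indicator K (?p x) * f (?p x)))"
        using b by (intro Bochner_Integration.integrable_bound[OF i3]) (auto intro!: AE_I2 order_trans[OF b] )
      have i1: "integrable lborel (\<lambda>x. indicator (S i (Suc k)) x * (f x * P (I - {i}) (Suc k) x))"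
        using Bochner_Integration.integrable_add[OF i4 i2] by simp
      have "real (Suc k) * (\<integral>x. indicator (S i (Suc k)) x * (f x * P (I - {i}) (Suc k) x) \<partial>lborel)
       - (\<integral>y. indicator ?H y * (indicator K y * f y) \<partial>surface_measure) =
        real (Suc k) * (\<integral>x. indicator (S i (Suc k)) x * (f x * P (I - {i}) (Suc k) x) - indicator (S i (Suc k)) x * (indicator K (?p x) * f (?p x)) \<partial>lborel)"
        using i1 i2 int_f by (subst slab(2)[of "\<lambda>y. indicator K y * f y" "Suc k"])
          (auto simp: right_diff_distrib simp del: of_nat_Suc)
      also have "\<bar>\<dots>\<bar> \<le> real (Suc k) * (\<integral>x. indicator (S i (Suc k)) x * E k (?p x) \<partial>lborel)"
        unfolding abs_mult using b i3 i4 
        by (intro mult_mono order_trans[OF integral_abs_bound] integral_mono) (auto simp del: of_nat_Suc)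
      also have "\<dots> = (\<integral>y. indicator ?H y * E k y \<partial>surface_measure)"
        using int_E by (subst slab(2)[of "E k" "Suc k"]) (auto simp del: of_nat_Suc)
      finally show ?thesis .
    qed
    have "(\<lambda>k. \<integral>y. indicator ?H y * E k y \<partial>surface_measure) \<longlonglongrightarrow> integral\<^sup>L (surface_measure :: 'a measure) (\<lambda>y. 0)"
    proof (rule integral_dominated_convergence[where w="\<lambda>y. (L + M) * indicator (B \<inter> ?H) y"])
      show "integrable surface_measure (\<lambda>y. (L + M) * indicator (B \<inter> ?H) y)"
        using int_BH by simp
      \<comment> \<open>Off the null intersections each point of the plane leaves the shrinking sets
        \<open>A k\<close> eventually, which is what dominated convergence needs.\<close>
      have "AE y in surface_measure. \<forall>j\<in>I - {i}. \<not> (y \<in> ?H \<and> l j y = 0)"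
      proof (intro AE_finite_allI)
        fix j assume j: "j \<in> I - {i}"
        have "?H \<inter> {y. n j \<bullet> y = c j} \<in> null_sets surface_measure"
          using j by (intro null_sets_surface_Int H hyperplanesI n distinct i) auto
        then show "AE y in surface_measure. \<not> (y \<in> ?H \<and> l j y = 0)"
          by (rule AE_I') (auto simp: l_def)
      qed (use fin in auto)
      then show "AE y in surface_measure. (\<lambda>k. indicator ?H y * E k y) \<longlonglongrightarrow> 0"
      proof eventually_elim
        case (elim y)
        show ?case
        proof (cases "y \<in> ?H")
          case True
          have "\<forall>\<^sub>F k in sequentially. \<forall>j\<in>I - {i}. 2 / real (Suc k) < \<bar>l j y\<bar>"
          proof (intro eventually_ball_finite ballI)
            fix j assume "j \<in> I - {i}"
            then have "\<bar>l j y\<bar> > 0" using elim True by auto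
            moreover have "(\<lambda>k. 2 * inverse (real (Suc k))) \<longlonglongrightarrow> 2 * 0"
              by (intro tendsto_intros LIMSEQ_inverse_real_of_nat)
            ultimately show "\<forall>\<^sub>F k in sequentially. 2 / real (Suc k) < \<bar>l j y\<bar>"
              by (intro order_tendstoD(2)[of _ 0]) (auto simp: divide_inverse)
          qed (use fin in auto)
          then have "\<forall>\<^sub>F k in sequentially. L * indicator B y * inverse (real (Suc k)) = indicator ?H y * E k y"
          proof eventually_elim
            case (elim k)
            then have "y \<notin> A k" unfolding A_def using linorder_not_le by blast
            then show ?case using True by (simp add: E_def divide_inverse)
          qed
          moreover have "(\<lambda>k. L * indicator B y * inverse (real (Suc k))) \<longlonglongrightarrow> L * indicator B y * 0"
            by (intro tendsto_intros LIMSEQ_inverse_real_of_nat)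
          ultimately show ?thesis using Lim_transform_eventually by fastforce
        qed simp
      qed
      show "AE y in surface_measure. norm (indicator ?H y * E k y) \<le> (L + M) * indicator (B \<inter> ?H) y" for k
      proof (intro AE_I2)
        fix y
        have "L / real (Suc k) \<le> L" using L(2) by (simp add: divide_le_eq algebra_simps)
        then show "norm (indicator ?H y * E k y) \<le> (L + M) * indicator (B \<inter> ?H) y"
          using L(2) M(2) by (auto simp: E_def A_def indicator_def)
      qed
    qed measurable
    then have "(\<lambda>k. \<integral>y. indicator ?H y * E k y \<partial>surface_measure) \<longlonglongrightarrow> 0" by simp
    then show ?thesis
      by (rule Lim_null_comparison[rotated, THEN LIM_zero_cancel]) (use err in \<open>auto intro!: always_eventually\<close>)
  qed
  have "(\<lambda>k. \<integral>x. deriv_along b f x * P I (Suc k) x \<partial>lborel) \<longlonglongrightarrow>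
     (\<Sum>i\<in>I. (n i \<bullet> b) * (\<integral>y. indicator {y. n i \<bullet> y = c i} y * (indicator K y * f y) \<partial>surface_measure))"
    unfolding cutoff[OF zero_less_Suc] by (intro tendsto_intros lim_rhs)
  with lim_lhs show ?thesis by (rule LIMSEQ_unique)
qed

section \<open>Square integrable functions\<close>

text \<open>The weight \<open>t = sqrt b / sqrt a\<close> is optimal. If \<open>a\<close> or
  \<open>b\<close> is 0, letting \<open>t\<close> become large or small forces \<open>c\<close> to
  be at most 0.\<close>

lemma le_sqrt_mult_sqrt_if_le_weighted:
  fixes a b c :: real
  assumes "0 \<le> a" "0 \<le> b" and le: "\<And>t. 0 < t \<Longrightarrow> 2 * c \<le> t * a + b / t"
  shows "c \<le> sqrt a * sqrt b"
proof (cases "a = 0 \<or> b = 0")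
  case True
  have eps: "2 * c \<le> e" if "e > 0" for e
  proof (cases "a = 0")
    case a: True
    show ?thesis
    proof (cases "b = 0")
      case True
      then show ?thesis using le[of 1] a \<open>e > 0\<close> by simp
    next
      case False
      then show ?thesis using le[of "b / e"] a \<open>e > 0\<close> assms(2) by simp
    qed
  next
    case False
    then have "b = 0" "a > 0" using True assms(1) by auto
    then show ?thesis using le[of "e / a"] \<open>e > 0\<close> by simp
  qed
  have "2 * c \<le> 0" using eps[of c] by (cases "c > 0") auto
  then show ?thesis using assms(1,2) True by auto
next
  case False
  define t where "t = sqrt b / sqrt a"
  have pos: "sqrt a > 0" "sqrt b > 0" using assms False by auto
  have a: "a = sqrt a * sqrt a" and b: "b = sqrt b * sqrt b" using assms by simp_all
  have "t * a = sqrt a * sqrt b" unfolding t_def using pos by (subst (2) a) (simp add: field_simps)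
  moreover have "b / t = sqrt a * sqrt b" unfolding t_def using pos by (subst b) (simp add: field_simps)
  ultimately show ?thesis using le[of t] pos by (simp add: t_def)
qed

text \<open>The counterpart of \<open>L2\<close> for vector-valued functions, needed for gradients
  and their jumps.\<close>

definition square_integrable :: "'a measure \<Rightarrow> ('a \<Rightarrow> 'b::euclidean_space) \<Rightarrow> bool" where
  "square_integrable M f \<longleftrightarrow> f \<in> borel_measurable M \<and> integrable M (\<lambda>x. (norm (f x))\<^sup>2)"

lemma L2_iff_square_integrable: "f \<in> L2 M \<longleftrightarrow> square_integrable M f"
  by (simp add: L2_def square_integrable_def)

lemma square_integrable_measurable [measurable_dest]:
  "square_integrable M f \<Longrightarrow> f \<in> borel_measurable M"
  by (simp add: square_integrable_def)

lemma L2_norm_sq_nonneg [simp]: "0 \<le> L2_norm_sq M f"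
  by (simp add: L2_norm_sq_def)

lemma integrable_inner_if_square_integrable:
  assumes "square_integrable M f" "square_integrable M g"
  shows "integrable M (\<lambda>x. f x \<bullet> g x)"
proof (rule Bochner_Integration.integrable_bound)
  show "integrable M (\<lambda>x. (norm (f x))\<^sup>2 + (norm (g x))\<^sup>2)"
    using assms by (auto simp: square_integrable_def)
  show "(\<lambda>x. f x \<bullet> g x) \<in> borel_measurable M"
    using assms by (intro borel_measurable_inner) (auto simp: square_integrable_def)
  show "AE x in M. norm (f x \<bullet> g x) \<le> norm ((norm (f x))\<^sup>2 + (norm (g x))\<^sup>2)"
  proof (intro AE_I2)
    fix x
    have "\<bar>f x \<bullet> g x\<bar> \<le> norm (f x) * norm (g x)" by (rule Cauchy_Schwarz_ineq2)
    also have "\<dots> \<le> (norm (f x))\<^sup>2 + (norm (g x))\<^sup>2"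
      using sum_squares_bound[of "norm (f x)" "norm (g x)"]
        mult_nonneg_nonneg[OF norm_ge_zero norm_ge_zero, of "f x" "g x"] by linarith
    finally show "norm (f x \<bullet> g x) \<le> norm ((norm (f x))\<^sup>2 + (norm (g x))\<^sup>2)" by simp
  qed
qed

lemma L2_mult_integrable: "f \<in> L2 M \<Longrightarrow> g \<in> L2 M \<Longrightarrow> integrable M (\<lambda>x. f x * g x)"
  using integrable_inner_if_square_integrable[of M f g] by (simp add: L2_iff_square_integrable)

text \<open>Integrating the pointwise inequality of Young with weight \<open>t\<close> and
  optimising over \<open>t\<close> afterwards gives Cauchy-Schwarz.\<close>

lemma integral_inner_le:
  assumes f: "square_integrable M f" and g: "square_integrable M g"
  shows "\<bar>\<integral>x. f x \<bullet> g x \<partial>M\<bar> \<le> sqrt (L2_norm_sq M f) * sqrt (L2_norm_sq M g)"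
proof (rule le_sqrt_mult_sqrt_if_le_weighted)
  fix t :: real assume t: "t > 0"
  have "2 * \<bar>\<integral>x. f x \<bullet> g x \<partial>M\<bar> \<le> (\<integral>x. 2 * \<bar>f x \<bullet> g x\<bar> \<partial>M)"
    using integral_abs_bound[of M "\<lambda>x. f x \<bullet> g x"] by simp
  also have "\<dots> \<le> (\<integral>x. t * (norm (f x))\<^sup>2 + (norm (g x))\<^sup>2 / t \<partial>M)"
  proof (rule integral_mono)
    fix x
    have "0 \<le> (t * norm (f x) - norm (g x))\<^sup>2 / t" using t by simp
    also have "\<dots> = t * (norm (f x))\<^sup>2 + (norm (g x))\<^sup>2 / t - 2 * (norm (f x) * norm (g x))"
      using t by (simp add: power2_diff field_simps power2_eq_square)
    finally show "2 * \<bar>f x \<bullet> g x\<bar> \<le> t * (norm (f x))\<^sup>2 + (norm (g x))\<^sup>2 / t"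
      using Cauchy_Schwarz_ineq2[of "f x" "g x"] by linarith
  qed (use assms in \<open>auto simp: square_integrable_def intro!: integrable_inner_if_square_integrable[OF f g] integrable_abs\<close>)
  also have "\<dots> = t * L2_norm_sq M f + L2_norm_sq M g / t"
    using assms by (simp add: square_integrable_def L2_norm_sq_def)
  finally show "2 * \<bar>\<integral>x. f x \<bullet> g x \<partial>M\<bar> \<le> t * L2_norm_sq M f + L2_norm_sq M g / t" .
qed auto

lemma integral_mult_le:
  assumes "f \<in> L2 M" "g \<in> L2 M"
  shows "\<bar>\<integral>x. f x * g x \<partial>M\<bar> \<le> sqrt (L2_norm_sq M f) * sqrt (L2_norm_sq M g)"
  using integral_inner_le[of M f g] assms by (simp add: L2_iff_square_integrable)

lemma power2_norm_add_le:
  fixes a b :: "'a::real_normed_vector"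
  shows "(norm (a + b))\<^sup>2 \<le> 2 * (norm a)\<^sup>2 + 2 * (norm b)\<^sup>2"
proof -
  have "(norm (a + b))\<^sup>2 \<le> (norm a + norm b)\<^sup>2" by (intro power_mono norm_triangle_ineq) auto
  also have "\<dots> \<le> 2 * (norm a)\<^sup>2 + 2 * (norm b)\<^sup>2"
    using sum_squares_bound[of "norm a" "norm b"] by (simp add: power2_sum)
  finally show ?thesis .
qed

lemma square_integrable_add:
  assumes "square_integrable M f" "square_integrable M g"
  shows "square_integrable M (\<lambda>x. f x + g x)"
    and "L2_norm_sq M (\<lambda>x. f x + g x) \<le> 2 * L2_norm_sq M f + 2 * L2_norm_sq M g"
proof -
  have int: "integrable M (\<lambda>x. 2 * (norm (f x))\<^sup>2 + 2 * (norm (g x))\<^sup>2)"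
    using assms by (auto simp: square_integrable_def)
  have int2: "integrable M (\<lambda>x. (norm (f x + g x))\<^sup>2)"
    using assms by (intro Bochner_Integration.integrable_bound[OF int])
      (auto intro!: AE_I2 power2_norm_add_le order_trans[OF power2_norm_add_le abs_ge_self])
  then show "square_integrable M (\<lambda>x. f x + g x)" using assms by (auto simp: square_integrable_def)
  have "L2_norm_sq M (\<lambda>x. f x + g x) \<le> (\<integral>x. 2 * (norm (f x))\<^sup>2 + 2 * (norm (g x))\<^sup>2 \<partial>M)"
    unfolding L2_norm_sq_def by (intro integral_mono int int2 power2_norm_add_le)
  also have "\<dots> = 2 * L2_norm_sq M f + 2 * L2_norm_sq M g"
    using assms by (simp add: square_integrable_def L2_norm_sq_def)
  finally show "L2_norm_sq M (\<lambda>x. f x + g x) \<le> 2 * L2_norm_sq M f + 2 * L2_norm_sq M g" .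
qed

lemma square_integrable_scaleR:
  "square_integrable M f \<Longrightarrow> square_integrable M (\<lambda>x. c *\<^sub>R f x)"
  by (auto simp: square_integrable_def power_mult_distrib)

lemma L2_norm_sq_scaleR: "L2_norm_sq M (\<lambda>x. c *\<^sub>R f x) = c\<^sup>2 * L2_norm_sq M f"
  by (simp add: L2_norm_sq_def power_mult_distrib)

lemma square_integrable_diff:
  assumes "square_integrable M f" "square_integrable M g"
  shows "square_integrable M (\<lambda>x. f x - g x)"
    and "L2_norm_sq M (\<lambda>x. f x - g x) \<le> 2 * L2_norm_sq M f + 2 * L2_norm_sq M g"
  using square_integrable_add[OF assms(1) square_integrable_scaleR[OF assms(2), of "-1"]]
  by (simp_all add: L2_norm_sq_scaleR[of M "-1", simplified])

lemma L2_add: "f \<in> L2 M \<Longrightarrow> g \<in> L2 M \<Longrightarrow> (\<lambda>x. f x + g x) \<in> L2 M"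
  using square_integrable_add(1) by (simp add: L2_iff_square_integrable)

lemma L2_diff: "f \<in> L2 M \<Longrightarrow> g \<in> L2 M \<Longrightarrow> (\<lambda>x. f x - g x) \<in> L2 M"
  using square_integrable_diff(1) by (simp add: L2_iff_square_integrable)

lemma L2_cmult: "f \<in> L2 M \<Longrightarrow> (\<lambda>x. c * f x) \<in> L2 M"
  using square_integrable_scaleR[of M f c] by (simp add: L2_iff_square_integrable)

lemma L2_norm_sq_diff_commute: "L2_norm_sq M (\<lambda>x. f x - g x) = L2_norm_sq M (\<lambda>x. g x - f x)"
  by (simp add: L2_norm_sq_def norm_minus_commute)

lemma L2_norm_sq_triangle:
  assumes "f \<in> L2 M" "g \<in> L2 M" "k \<in> L2 M"
  shows "L2_norm_sq M (\<lambda>x. f x - k x) \<le> 2 * L2_norm_sq M (\<lambda>x. f x - g x) + 2 * L2_norm_sq M (\<lambda>x. g x - k x)"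
  using square_integrable_add(2)[of M "\<lambda>x. f x - g x" "\<lambda>x. g x - k x"] assms L2_diff[of _ M]
  by (simp add: L2_iff_square_integrable)

lemma L2_measurable: "f \<in> L2 M \<Longrightarrow> f \<in> borel_measurable M"
  by (simp add: L2_def)

lemma L2_cong_AE:
  assumes "f \<in> L2 M" "g \<in> borel_measurable M" "AE x in M. f x = g x"
  shows "g \<in> L2 M"
proof -
  have "AE x in M. (f x)\<^sup>2 = (g x)\<^sup>2" using assms(3) by eventually_elim simp
  then show ?thesis
    using assms integrable_cong_AE[of "\<lambda>x. (f x)\<^sup>2" M "\<lambda>x. (g x)\<^sup>2"] by (auto simp: L2_def)
qed

lemma L2_norm_sq_cong_AE:
  fixes f g :: "'a \<Rightarrow> 'b::euclidean_space"
  assumes "f \<in> borel_measurable M" "g \<in> borel_measurable M" "AE x in M. f x = g x"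
  shows "L2_norm_sq M f = L2_norm_sq M g"
  unfolding L2_norm_sq_def using assms by (intro integral_cong_AE) auto

lemma L2_norm_sq_eq_0_iff:
  assumes "f \<in> L2 M" shows "L2_norm_sq M f = 0 \<longleftrightarrow> (AE x in M. f x = 0)"
  using assms integral_nonneg_eq_0_iff_AE[of M "\<lambda>x. (f x)\<^sup>2"] by (simp add: L2_norm_sq_def L2_def)

lemma L2_bounded:
  assumes "finite_measure M" "f \<in> borel_measurable M" "\<And>x. x \<in> space M \<Longrightarrow> \<bar>f x\<bar> \<le> B"
  shows "f \<in> L2 M"
proof -
  interpret finite_measure M by fact
  have "integrable M (\<lambda>x. (f x)\<^sup>2)"
  proof (rule integrable_const_bound[of _ "B\<^sup>2"])
    show "AE x in M. norm ((f x)\<^sup>2) \<le> B\<^sup>2"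
      using power_mono[OF assms(3), of _ 2] by (auto intro!: AE_I2)
  qed (use assms in auto)
  then show ?thesis using assms by (simp add: L2_def)
qed

lemma L2_mult_bounded:
  assumes "f \<in> L2 M" "g \<in> borel_measurable M" "\<And>x. x \<in> space M \<Longrightarrow> \<bar>g x\<bar> \<le> B"
  shows "(\<lambda>x. f x * g x) \<in> L2 M"
proof -
  have "integrable M (\<lambda>x. (f x * g x)\<^sup>2)"
  proof (rule Bochner_Integration.integrable_bound)
    show "integrable M (\<lambda>x. B\<^sup>2 * (f x)\<^sup>2)" using assms by (simp add: L2_def)
    show "AE x in M. norm ((f x * g x)\<^sup>2) \<le> norm (B\<^sup>2 * (f x)\<^sup>2)"
    proof (intro AE_I2)
      fix x assume "x \<in> space M"
      then have "(g x)\<^sup>2 \<le> B\<^sup>2" using power_mono[OF assms(3), of x 2] by simp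
      then show "norm ((f x * g x)\<^sup>2) \<le> norm (B\<^sup>2 * (f x)\<^sup>2)"
        using mult_right_mono[of "(g x)\<^sup>2" "B\<^sup>2" "(f x)\<^sup>2"] by (simp add: power_mult_distrib mult.commute)
    qed
  qed (use assms L2_measurable[OF assms(1)] in auto)
  then show ?thesis using assms L2_measurable[OF assms(1)] by (simp add: L2_def)
qed

lemma L2_integrable: "finite_measure M \<Longrightarrow> f \<in> L2 M \<Longrightarrow> integrable M f"
  unfolding L2_def by (blast intro: finite_measure.square_integrable_imp_integrable)

lemma tendsto_integral_mult_L2:
  assumes "\<And>n. f n \<in> L2 M" "g \<in> L2 M" "k \<in> L2 M"
    and lim: "(\<lambda>n. L2_norm_sq M (\<lambda>x. f n x - g x)) \<longlonglongrightarrow> 0"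
  shows "(\<lambda>n. \<integral>x. f n x * k x \<partial>M) \<longlonglongrightarrow> (\<integral>x. g x * k x \<partial>M)"
proof (rule LIM_zero_cancel, rule Lim_null_comparison)
  have "norm ((\<integral>x. f n x * k x \<partial>M) - (\<integral>x. g x * k x \<partial>M)) \<le> sqrt (L2_norm_sq M (\<lambda>x. f n x - g x)) * sqrt (L2_norm_sq M k)" for n
  proof -
    have "(\<integral>x. f n x * k x \<partial>M) - (\<integral>x. g x * k x \<partial>M) = (\<integral>x. (f n x - g x) * k x \<partial>M)"
      unfolding left_diff_distrib
      by (rule Bochner_Integration.integral_diff[OF L2_mult_integrable[OF assms(1)[of n] assms(3)] L2_mult_integrable[OF assms(2,3)], symmetric])
    then show ?thesis
      using integral_mult_le[OF L2_diff[OF assms(1)[of n] assms(2)] assms(3)] by simp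
  qed
  then show "\<forall>\<^sub>F n in sequentially. norm ((\<integral>x. f n x * k x \<partial>M) - (\<integral>x. g x * k x \<partial>M)) \<le> sqrt (L2_norm_sq M (\<lambda>x. f n x - g x)) * sqrt (L2_norm_sq M k)"
    by (rule always_eventually[OF allI])
  show "(\<lambda>n. sqrt (L2_norm_sq M (\<lambda>x. f n x - g x)) * sqrt (L2_norm_sq M k)) \<longlonglongrightarrow> 0"
    using tendsto_mult[OF tendsto_real_sqrt[OF lim] tendsto_const[of "sqrt (L2_norm_sq M k)"]] by simp
qed

text \<open>Riesz-Fischer: along a fast subsequence the increments are summable almost everywhere,
  so a pointwise limit exists. Fatou carries the Cauchy estimate of the whole sequence over to that
  limit.\<close>

lemma L2_complete:
  fixes f :: "nat \<Rightarrow> 'a \<Rightarrow> real"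
  assumes "finite_measure M" and f: "\<And>n. f n \<in> L2 M"
    and cauchy: "\<And>e. e > 0 \<Longrightarrow> \<exists>N. \<forall>m\<ge>N. \<forall>n\<ge>N. L2_norm_sq M (\<lambda>x. f m x - f n x) < e"
  obtains g where "g \<in> L2 M" "(\<lambda>n. L2_norm_sq M (\<lambda>x. f n x - g x)) \<longlonglongrightarrow> 0"
proof -
  interpret finite_measure M by fact
  have [measurable]: "f n \<in> borel_measurable M" for n using f L2_measurable by blast
  have "\<exists>N. \<forall>m\<ge>N. \<forall>n\<ge>N. L2_norm_sq M (\<lambda>x. f m x - f n x) < (1/4) ^ k" for k :: nat
    by (rule cauchy) simp
  then obtain N where N: "\<And>k m n. m \<ge> N k \<Longrightarrow> n \<ge> N k \<Longrightarrow> L2_norm_sq M (\<lambda>x. f m x - f n x) < (1/4) ^ k"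
    by metis
  \<comment> \<open>Partial sums of the thresholds are monotone and dominate \<open>N k\<close>, so
    \<open>r k\<close> and \<open>r (Suc k)\<close> are both beyond the threshold
    \<open>N k\<close>.\<close>
  define r where "r k = (\<Sum>j\<le>k. N j)" for k
  have r: "N k \<le> r k" "r k \<le> r (Suc k)" for k
    unfolding r_def by (auto intro: member_le_sum)
  define d where "d k x = \<bar>f (r (Suc k)) x - f (r k) x\<bar>" for k x
  have [measurable]: "d k \<in> borel_measurable M" for k unfolding d_def[abs_def] by measurable
  have dint: "integrable M (\<lambda>x. (d k x)\<^sup>2)" and dle: "(\<integral>x. (d k x)\<^sup>2 \<partial>M) \<le> (1/4) ^ k" for k
    using L2_diff[OF f f, of "r (Suc k)" "r k"] N[of k "r (Suc k)" "r k"] r[of k]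
    by (auto simp: d_def L2_def L2_norm_sq_def)
  \<comment> \<open>On a finite measure space the squared bounds \<open>(1/4) ^ k\<close> become
    summable bounds for the integrals: pointwise \<open>d\<close> is at most
    \<open>2 ^ k * d^2 + (1/2) ^ k\<close>.\<close>
  have nn: "(\<integral>\<^sup>+x. ennreal (d k x) \<partial>M) \<le> ennreal ((1 + measure M (space M)) * (1/2) ^ k)" for k
  proof -
    have int: "integrable M (\<lambda>x. 2 ^ k * (d k x)\<^sup>2 + (1/2) ^ k)" using dint by auto
    have "(\<integral>\<^sup>+x. ennreal (d k x) \<partial>M) \<le> (\<integral>\<^sup>+x. ennreal (2 ^ k * (d k x)\<^sup>2 + (1/2) ^ k) \<partial>M)"
    proof (intro nn_integral_mono ennreal_leI)
      fix x
      have d0: "d k x \<ge> 0" by (simp add: d_def)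
      show "d k x \<le> 2 ^ k * (d k x)\<^sup>2 + (1/2) ^ k"
      proof (cases "d k x \<le> (1/2) ^ k")
        case False
        then have "1 \<le> 2 ^ k * d k x" by (simp add: power_divide field_simps)
        then have "1 * d k x \<le> (2 ^ k * d k x) * d k x" using d0 by (intro mult_right_mono) auto
        then show ?thesis by (simp add: power2_eq_square add_increasing2)
      qed (simp add: add_increasing)
    qed
    also have "\<dots> = ennreal (\<integral>x. 2 ^ k * (d k x)\<^sup>2 + (1/2) ^ k \<partial>M)"
      by (intro nn_integral_eq_integral int) auto
    also have "(\<integral>x. 2 ^ k * (d k x)\<^sup>2 + (1/2) ^ k \<partial>M) = 2 ^ k * (\<integral>x. (d k x)\<^sup>2 \<partial>M) + (1/2) ^ k * measure M (space M)"
      using dint by simp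
    also have "\<dots> \<le> 2 ^ k * (1/4) ^ k + (1/2) ^ k * measure M (space M)"
      using dle by (intro add_right_mono mult_left_mono) auto
    also have "(2::real) ^ k * (1/4) ^ k = (1/2) ^ k" by (simp add: power_mult_distrib[symmetric])
    finally show ?thesis by (simp add: algebra_simps ennreal_leI)
  qed
  have "(\<integral>\<^sup>+x. (\<Sum>k. ennreal (d k x)) \<partial>M) = (\<Sum>k. \<integral>\<^sup>+x. ennreal (d k x) \<partial>M)"
    by (rule nn_integral_suminf) simp
  also have "\<dots> \<le> (\<Sum>k. ennreal ((1 + measure M (space M)) * (1/2) ^ k))"
    by (intro suminf_le nn) auto
  also have "\<dots> = ennreal (\<Sum>k. (1 + measure M (space M)) * (1/2) ^ k)"
    by (intro suminf_ennreal2 summable_mult summable_geometric) auto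
  also have "\<dots> < \<infinity>" by simp
  finally have "AE x in M. (\<Sum>k. ennreal (d k x)) \<noteq> \<infinity>"
    by (intro nn_integral_PInf_AE) auto
  then have ae: "AE x in M. convergent (\<lambda>k. f (r k) x)"
  proof eventually_elim
    case (elim x)
    then have "summable (\<lambda>k. d k x)"
      by (intro summable_suminf_not_top) (auto simp: d_def)
    then have "summable (\<lambda>k. f (r (Suc k)) x - f (r k) x)"
      unfolding d_def by (rule summable_rabs_cancel)
    then have "convergent (\<lambda>n. \<Sum>k<n. f (r (Suc k)) x - f (r k) x)"
      by (simp add: summable_iff_convergent)
    then have "convergent (\<lambda>n. f (r n) x - f (r 0) x)"
      unfolding sum_lessThan_telescope[of "\<lambda>k. f (r k) x"] .
    then have "convergent (\<lambda>n. (f (r n) x - f (r 0) x) + f (r 0) x)"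
      by (intro convergent_add convergent_const)
    then show ?case by simp
  qed
  define g where "g x = lim (\<lambda>k. f (r k) x)" for x
  have [measurable]: "g \<in> borel_measurable M" unfolding g_def[abs_def] by measurable
  have bound: "(\<integral>\<^sup>+x. ennreal ((f n x - g x)\<^sup>2) \<partial>M) \<le> ennreal e"
    if e: "\<And>m. m \<ge> k0 \<Longrightarrow> L2_norm_sq M (\<lambda>x. f n x - f (r m) x) \<le> e" for n e k0
  proof -
    have "(\<integral>\<^sup>+x. ennreal ((f n x - g x)\<^sup>2) \<partial>M) = (\<integral>\<^sup>+x. liminf (\<lambda>m. ennreal ((f n x - f (r m) x)\<^sup>2)) \<partial>M)"
    proof (intro nn_integral_cong_AE)
      show "AE x in M. ennreal ((f n x - g x)\<^sup>2) = liminf (\<lambda>m. ennreal ((f n x - f (r m) x)\<^sup>2))"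
        using ae
      proof eventually_elim
        case (elim x)
        then have "(\<lambda>k. f (r k) x) \<longlonglongrightarrow> g x" unfolding g_def by (simp add: convergent_LIMSEQ_iff)
        then have "(\<lambda>m. ennreal ((f n x - f (r m) x)\<^sup>2)) \<longlonglongrightarrow> ennreal ((f n x - g x)\<^sup>2)"
          by (intro tendsto_ennrealI tendsto_intros)
        from lim_imp_Liminf[OF trivial_limit_sequentially this] show ?case by (rule sym)
      qed
    qed
    also have "\<dots> \<le> liminf (\<lambda>m. \<integral>\<^sup>+x. ennreal ((f n x - f (r m) x)\<^sup>2) \<partial>M)"
      by (rule nn_integral_liminf) measurable
    also have "\<dots> \<le> ennreal e"
    proof (rule Liminf_le)
      show "\<forall>\<^sub>F m in sequentially. (\<integral>\<^sup>+x. ennreal ((f n x - f (r m) x)\<^sup>2) \<partial>M) \<le> ennreal e"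
      proof (rule eventually_sequentiallyI[of k0])
        fix m assume "m \<ge> k0"
        have "(\<integral>\<^sup>+x. ennreal ((f n x - f (r m) x)\<^sup>2) \<partial>M) = ennreal (\<integral>x. (f n x - f (r m) x)\<^sup>2 \<partial>M)"
          using L2_diff[OF f f, of n "r m"] by (intro nn_integral_eq_integral) (auto simp: L2_def)
        then show "(\<integral>\<^sup>+x. ennreal ((f n x - f (r m) x)\<^sup>2) \<partial>M) \<le> ennreal e"
          using e[OF \<open>m \<ge> k0\<close>] by (auto simp: L2_norm_sq_def intro: ennreal_leI)
      qed
    qed auto
    finally show ?thesis .
  qed
  have tail: "\<exists>k0. \<forall>n\<ge>k0. f n \<in> L2 M \<and> (\<integral>\<^sup>+x. ennreal ((f n x - g x)\<^sup>2) \<partial>M) \<le> ennreal ((1/4) ^ j)" for j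
  proof (intro exI[of _ "N j"] allI impI conjI f)
    fix n assume n: "n \<ge> N j"
    have rj: "r m \<ge> N j" if "m \<ge> j" for m
      using that unfolding r_def by (intro member_le_sum) auto
    show "(\<integral>\<^sup>+x. ennreal ((f n x - g x)\<^sup>2) \<partial>M) \<le> ennreal ((1/4) ^ j)"
      using N[OF n rj] by (intro bound[of j]) (auto intro: less_imp_le)
  qed
  have int: "integrable M (\<lambda>x. (f n x - g x)\<^sup>2)" if "(\<integral>\<^sup>+x. ennreal ((f n x - g x)\<^sup>2) \<partial>M) \<le> ennreal ((1/4) ^ j)" for n j
    using that by (intro integrableI_bounded) (auto intro: le_less_trans)
  obtain k0 where "\<forall>n\<ge>k0. f n \<in> L2 M \<and> (\<integral>\<^sup>+x. ennreal ((f n x - g x)\<^sup>2) \<partial>M) \<le> ennreal ((1/4) ^ 0)"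
    using tail[of 0] by blast
  then have "(\<lambda>x. f k0 x - g x) \<in> L2 M" using int[of k0 0] by (simp add: L2_def)
  from L2_diff[OF f[of k0] this] have g: "g \<in> L2 M" by simp
  have "(\<lambda>n. L2_norm_sq M (\<lambda>x. f n x - g x)) \<longlonglongrightarrow> 0"
  proof (rule LIMSEQ_I)
    fix e :: real assume "e > 0"
    obtain j where j: "(1/4::real) ^ j < e" using \<open>e > 0\<close> real_arch_pow_inv[of e "1/4"] by auto
    obtain k0 where k0: "\<forall>n\<ge>k0. (\<integral>\<^sup>+x. ennreal ((f n x - g x)\<^sup>2) \<partial>M) \<le> ennreal ((1/4) ^ j)"
      using tail[of j] by blast
    have "norm (L2_norm_sq M (\<lambda>x. f n x - g x) - 0) < e" if "n \<ge> k0" for n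
    proof -
      have "ennreal (\<integral>x. (f n x - g x)\<^sup>2 \<partial>M) = (\<integral>\<^sup>+x. ennreal ((f n x - g x)\<^sup>2) \<partial>M)"
        using k0 that int by (intro nn_integral_eq_integral[symmetric]) auto
      also have "\<dots> \<le> ennreal ((1/4) ^ j)" using k0 that by blast
      finally have "(\<integral>x. (f n x - g x)\<^sup>2 \<partial>M) \<le> (1/4) ^ j" by (simp add: ennreal_le_iff)
      then show ?thesis using j by (simp add: L2_norm_sq_def)
    qed
    then show "\<exists>no. \<forall>n\<ge>no. norm (L2_norm_sq M (\<lambda>x. f n x - g x) - 0) < e" by blast
  qed
  with g that show ?thesis by blast
qed

lemma L2_restrict_space_mono:
  fixes f :: "'a \<Rightarrow> 'b::euclidean_space"
  assumes f: "square_integrable (restrict_space M A) f" and AB: "B \<subseteq> A" "A \<in> sets M" "B \<in> sets M"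
  shows "square_integrable (restrict_space M B) f"
    and "L2_norm_sq (restrict_space M B) f \<le> L2_norm_sq (restrict_space M A) f"
proof -
  have *: "A \<inter> space M \<in> sets M" "B \<inter> space M \<in> sets M" using AB by auto
  have m: "f \<in> borel_measurable (restrict_space M B)"
    using f AB measurable_restrict_space1 unfolding square_integrable_def
    by (metis measurable_restrict_mono)
  have iA: "integrable M (\<lambda>x. indicator A x *\<^sub>R (norm (f x))\<^sup>2)"
    using f integrable_restrict_space[OF *(1), of "\<lambda>x. (norm (f x))\<^sup>2"] by (simp add: square_integrable_def)
  have eq: "(\<lambda>x. indicator B x *\<^sub>R (indicator A x *\<^sub>R (norm (f x))\<^sup>2)) = (\<lambda>x. indicator B x *\<^sub>R (norm (f x))\<^sup>2)"
    using AB(1) by (intro ext) (auto simp: indicator_def)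
  have iB: "integrable M (\<lambda>x. indicator B x *\<^sub>R (norm (f x))\<^sup>2)"
    using integrable_mult_indicator[OF AB(3) iA] unfolding eq .
  then show "square_integrable (restrict_space M B) f"
    using m integrable_restrict_space[OF *(2), of "\<lambda>x. (norm (f x))\<^sup>2"] by (simp add: square_integrable_def)
  show "L2_norm_sq (restrict_space M B) f \<le> L2_norm_sq (restrict_space M A) f"
    unfolding L2_norm_sq_def integral_restrict_space[OF *(1)] integral_restrict_space[OF *(2)]
    using iA iB AB(1) by (intro integral_mono) (auto simp: indicator_def)
qed

section \<open>Facets of full-dimensional polytopes\<close>

text \<open>Nonempty interior means full dimension. It makes the outer normal of a facet unique,
  which the definite description in \<open>outer_normal\<close> relies on.\<close>

definition solid_polytope :: "'a::euclidean_space set \<Rightarrow> bool" where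
  "solid_polytope K \<longleftrightarrow> polytope K \<and> interior K \<noteq> {}"

definition facets :: "'a::euclidean_space set \<Rightarrow> 'a set set" where
  "facets K = {F. F facet_of K}"

text \<open>The right-hand side of the facet equation. Any point of the facet serves, since the
  normal component is constant there.\<close>

definition facet_offset :: "'a::euclidean_space set \<Rightarrow> 'a set \<Rightarrow> real" where
  "facet_offset K F = outer_normal K F \<bullet> (SOME y. y \<in> F)"

lemma finite_facets: "solid_polytope K \<Longrightarrow> finite (facets K)"
  unfolding solid_polytope_def facets_def by (auto intro: finite_polytope_facets)

text \<open>A dimension count: a facet of a full-dimensional polytope has the dimension of a
  hyperplane, so it spans any hyperplane containing it.\<close>

lemma affine_hull_facet:
  fixes K :: "'a::euclidean_space set"
  assumes K: "solid_polytope K" and F: "F \<in> facets K" and sub: "F \<subseteq> {y. n \<bullet> y = c}" and n: "n \<noteq> 0"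
  shows "affine hull F = {y. n \<bullet> y = c}"
proof (rule affine_dim_equal)
  have "aff_dim K = int DIM('a)" using K unfolding solid_polytope_def by (simp add: aff_dim_nonempty_interior)
  then have "aff_dim F = int DIM('a) - 1" using F by (simp add: facets_def facet_of_def)
  then show "aff_dim (affine hull F) = aff_dim {y. n \<bullet> y = c}" using n by simp
  show "affine hull F \<noteq> {}" using F by (auto simp: facets_def facet_of_def)
  show "affine hull F \<subseteq> {y. n \<bullet> y = c}" using sub by (intro hull_minimal affine_hyperplane)
qed (auto intro: affine_hyperplane)

text \<open>Any admissible normal is constant on \<open>F\<close>, so its level plane is the affine
  hull of \<open>F\<close> and only the sign is open. Both signs together would squeeze
  \<open>K\<close> into a hyperplane.\<close>

lemma outer_normal_eq:
  fixes K :: "'a::euclidean_space set"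
  assumes K: "solid_polytope K" and F: "F \<in> facets K"
    and n: "norm n = 1" "\<forall>x\<in>K. \<forall>y\<in>F. n \<bullet> (x - y) \<le> 0"
  shows "outer_normal K F = n"
  unfolding outer_normal_def
proof (rule the_equality)
  show "norm n = 1 \<and> (\<forall>x\<in>K. \<forall>y\<in>F. n \<bullet> (x - y) \<le> 0)" using n by blast
  fix w assume w: "norm w = 1 \<and> (\<forall>x\<in>K. \<forall>y\<in>F. w \<bullet> (x - y) \<le> 0)"
  have FK: "F \<subseteq> K" using F facet_of_imp_subset by (auto simp: facets_def)
  obtain y0 where y0: "y0 \<in> F" using F by (auto simp: facets_def facet_of_def)
  have sub: "F \<subseteq> {y. m \<bullet> y = m \<bullet> y0}" if "\<forall>x\<in>K. \<forall>y\<in>F. m \<bullet> (x - y) \<le> 0" for m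
  proof
    fix y assume "y \<in> F"
    then have "m \<bullet> (y - y0) \<le> 0" "m \<bullet> (y0 - y) \<le> 0" using that y0 FK by blast+
    then show "y \<in> {y. m \<bullet> y = m \<bullet> y0}" by (simp add: inner_diff_right)
  qed
  have "n \<noteq> 0" "w \<noteq> 0" using n w by auto
  then have "{y. n \<bullet> y = n \<bullet> y0} = {y. w \<bullet> y = w \<bullet> y0}"
    using affine_hull_facet[OF K F sub, of n] affine_hull_facet[OF K F sub, of w] n w by auto
  from hyperplane_eq_normal[OF n(1) _ this] have "w = n \<or> w = - n" using w by blast
  moreover have False if "w = - n"
  proof -
    have "n \<bullet> (x - y0) = 0" if "x \<in> K" for x
    proof -
      have "n \<bullet> (x - y0) \<le> 0" "w \<bullet> (x - y0) \<le> 0" using n w that y0 by blast+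
      then show ?thesis using \<open>w = - n\<close> by simp
    qed
    then have "K \<subseteq> {x. n \<bullet> x = n \<bullet> y0}" by (auto simp: inner_diff_right)
    then have "interior K \<subseteq> interior {x. n \<bullet> x = n \<bullet> y0}" by (rule interior_mono)
    then show False using K \<open>n \<noteq> 0\<close> by (simp add: solid_polytope_def)
  qed
  ultimately show "w = n" by blast
qed

text \<open>In a minimal representation by halfspaces the facets are exactly the sections with the
  bounding planes. Dividing by the norm of the coefficient vector gives outer unit normals.\<close>

lemma solid_polytope_facets:
  fixes K :: "'a::euclidean_space set"
  assumes K: "solid_polytope K"
  shows "F \<in> facets K \<Longrightarrow> norm (outer_normal K F) = 1"
    and "F \<in> facets K \<Longrightarrow> F = K \<inter> {y. outer_normal K F \<bullet> y = facet_offset K F}"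
    and "K = {x. \<forall>F\<in>facets K. outer_normal K F \<bullet> x \<le> facet_offset K F}"
proof -
  have "polyhedron K" using K by (simp add: solid_polytope_def polytope_imp_polyhedron)
  from iffD1[OF polyhedron_Int_affine_minimal this]
  obtain \<H> where H: "finite \<H> \<and> K = affine hull K \<inter> \<Inter>\<H> \<and>
      (\<forall>h\<in>\<H>. \<exists>a b. a \<noteq> 0 \<and> h = {x. a \<bullet> x \<le> b}) \<and>
      (\<forall>F'. F' \<subset> \<H> \<longrightarrow> K \<subset> affine hull K \<inter> \<Inter>F')" by (rule exE)
  note fin = H[THEN conjunct1] and seq = H[THEN conjunct2, THEN conjunct1]
    and ab = H[THEN conjunct2, THEN conjunct2, THEN conjunct1]
    and min = H[THEN conjunct2, THEN conjunct2, THEN conjunct2, rule_format]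
  obtain a b where ab: "\<And>h. h \<in> \<H> \<Longrightarrow> a h \<noteq> 0 \<and> h = {x. a h \<bullet> x \<le> b h}"
    using ab by metis
  have "affine hull K = UNIV"
    using K unfolding solid_polytope_def by (intro affine_hull_nonempty_interior) blast
  then have KH: "K = \<Inter>\<H>" using seq by simp
  have facet: "F facet_of K \<longleftrightarrow> (\<exists>h\<in>\<H>. F = K \<inter> {x. a h \<bullet> x = b h})" for F
    using facet_of_polyhedron_explicit[OF fin seq ab min] by blast
  have h: "outer_normal K F = a h /\<^sub>R norm (a h)" "facet_offset K F = b h / norm (a h)" "norm (a h) > 0"
    if h: "h \<in> \<H>" and Fh: "F = K \<inter> {x. a h \<bullet> x = b h}" for F h
  proof -
    have F: "F \<in> facets K" using facet h Fh by (auto simp: facets_def)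
    show pos: "norm (a h) > 0" using ab[OF h] by simp
    show on: "outer_normal K F = a h /\<^sub>R norm (a h)"
    proof (rule outer_normal_eq[OF K F])
      show "norm (a h /\<^sub>R norm (a h)) = 1" using pos by simp
      show "\<forall>x\<in>K. \<forall>y\<in>F. (a h /\<^sub>R norm (a h)) \<bullet> (x - y) \<le> 0"
      proof (intro ballI)
        fix x y assume "x \<in> K" "y \<in> F"
        then have "a h \<bullet> x \<le> b h" "a h \<bullet> y = b h" using KH h ab[OF h] Fh by auto
        then have "a h \<bullet> (x - y) \<le> 0" by (simp add: inner_diff_right)
        then show "(a h /\<^sub>R norm (a h)) \<bullet> (x - y) \<le> 0"
          using pos by (simp add: mult_le_0_iff)
      qed
    qed
    have "(SOME y. y \<in> F) \<in> F" using F unfolding some_in_eq by (auto simp: facets_def facet_of_def)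
    then have "a h \<bullet> (SOME y. y \<in> F) = b h" using Fh by auto
    then show "facet_offset K F = b h / norm (a h)"
      by (simp add: facet_offset_def on divide_inverse mult.commute)
  qed
  have cond: "outer_normal K F \<bullet> x \<le> facet_offset K F \<longleftrightarrow> a h \<bullet> x \<le> b h"
    "outer_normal K F \<bullet> x = facet_offset K F \<longleftrightarrow> a h \<bullet> x = b h"
    if "h \<in> \<H>" "F = K \<inter> {x. a h \<bullet> x = b h}" for F h x
    using h[OF that] by (auto simp: field_simps)
  show "F \<in> facets K \<Longrightarrow> norm (outer_normal K F) = 1"
    using h facet by (auto simp: facets_def)
  show "F \<in> facets K \<Longrightarrow> F = K \<inter> {y. outer_normal K F \<bullet> y = facet_offset K F}"
    using cond(2) facet unfolding facets_def mem_Collect_eq by blast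
  show "K = {x. \<forall>F\<in>facets K. outer_normal K F \<bullet> x \<le> facet_offset K F}"
  proof (intro set_eqI iffI CollectI ballI)
    fix x F assume "x \<in> K" "F \<in> facets K"
    then obtain h where "h \<in> \<H>" "F = K \<inter> {x. a h \<bullet> x = b h}" using facet by (auto simp: facets_def)
    then show "outer_normal K F \<bullet> x \<le> facet_offset K F" using cond(1) KH ab \<open>x \<in> K\<close> by blast
  next
    fix x assume x: "x \<in> {x. \<forall>F\<in>facets K. outer_normal K F \<bullet> x \<le> facet_offset K F}"
    have "x \<in> h" if "h \<in> \<H>" for h
    proof -
      have "K \<inter> {x. a h \<bullet> x = b h} \<in> facets K" using facet that by (auto simp: facets_def)
      then have "a h \<bullet> x \<le> b h" using x cond(1)[OF that refl, of x] by blast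
      then show ?thesis using ab[OF that] by blast
    qed
    then show "x \<in> K" using KH by blast
  qed
qed

lemma facet_hyperplane:
  assumes K: "solid_polytope K" and F: "F \<in> facets K"
  shows "{y. outer_normal K F \<bullet> y = facet_offset K F} \<in> hyperplanes"
    and "affine hull F = {y. outer_normal K F \<bullet> y = facet_offset K F}"
    and "F \<subseteq> {y. outer_normal K F \<bullet> y = facet_offset K F}"
    and "F \<subseteq> K"
proof -
  show sub: "F \<subseteq> {y. outer_normal K F \<bullet> y = facet_offset K F}" and "F \<subseteq> K"
    using solid_polytope_facets(2)[OF K F] by blast+
  show "{y. outer_normal K F \<bullet> y = facet_offset K F} \<in> hyperplanes"
    by (intro hyperplanesI solid_polytope_facets[OF K] F)
  have "outer_normal K F \<noteq> 0" using solid_polytope_facets(1)[OF K F] by auto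
  then show "affine hull F = {y. outer_normal K F \<bullet> y = facet_offset K F}"
    by (intro affine_hull_facet[OF K F sub])
qed

lemma facet_hyperplane_inj:
  assumes K: "solid_polytope K" and "F \<in> facets K" "F' \<in> facets K" "F \<noteq> F'"
  shows "{y. outer_normal K F \<bullet> y = facet_offset K F} \<noteq> {y. outer_normal K F' \<bullet> y = facet_offset K F'}"
  using solid_polytope_facets(2)[OF K assms(2)] solid_polytope_facets(2)[OF K assms(3)] assms(4) by metis

lemma compact_solid_polytope: "solid_polytope K \<Longrightarrow> compact K"
  by (simp add: solid_polytope_def polytope_imp_compact)

text \<open>Finitely many strict facet inequalities define an open set, and an interior point of
  \<open>K\<close> cannot lie on the bounding plane of a halfspace containing
  \<open>K\<close>.\<close>

lemma frontier_solid_polytope: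
  assumes K: "solid_polytope K"
  shows "frontier K = \<Union>(facets K)" "interior K = {x. \<forall>F\<in>facets K. outer_normal K F \<bullet> x < facet_offset K F}"
proof -
  let ?I = "{x. \<forall>F\<in>facets K. outer_normal K F \<bullet> x < facet_offset K F}"
  have "open ?I"
  proof -
    have "?I = (\<Inter>F\<in>facets K. {x. outer_normal K F \<bullet> x < facet_offset K F})" by auto
    then show ?thesis using finite_facets[OF K] by (auto intro!: open_INT open_halfspace_lt)
  qed
  have "?I \<subseteq> K" by (subst (3) solid_polytope_facets(3)[OF K]) (auto intro: less_imp_le)
  then have "?I \<subseteq> interior K" using \<open>open ?I\<close> by (simp add: interior_maximal)
  moreover have "interior K \<subseteq> ?I"
  proof (intro subsetI CollectI ballI)
    fix x F assume x: "x \<in> interior K" and F: "F \<in> facets K"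
    have "outer_normal K F \<noteq> 0" using solid_polytope_facets(1)[OF K F] by auto
    moreover have "K \<subseteq> {x. outer_normal K F \<bullet> x \<le> facet_offset K F}"
      using F by (subst solid_polytope_facets(3)[OF K]) auto
    ultimately show "outer_normal K F \<bullet> x < facet_offset K F"
      using x interior_mono[of K "{x. outer_normal K F \<bullet> x \<le> facet_offset K F}"] by (auto simp: interior_halfspace_le)
  qed
  ultimately show int: "interior K = ?I" by blast
  have "closed K" using compact_solid_polytope[OF K] by (rule compact_imp_closed)
  then have fr: "frontier K = K - interior K" by (simp add: frontier_def)
  show "frontier K = \<Union>(facets K)"
  proof (intro set_eqI iffI)
    fix x assume "x \<in> frontier K"
    then have "x \<in> K" "x \<notin> ?I" using fr int by auto
    then obtain F where F: "F \<in> facets K" "\<not> outer_normal K F \<bullet> x < facet_offset K F" by blast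
    moreover have "outer_normal K F \<bullet> x \<le> facet_offset K F"
      using \<open>x \<in> K\<close> F(1) by (subst (asm) solid_polytope_facets(3)[OF K]) auto
    ultimately have "x \<in> F" using \<open>x \<in> K\<close> solid_polytope_facets(2)[OF K F(1)] by auto
    then show "x \<in> \<Union>(facets K)" using F by blast
  next
    fix x assume "x \<in> \<Union>(facets K)"
    then obtain F where F: "F \<in> facets K" "x \<in> F" by blast
    then have "x \<in> K" "outer_normal K F \<bullet> x = facet_offset K F" using facet_hyperplane[OF K F(1)] by auto
    moreover have "x \<notin> ?I" using F(1) calculation(2) by force
    ultimately show "x \<in> frontier K" using fr int by auto
  qed
qed

text \<open>At a point on no other facet the other inequalities are strict, and they stay so in a
  ball; within it only the inequality of \<open>F\<close> decides.\<close>

lemma half_ball_subset_solid_polytope: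
  assumes K: "solid_polytope K" and F: "F \<in> facets K" and y: "y \<in> F"
    and reg: "\<And>F'. F' \<in> facets K \<Longrightarrow> F' \<noteq> F \<Longrightarrow> y \<notin> F'"
  obtains e where "e > 0" "\<And>x. x \<in> ball y e \<Longrightarrow> outer_normal K F \<bullet> x \<le> facet_offset K F \<Longrightarrow> x \<in> K"
proof -
  let ?I = "\<Inter>F'\<in>facets K - {F}. {x. outer_normal K F' \<bullet> x < facet_offset K F'}"
  have "y \<in> K" using facet_hyperplane(4)[OF K F] y by blast
  have "outer_normal K F' \<bullet> y < facet_offset K F'" if F': "F' \<in> facets K - {F}" for F'
  proof -
    have "outer_normal K F' \<bullet> y \<le> facet_offset K F'"
      using \<open>y \<in> K\<close> F' by (subst (asm) solid_polytope_facets(3)[OF K]) auto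
    moreover have "outer_normal K F' \<bullet> y \<noteq> facet_offset K F'"
      using reg[of F'] F' solid_polytope_facets(2)[OF K, of F'] \<open>y \<in> K\<close> by auto
    ultimately show ?thesis by simp
  qed
  then have "y \<in> ?I" by blast
  moreover have "open ?I" using finite_facets[OF K] by (auto intro!: open_INT open_halfspace_lt)
  ultimately obtain e where e: "e > 0" "ball y e \<subseteq> ?I" using openE by blast
  show ?thesis
  proof (rule that[OF e(1)])
    fix x assume x: "x \<in> ball y e" "outer_normal K F \<bullet> x \<le> facet_offset K F"
    have "\<forall>F'\<in>facets K. outer_normal K F' \<bullet> x \<le> facet_offset K F'"
    proof
      fix F' assume "F' \<in> facets K"
      show "outer_normal K F' \<bullet> x \<le> facet_offset K F'"
      proof (cases "F' = F")
        case False
        then have "x \<in> {x. outer_normal K F' \<bullet> x < facet_offset K F'}" using x(1) e(2) \<open>F' \<in> facets K\<close> by blast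
        then show ?thesis by simp
      qed (use x in simp)
    qed
    then show "x \<in> K" by (subst solid_polytope_facets(3)[OF K]) auto
  qed
qed

text \<open>A face of \<open>F\<close> that meets the relative interior of \<open>F\<close> is all
  of \<open>F\<close>. A common point would therefore make \<open>F\<close> a proper face of
  \<open>F'\<close>, against equality of dimensions.\<close>

lemma rel_interior_facet:
  assumes K: "solid_polytope K" and F: "F \<in> facets K"
  shows "rel_interior F \<noteq> {}" and "y \<in> rel_interior F \<Longrightarrow> F' \<in> facets K \<Longrightarrow> F' \<noteq> F \<Longrightarrow> y \<notin> F'"
proof -
  have "convex F" using F K by (auto simp: facets_def facet_of_def solid_polytope_def intro: face_of_imp_convex polytope_imp_convex)
  moreover have "F \<noteq> {}" using F by (auto simp: facets_def facet_of_def)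
  ultimately show "rel_interior F \<noteq> {}" using rel_interior_eq_empty by blast
  assume y: "y \<in> rel_interior F" and F': "F' \<in> facets K" "F' \<noteq> F"
  have face: "F face_of K" "F' face_of K" and dim: "aff_dim F = aff_dim F'"
    using F F' by (auto simp: facets_def facet_of_def)
  show "y \<notin> F'"
  proof
    assume "y \<in> F'"
    have "y \<in> F" using y rel_interior_subset by blast
    have "(F \<inter> F') face_of F"
      using face face_of_Int face_of_imp_subset face_of_subset by (metis inf_le1)
    then have "F \<inter> F' = F"
      using face_of_disjoint_rel_interior[of "F \<inter> F'" F] y \<open>y \<in> F\<close> \<open>y \<in> F'\<close> by blast
    then have "F face_of F'"
      using face face_of_subset face_of_imp_subset by (metis inf.absorb_iff1)
    moreover have "convex F'" using face K by (auto simp: solid_polytope_def intro: face_of_imp_convex polytope_imp_convex)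
    ultimately have "aff_dim F < aff_dim F'" using face_of_aff_dim_lt F' by metis
    then show False using dim by simp
  qed
qed

section \<open>Smooth approximation on convex sets\<close>

lemma lborel_integral_affine:
  fixes f :: "'a::euclidean_space \<Rightarrow> real"
  assumes c: "c \<noteq> 0" and [measurable]: "f \<in> borel_measurable borel"
  shows "(\<integral>\<^sup>+x. ennreal (f x) \<partial>lborel) = ennreal (\<bar>c\<bar> ^ DIM('a)) * (\<integral>\<^sup>+x. ennreal (f (t + c *\<^sub>R x)) \<partial>lborel)"
    and "(\<integral>x. f x \<partial>lborel) = \<bar>c\<bar> ^ DIM('a) * (\<integral>x. f (t + c *\<^sub>R x) \<partial>lborel)"
proof -
  have [measurable]: "(\<lambda>x::'a. t + c *\<^sub>R x) \<in> borel \<rightarrow>\<^sub>M borel" by measurable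
  have eq: "(lborel :: 'a measure) = density (distr lborel borel (\<lambda>x. t + c *\<^sub>R x)) (\<lambda>_. ennreal (\<bar>c\<bar> ^ DIM('a)))"
    by (rule lborel_affine[OF c])
  show "(\<integral>\<^sup>+x. ennreal (f x) \<partial>lborel) = ennreal (\<bar>c\<bar> ^ DIM('a)) * (\<integral>\<^sup>+x. ennreal (f (t + c *\<^sub>R x)) \<partial>lborel)"
    by (subst eq) (simp add: nn_integral_density nn_integral_distr nn_integral_cmult)
  show "(\<integral>x. f x \<partial>lborel) = \<bar>c\<bar> ^ DIM('a) * (\<integral>x. f (t + c *\<^sub>R x) \<partial>lborel)"
    by (subst eq) (simp add: integral_density integral_distr)
qed

section \<open>Convolutions with smooth kernels of bounded support\<close>

lemma integrable_mult_bounded: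
  fixes f u :: "'a \<Rightarrow> real"
  assumes "integrable M u" "f \<in> borel_measurable M" "\<And>x. \<bar>f x\<bar> \<le> B"
  shows "integrable M (\<lambda>x. f x * u x)"
proof (rule Bochner_Integration.integrable_bound[of M "\<lambda>x. B * u x"])
  show "AE x in M. norm (f x * u x) \<le> norm (B * u x)"
    using assms(3) by (auto intro!: AE_I2 mult_right_mono simp: abs_mult intro: order_trans[OF _ abs_ge_self])
qed (use assms borel_measurable_integrable[OF assms(1)] in auto)

lemma smooth_compact_support_bounded:
  fixes k :: "'a::euclidean_space \<Rightarrow> real"
  assumes "smooth k" "\<And>x. x \<notin> cball 0 R \<Longrightarrow> k x = 0"
  obtains B where "\<And>x. \<bar>k x\<bar> \<le> B"
proof -
  obtain M L where M: "\<And>x. x \<in> cball 0 R \<Longrightarrow> \<bar>k x\<bar> \<le> M" "0 \<le> M"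
    using smooth_bounded_lipschitz_on_cball[OF assms(1), of R] by metis
  have "\<bar>k x\<bar> \<le> M" for x using M assms(2) by (cases "x \<in> cball 0 R") auto
  then show ?thesis by (rule that)
qed

lemma deriv_along_support:
  fixes k :: "'a::euclidean_space \<Rightarrow> real"
  assumes k: "\<And>x. x \<notin> cball 0 R \<Longrightarrow> k x = 0" and x: "x \<notin> cball 0 R"
  shows "deriv_along b k x = 0"
proof (rule deriv_along_eq)
  have "((\<lambda>x. 0) has_derivative (\<lambda>h. 0)) (at x)" by simp
  then show "(k has_derivative (\<lambda>h. 0)) (at x)"
    by (rule has_derivative_transform_within_open[of _ _ _ _ "- cball 0 R"]) (use k x in \<open>auto simp: open_Compl\<close>)
qed

text \<open>The remainder bound is uniform in \<open>z\<close>: the partial derivatives are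
  Lipschitz on a ball and vanish outside it. Uniformity is what permits differentiation under an
  integral against an integrable function.\<close>

lemma smooth_compact_support_taylor:
  fixes k :: "'a::euclidean_space \<Rightarrow> real"
  assumes k: "smooth k" and supp: "\<And>x. x \<notin> cball 0 R \<Longrightarrow> k x = 0"
  obtains L where "L \<ge> 0"
    "\<And>z h. norm h \<le> 1 \<Longrightarrow> \<bar>k (z + h) - k z - (\<Sum>b\<in>Basis. (h \<bullet> b) * deriv_along b k z)\<bar> \<le> L * (norm h)\<^sup>2"
proof -
  have "\<exists>L\<ge>0. \<forall>x y. norm (x - y) \<le> 1 \<longrightarrow> \<bar>deriv_along b k x - deriv_along b k y\<bar> \<le> L * norm (x - y)"
    if b: "b \<in> Basis" for b
  proof -
    obtain M L where L: "\<And>x y. x \<in> cball 0 (R + 1) \<Longrightarrow> y \<in> cball 0 (R + 1) \<Longrightarrow>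
        \<bar>deriv_along b k x - deriv_along b k y\<bar> \<le> L * norm (x - y)" "0 \<le> L"
      using smooth_bounded_lipschitz_on_cball[OF smooth_deriv_along[OF k b], of "R + 1"] by metis
    have "\<bar>deriv_along b k x - deriv_along b k y\<bar> \<le> L * norm (x - y)" if xy: "norm (x - y) \<le> 1" for x y
    proof (cases "x \<in> cball 0 R \<or> y \<in> cball 0 R")
      case True
      have "norm x \<le> norm y + norm (x - y)" "norm y \<le> norm x + norm (x - y)"
        using norm_triangle_sub[of x y] norm_triangle_sub[of y x] by (simp_all add: norm_minus_commute)
      then show ?thesis using True xy by (intro L(1)) auto
    next
      case False
      then have "deriv_along b k x = 0" "deriv_along b k y = 0"
        using deriv_along_support[of R k, OF supp] by auto
      then show ?thesis using L(2) by simp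
    qed
    with L(2) show ?thesis by blast
  qed
  then obtain C where C: "\<And>b. b \<in> Basis \<Longrightarrow> C b \<ge> 0"
    "\<And>b x y. b \<in> Basis \<Longrightarrow> norm (x - y) \<le> 1 \<Longrightarrow> \<bar>deriv_along b k x - deriv_along b k y\<bar> \<le> C b * norm (x - y)"
    by metis
  define L where "L = (\<Sum>b\<in>Basis. C b)"
  have L0: "L \<ge> 0" unfolding L_def by (intro sum_nonneg C)
  have "\<bar>k (z + h) - k z - (\<Sum>b\<in>Basis. (h \<bullet> b) * deriv_along b k z)\<bar> \<le> L * (norm h)\<^sup>2"
    if h: "norm h \<le> 1" for z h
  proof -
    \<comment> \<open>Subtracting the linear part frozen at \<open>z\<close> leaves a function whose
      derivative is at most \<open>L * norm h\<close> in the ball, so the mean value estimate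
      already yields the quadratic bound.\<close>
    define f where "f y = k y - (\<Sum>b\<in>Basis. (y \<bullet> b) * deriv_along b k z)" for y
    have "norm (f (z + h) - f z) \<le> (L * norm h) * norm ((z + h) - z)"
    proof (rule differentiable_bound[of "cball z (norm h)" f
          "\<lambda>y v. (\<Sum>b\<in>Basis. (v \<bullet> b) * deriv_along b k y) - (\<Sum>b\<in>Basis. (v \<bullet> b) * deriv_along b k z)"])
      fix y assume y: "y \<in> cball z (norm h)"
      have "(f has_derivative (\<lambda>v. (\<Sum>b\<in>Basis. (v \<bullet> b) * deriv_along b k y) - (\<Sum>b\<in>Basis. (v \<bullet> b) * deriv_along b k z))) (at y)"
        unfolding f_def by (intro has_derivative_diff smooth_has_derivative k has_derivative_sum has_derivative_mult_left)
           (auto intro!: derivative_eq_intros)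
      then show "(f has_derivative (\<lambda>v. (\<Sum>b\<in>Basis. (v \<bullet> b) * deriv_along b k y) - (\<Sum>b\<in>Basis. (v \<bullet> b) * deriv_along b k z)))
          (at y within cball z (norm h))"
        by (rule has_derivative_at_withinI)
      show "onorm (\<lambda>v. (\<Sum>b\<in>Basis. (v \<bullet> b) * deriv_along b k y) - (\<Sum>b\<in>Basis. (v \<bullet> b) * deriv_along b k z)) \<le> L * norm h"
      proof (rule onorm_le)
        fix v :: 'a
        have yz: "norm (y - z) \<le> norm h" using y by (simp add: dist_norm norm_minus_commute)
        have "norm ((\<Sum>b\<in>Basis. (v \<bullet> b) * deriv_along b k y) - (\<Sum>b\<in>Basis. (v \<bullet> b) * deriv_along b k z))
            = norm (\<Sum>b\<in>Basis. (v \<bullet> b) * (deriv_along b k y - deriv_along b k z))"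
          by (simp add: sum_subtractf right_diff_distrib)
        also have "\<dots> \<le> (\<Sum>b\<in>Basis. norm v * (C b * norm h))"
        proof (intro sum_norm_le)
          fix b :: 'a assume b: "b \<in> Basis"
          have "\<bar>deriv_along b k y - deriv_along b k z\<bar> \<le> C b * norm (y - z)"
            using C(2)[OF b, of y z] yz h by linarith
          also have "\<dots> \<le> C b * norm h" using C(1)[OF b] yz by (intro mult_left_mono) auto
          finally show "norm ((v \<bullet> b) * (deriv_along b k y - deriv_along b k z)) \<le> norm v * (C b * norm h)"
            unfolding real_norm_def abs_mult using b Basis_le_norm[OF b, of v] by (intro mult_mono) auto
        qed
        also have "\<dots> = L * norm h * norm v"
          by (simp add: L_def sum_distrib_left sum_distrib_right mult_ac)
        finally show "norm ((\<Sum>b\<in>Basis. (v \<bullet> b) * deriv_along b k y) - (\<Sum>b\<in>Basis. (v \<bullet> b) * deriv_along b k z)) \<le> L * norm h * norm v" .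
      qed
    qed (auto simp: dist_norm)
    moreover have "f (z + h) - f z = k (z + h) - k z - (\<Sum>b\<in>Basis. (h \<bullet> b) * deriv_along b k z)"
      by (simp add: f_def inner_add_left distrib_right sum.distrib)
    ultimately show ?thesis by (simp add: power2_eq_square mult.assoc)
  qed
  then show ?thesis using that L0 by metis
qed

text \<open>The derivative falls on the kernel, with a factor \<open>\<gamma>\<close>, and its
  result is an integral of the same form; hence the induction over all kernels. The affine argument
  admits kernels scaled around a point, not just translates.\<close>

lemma smooth_convolution:
  fixes k u :: "'a::euclidean_space \<Rightarrow> real"
  assumes k: "smooth k" and supp: "\<And>x. x \<notin> cball 0 R \<Longrightarrow> k x = 0" and u: "integrable lborel u"
  shows "smooth (\<lambda>x. \<integral>w. k (\<alpha> *\<^sub>R w + \<gamma> *\<^sub>R x) * u w \<partial>lborel)"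
    and "b \<in> Basis \<Longrightarrow> deriv_along b (\<lambda>x. \<integral>w. k (\<alpha> *\<^sub>R w + \<gamma> *\<^sub>R x) * u w \<partial>lborel) x =
       \<gamma> * (\<integral>w. deriv_along b k (\<alpha> *\<^sub>R w + \<gamma> *\<^sub>R x) * u w \<partial>lborel)"
proof -
  define C where "C k x = (\<integral>w. k (\<alpha> *\<^sub>R w + \<gamma> *\<^sub>R x) * u w \<partial>lborel)" for k x
  define U where "U = (\<integral>w. \<bar>u w\<bar> \<partial>lborel)"
  have int: "integrable lborel (\<lambda>w. k (\<alpha> *\<^sub>R w + \<gamma> *\<^sub>R x) * u w)"
    if k: "smooth k" and supp: "\<And>x. x \<notin> cball 0 R \<Longrightarrow> k x = 0" for k :: "'a \<Rightarrow> real" and x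
  proof -
    obtain B where "\<And>x. \<bar>k x\<bar> \<le> B" using smooth_compact_support_bounded[OF k supp] by metis
    moreover have [measurable]: "k \<in> borel_measurable borel" by (rule smooth_borel_measurable[OF k])
    ultimately show ?thesis by (intro integrable_mult_bounded[OF u]) auto
  qed
  have deriv: "(C k has_derivative (\<lambda>h. \<Sum>b\<in>Basis. (h \<bullet> b) * (\<gamma> * C (deriv_along b k) x))) (at x)"
    if k: "smooth k" and supp: "\<And>x. x \<notin> cball 0 R \<Longrightarrow> k x = 0" for k x
  proof -
    obtain L where L: "L \<ge> 0"
      "\<And>z h. norm h \<le> 1 \<Longrightarrow> \<bar>k (z + h) - k z - (\<Sum>b\<in>Basis. (h \<bullet> b) * deriv_along b k z)\<bar> \<le> L * (norm h)\<^sup>2"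
      using smooth_compact_support_taylor[OF k supp] by metis
    have dint: "integrable lborel (\<lambda>w. deriv_along b k (\<alpha> *\<^sub>R w + \<gamma> *\<^sub>R x) * u w)" if "b \<in> Basis" for b
      by (rule int[OF smooth_deriv_along[OF k that] deriv_along_support[of R k, OF supp]])
    \<comment> \<open>Chosen so that displacements of \<open>x\<close> shorter than \<open>e\<close>
      move the kernel argument by at most 1, the range of the Taylor estimate.\<close>
    define e where "e = 1 / (\<bar>\<gamma>\<bar> + 1)"
    have e: "e > 0" by (simp add: e_def add_nonneg_pos)
    show ?thesis
    proof (rule has_derivativeI_sandwich[OF e])
      show "bounded_linear (\<lambda>h. \<Sum>b\<in>Basis. (h \<bullet> b) * (\<gamma> * C (deriv_along b k) x))"
        by (intro bounded_linear_sum bounded_linear_mult_const bounded_linear_inner_left)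
      show "((\<lambda>y. (L * \<gamma>\<^sup>2 * U) * norm (y - x)) \<longlongrightarrow> 0) (at x within UNIV)"
        by (auto intro!: tendsto_eq_intros)
      fix y assume "y \<in> (UNIV::'a set)" "y \<noteq> x" and y: "dist y x < e"
      define h where "h = y - x"
      have nh: "norm (\<gamma> *\<^sub>R h) \<le> 1"
      proof -
        have "norm (\<gamma> *\<^sub>R h) \<le> \<bar>\<gamma>\<bar> * e" using y by (auto simp: h_def dist_norm intro!: mult_left_mono)
        also have "\<dots> \<le> 1" by (simp add: e_def field_simps)
        finally show ?thesis .
      qed
      define D where "D w = k (\<alpha> *\<^sub>R w + \<gamma> *\<^sub>R y) - k (\<alpha> *\<^sub>R w + \<gamma> *\<^sub>R x) - (\<Sum>b\<in>Basis. (h \<bullet> b) * (\<gamma> * deriv_along b k (\<alpha> *\<^sub>R w + \<gamma> *\<^sub>R x)))" for w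
      have D: "\<bar>D w\<bar> \<le> L * \<gamma>\<^sup>2 * (norm h)\<^sup>2" for w
      proof -
        have "\<alpha> *\<^sub>R w + \<gamma> *\<^sub>R y = (\<alpha> *\<^sub>R w + \<gamma> *\<^sub>R x) + \<gamma> *\<^sub>R h" by (simp add: h_def algebra_simps)
        moreover have "(\<Sum>b\<in>Basis. (\<gamma> *\<^sub>R h \<bullet> b) * deriv_along b k (\<alpha> *\<^sub>R w + \<gamma> *\<^sub>R x)) =
            (\<Sum>b\<in>Basis. (h \<bullet> b) * (\<gamma> * deriv_along b k (\<alpha> *\<^sub>R w + \<gamma> *\<^sub>R x)))"
          by (intro sum.cong) auto
        moreover have "(norm (\<gamma> *\<^sub>R h))\<^sup>2 = \<gamma>\<^sup>2 * (norm h)\<^sup>2" by (simp add: power_mult_distrib)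
        ultimately show ?thesis
          using L(2)[OF nh, of "\<alpha> *\<^sub>R w + \<gamma> *\<^sub>R x"] unfolding D_def by (simp only: mult.assoc)
      qed
      have "(C k y - C k x) - (\<Sum>b\<in>Basis. (h \<bullet> b) * (\<gamma> * C (deriv_along b k) x)) = (\<integral>w. D w * u w \<partial>lborel)"
      proof -
        have S: "(\<Sum>b\<in>Basis. (h \<bullet> b) * (\<gamma> * deriv_along b k z)) * r = (\<Sum>b\<in>Basis. (h \<bullet> b) * (\<gamma> * (deriv_along b k z * r)))" for z r
          unfolding sum_distrib_right by (intro sum.cong) auto
        have "(\<integral>w. D w * u w \<partial>lborel) = (\<integral>w. (k (\<alpha> *\<^sub>R w + \<gamma> *\<^sub>R y) * u w - k (\<alpha> *\<^sub>R w + \<gamma> *\<^sub>R x) * u w)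
            - (\<Sum>b\<in>Basis. (h \<bullet> b) * (\<gamma> * (deriv_along b k (\<alpha> *\<^sub>R w + \<gamma> *\<^sub>R x) * u w))) \<partial>lborel)"
          by (intro Bochner_Integration.integral_cong refl) (simp only: D_def left_diff_distrib S)
        also have "\<dots> = (C k y - C k x) - (\<Sum>b\<in>Basis. (h \<bullet> b) * (\<gamma> * C (deriv_along b k) x))"
          using int[OF k supp] dint unfolding C_def
          by (subst Bochner_Integration.integral_diff) auto
        finally show ?thesis by simp
      qed
      also have "\<bar>\<dots>\<bar> \<le> (\<integral>w. (L * \<gamma>\<^sup>2 * (norm h)\<^sup>2) * \<bar>u w\<bar> \<partial>lborel)"
      proof (rule integral_abs_bound_integral)
        have [measurable]: "k \<in> borel_measurable borel" "\<And>b. b \<in> Basis \<Longrightarrow> deriv_along b k \<in> borel_measurable borel"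
          using k by (auto intro: smooth_borel_measurable smooth_deriv_along)
        have "D \<in> borel_measurable borel" unfolding D_def[abs_def] by measurable
        then show "integrable lborel (\<lambda>w. D w * u w)" by (intro integrable_mult_bounded[OF u _ D]) simp
        show "\<bar>D w * u w\<bar> \<le> L * \<gamma>\<^sup>2 * (norm h)\<^sup>2 * \<bar>u w\<bar>" for w
          unfolding abs_mult by (intro mult_right_mono D) simp
      qed (use u in auto)
      also have "\<dots> = L * \<gamma>\<^sup>2 * (norm h)\<^sup>2 * U" by (simp add: U_def)
      finally have "\<bar>(C k y - C k x) - (\<Sum>b\<in>Basis. (h \<bullet> b) * (\<gamma> * C (deriv_along b k) x))\<bar> \<le> L * \<gamma>\<^sup>2 * (norm h)\<^sup>2 * U" .
      moreover have "norm h > 0" using \<open>y \<noteq> x\<close> by (simp add: h_def)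
      ultimately show "norm ((C k y - C k x) - (\<Sum>b\<in>Basis. ((y - x) \<bullet> b) * (\<gamma> * C (deriv_along b k) x))) / norm (y - x) \<le> (L * \<gamma>\<^sup>2 * U) * norm (y - x)"
        by (simp add: h_def[symmetric] divide_le_eq power2_eq_square mult_ac)
    qed
  qed
  have eq: "deriv_along b (C k) = (\<lambda>x. \<gamma> * C (deriv_along b k) x)"
    if k: "smooth k" and supp: "\<And>x. x \<notin> cball 0 R \<Longrightarrow> k x = 0" and b: "b \<in> Basis" for k b
  proof
    fix x
    have "deriv_along b (C k) x = (\<Sum>b'\<in>Basis. (b \<bullet> b') * (\<gamma> * C (deriv_along b' k) x))"
      by (rule deriv_along_eq[OF deriv[OF k supp]])
    also have "\<dots> = (\<Sum>b'\<in>Basis. if b' = b then \<gamma> * C (deriv_along b' k) x else 0)"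
      using b by (intro sum.cong) (auto simp: inner_Basis)
    also have "\<dots> = \<gamma> * C (deriv_along b k) x" using b by simp
    finally show "deriv_along b (C k) x = \<gamma> * C (deriv_along b k) x" .
  qed
  have "times_cont_differentiable n (C k)" if "smooth k" "\<And>x. x \<notin> cball 0 R \<Longrightarrow> k x = 0" for n k
    using that
  proof (induction n arbitrary: k)
    case 0
    have "continuous (at x) (C k)" for x using has_derivative_continuous[OF deriv[OF 0]] .
    then show ?case by (simp add: continuous_at_imp_continuous_on)
  next
    case (Suc n)
    have "times_cont_differentiable n (deriv_along b (C k))" if b: "b \<in> Basis" for b
    proof -
      have "times_cont_differentiable n (C (deriv_along b k))"
        by (rule Suc.IH[OF smooth_deriv_along[OF Suc.prems(1) b] deriv_along_support[of R k, OF Suc.prems(2)]])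
      then have "times_cont_differentiable n (\<lambda>x. \<gamma> * C (deriv_along b k) x)"
        by (intro times_cont_differentiable_mult times_cont_differentiable_const)
      moreover have "deriv_along b (C k) = (\<lambda>x. \<gamma> * C (deriv_along b k) x)"
        using eq[of k b] Suc.prems b by blast
      ultimately show ?thesis by (rule ssubst[rotated])
    qed
    then show ?case using deriv[OF Suc.prems] by (auto intro: differentiableI)
  qed
  from this[OF k supp] have "smooth (C k)" by (simp add: smooth_def)
  then show "smooth (\<lambda>x. \<integral>w. k (\<alpha> *\<^sub>R w + \<gamma> *\<^sub>R x) * u w \<partial>lborel)" unfolding C_def .
  assume b: "b \<in> Basis"
  show "deriv_along b (\<lambda>x. \<integral>w. k (\<alpha> *\<^sub>R w + \<gamma> *\<^sub>R x) * u w \<partial>lborel) x =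
       \<gamma> * (\<integral>w. deriv_along b k (\<alpha> *\<^sub>R w + \<gamma> *\<^sub>R x) * u w \<partial>lborel)"
    using fun_cong[OF eq[OF k supp b], of x] unfolding C_def .
qed

text \<open>Truncation at a height \<open>M\<close> costs little; the truncated function is an
  almost everywhere limit of continuous functions. Truncating these at \<open>M\<close> too keeps
  them continuous and gives a constant dominating function.\<close>

lemma L2_approx_continuous:
  fixes f :: "'a::euclidean_space \<Rightarrow> real"
  assumes G: "G \<in> lmeasurable" and f: "f \<in> L2 (lebesgue_on G)" and e: "e > 0"
  obtains c where "continuous_on UNIV c" "c \<in> L2 (lebesgue_on G)" "L2_norm_sq (lebesgue_on G) (\<lambda>x. f x - c x) < e"
proof -
  have GS: "G \<in> sets lebesgue" using G by (simp add: fmeasurableD)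
  have fin: "finite_measure (lebesgue_on G)" by (rule finite_measure_lebesgue_on[OF G])
  have [measurable]: "f \<in> borel_measurable (lebesgue_on G)" by (rule L2_measurable[OF f])
  define t where "t M r = max (- M) (min M r)" for M r :: real
  have t: "\<bar>t M r\<bar> \<le> \<bar>M\<bar>" "\<bar>r - t (real n) r\<bar> \<le> \<bar>r\<bar>" "\<bar>r\<bar> \<le> real n \<Longrightarrow> t (real n) r = r" for M r n
    by (auto simp: t_def max_def min_def)
  have [measurable]: "t M \<in> borel_measurable borel" for M unfolding t_def[abs_def] by measurable
  have tc: "continuous_on UNIV (t M)" for M unfolding t_def[abs_def] by (intro continuous_intros)
  have "(\<lambda>n. L2_norm_sq (lebesgue_on G) (\<lambda>x. f x - t (real n) (f x))) \<longlonglongrightarrow> L2_norm_sq (lebesgue_on G) (\<lambda>x. 0::real)"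
    unfolding L2_norm_sq_def
  proof (rule integral_dominated_convergence[where w="\<lambda>x. (f x)\<^sup>2"])
    show "integrable (lebesgue_on G) (\<lambda>x. (f x)\<^sup>2)" using f by (simp add: L2_def)
    show "AE x in lebesgue_on G. (\<lambda>n. (norm (f x - t (real n) (f x)))\<^sup>2) \<longlonglongrightarrow> (norm (0::real))\<^sup>2"
    proof (intro AE_I2 tendsto_eventually)
      fix x
      obtain N where "\<bar>f x\<bar> \<le> real N" using real_arch_simple by blast
      then show "\<forall>\<^sub>F n in sequentially. (norm (f x - t (real n) (f x)))\<^sup>2 = (norm (0::real))\<^sup>2"
        using t(3) by (intro eventually_sequentiallyI[of N]) (auto dest: order_trans)
    qed
    show "AE x in lebesgue_on G. norm ((norm (f x - t (real n) (f x)))\<^sup>2) \<le> (f x)\<^sup>2" for n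
      using t(2) by (auto intro!: AE_I2 simp: abs_le_square_iff[symmetric])
  qed measurable
  then have "(\<lambda>n. L2_norm_sq (lebesgue_on G) (\<lambda>x. f x - t (real n) (f x))) \<longlonglongrightarrow> 0" by (simp add: L2_norm_sq_def)
  then have "\<forall>\<^sub>F n in sequentially. L2_norm_sq (lebesgue_on G) (\<lambda>x. f x - t (real n) (f x)) < e / 4"
    using e by (intro order_tendstoD(2)) auto
  then obtain n where n: "L2_norm_sq (lebesgue_on G) (\<lambda>x. f x - t (real n) (f x)) < e / 4"
    using eventually_sequentially by auto
  define M where "M = real n"
  define h where "h x = (if x \<in> G then t M (f x) else 0)" for x
  have "h \<in> borel_measurable lebesgue"
    unfolding h_def[abs_def] using borel_measurable_if_lebesgue_on[of G UNIV "\<lambda>x. t M (f x)"] GS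
    by (simp add: lebesgue_on_UNIV_eq)
  then have "h measurable_on UNIV" by (rule lebesgue_measurable_imp_measurable_on) simp
  then obtain N g where N: "negligible N" and g: "\<And>n. continuous_on UNIV (g n)"
    and lim: "\<And>x. x \<notin> N \<Longrightarrow> (\<lambda>n. g n x) \<longlonglongrightarrow> h x"
    unfolding measurable_on_def by auto
  have [measurable]: "g n \<in> borel_measurable (lebesgue_on G)" for n
    by (intro continuous_imp_measurable_on_sets_lebesgue continuous_on_subset[OF g] GS) auto
  have AEN: "AE x in lebesgue_on G. x \<notin> N"
  proof -
    have "AE x in lebesgue. x \<notin> N" using N by (intro AE_not_in) (simp add: negligible_iff_null_sets)
    then show ?thesis using GS by (subst AE_restrict_space_iff) auto
  qed
  have "(\<lambda>m. L2_norm_sq (lebesgue_on G) (\<lambda>x. t M (f x) - t M (g m x))) \<longlonglongrightarrow> L2_norm_sq (lebesgue_on G) (\<lambda>x. 0::real)"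
    unfolding L2_norm_sq_def
  proof (rule integral_dominated_convergence[where w="\<lambda>x. (2 * \<bar>M\<bar>)\<^sup>2"])
    show "integrable (lebesgue_on G) (\<lambda>x. (2 * \<bar>M\<bar>)\<^sup>2)" using fin by (simp add: finite_measure.integrable_const)
    show "AE x in lebesgue_on G. (\<lambda>m. (norm (t M (f x) - t M (g m x)))\<^sup>2) \<longlonglongrightarrow> (norm (0::real))\<^sup>2"
      using AEN AE_space
    proof eventually_elim
      case (elim x)
      then have x: "x \<in> G" by simp
      have "(\<lambda>m. t M (g m x)) \<longlonglongrightarrow> t M (h x)"
        using tc[of M] lim[OF elim(1)] by (metis UNIV_I continuous_on_eq_continuous_at isCont_tendsto_compose open_UNIV)
      moreover have "t M (h x) = t M (f x)" using x by (auto simp: h_def t_def max_def min_def)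
      ultimately have "(\<lambda>m. (norm (t M (f x) - t M (g m x)))\<^sup>2) \<longlonglongrightarrow> (norm (t M (f x) - t M (f x)))\<^sup>2"
        by (intro tendsto_intros) simp
      then show ?case by simp
    qed
    show "AE x in lebesgue_on G. norm ((norm (t M (f x) - t M (g m x)))\<^sup>2) \<le> (2 * \<bar>M\<bar>)\<^sup>2" for m
    proof (intro AE_I2)
      fix x
      have "\<bar>t M (f x) - t M (g m x)\<bar> \<le> 2 * \<bar>M\<bar>" using t(1)[of M "f x"] t(1)[of M "g m x"] by linarith
      then show "norm ((norm (t M (f x) - t M (g m x)))\<^sup>2) \<le> (2 * \<bar>M\<bar>)\<^sup>2"
        using power_mono[of "\<bar>t M (f x) - t M (g m x)\<bar>" "2 * \<bar>M\<bar>" 2] by simp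
    qed
  qed measurable
  then have "(\<lambda>m. L2_norm_sq (lebesgue_on G) (\<lambda>x. t M (f x) - t M (g m x))) \<longlonglongrightarrow> 0" by (simp add: L2_norm_sq_def)
  then have "\<forall>\<^sub>F m in sequentially. L2_norm_sq (lebesgue_on G) (\<lambda>x. t M (f x) - t M (g m x)) < e / 4"
    using e by (intro order_tendstoD(2)) auto
  then obtain m where m: "L2_norm_sq (lebesgue_on G) (\<lambda>x. t M (f x) - t M (g m x)) < e / 4"
    using eventually_sequentially by auto
  have c1: "(\<lambda>x. t M (f x)) \<in> L2 (lebesgue_on G)" and c2: "(\<lambda>x. t M (g m x)) \<in> L2 (lebesgue_on G)"
    using t(1) by (auto intro!: L2_bounded[OF fin])
  have "L2_norm_sq (lebesgue_on G) (\<lambda>x. f x - t M (g m x)) < e"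
    using L2_norm_sq_triangle[OF f c1 c2] n m unfolding M_def by linarith
  moreover have "continuous_on UNIV (\<lambda>x. t M (g m x))"
    by (rule continuous_on_compose2[OF tc g]) auto
  ultimately show ?thesis using c2 that by blast
qed

text \<open>Jensen for the probability density \<open>\<beta>\<close> moves the square inside,
  Tonelli exchanges the integrals, and the substitution \<open>c x + d y\<close> in \<open>x\<close>
  contributes the factor \<open>(1 / c) ^ DIM\<close>.\<close>

lemma averaging_L2_bound:
  fixes f \<beta> :: "'a::euclidean_space \<Rightarrow> real"
  assumes [measurable]: "f \<in> borel_measurable borel" "\<beta> \<in> borel_measurable borel"
    and \<beta>: "\<And>y. 0 \<le> \<beta> y" "integrable lborel \<beta>" "(\<integral>y. \<beta> y \<partial>lborel) = 1" and c: "0 < c"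
  shows "(\<integral>\<^sup>+x. ennreal ((\<integral>y. \<beta> y * f (c *\<^sub>R x + d *\<^sub>R y) \<partial>lborel)\<^sup>2) \<partial>lborel)
    \<le> ennreal ((1 / c) ^ DIM('a)) * (\<integral>\<^sup>+x. ennreal ((f x)\<^sup>2) \<partial>lborel)"
proof -
  define P where "P = density lborel (\<lambda>y. ennreal (\<beta> y))"
  have eP: "emeasure P (space P) = 1"
  proof -
    have "emeasure P (space P) = (\<integral>\<^sup>+y. ennreal (\<beta> y) \<partial>lborel)" unfolding P_def by (subst emeasure_density) auto
    also have "\<dots> = ennreal (\<integral>y. \<beta> y \<partial>lborel)" by (intro nn_integral_eq_integral \<beta>) (use \<beta> in auto)
    finally show ?thesis using \<beta> by simp
  qed
  have finP: "finite_measure P" by (rule finite_measureI) (simp add: eP)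
  have mP: "measure P (space P) = 1" using eP by (simp add: measure_def)
  have jensen: "ennreal ((\<integral>y. \<beta> y * g y \<partial>lborel)\<^sup>2) \<le> (\<integral>\<^sup>+y. ennreal (\<beta> y) * ennreal ((g y)\<^sup>2) \<partial>lborel)"
    if [measurable]: "g \<in> borel_measurable borel" for g :: "'a \<Rightarrow> real"
  proof (cases "(\<integral>\<^sup>+y. ennreal (\<beta> y) * ennreal ((g y)\<^sup>2) \<partial>lborel) = \<infinity>")
    case False
    have nn: "(\<integral>\<^sup>+y. ennreal ((g y)\<^sup>2) \<partial>P) = (\<integral>\<^sup>+y. ennreal (\<beta> y) * ennreal ((g y)\<^sup>2) \<partial>lborel)"
      unfolding P_def by (subst nn_integral_density) auto
    have gP: "g \<in> borel_measurable P" by (simp add: P_def)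
    have int: "integrable P (\<lambda>y. (g y)\<^sup>2)"
      using False nn gP by (intro integrableI_bounded) (auto simp: less_top)
    then have g: "g \<in> L2 P" using gP by (simp add: L2_def)
    have one: "(\<lambda>y. 1) \<in> L2 P" by (intro L2_bounded[OF finP, of _ 1]) auto
    have "\<bar>\<integral>y. g y * 1 \<partial>P\<bar> \<le> sqrt (L2_norm_sq P g) * sqrt (L2_norm_sq P (\<lambda>y. 1::real))"
      by (rule integral_mult_le[OF g one])
    also have "L2_norm_sq P (\<lambda>y. 1::real) = 1" using mP by (simp add: L2_norm_sq_def)
    finally have "\<bar>\<integral>y. g y \<partial>P\<bar>\<^sup>2 \<le> (sqrt (L2_norm_sq P g))\<^sup>2" by (intro power_mono) auto
    then have "(\<integral>y. g y \<partial>P)\<^sup>2 \<le> L2_norm_sq P g" by simp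
    moreover have "(\<integral>y. g y \<partial>P) = (\<integral>y. \<beta> y * g y \<partial>lborel)"
      unfolding P_def using \<beta> by (subst integral_density) auto
    moreover have "ennreal (L2_norm_sq P g) = (\<integral>\<^sup>+y. ennreal ((g y)\<^sup>2) \<partial>P)"
      unfolding L2_norm_sq_def using int by (subst nn_integral_eq_integral) auto
    ultimately show ?thesis unfolding nn[symmetric] by (metis ennreal_leI)
  qed simp
  have "(\<integral>\<^sup>+x. ennreal ((\<integral>y. \<beta> y * f (c *\<^sub>R x + d *\<^sub>R y) \<partial>lborel)\<^sup>2) \<partial>lborel)
    \<le> (\<integral>\<^sup>+x. (\<integral>\<^sup>+y. ennreal (\<beta> y) * ennreal ((f (c *\<^sub>R x + d *\<^sub>R y))\<^sup>2) \<partial>lborel) \<partial>lborel)"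
  proof (intro nn_integral_mono)
    fix x
    show "ennreal ((\<integral>y. \<beta> y * f (c *\<^sub>R x + d *\<^sub>R y) \<partial>lborel)\<^sup>2)
      \<le> (\<integral>\<^sup>+y. ennreal (\<beta> y) * ennreal ((f (c *\<^sub>R x + d *\<^sub>R y))\<^sup>2) \<partial>lborel)"
      by (rule jensen) measurable
  qed
  also have "\<dots> = (\<integral>\<^sup>+y. (\<integral>\<^sup>+x. ennreal (\<beta> y) * ennreal ((f (c *\<^sub>R x + d *\<^sub>R y))\<^sup>2) \<partial>lborel) \<partial>lborel)"
  proof (rule lborel_pair.Fubini'[symmetric])
    have [measurable]: "(\<lambda>p. f (c *\<^sub>R fst p + d *\<^sub>R snd p)) \<in> borel_measurable (lborel \<Otimes>\<^sub>M lborel)"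
      by (rule measurable_compose[OF _ assms(1)]) measurable
    show "(\<lambda>(y, x). ennreal (\<beta> x) * ennreal ((f (c *\<^sub>R y + d *\<^sub>R x))\<^sup>2)) \<in> borel_measurable (lborel \<Otimes>\<^sub>M lborel)"
      unfolding split_beta' by measurable
  qed
  also have "\<dots> = (\<integral>\<^sup>+y. ennreal (\<beta> y) * (ennreal ((1 / c) ^ DIM('a)) * (\<integral>\<^sup>+x. ennreal ((f x)\<^sup>2) \<partial>lborel)) \<partial>lborel)"
  proof (intro nn_integral_cong)
    fix y
    have "(\<integral>\<^sup>+x. ennreal ((f x)\<^sup>2) \<partial>lborel) = ennreal (c ^ DIM('a)) * (\<integral>\<^sup>+x. ennreal ((f (d *\<^sub>R y + c *\<^sub>R x))\<^sup>2) \<partial>lborel)"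
      using lborel_integral_affine(1)[of c "\<lambda>x. (f x)\<^sup>2" "d *\<^sub>R y"] c by simp
    then have "ennreal ((1 / c) ^ DIM('a)) * (\<integral>\<^sup>+x. ennreal ((f x)\<^sup>2) \<partial>lborel) =
        ennreal ((1 / c) ^ DIM('a) * c ^ DIM('a)) * (\<integral>\<^sup>+x. ennreal ((f (d *\<^sub>R y + c *\<^sub>R x))\<^sup>2) \<partial>lborel)"
      using c by (simp add: ennreal_mult mult.assoc)
    also have "(1 / c) ^ DIM('a) * c ^ DIM('a) = 1" using c by (simp add: power_mult_distrib[symmetric])
    finally show "(\<integral>\<^sup>+x. ennreal (\<beta> y) * ennreal ((f (c *\<^sub>R x + d *\<^sub>R y))\<^sup>2) \<partial>lborel) =
        ennreal (\<beta> y) * (ennreal ((1 / c) ^ DIM('a)) * (\<integral>\<^sup>+x. ennreal ((f x)\<^sup>2) \<partial>lborel))"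
      by (subst nn_integral_cmult) (auto simp: add.commute)
  qed
  also have "\<dots> = (\<integral>\<^sup>+y. ennreal (\<beta> y) \<partial>lborel) * (ennreal ((1 / c) ^ DIM('a)) * (\<integral>\<^sup>+x. ennreal ((f x)\<^sup>2) \<partial>lborel))"
    by (rule nn_integral_multc) simp
  also have "(\<integral>\<^sup>+y. ennreal (\<beta> y) \<partial>lborel) = 1"
    using \<beta> by (subst nn_integral_eq_integral) auto
  finally show ?thesis by simp
qed

subsection \<open>Weak derivatives\<close>

lemma integral_lebesgue_on_borel:
  fixes g :: "'a::euclidean_space \<Rightarrow> real"
  assumes [measurable]: "g \<in> borel_measurable borel" "G \<in> sets borel"
  shows "(\<integral>x. g x \<partial>lebesgue_on G) = (\<integral>x. indicator G x * g x \<partial>lborel)"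
    and "integrable (lebesgue_on G) g \<longleftrightarrow> integrable lborel (\<lambda>x. indicator G x * g x)"
proof -
  have G: "G \<inter> space lebesgue \<in> sets lebesgue" using assms by simp
  have m: "(\<lambda>x. indicator G x * g x) \<in> borel_measurable lborel" by measurable
  show "(\<integral>x. g x \<partial>lebesgue_on G) = (\<integral>x. indicator G x * g x \<partial>lborel)"
    using integral_restrict_space[OF G, of g] integral_completion[OF m] by simp
  show "integrable (lebesgue_on G) g \<longleftrightarrow> integrable lborel (\<lambda>x. indicator G x * g x)"
    using integrable_restrict_space[OF G, of g] integrable_completion[OF m] by simp
qed

lemma indicator_mult_eq: "(x \<notin> G \<Longrightarrow> f x = 0) \<Longrightarrow> indicator G x * f x = (f x :: real)"
  by (cases "x \<in> G") auto

lemma L2_norm_sq_add_le: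
  "f \<in> L2 M \<Longrightarrow> g \<in> L2 M \<Longrightarrow> L2_norm_sq M (\<lambda>x. f x + g x) \<le> 2 * L2_norm_sq M f + 2 * L2_norm_sq M g"
  unfolding L2_iff_square_integrable by (rule square_integrable_add(2))

text \<open>Affine substitutions and Fubini are available for Borel functions on the whole space.
  Elements of \<open>L2\<close> on \<open>G\<close> are replaced by such functions, extended by
  zero.\<close>

lemma borel_representative:
  fixes f :: "'a::euclidean_space \<Rightarrow> real"
  assumes G: "G \<in> sets borel" and f: "f \<in> borel_measurable (lebesgue_on G)"
  obtains f0 where "f0 \<in> borel_measurable borel" "\<And>x. x \<notin> G \<Longrightarrow> f0 x = 0" "AE x in lebesgue_on G. f x = f0 x"
proof -
  have GS: "G \<in> sets lebesgue" using G by simp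
  have "(\<lambda>x. if x \<in> G then f x else 0) \<in> borel_measurable lebesgue"
    using borel_measurable_if_lebesgue_on[of G UNIV f] GS f by (simp add: lebesgue_on_UNIV_eq)
  then obtain f1 where f1: "f1 \<in> borel_measurable lborel" "AE x in lborel. (if x \<in> G then f x else 0) = f1 x"
    using completion_ex_borel_measurable_real by blast
  from f1 G have "(\<lambda>x. indicator G x * f1 x) \<in> borel_measurable borel" by measurable
  moreover have "AE x in lebesgue_on G. f x = indicator G x * f1 x"
  proof -
    have "AE x in lebesgue. (if x \<in> G then f x else 0) = f1 x" using f1(2) by (rule AE_completion)
    then have "AE x in lebesgue. x \<in> G \<longrightarrow> f x = indicator G x * f1 x" by eventually_elim auto
    then show ?thesis using GS by (subst AE_restrict_space_iff) auto
  qed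
  ultimately show ?thesis using that by fastforce
qed

lemma lmeasurable_bounded_open: "bounded G \<Longrightarrow> open G \<Longrightarrow> (G :: 'a::euclidean_space set) \<in> lmeasurable"
  by (rule lmeasurable_open)

lemma smooth_bounded_on:
  fixes f :: "'a::euclidean_space \<Rightarrow> real"
  assumes "smooth f" "bounded G"
  obtains B where "\<And>x. x \<in> G \<Longrightarrow> \<bar>f x\<bar> \<le> B"
proof -
  obtain R where R: "\<forall>x\<in>G. norm x \<le> R" using assms(2) unfolding bounded_iff by blast
  obtain M where M: "\<And>x. x \<in> cball 0 R \<Longrightarrow> \<bar>f x\<bar> \<le> M"
    using smooth_bounded_lipschitz_on_cball[OF assms(1), of R] by metis
  show ?thesis by (rule that[of M], rule M) (use R in simp)
qed

lemma borel_measurable_lebesgue_on: "f \<in> borel_measurable borel \<Longrightarrow> f \<in> borel_measurable (lebesgue_on G)"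
  for f :: "'a::euclidean_space \<Rightarrow> 'b::topological_space"
  by (intro measurable_restrict_space1 measurable_completion) simp

lemma smooth_L2_lebesgue_on:
  assumes "smooth f" "bounded G" "open G" shows "f \<in> L2 (lebesgue_on G)"
proof -
  obtain B where "\<And>x. x \<in> G \<Longrightarrow> \<bar>f x\<bar> \<le> B" using smooth_bounded_on[OF assms(1,2)] by metis
  then show ?thesis
    by (intro L2_bounded[OF finite_measure_lebesgue_on[OF lmeasurable_bounded_open[OF assms(2,3)]], of _ B])
      (auto intro: borel_measurable_lebesgue_on smooth_borel_measurable[OF assms(1)])
qed

lemma test_functions_support:
  assumes "\<phi> \<in> test_functions G" "x \<notin> G"
  shows "\<phi> x = 0" and "deriv_along b \<phi> x = 0"
proof -
  let ?S = "closure {x. \<phi> x \<noteq> 0}"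
  have S: "x \<notin> ?S" using assms by (auto simp: test_functions_def)
  have zero: "\<phi> y = 0" if "y \<notin> ?S" for y
    using that closure_subset[of "{x. \<phi> x \<noteq> 0}"] by blast
  show "\<phi> x = 0" by (rule zero[OF S])
  show "deriv_along b \<phi> x = 0"
  proof (rule deriv_along_eq)
    have "((\<lambda>x. 0) has_derivative (\<lambda>h. 0)) (at x)" by simp
    then show "(\<phi> has_derivative (\<lambda>h. 0)) (at x)"
    proof (rule has_derivative_transform_within_open[of _ _ _ _ "- ?S"])
      show "open (- ?S)" by (intro open_Compl closed_closure)
      show "x \<in> - ?S" using S by blast
      show "0 = \<phi> y" if "y \<in> - ?S" for y using zero[of y] that by simp
    qed
  qed
qed

lemma test_functions_mono: "G \<subseteq> G' \<Longrightarrow> test_functions G \<subseteq> test_functions G'"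
  by (auto simp: test_functions_def)

lemma AE_eq_0_lebesgue_on:
  fixes f :: "'a::euclidean_space \<Rightarrow> real"
  assumes G: "open G" "bounded G" and f: "f \<in> L2 (lebesgue_on G)"
    and test: "\<And>\<phi>. \<phi> \<in> test_functions G \<Longrightarrow> (\<integral>x. f x * \<phi> x \<partial>lebesgue_on G) = 0"
  shows "AE x in lebesgue_on G. f x = 0"
proof -
  have GB: "G \<in> sets borel" and GS: "G \<in> sets lebesgue" using G by auto
  have fin: "finite_measure (lebesgue_on G)" by (rule finite_measure_lebesgue_on[OF lmeasurable_bounded_open[OF G(2,1)]])
  obtain f0 where f0: "f0 \<in> borel_measurable borel" "\<And>x. x \<notin> G \<Longrightarrow> f0 x = 0" "AE x in lebesgue_on G. f x = f0 x"
    using borel_representative[OF GB L2_measurable[OF f]] by metis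
  have f0m: "f0 \<in> borel_measurable (lebesgue_on G)" by (rule borel_measurable_lebesgue_on[OF f0(1)])
  have ind: "indicator G x * f0 x = f0 x" for x by (rule indicator_mult_eq) (rule f0(2))
  have "integrable (lebesgue_on G) f0"
    using L2_integrable[OF fin L2_cong_AE[OF f f0m f0(3)]] .
  then have int: "integrable lborel f0" using integral_lebesgue_on_borel(2)[OF f0(1) GB] by (simp add: ind)
  have "AE x in lborel. x \<in> G \<longrightarrow> f0 x = 0"
  proof (rule AE_eq_0_if_integral_test_functions_eq_0[OF _ int G(1)])
    fix \<phi> assume \<phi>: "\<phi> \<in> test_functions G"
    have [measurable]: "\<phi> \<in> borel_measurable borel" by (rule smooth_borel_measurable[OF test_functions_smooth[OF \<phi>]])
    have [measurable]: "\<phi> \<in> borel_measurable (lebesgue_on G)" by (rule borel_measurable_lebesgue_on) simp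
    have [measurable]: "f \<in> borel_measurable (lebesgue_on G)" "f0 \<in> borel_measurable (lebesgue_on G)"
      using f0m L2_measurable[OF f] by auto
    have "(\<integral>x. f0 x * \<phi> x \<partial>lborel) = (\<integral>x. f0 x * \<phi> x \<partial>lebesgue_on G)"
      using f0(1) GB by (subst integral_lebesgue_on_borel) (auto simp: mult.assoc[symmetric] ind)
    also have "\<dots> = (\<integral>x. f x * \<phi> x \<partial>lebesgue_on G)"
      using f0(3) by (intro integral_cong_AE) auto
    finally show "(\<integral>x. f0 x * \<phi> x \<partial>lborel) = 0" using test[OF \<phi>] by simp
  qed simp
  then have "AE x in lebesgue_on G. f0 x = 0"
    using GS AE_completion by (subst AE_restrict_space_iff) auto
  with f0(3) show ?thesis by eventually_elim simp
qed

lemma weak_deriv: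
  assumes "has_L2_weak_deriv G b u"
  shows "weak_deriv G b u \<in> L2 (lebesgue_on G)" "is_weak_deriv G b u (weak_deriv G b u)"
proof -
  have "\<exists>g. g \<in> L2 (lebesgue_on G) \<and> is_weak_deriv G b u g"
    using assms by (auto simp: has_L2_weak_deriv_def)
  from someI_ex[OF this] show "weak_deriv G b u \<in> L2 (lebesgue_on G)" "is_weak_deriv G b u (weak_deriv G b u)"
    unfolding weak_deriv_def by auto
qed

lemma sobolevD:
  assumes "u \<in> sobolev D G"
  shows "u \<in> L2 (lebesgue_on G)" "b \<in> D \<Longrightarrow> weak_deriv G b u \<in> L2 (lebesgue_on G)"
    "b \<in> D \<Longrightarrow> is_weak_deriv G b u (weak_deriv G b u)"
  using assms by (auto simp: sobolev_def intro: weak_deriv)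

lemma test_function_L2:
  assumes "\<phi> \<in> test_functions G" "open G" "bounded G" "b \<in> Basis"
  shows "\<phi> \<in> L2 (lebesgue_on G)" "deriv_along b \<phi> \<in> L2 (lebesgue_on G)"
  using assms by (auto intro: smooth_L2_lebesgue_on smooth_deriv_along test_functions_smooth)

lemma is_weak_deriv_unique:
  assumes G: "open G" "bounded G" and b: "b \<in> Basis" and g: "g \<in> L2 (lebesgue_on G)" "g' \<in> L2 (lebesgue_on G)"
    and "is_weak_deriv G b u g" "is_weak_deriv G b u g'"
  shows "AE x in lebesgue_on G. g x = g' x"
proof -
  have "AE x in lebesgue_on G. g x - g' x = 0"
  proof (rule AE_eq_0_lebesgue_on[OF G L2_diff[OF g]])
    fix \<phi> assume \<phi>: "\<phi> \<in> test_functions G"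
    have "(\<integral>x. g x * \<phi> x \<partial>lebesgue_on G) = (\<integral>x. g' x * \<phi> x \<partial>lebesgue_on G)"
      using assms \<phi> unfolding is_weak_deriv_def by (metis neg_equal_iff_equal)
    then show "(\<integral>x. (g x - g' x) * \<phi> x \<partial>lebesgue_on G) = 0"
      using L2_mult_integrable[OF g(1) test_function_L2(1)[OF \<phi> G b]]
        L2_mult_integrable[OF g(2) test_function_L2(1)[OF \<phi> G b]]
      by (simp add: left_diff_distrib)
  qed
  then show ?thesis by eventually_elim simp
qed

text \<open>\<open>weak_deriv\<close> is a choice. Any square integrable weak derivative that can be
  exhibited identifies it up to null sets.\<close>

lemma weak_deriv_AE_eq:
  assumes G: "open G" "bounded G" and b: "b \<in> Basis" and g: "g \<in> L2 (lebesgue_on G)" "is_weak_deriv G b u g"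
  shows "has_L2_weak_deriv G b u" "AE x in lebesgue_on G. weak_deriv G b u x = g x"
proof -
  show h: "has_L2_weak_deriv G b u" using g by (auto simp: has_L2_weak_deriv_def)
  show "AE x in lebesgue_on G. weak_deriv G b u x = g x"
    using is_weak_deriv_unique[OF G b weak_deriv(1)[OF h] g(1) weak_deriv(2)[OF h] g(2)] .
qed

lemma is_weak_deriv_add:
  assumes G: "open G" "bounded G" and b: "b \<in> Basis"
    and "u \<in> L2 (lebesgue_on G)" "v \<in> L2 (lebesgue_on G)" "f \<in> L2 (lebesgue_on G)" "g \<in> L2 (lebesgue_on G)"
    and "is_weak_deriv G b u f" "is_weak_deriv G b v g"
  shows "is_weak_deriv G b (\<lambda>x. u x + v x) (\<lambda>x. f x + g x)"
  unfolding is_weak_deriv_def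
proof
  fix \<phi> assume \<phi>: "\<phi> \<in> test_functions G"
  note t = test_function_L2[OF \<phi> G b]
  show "(\<integral>x. (u x + v x) * deriv_along b \<phi> x \<partial>lebesgue_on G) = - (\<integral>x. (f x + g x) * \<phi> x \<partial>lebesgue_on G)"
    using assms \<phi> L2_mult_integrable[OF assms(4) t(2)] L2_mult_integrable[OF assms(5) t(2)]
      L2_mult_integrable[OF assms(6) t(1)] L2_mult_integrable[OF assms(7) t(1)]
    by (simp add: distrib_right is_weak_deriv_def)
qed

lemma sobolev_add:
  assumes G: "open G" "bounded G" and D: "D \<subseteq> Basis" and u: "u \<in> sobolev D G" and v: "v \<in> sobolev D G"
  shows "(\<lambda>x. u x + v x) \<in> sobolev D G"
    and "b \<in> D \<Longrightarrow> AE x in lebesgue_on G. weak_deriv G b (\<lambda>x. u x + v x) x = weak_deriv G b u x + weak_deriv G b v x"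
proof -
  have *: "has_L2_weak_deriv G b (\<lambda>x. u x + v x)"
    "AE x in lebesgue_on G. weak_deriv G b (\<lambda>x. u x + v x) x = weak_deriv G b u x + weak_deriv G b v x"
    if b: "b \<in> D" for b
  proof -
    have bB: "b \<in> Basis" using b D by auto
    have w: "is_weak_deriv G b (\<lambda>x. u x + v x) (\<lambda>x. weak_deriv G b u x + weak_deriv G b v x)"
      by (intro is_weak_deriv_add[OF G bB] sobolevD[OF u] sobolevD[OF v] b)
    show "has_L2_weak_deriv G b (\<lambda>x. u x + v x)"
      "AE x in lebesgue_on G. weak_deriv G b (\<lambda>x. u x + v x) x = weak_deriv G b u x + weak_deriv G b v x"
      using weak_deriv_AE_eq[OF G bB L2_add[OF sobolevD(2)[OF u b] sobolevD(2)[OF v b]] w] by auto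
  qed
  show "(\<lambda>x. u x + v x) \<in> sobolev D G"
    using * L2_add[OF sobolevD(1)[OF u] sobolevD(1)[OF v]] by (simp add: sobolev_def)
  show "b \<in> D \<Longrightarrow> AE x in lebesgue_on G. weak_deriv G b (\<lambda>x. u x + v x) x = weak_deriv G b u x + weak_deriv G b v x"
    using * by blast
qed

lemma L2_lebesgue_on_subset:
  assumes "open G" "open G'" "G' \<subseteq> G" "f \<in> L2 (lebesgue_on G)"
  shows "f \<in> L2 (lebesgue_on G')" "L2_norm_sq (lebesgue_on G') f \<le> L2_norm_sq (lebesgue_on G) f"
  using L2_restrict_space_mono[of lebesgue G f G'] assms by (auto simp: L2_iff_square_integrable)

lemma integral_lebesgue_on_subset:
  fixes f :: "'a::euclidean_space \<Rightarrow> real"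
  assumes "open G" "open G'" "G' \<subseteq> G" "\<And>x. x \<notin> G' \<Longrightarrow> f x = 0"
  shows "(\<integral>x. f x \<partial>lebesgue_on G') = (\<integral>x. f x \<partial>lebesgue_on G)"
proof -
  have s: "G \<inter> space lebesgue \<in> sets lebesgue" "G' \<inter> space lebesgue \<in> sets lebesgue" using assms by auto
  have "indicator G' x *\<^sub>R f x = indicator G x *\<^sub>R f x" for x
    using assms(3,4) by (auto simp: indicator_def)
  then show ?thesis unfolding integral_restrict_space[OF s(1)] integral_restrict_space[OF s(2)] by (simp only:)
qed

lemma is_weak_deriv_subset:
  assumes "open G" "open G'" "G' \<subseteq> G" "is_weak_deriv G b u g"
  shows "is_weak_deriv G' b u g"
  unfolding is_weak_deriv_def
proof
  fix \<phi> assume \<phi>: "\<phi> \<in> test_functions G'"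
  then have "\<phi> \<in> test_functions G" using test_functions_mono[OF assms(3)] by blast
  then show "(\<integral>x. u x * deriv_along b \<phi> x \<partial>lebesgue_on G') = - (\<integral>x. g x * \<phi> x \<partial>lebesgue_on G')"
    using assms(4) test_functions_support[OF \<phi>] unfolding is_weak_deriv_def
    by (subst (1 2) integral_lebesgue_on_subset[OF assms(1-3)]) auto
qed

text \<open>Test functions of \<open>G'\<close> are test functions of \<open>G\<close>, so weak
  derivatives restrict. The representatives chosen on the two sets agree almost everywhere
  only.\<close>

lemma sobolev_subset:
  assumes G: "open G" "open G'" "G' \<subseteq> G" "bounded G" and D: "D \<subseteq> Basis" and u: "u \<in> sobolev D G"
  shows "u \<in> sobolev D G'" and "b \<in> D \<Longrightarrow> AE x in lebesgue_on G'. weak_deriv G' b u x = weak_deriv G b u x"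
proof -
  have bd: "bounded G'" using G bounded_subset by blast
  have *: "has_L2_weak_deriv G' b u" "AE x in lebesgue_on G'. weak_deriv G' b u x = weak_deriv G b u x" if b: "b \<in> D" for b
    using weak_deriv_AE_eq[OF G(2) bd _ L2_lebesgue_on_subset(1)[OF G(1-3) sobolevD(2)[OF u b]]
        is_weak_deriv_subset[OF G(1-3) sobolevD(3)[OF u b]]] b D by auto
  then show "u \<in> sobolev D G'" using L2_lebesgue_on_subset(1)[OF G(1-3) sobolevD(1)[OF u]] by (simp add: sobolev_def)
  show "b \<in> D \<Longrightarrow> AE x in lebesgue_on G'. weak_deriv G' b u x = weak_deriv G b u x" using * by blast
qed

lemma is_weak_deriv_cong_AE:
  assumes "AE x in lebesgue_on G. u x = v x" "u \<in> borel_measurable (lebesgue_on G)" "v \<in> borel_measurable (lebesgue_on G)"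
    and b: "b \<in> Basis"
  shows "is_weak_deriv G b u g \<longleftrightarrow> is_weak_deriv G b v g"
proof -
  have "(\<integral>x. u x * deriv_along b \<phi> x \<partial>lebesgue_on G) = (\<integral>x. v x * deriv_along b \<phi> x \<partial>lebesgue_on G)"
    if "\<phi> \<in> test_functions G" for \<phi>
  proof -
    have "deriv_along b \<phi> \<in> borel_measurable (lebesgue_on G)"
      by (intro borel_measurable_lebesgue_on smooth_borel_measurable smooth_deriv_along b test_functions_smooth[OF that])
    then show ?thesis using assms by (intro integral_cong_AE) auto
  qed
  then show ?thesis by (simp add: is_weak_deriv_def)
qed

text \<open>The two derivatives are equal as functions: the predicate handed to the choice operator
  depends on the function only through integrals.\<close>

lemma sobolev_cong_AE:
  assumes "AE x in lebesgue_on G. u x = v x" "v \<in> borel_measurable (lebesgue_on G)" "D \<subseteq> Basis" "u \<in> sobolev D G"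
  shows "v \<in> sobolev D G" "b \<in> D \<Longrightarrow> weak_deriv G b v = weak_deriv G b u"
proof -
  note u = sobolevD(1)[OF assms(4)]
  have *: "is_weak_deriv G b u g \<longleftrightarrow> is_weak_deriv G b v g" if "b \<in> D" for b g
    using is_weak_deriv_cong_AE[OF assms(1) L2_measurable[OF u] assms(2), of b g] assms(3) that by auto
  show "v \<in> sobolev D G"
    using assms(4) L2_cong_AE[OF u assms(2,1)] * by (simp add: sobolev_def has_L2_weak_deriv_def)
  show "b \<in> D \<Longrightarrow> weak_deriv G b v = weak_deriv G b u"
    using * by (simp add: weak_deriv_def)
qed

subsection \<open>Averages over contracted copies\<close>

text \<open>An average of \<open>f\<close> composed with contractions towards the points
  \<open>y\<close>, weighted by \<open>\<beta>\<close>. If \<open>G\<close> is convex and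
  \<open>\<beta>\<close> lives in \<open>G\<close>, the arguments stay in \<open>G\<close> for every
  \<open>x\<close> of \<open>G\<close>. This replaces mollification, which would need values outside
  \<open>G\<close>.\<close>

definition dilation_average :: "('a::euclidean_space \<Rightarrow> real) \<Rightarrow> real \<Rightarrow> ('a \<Rightarrow> real) \<Rightarrow> 'a \<Rightarrow> real" where
  "dilation_average \<beta> t f x = (\<integral>y. \<beta> y * f ((1 - t) *\<^sub>R x + t *\<^sub>R y) \<partial>lborel)"

text \<open>The substitution \<open>w = (1 - t) x + t y\<close> moves \<open>x\<close> from the
  argument of \<open>f\<close> into the kernel, where it can be differentiated.\<close>

lemma dilation_average_eq_convolution:
  fixes f \<beta> :: "'a::euclidean_space \<Rightarrow> real"
  assumes [measurable]: "f \<in> borel_measurable borel" "\<beta> \<in> borel_measurable borel" and t: "t > 0"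
  shows "(\<integral>w. \<beta> ((1 / t) *\<^sub>R w + (- ((1 - t) / t)) *\<^sub>R x) * f w \<partial>lborel) = t ^ DIM('a) * dilation_average \<beta> t f x"
proof -
  have "(\<integral>w. \<beta> ((1 / t) *\<^sub>R w + (- ((1 - t) / t)) *\<^sub>R x) * f w \<partial>lborel) =
    \<bar>t\<bar> ^ DIM('a) * (\<integral>y. \<beta> ((1 / t) *\<^sub>R ((1 - t) *\<^sub>R x + t *\<^sub>R y) + (- ((1 - t) / t)) *\<^sub>R x) * f ((1 - t) *\<^sub>R x + t *\<^sub>R y) \<partial>lborel)"
    using t by (intro lborel_integral_affine(2)) auto
  moreover have "(1 / t) *\<^sub>R ((1 - t) *\<^sub>R x + t *\<^sub>R y) + (- ((1 - t) / t)) *\<^sub>R x = y" for y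
    using t by (simp add: scaleR_add_right)
  ultimately show ?thesis using t by (simp add: dilation_average_def)
qed

lemma smooth_dilation_average:
  fixes f \<beta> :: "'a::euclidean_space \<Rightarrow> real"
  assumes \<beta>: "smooth \<beta>" "\<And>x. x \<notin> cball 0 R \<Longrightarrow> \<beta> x = 0" and f: "f \<in> borel_measurable borel" "integrable lborel f" and t: "t > 0"
  shows "smooth (dilation_average \<beta> t f)"
    and "b \<in> Basis \<Longrightarrow> deriv_along b (dilation_average \<beta> t f) x = - ((1 - t) / t) * dilation_average (deriv_along b \<beta>) t f x"
proof -
  let ?C = "\<lambda>k x. \<integral>w. k ((1 / t) *\<^sub>R w + (- ((1 - t) / t)) *\<^sub>R x) * f w \<partial>lborel"
  have eq: "dilation_average k t f = (\<lambda>x. inverse (t ^ DIM('a)) * ?C k x)" if "smooth k" for k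
  proof
    fix x
    show "dilation_average k t f x = inverse (t ^ DIM('a)) * ?C k x"
      using t unfolding dilation_average_eq_convolution[OF f(1) smooth_borel_measurable[OF that] t] by simp
  qed
  have sm: "smooth (?C \<beta>)" by (rule smooth_convolution(1)[of \<beta> R, OF \<beta> f(2)])
  then show "smooth (dilation_average \<beta> t f)"
    unfolding eq[OF \<beta>(1)] by (intro smooth_mult smooth_const)
  assume b: "b \<in> Basis"
  have "deriv_along b (dilation_average \<beta> t f) x = inverse (t ^ DIM('a)) * deriv_along b (?C \<beta>) x"
    unfolding eq[OF \<beta>(1)] using deriv_along_mult[of "\<lambda>_. inverse (t ^ DIM('a))" x "?C \<beta>" b] smooth_differentiable[OF sm, of x]
      deriv_along_eq[of "\<lambda>_. inverse (t ^ DIM('a))" "\<lambda>_. 0" x b] by simp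
  also have "deriv_along b (?C \<beta>) x = - ((1 - t) / t) * ?C (deriv_along b \<beta>) x"
    by (rule smooth_convolution(2)[of \<beta> R, OF \<beta> f(2) b])
  also have "inverse (t ^ DIM('a)) * (- ((1 - t) / t) * ?C (deriv_along b \<beta>) x) = - ((1 - t) / t) * dilation_average (deriv_along b \<beta>) t f x"
    unfolding eq[OF smooth_deriv_along[OF \<beta>(1) b]] by (rule mult.left_commute)
  finally show "deriv_along b (dilation_average \<beta> t f) x = - ((1 - t) / t) * dilation_average (deriv_along b \<beta>) t f x" .
qed

lemma integrable_lborel_affine:
  fixes f :: "'a::euclidean_space \<Rightarrow> real"
  assumes c: "c \<noteq> 0" and f: "integrable lborel f" "f \<in> borel_measurable borel"
  shows "integrable lborel (\<lambda>x. f (a + c *\<^sub>R x))"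
proof (rule integrableI_bounded)
  have [measurable]: "f \<in> borel_measurable borel" by (rule f(2))
  show "(\<lambda>x. f (a + c *\<^sub>R x)) \<in> borel_measurable lborel" by measurable
  have "(\<integral>\<^sup>+x. ennreal (norm (f x)) \<partial>lborel) = ennreal (\<bar>c\<bar> ^ DIM('a)) * (\<integral>\<^sup>+x. ennreal (norm (f (a + c *\<^sub>R x))) \<partial>lborel)"
    by (rule lborel_integral_affine(1)[OF c]) measurable
  moreover have "(\<integral>\<^sup>+x. ennreal (norm (f x)) \<partial>lborel) < \<infinity>" using f(1) by (simp add: integrable_iff_bounded)
  ultimately show "(\<integral>\<^sup>+x. ennreal (norm (f (a + c *\<^sub>R x))) \<partial>lborel) < \<infinity>"
    using c by (auto simp: ennreal_mult_less_top)
qed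

text \<open>\<open>f\<close> is replaced by a continuous \<open>h\<close>. The error
  \<open>k\<close> is controlled because averaging is bounded in \<open>L2\<close> uniformly in
  \<open>t\<close>, as \<open>1 - t\<close> is at least 1/2. For \<open>h\<close> uniform continuity
  suffices: the contractions move points of \<open>G\<close> by at most
  \<open>2 R t\<close>.\<close>

lemma dilation_average_tendsto:
  fixes f \<beta> :: "'a::euclidean_space \<Rightarrow> real"
  assumes G: "open G" "convex G" "bounded G"
    and \<beta>: "smooth \<beta>" "\<And>y. 0 \<le> \<beta> y" "\<And>y. y \<notin> G \<Longrightarrow> \<beta> y = 0" "(\<integral>y. \<beta> y \<partial>lborel) = 1"
    and f: "f \<in> borel_measurable borel" "\<And>x. x \<notin> G \<Longrightarrow> f x = 0" "f \<in> L2 (lebesgue_on G)"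
    and t: "t \<longlonglongrightarrow> 0" "\<And>n. 0 < t n" "\<And>n. t n \<le> 1/2"
  shows "(\<lambda>n. L2_norm_sq (lebesgue_on G) (\<lambda>x. dilation_average \<beta> (t n) f x - f x)) \<longlonglongrightarrow> 0"
proof (rule LIMSEQ_I)
  fix e :: real assume e: "e > 0"
  have GB [measurable]: "G \<in> sets borel" using G by simp
  have Gm: "G \<in> lmeasurable" by (rule lmeasurable_bounded_open[OF G(3,1)])
  have fin: "finite_measure (lebesgue_on G)" by (rule finite_measure_lebesgue_on[OF Gm])
  have [measurable]: "f \<in> borel_measurable borel" "\<beta> \<in> borel_measurable borel"
    using f smooth_borel_measurable[OF \<beta>(1)] by auto
  have int\<beta>: "integrable lborel \<beta>" using \<beta>(4) not_integrable_integral_eq by fastforce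
  obtain R where R: "R > 0" "\<And>x. x \<in> G \<Longrightarrow> norm x \<le> R" using G(3) bounded_pos by metis
  have supp: "\<beta> x = 0" if "x \<notin> cball 0 R" for x using that R(2) \<beta>(3) by force
  define m where "m = measure (lebesgue_on G) G"
  have m0: "m \<ge> 0" by (simp add: m_def)
  \<comment> \<open>The total weight of the squared norm of \<open>k\<close> in the final estimate:
    \<open>2 * 2 ^ DIM\<close> from its average and 4 from \<open>k\<close> itself.\<close>
  define C where "C = 2 * 2 ^ DIM('a) + (4::real)"
  have C: "C > 0" by (simp add: C_def add_pos_pos)
  \<comment> \<open>The tolerance for \<open>h\<close>, entering as four times its square times the
    measure of \<open>G\<close>. Using \<open>m + 1\<close> keeps the quotient defined for every
    \<open>m\<close>.\<close>
  define \<eta> where "\<eta> = sqrt (e / (8 * (m + 1)))"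
  have \<eta>: "\<eta> > 0" "4 * (\<eta>\<^sup>2 * m) \<le> e / 2"
  proof -
    show "\<eta> > 0" using e m0 by (simp add: \<eta>_def)
    have "\<eta>\<^sup>2 = e / (8 * (m + 1))" using e m0 by (simp add: \<eta>_def)
    then have "4 * (\<eta>\<^sup>2 * m) = (e / 2) * (m / (m + 1))" using m0 by (simp add: field_simps)
    also have "\<dots> \<le> (e / 2) * 1" using e m0 by (intro mult_left_mono) auto
    finally show "4 * (\<eta>\<^sup>2 * m) \<le> e / 2" by simp
  qed
  obtain h where h: "continuous_on UNIV h" "h \<in> L2 (lebesgue_on G)" "L2_norm_sq (lebesgue_on G) (\<lambda>x. f x - h x) < e / (2 * C)"
    using L2_approx_continuous[OF Gm f(3), of "e / (2 * C)"] e C by auto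
  have [measurable]: "h \<in> borel_measurable borel" using h(1) by (simp add: borel_measurable_continuous_onI)
  have "uniformly_continuous_on (cball 0 R) h"
    by (intro compact_uniformly_continuous continuous_on_subset[OF h(1)]) auto
  then obtain \<delta> where \<delta>: "\<delta> > 0" "\<And>x y. x \<in> cball 0 R \<Longrightarrow> y \<in> cball 0 R \<Longrightarrow> dist x y < \<delta> \<Longrightarrow> dist (h x) (h y) < \<eta>"
    unfolding uniformly_continuous_on_def using \<eta>(1) by meson
  define k where "k x = f x - indicator G x * h x" for x
  have km [measurable]: "k \<in> borel_measurable borel" unfolding k_def[abs_def] by measurable
  have kG: "k x = 0" if "x \<notin> G" for x using that f(2) by (simp add: k_def)
  have kL2: "L2_norm_sq (lebesgue_on G) k = L2_norm_sq (lebesgue_on G) (\<lambda>x. f x - h x)" "k \<in> L2 (lebesgue_on G)"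
  proof -
    have ae: "AE x in lebesgue_on G. f x - h x = k x" by (rule AE_I2) (simp add: k_def)
    have k: "k \<in> borel_measurable (lebesgue_on G)" by (rule borel_measurable_lebesgue_on[OF km])
    show "L2_norm_sq (lebesgue_on G) k = L2_norm_sq (lebesgue_on G) (\<lambda>x. f x - h x)"
      using L2_norm_sq_cong_AE[OF L2_measurable[OF L2_diff[OF f(3) h(2)]] k ae] by simp
    show "k \<in> L2 (lebesgue_on G)" by (rule L2_cong_AE[OF L2_diff[OF f(3) h(2)] k ae])
  qed
  have int_ext: "integrable lborel g" if "g \<in> L2 (lebesgue_on G)" "\<And>x. x \<notin> G \<Longrightarrow> g x = 0" and [measurable]: "g \<in> borel_measurable borel" for g
  proof -
    have *: "indicator G x * g x = g x" for x by (rule indicator_mult_eq) (rule that(2))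
    show ?thesis using L2_integrable[OF fin that(1)] integral_lebesgue_on_borel(2)[OF that(3) GB] by (simp only: *)
  qed
  have intf: "integrable lborel f" by (intro int_ext f) auto
  have intk: "integrable lborel k" by (rule int_ext[OF kL2(2) kG km])
  obtain B where B: "\<And>x. \<bar>\<beta> x\<bar> \<le> B" using smooth_compact_support_bounded[OF \<beta>(1) supp] by metis
  obtain N where N: "\<And>n. n \<ge> N \<Longrightarrow> t n < \<delta> / (2 * R)"
  proof -
    have "\<forall>\<^sub>F n in sequentially. t n < \<delta> / (2 * R)" using t(1) \<delta>(1) R(1) by (intro order_tendstoD(2)) auto
    then show ?thesis using that eventually_sequentially by auto
  qed
  have "L2_norm_sq (lebesgue_on G) (\<lambda>x. dilation_average \<beta> (t n) f x - f x) < e" if n: "n \<ge> N" for n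
  proof -
    let ?t = "t n"
    let ?A = "dilation_average \<beta> ?t"
    have tn: "0 < ?t" "1 - ?t > 0" "1 - ?t \<ge> 1/2" using t(2,3)[of n] by auto
    have sm: "smooth (?A f)" "smooth (?A k)"
      using smooth_dilation_average(1)[of \<beta> R, OF \<beta>(1) supp _ intf tn(1)] smooth_dilation_average(1)[of \<beta> R, OF \<beta>(1) supp _ intk tn(1)]
      by auto
    have ib: "integrable lborel (\<lambda>y. \<beta> y * g ((1 - ?t) *\<^sub>R x + ?t *\<^sub>R y))"
      if "integrable lborel g" "g \<in> borel_measurable borel" for g x
      using tn B by (intro integrable_mult_bounded[OF integrable_lborel_affine[OF _ that]]) auto
    have L2k: "L2_norm_sq (lebesgue_on G) (?A k) \<le> 2 ^ DIM('a) * L2_norm_sq (lebesgue_on G) k"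
    proof -
      have eqk: "(\<integral>\<^sup>+x. ennreal ((k x)\<^sup>2) \<partial>lborel) = ennreal (L2_norm_sq (lebesgue_on G) k)"
      proof -
        have *: "indicator G x * (k x)\<^sup>2 = (k x)\<^sup>2" for x by (rule indicator_mult_eq) (simp add: kG)
        have "integrable lborel (\<lambda>x. (k x)\<^sup>2)"
          using kL2(2) integral_lebesgue_on_borel(2)[of "\<lambda>x. (k x)\<^sup>2" G] by (simp add: L2_def *)
        then have "(\<integral>\<^sup>+x. ennreal ((k x)\<^sup>2) \<partial>lborel) = ennreal (\<integral>x. (k x)\<^sup>2 \<partial>lborel)"
          by (intro nn_integral_eq_integral) auto
        also have "(\<integral>x. (k x)\<^sup>2 \<partial>lborel) = L2_norm_sq (lebesgue_on G) k"
          using integral_lebesgue_on_borel(1)[of "\<lambda>x. (k x)\<^sup>2" G] by (simp add: L2_norm_sq_def *)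
        finally show ?thesis .
      qed
      have [measurable]: "?A k \<in> borel_measurable borel" by (rule smooth_borel_measurable[OF sm(2)])
      have "?A k \<in> L2 (lebesgue_on G)" by (rule smooth_L2_lebesgue_on[OF sm(2) G(3,1)])
      then have "integrable lborel (\<lambda>x. indicator G x * (?A k x)\<^sup>2)"
        using integral_lebesgue_on_borel(2)[of "\<lambda>x. (?A k x)\<^sup>2" G] by (simp add: L2_def)
      then have "ennreal (L2_norm_sq (lebesgue_on G) (?A k)) = (\<integral>\<^sup>+x. ennreal (indicator G x * (?A k x)\<^sup>2) \<partial>lborel)"
        using integral_lebesgue_on_borel(1)[of "\<lambda>x. (?A k x)\<^sup>2" G]
        by (subst nn_integral_eq_integral) (auto simp: L2_norm_sq_def)
      also have "\<dots> \<le> (\<integral>\<^sup>+x. ennreal ((?A k x)\<^sup>2) \<partial>lborel)"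
        by (intro nn_integral_mono ennreal_leI) (auto simp: indicator_def)
      also have "\<dots> \<le> ennreal ((1 / (1 - ?t)) ^ DIM('a)) * (\<integral>\<^sup>+x. ennreal ((k x)\<^sup>2) \<partial>lborel)"
        unfolding dilation_average_def using \<beta> int\<beta> tn by (intro averaging_L2_bound) auto
      also have "\<dots> = ennreal ((1 / (1 - ?t)) ^ DIM('a) * L2_norm_sq (lebesgue_on G) k)"
        unfolding eqk using tn by (subst ennreal_mult) auto
      finally have "L2_norm_sq (lebesgue_on G) (?A k) \<le> (1 / (1 - ?t)) ^ DIM('a) * L2_norm_sq (lebesgue_on G) k"
        using tn by (subst (asm) ennreal_le_iff) auto
      also have "\<dots> \<le> 2 ^ DIM('a) * L2_norm_sq (lebesgue_on G) k"
      proof (intro mult_right_mono power_mono)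
        show "1 / (1 - ?t) \<le> 2" using tn by (simp add: divide_le_eq)
      qed (use tn in auto)
      finally show ?thesis .
    qed
    \<comment> \<open>As \<open>\<beta>\<close> has mass one, the difference is an average of
      \<open>h z - h x\<close> over points \<open>z\<close> that lie in \<open>G\<close> by
      convexity and are close to \<open>x\<close>.\<close>
    have close: "\<bar>?A f x - ?A k x - h x\<bar> \<le> \<eta>" if x: "x \<in> G" for x
    proof -
      have 1: "?A f x - ?A k x - h x = (\<integral>y. \<beta> y * (indicator G ((1 - ?t) *\<^sub>R x + ?t *\<^sub>R y) * h ((1 - ?t) *\<^sub>R x + ?t *\<^sub>R y) - h x) \<partial>lborel)"
      proof -
        have "?A f x - ?A k x - h x = (\<integral>y. (\<beta> y * f ((1 - ?t) *\<^sub>R x + ?t *\<^sub>R y) - \<beta> y * k ((1 - ?t) *\<^sub>R x + ?t *\<^sub>R y)) - \<beta> y * h x \<partial>lborel)"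
          using ib[OF intf, of x] ib[OF intk, of x] int\<beta> \<beta>(4)
          by (simp add: dilation_average_def)
        also have "\<dots> = (\<integral>y. \<beta> y * (indicator G ((1 - ?t) *\<^sub>R x + ?t *\<^sub>R y) * h ((1 - ?t) *\<^sub>R x + ?t *\<^sub>R y) - h x) \<partial>lborel)"
          by (intro Bochner_Integration.integral_cong refl) (simp add: k_def algebra_simps)
        finally show ?thesis .
      qed
      have pt: "\<bar>\<beta> y * (indicator G ((1 - ?t) *\<^sub>R x + ?t *\<^sub>R y) * h ((1 - ?t) *\<^sub>R x + ?t *\<^sub>R y) - h x)\<bar> \<le> \<eta> * \<beta> y" for y
      proof (cases "y \<in> G")
        case True
        let ?z = "(1 - ?t) *\<^sub>R x + ?t *\<^sub>R y"
        have z: "?z \<in> G" using G(2) x True tn by (auto simp: convex_alt)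
        have "?z - x = ?t *\<^sub>R (y - x)" by (simp add: algebra_simps)
        then have "dist ?z x = ?t * norm (y - x)" using tn by (simp add: dist_norm)
        also have "\<dots> \<le> ?t * (2 * R)"
          using tn norm_triangle_ineq4[of y x] R(2)[OF x] R(2)[OF True] by (intro mult_left_mono) auto
        also have "\<dots> < \<delta>" using N[OF n] R(1) by (simp add: field_simps)
        finally have "dist (h ?z) (h x) < \<eta>" using R(2)[OF z] R(2)[OF x] by (intro \<delta>(2)) auto
        then have "\<beta> y * \<bar>h ?z - h x\<bar> \<le> \<beta> y * \<eta>" using \<beta>(2) by (intro mult_left_mono) (auto simp: dist_real_def)
        then show ?thesis using z \<beta>(2)[of y] by (simp add: abs_mult mult.commute)
      qed (use \<beta>(3) in simp)
      have "\<bar>\<integral>y. \<beta> y * (indicator G ((1 - ?t) *\<^sub>R x + ?t *\<^sub>R y) * h ((1 - ?t) *\<^sub>R x + ?t *\<^sub>R y) - h x) \<partial>lborel\<bar> \<le> (\<integral>y. \<eta> * \<beta> y \<partial>lborel)"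
      proof (rule integral_abs_bound_integral)
        show i: "integrable lborel (\<lambda>y. \<eta> * \<beta> y)" using int\<beta> by simp
        show "integrable lborel (\<lambda>y. \<beta> y * (indicator G ((1 - ?t) *\<^sub>R x + ?t *\<^sub>R y) * h ((1 - ?t) *\<^sub>R x + ?t *\<^sub>R y) - h x))"
          by (rule Bochner_Integration.integrable_bound[OF i], measurable) (use pt in \<open>auto intro!: AE_I2 intro: order_trans[OF _ abs_ge_self]\<close>)
      qed (rule pt)
      then show ?thesis unfolding 1 using \<beta>(4) by simp
    qed
    have AfL2: "?A f \<in> L2 (lebesgue_on G)" "?A k \<in> L2 (lebesgue_on G)"
      by (intro smooth_L2_lebesgue_on sm G)+
    have bL2: "(\<lambda>x. ?A f x - ?A k x - h x) \<in> L2 (lebesgue_on G)"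
      by (intro L2_diff AfL2 h)
    have bb: "L2_norm_sq (lebesgue_on G) (\<lambda>x. ?A f x - ?A k x - h x) \<le> \<eta>\<^sup>2 * m"
    proof -
      have "L2_norm_sq (lebesgue_on G) (\<lambda>x. ?A f x - ?A k x - h x) \<le> (\<integral>x. \<eta>\<^sup>2 \<partial>lebesgue_on G)"
        unfolding L2_norm_sq_def
      proof (rule integral_mono_AE)
        show "AE x in lebesgue_on G. (norm (?A f x - ?A k x - h x))\<^sup>2 \<le> \<eta>\<^sup>2"
          using close by (intro AE_I2 power_mono) auto
      qed (use bL2 fin in \<open>auto simp: L2_def finite_measure.integrable_const\<close>)
      then show ?thesis by (simp add: m_def mult.commute)
    qed
    have "L2_norm_sq (lebesgue_on G) (\<lambda>x. ?A k x + ((?A f x - ?A k x - h x) + (h x - f x)))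
      \<le> 2 * L2_norm_sq (lebesgue_on G) (?A k) + 2 * L2_norm_sq (lebesgue_on G) (\<lambda>x. (?A f x - ?A k x - h x) + (h x - f x))"
      by (rule L2_norm_sq_add_le[OF AfL2(2) L2_add[OF bL2 L2_diff[OF h(2) f(3)]]])
    also have "L2_norm_sq (lebesgue_on G) (\<lambda>x. (?A f x - ?A k x - h x) + (h x - f x)) \<le>
      2 * L2_norm_sq (lebesgue_on G) (\<lambda>x. ?A f x - ?A k x - h x) + 2 * L2_norm_sq (lebesgue_on G) (\<lambda>x. h x - f x)"
      by (rule L2_norm_sq_add_le[OF bL2 L2_diff[OF h(2) f(3)]])
    also have "L2_norm_sq (lebesgue_on G) (\<lambda>x. h x - f x) = L2_norm_sq (lebesgue_on G) k"
      unfolding kL2(1) by (rule L2_norm_sq_diff_commute)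
    finally have "L2_norm_sq (lebesgue_on G) (\<lambda>x. ?A f x - f x) \<le>
       2 * (2 ^ DIM('a) * L2_norm_sq (lebesgue_on G) k) + 2 * (2 * (\<eta>\<^sup>2 * m) + 2 * L2_norm_sq (lebesgue_on G) k)"
      using L2k bb by (simp add: algebra_simps)
    also have "\<dots> = C * L2_norm_sq (lebesgue_on G) k + 4 * (\<eta>\<^sup>2 * m)" by (simp add: C_def algebra_simps)
    also have "\<dots> < e / 2 + e / 2"
    proof (intro add_less_le_mono \<eta>(2))
      have "C * L2_norm_sq (lebesgue_on G) k < C * (e / (2 * C))" using h(3) C kL2(1) by (intro mult_strict_left_mono) auto
      then show "C * L2_norm_sq (lebesgue_on G) k < e / 2" using C by simp
    qed
    finally show ?thesis by simp
  qed
  then show "\<exists>no. \<forall>n\<ge>no. norm (L2_norm_sq (lebesgue_on G) (\<lambda>x. dilation_average \<beta> (t n) f x - f x) - 0) < e"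
    by (auto intro!: exI[of _ N])
qed

text \<open>For \<open>x\<close> in \<open>G\<close> the kernel, as a function of the integration
  variable, is supported in a contracted copy of a closed box in \<open>G\<close> and so is a test
  function. Hence the weak derivative passes through the average without boundary terms, and
  convergence of derivatives is convergence of averages.\<close>

lemma sobolev_smooth_approximation:
  fixes u :: "'a::euclidean_space \<Rightarrow> real"
  assumes G: "open G" "convex G" "bounded G" "G \<noteq> {}" and u: "u \<in> sobolev Basis G"
  obtains \<phi> where "\<And>n. smooth (\<phi> n)"
    "(\<lambda>n. L2_norm_sq (lebesgue_on G) (\<lambda>x. \<phi> n x - u x)) \<longlonglongrightarrow> 0"
    "\<And>b. b \<in> Basis \<Longrightarrow> (\<lambda>n. L2_norm_sq (lebesgue_on G) (\<lambda>x. deriv_along b (\<phi> n) x - weak_deriv G b u x)) \<longlonglongrightarrow> 0"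
proof -
  have GB [measurable]: "G \<in> sets borel" using G by simp
  have Gm: "G \<in> lmeasurable" by (rule lmeasurable_bounded_open[OF G(3,1)])
  have fin: "finite_measure (lebesgue_on G)" by (rule finite_measure_lebesgue_on[OF Gm])
  obtain R where R: "R > 0" "\<And>x. x \<in> G \<Longrightarrow> norm x \<le> R" using G(3) bounded_pos by metis
  obtain x0 where "x0 \<in> G" using G(4) by blast
  then obtain l w where lw: "cbox l w \<subseteq> G" "x0 \<in> box l w" using open_contains_cbox[OF G(1)] by metis
  define Z where "Z = (\<integral>y. bump l w 1 y \<partial>lborel)"
  have bsm: "smooth (bump l w 1)" by (rule smooth_bump)
  have b0: "bump l w 1 x = 0" if "x \<notin> G" for x
    using that bump_nonzero_iff[of 1 l w x] lw(1) box_subset_cbox[of l w] by auto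
  have [measurable]: "bump l w 1 \<in> borel_measurable borel" by (rule smooth_borel_measurable[OF bsm])
  have bint: "integrable lborel (bump l w 1)"
  proof (rule Bochner_Integration.integrable_bound)
    show "integrable lborel (indicator (cbox l w) :: 'a \<Rightarrow> real)"
      using emeasure_lborel_cbox_finite[of l w] by (intro integrable_real_indicator) auto
    show "AE x in lborel. norm (bump l w 1 x) \<le> norm (indicator (cbox l w) x :: real)"
    proof (intro AE_I2)
      fix x
      show "norm (bump l w 1 x) \<le> norm (indicator (cbox l w) x :: real)"
        using bump_nonneg[of l w 1 x] bump_le_1[of l w 1 x] bump_nonzero_iff[of 1 l w x] box_subset_cbox[of l w]
        by (cases "x \<in> box l w") auto
    qed
  qed measurable
  have Z: "Z > 0"
  proof -
    have "Z \<noteq> 0"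
    proof
      assume "Z = 0"
      moreover have "AE x in lborel. 0 \<le> bump l w 1 x" by (simp add: bump_nonneg)
      ultimately have "AE x in lborel. bump l w 1 x = 0"
        unfolding Z_def using integral_nonneg_eq_0_iff_AE[OF bint] by simp
      then have "AE x in lborel. x \<notin> box l w" by eventually_elim (use bump_nonzero_iff[of 1 l w] in auto)
      then have "box l w \<in> null_sets lborel" by (subst (asm) AE_iff_null) auto
      then have "negligible (box l w)" by (simp add: negligible_iff_null_sets null_sets_completionI)
      then show False using lw(2) open_not_negligible[OF open_box, of l w] by blast
    qed
    moreover have "Z \<ge> 0" unfolding Z_def by (intro integral_nonneg_AE AE_I2 bump_nonneg)
    ultimately show ?thesis by simp
  qed
  define \<beta> where "\<beta> y = inverse Z * bump l w 1 y" for y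
  have \<beta>: "smooth \<beta>" "\<And>y. 0 \<le> \<beta> y" "\<And>y. y \<notin> G \<Longrightarrow> \<beta> y = 0" "(\<integral>y. \<beta> y \<partial>lborel) = 1"
    unfolding \<beta>_def[abs_def] using Z b0 bump_nonneg[of l w 1] Z_def
    by (auto intro!: smooth_mult smooth_bump)
  have supp: "\<beta> x = 0" if "x \<notin> cball 0 R" for x using that R(2) \<beta>(3) by force
  have [measurable]: "\<beta> \<in> borel_measurable borel" by (rule smooth_borel_measurable[OF \<beta>(1)])
  define t where "t n = 1 / (real n + 2)" for n
  have t: "t \<longlonglongrightarrow> 0" "0 < t n" "t n \<le> 1/2" for n
  proof -
    have "filterlim (\<lambda>n. real n + 2) at_top sequentially"
      by (subst add.commute) (intro filterlim_tendsto_add_at_top[OF tendsto_const] filterlim_real_sequentially)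
    then show "t \<longlonglongrightarrow> 0" unfolding t_def[abs_def] by (rule real_tendsto_divide_at_top[OF tendsto_const])
  qed (auto simp: t_def field_simps)
  note uL2 = sobolevD[OF u]
  obtain u0 where u0: "u0 \<in> borel_measurable borel" "\<And>x. x \<notin> G \<Longrightarrow> u0 x = 0" "AE x in lebesgue_on G. u x = u0 x"
    using borel_representative[OF GB L2_measurable[OF uL2(1)]] by metis
  have u0m: "u0 \<in> borel_measurable (lebesgue_on G)" by (rule borel_measurable_lebesgue_on[OF u0(1)])
  have u0L2: "u0 \<in> L2 (lebesgue_on G)" by (rule L2_cong_AE[OF uL2(1) u0m u0(3)])
  have ext: "indicator G x * g x = g x" if "\<And>x. x \<notin> G \<Longrightarrow> g x = 0" for g :: "'a \<Rightarrow> real" and x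
    by (rule indicator_mult_eq) (rule that)
  have u0int: "integrable lborel u0"
    using L2_integrable[OF fin u0L2] integral_lebesgue_on_borel(2)[OF u0(1) GB] ext[of u0, OF u0(2)] by simp
  define \<phi> where "\<phi> n = dilation_average \<beta> (t n) u0" for n
  have sm: "smooth (\<phi> n)" for n
    unfolding \<phi>_def by (rule smooth_dilation_average(1)[of \<beta> R, OF \<beta>(1) supp u0(1) u0int t(2)])
  have lim0: "(\<lambda>n. L2_norm_sq (lebesgue_on G) (\<lambda>x. \<phi> n x - u x)) \<longlonglongrightarrow> 0"
  proof -
    have "L2_norm_sq (lebesgue_on G) (\<lambda>x. \<phi> n x - u x) = L2_norm_sq (lebesgue_on G) (\<lambda>x. \<phi> n x - u0 x)" for n
      using u0(3) L2_measurable[OF L2_diff[OF smooth_L2_lebesgue_on[OF sm G(3,1)] uL2(1)]]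
        L2_measurable[OF L2_diff[OF smooth_L2_lebesgue_on[OF sm G(3,1)] u0L2]]
      by (intro L2_norm_sq_cong_AE) auto
    then show ?thesis
      unfolding \<phi>_def using dilation_average_tendsto[OF G(1-3) \<beta> u0(1,2) u0L2 t] by simp
  qed
  have lim1: "(\<lambda>n. L2_norm_sq (lebesgue_on G) (\<lambda>x. deriv_along b (\<phi> n) x - weak_deriv G b u x)) \<longlonglongrightarrow> 0"
    if b: "b \<in> Basis" for b
  proof -
    define g where "g = weak_deriv G b u"
    have gL2: "g \<in> L2 (lebesgue_on G)" and gw: "is_weak_deriv G b u g"
      unfolding g_def using uL2(2,3) b by auto
    obtain g0 where g0: "g0 \<in> borel_measurable borel" "\<And>x. x \<notin> G \<Longrightarrow> g0 x = 0" "AE x in lebesgue_on G. g x = g0 x"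
      using borel_representative[OF GB L2_measurable[OF gL2]] by metis
    have g0m: "g0 \<in> borel_measurable (lebesgue_on G)" by (rule borel_measurable_lebesgue_on[OF g0(1)])
    have g0L2: "g0 \<in> L2 (lebesgue_on G)" by (rule L2_cong_AE[OF gL2 g0m g0(3)])
    have g0int: "integrable lborel g0"
      using L2_integrable[OF fin g0L2] integral_lebesgue_on_borel(2)[OF g0(1) GB] ext[of g0, OF g0(2)] by simp
    have to_borel: "(\<integral>x. f x * k x \<partial>lebesgue_on G) = (\<integral>x. k x * f0 x \<partial>lborel)"
      if [measurable]: "k \<in> borel_measurable borel" and f0: "f0 \<in> borel_measurable borel" "\<And>x. x \<notin> G \<Longrightarrow> f0 x = 0"
        and f: "f \<in> borel_measurable (lebesgue_on G)" "AE x in lebesgue_on G. f x = f0 x" for f f0 k :: "'a \<Rightarrow> real"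
    proof -
      have [measurable]: "f \<in> borel_measurable (lebesgue_on G)" by (rule f(1))
      have [measurable]: "k \<in> borel_measurable (lebesgue_on G)" "f0 \<in> borel_measurable (lebesgue_on G)"
        by (intro borel_measurable_lebesgue_on that f0)+
      have "(\<integral>x. f x * k x \<partial>lebesgue_on G) = (\<integral>x. f0 x * k x \<partial>lebesgue_on G)"
        using f(2) by (intro integral_cong_AE) auto
      also have "\<dots> = (\<integral>x. k x * f0 x \<partial>lborel)"
      proof -
        have e: "indicator G x * (f0 x * k x) = k x * f0 x" for x
        proof -
          have "indicator G x * f0 x = f0 x" by (rule indicator_mult_eq) (rule f0(2))
          then show ?thesis by (simp only: mult.assoc[symmetric] mult.commute[of "k x"])
        qed
        have "(\<lambda>x. f0 x * k x) \<in> borel_measurable borel" using f0(1) by measurable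
        from integral_lebesgue_on_borel(1)[OF this GB] show ?thesis by (simp only: e)
      qed
      finally show ?thesis .
    qed
    \<comment> \<open>The kernel scales with \<open>1 / t\<close> in \<open>w\<close> and with
      \<open>- (1 - t) / t\<close> in \<open>x\<close>. Testing the weak derivative uses the first
      factor, differentiating the average the second; their quotient leaves
      \<open>1 - t\<close>.\<close>
    have der: "deriv_along b (\<phi> n) x = (1 - t n) * dilation_average \<beta> (t n) g0 x" if x: "x \<in> G" for n x
    proof -
      let ?t = "t n"
      have tn: "0 < ?t" "?t \<noteq> 0" "?t \<le> 1/2" using t(2)[of n] t(3)[of n] by auto
      let ?z = "(- ((1 - ?t) / ?t)) *\<^sub>R x"
      define \<psi> where "\<psi> w = \<beta> ((1 / ?t) *\<^sub>R w + ?z)" for w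
      have \<psi>s: "smooth \<psi>" unfolding \<psi>_def[abs_def] by (rule smooth_comp_affine[OF \<beta>(1)])
      have d\<psi>: "deriv_along b \<psi> w = (1 / ?t) * deriv_along b \<beta> ((1 / ?t) *\<^sub>R w + ?z)" for w
        unfolding \<psi>_def[abs_def] by (rule deriv_along_comp_affine) (rule smooth_differentiable[OF \<beta>(1)])
      have \<psi>t: "\<psi> \<in> test_functions G"
      proof -
        \<comment> \<open>The support box of the bump contracted towards \<open>x\<close>; it is
          compact, and convexity keeps it in \<open>G\<close>.\<close>
        let ?S = "(\<lambda>y. (1 - ?t) *\<^sub>R x + ?t *\<^sub>R y) ` cbox l w"
        have cS: "compact ?S" by (intro compact_continuous_image continuous_intros compact_cbox)
        have SG: "?S \<subseteq> G"
        proof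
          fix z assume "z \<in> ?S"
          then obtain y where "y \<in> cbox l w" "z = (1 - ?t) *\<^sub>R x + ?t *\<^sub>R y" by blast
          then show "z \<in> G" using G(2) x lw(1) tn by (auto simp: convex_alt)
        qed
        have "{w. \<psi> w \<noteq> 0} \<subseteq> ?S"
        proof
          fix v assume "v \<in> {w. \<psi> w \<noteq> 0}"
          then have "(1 / ?t) *\<^sub>R v + ?z \<in> cbox l w"
            using bump_nonzero_iff[of 1 l w] box_subset_cbox[of l w] by (auto simp: \<psi>_def \<beta>_def)
          moreover have "v = (1 - ?t) *\<^sub>R x + ?t *\<^sub>R ((1 / ?t) *\<^sub>R v + ?z)"
          proof -
            have "?t * (- ((1 - ?t) / ?t)) = - (1 - ?t)" "?t * (1 / ?t) = 1" using tn(2) by (simp_all add: field_simps)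
            then show ?thesis unfolding scaleR_add_right scaleR_scaleR by (simp only: scaleR_minus_left scaleR_one) simp
          qed
          ultimately show "v \<in> ?S" by blast
        qed
        then have cl: "closure {w. \<psi> w \<noteq> 0} \<subseteq> ?S" by (intro closure_minimal compact_imp_closed cS)
        then have "compact (closure {w. \<psi> w \<noteq> 0})" using cS compact_imp_bounded bounded_subset compact_eq_bounded_closed closed_closure by metis
        then show ?thesis using \<psi>s cl SG by (auto simp: test_functions_def)
      qed
      have "(\<integral>w. deriv_along b \<psi> w * u0 w \<partial>lborel) = - (\<integral>w. \<psi> w * g0 w \<partial>lborel)"
        using gw \<psi>t to_borel[OF _ u0(1,2) L2_measurable[OF uL2(1)] u0(3), of "deriv_along b \<psi>"]
          to_borel[OF _ g0(1,2) L2_measurable[OF gL2] g0(3), of \<psi>] smooth_borel_measurable[OF \<psi>s]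
          smooth_borel_measurable[OF smooth_deriv_along[OF \<psi>s b]]
        by (simp add: is_weak_deriv_def)
      moreover have "(\<integral>w. \<psi> w * g0 w \<partial>lborel) = ?t ^ DIM('a) * dilation_average \<beta> ?t g0 x"
        unfolding \<psi>_def by (rule dilation_average_eq_convolution[OF g0(1) _ tn(1)]) measurable
      moreover have "(\<integral>w. deriv_along b \<psi> w * u0 w \<partial>lborel) = (1 / ?t) * (?t ^ DIM('a) * dilation_average (deriv_along b \<beta>) ?t u0 x)"
        unfolding d\<psi> mult.assoc
        by (subst dilation_average_eq_convolution[OF u0(1) _ tn(1), symmetric])
          (auto intro: smooth_borel_measurable smooth_deriv_along \<beta>(1) b)
      ultimately have "(1 / ?t) * (?t ^ DIM('a) * dilation_average (deriv_along b \<beta>) ?t u0 x) = - (?t ^ DIM('a) * dilation_average \<beta> ?t g0 x)"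
        by simp
      then have "?t ^ DIM('a) * ((1 / ?t) * dilation_average (deriv_along b \<beta>) ?t u0 x) = ?t ^ DIM('a) * (- dilation_average \<beta> ?t g0 x)"
        by (simp add: mult.left_commute)
      then have e: "(1 / ?t) * dilation_average (deriv_along b \<beta>) ?t u0 x = - dilation_average \<beta> ?t g0 x"
        by (rule mult_left_cancel[THEN iffD1, rotated]) (use tn in simp)
      have "deriv_along b (\<phi> n) x = - ((1 - ?t) / ?t) * dilation_average (deriv_along b \<beta>) ?t u0 x"
        unfolding \<phi>_def by (rule smooth_dilation_average(2)[of \<beta> R, OF \<beta>(1) supp u0(1) u0int tn(1) b])
      also have "\<dots> = - (1 - ?t) * ((1 / ?t) * dilation_average (deriv_along b \<beta>) ?t u0 x)"
        using tn(2) by (simp add: field_simps)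
      also have "\<dots> = (1 - ?t) * dilation_average \<beta> ?t g0 x" unfolding e by (simp only: minus_mult_minus)
      finally show ?thesis .
    qed
    let ?S = "\<lambda>n. dilation_average \<beta> (t n) g0"
    have lim: "(\<lambda>n. L2_norm_sq (lebesgue_on G) (\<lambda>x. ?S n x - g0 x)) \<longlonglongrightarrow> 0"
      by (rule dilation_average_tendsto[OF G(1-3) \<beta> g0(1,2) g0L2 t])
    have SL2: "?S n \<in> L2 (lebesgue_on G)" for n
      by (rule smooth_L2_lebesgue_on[OF smooth_dilation_average(1)[of \<beta> R, OF \<beta>(1) supp g0(1) g0int t(2)] G(3,1)])
    \<comment> \<open>The factor \<open>1 - t n\<close> is split as
      \<open>(1 - t) S - g = (1 - t) (S - g) - t g\<close>, and both parts vanish in the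
      limit.\<close>
    have bound: "L2_norm_sq (lebesgue_on G) (\<lambda>x. deriv_along b (\<phi> n) x - g x) \<le>
       2 * ((1 - t n)\<^sup>2 * L2_norm_sq (lebesgue_on G) (\<lambda>x. ?S n x - g0 x)) + 2 * ((t n)\<^sup>2 * L2_norm_sq (lebesgue_on G) g0)" for n
    proof -
      have L2a: "(\<lambda>x. (1 - t n) * (?S n x - g0 x)) \<in> L2 (lebesgue_on G)" "(\<lambda>x. (- t n) * g0 x) \<in> L2 (lebesgue_on G)"
        by (intro L2_cmult L2_diff SL2 g0L2)+
      have "L2_norm_sq (lebesgue_on G) (\<lambda>x. deriv_along b (\<phi> n) x - g x) =
        L2_norm_sq (lebesgue_on G) (\<lambda>x. (1 - t n) * (?S n x - g0 x) + (- t n) * g0 x)"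
      proof (rule L2_norm_sq_cong_AE)
        show "(\<lambda>x. deriv_along b (\<phi> n) x - g x) \<in> borel_measurable (lebesgue_on G)"
          by (intro L2_measurable L2_diff gL2 smooth_L2_lebesgue_on smooth_deriv_along sm b G)
        show "(\<lambda>x. (1 - t n) * (?S n x - g0 x) + (- t n) * g0 x) \<in> borel_measurable (lebesgue_on G)"
          by (intro L2_measurable L2_add L2a)
        show "AE x in lebesgue_on G. deriv_along b (\<phi> n) x - g x = (1 - t n) * (?S n x - g0 x) + (- t n) * g0 x"
          using g0(3) AE_space by eventually_elim (simp add: der algebra_simps)
      qed
      also have "\<dots> \<le> 2 * L2_norm_sq (lebesgue_on G) (\<lambda>x. (1 - t n) * (?S n x - g0 x)) + 2 * L2_norm_sq (lebesgue_on G) (\<lambda>x. (- t n) * g0 x)"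
        by (rule L2_norm_sq_add_le[OF L2a])
      also have "\<dots> = 2 * ((1 - t n)\<^sup>2 * L2_norm_sq (lebesgue_on G) (\<lambda>x. ?S n x - g0 x)) + 2 * ((t n)\<^sup>2 * L2_norm_sq (lebesgue_on G) g0)"
        using L2_norm_sq_scaleR[of "lebesgue_on G" "1 - t n" "\<lambda>x. ?S n x - g0 x"] L2_norm_sq_scaleR[of "lebesgue_on G" "- t n" g0] by simp
      finally show ?thesis .
    qed
    have "(\<lambda>n. 2 * ((1 - t n)\<^sup>2 * L2_norm_sq (lebesgue_on G) (\<lambda>x. ?S n x - g0 x)) + 2 * ((t n)\<^sup>2 * L2_norm_sq (lebesgue_on G) g0))
      \<longlonglongrightarrow> 2 * ((1 - 0)\<^sup>2 * 0) + 2 * (0\<^sup>2 * L2_norm_sq (lebesgue_on G) g0)"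
      by (intro tendsto_intros lim t)
    then have "(\<lambda>n. 2 * ((1 - t n)\<^sup>2 * L2_norm_sq (lebesgue_on G) (\<lambda>x. ?S n x - g0 x)) + 2 * ((t n)\<^sup>2 * L2_norm_sq (lebesgue_on G) g0)) \<longlonglongrightarrow> 0"
      by simp
    then show ?thesis unfolding g_def[symmetric]
      by (rule Lim_null_comparison[rotated]) (use bound in \<open>auto intro!: always_eventually\<close>)
  qed
  show ?thesis by (rule that[OF sm lim0 lim1])
qed

section \<open>Traces on the boundary of a polytope\<close>

lemma solid_polytope_basic:
  assumes "solid_polytope K"
  shows "closed K" "bounded K" "convex K" "open (interior K)" "convex (interior K)" "bounded (interior K)" "interior K \<noteq> {}"
    "closed (frontier K)" "negligible (frontier K)" "K = interior K \<union> frontier K" "interior K \<inter> frontier K = {}"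
proof -
  have "compact K" using assms by (rule compact_solid_polytope)
  then show "closed K" "bounded K" by (auto intro: compact_imp_closed compact_imp_bounded)
  show "convex K" using assms by (simp add: solid_polytope_def polytope_imp_convex)
  then show "convex (interior K)" "negligible (frontier K)" by (auto intro: negligible_convex_frontier)
  show "bounded (interior K)" using \<open>bounded K\<close> interior_subset by (rule bounded_subset)
  show "interior K \<noteq> {}" using assms by (simp add: solid_polytope_def)
  show "K = interior K \<union> frontier K" using \<open>closed K\<close> interior_subset[of K] by (auto simp: frontier_def)
  show "interior K \<inter> frontier K = {}" by (auto simp: frontier_def)
qed auto

lemma closed_facet: "solid_polytope K \<Longrightarrow> F \<in> facets K \<Longrightarrow> closed F"
  using solid_polytope_facets(2)[of K F] solid_polytope_basic(1)[of K] closed_hyperplane[of "outer_normal K F" "facet_offset K F"]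
  by (metis closed_Int)

lemma emeasure_surface_facet: "solid_polytope K \<Longrightarrow> F \<in> facets K \<Longrightarrow> emeasure surface_measure F < \<infinity>"
  by (rule emeasure_surface_bounded_finite[OF _ facet_hyperplane(3,1)])
    (auto intro: borel_closed closed_facet bounded_subset[OF solid_polytope_basic(2) facet_hyperplane(4)])

lemma emeasure_surface_frontier:
  assumes K: "solid_polytope K" shows "emeasure surface_measure (frontier K) < \<infinity>"
proof -
  have "emeasure surface_measure (\<Union>F\<in>facets K. F) \<le> (\<Sum>F\<in>facets K. emeasure surface_measure F)"
    by (rule emeasure_subadditive_finite) (auto intro: finite_facets K closed_facet borel_closed)
  also have "\<dots> < \<infinity>" using emeasure_surface_facet[OF K] finite_facets[OF K] by (simp add: less_top)
  finally show ?thesis by (simp add: frontier_solid_polytope[OF K])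
qed

lemma finite_surface_on:
  assumes "A \<in> sets borel" "emeasure surface_measure A < \<infinity>"
  shows "finite_measure (surface_on A)"
  using assms by (intro finite_measureI) (simp add: emeasure_restrict_space space_restrict_space less_top)

lemma borel_measurable_surface_on:
  "f \<in> borel_measurable borel \<Longrightarrow> f \<in> borel_measurable (surface_on A)"
  for f :: "'a::euclidean_space \<Rightarrow> 'b::topological_space"
  by (intro measurable_restrict_space1) (simp cong: measurable_cong_sets)

lemma integral_surface_on:
  fixes f :: "'a::euclidean_space \<Rightarrow> real"
  assumes "A \<in> sets borel"
  shows "(\<integral>y. f y \<partial>surface_on A) = (\<integral>y. indicator A y * f y \<partial>surface_measure)"
    "integrable (surface_on A) f \<longleftrightarrow> integrable surface_measure (\<lambda>y. indicator A y * f y)"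
  using assms integral_restrict_space[of A surface_measure f] integrable_restrict_space[of A surface_measure f] by simp_all

lemma integrable_surface_bounded:
  fixes f :: "'a::euclidean_space \<Rightarrow> real"
  assumes "A \<in> sets borel" "emeasure surface_measure A < \<infinity>" "f \<in> borel_measurable borel" "\<And>y. y \<in> A \<Longrightarrow> \<bar>f y\<bar> \<le> B"
  shows "integrable surface_measure (\<lambda>y. indicator A y * f y)"
proof -
  interpret finite_measure "surface_on A" by (rule finite_surface_on[OF assms(1,2)])
  have "integrable (surface_on A) f"
    using assms by (intro integrable_const_bound[of _ B] borel_measurable_surface_on) (auto intro!: AE_I2 simp: space_restrict_space)
  then show ?thesis using integral_surface_on(2)[OF assms(1)] by simp
qed

text \<open>The component of the outer normal in direction \<open>b\<close>. A sum of indicators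
  makes it Borel; where facets meet the normals add up, but this happens on a null set only.\<close>

definition normal_field :: "'a::euclidean_space set \<Rightarrow> 'a \<Rightarrow> 'a \<Rightarrow> real" where
  "normal_field K b y = (\<Sum>F\<in>facets K. indicator F y * (outer_normal K F \<bullet> b))"

lemma normal_field_measurable:
  assumes "solid_polytope K" shows "normal_field K b \<in> borel_measurable borel"
  unfolding normal_field_def[abs_def]
  using borel_closed[OF closed_facet[OF assms]] by (intro borel_measurable_sum borel_measurable_times borel_measurable_indicator) auto

lemma normal_field_bounded:
  assumes K: "solid_polytope K" and b: "b \<in> Basis"
  shows "\<bar>normal_field K b y\<bar> \<le> real (card (facets K))"
proof -
  have "\<bar>normal_field K b y\<bar> \<le> (\<Sum>F\<in>facets K. \<bar>indicator F y * (outer_normal K F \<bullet> b)\<bar>)"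
    unfolding normal_field_def by (rule sum_abs)
  also have "\<dots> \<le> (\<Sum>F\<in>facets K. 1)"
  proof (rule sum_mono)
    fix F assume "F \<in> facets K"
    then have "\<bar>outer_normal K F \<bullet> b\<bar> \<le> 1"
      using Basis_le_norm[OF b, of "outer_normal K F"] solid_polytope_facets(1)[OF K] by simp
    then show "\<bar>indicator F y * (outer_normal K F \<bullet> b)\<bar> \<le> 1" by (simp add: indicator_def)
  qed
  finally show ?thesis by simp
qed

text \<open>Passing from \<open>K\<close> to its interior costs a negligible set and gives the form
  suited to Sobolev functions; the facet integrals are collected into one integral over the
  frontier.\<close>

lemma divergence_solid_polytope:
  fixes f :: "'a::euclidean_space \<Rightarrow> real"
  assumes K: "solid_polytope K" and f: "smooth f" and b: "b \<in> Basis"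
  shows "(\<integral>x. deriv_along b f x \<partial>lebesgue_on (interior K)) = (\<integral>y. f y * normal_field K b y \<partial>surface_on (frontier K))"
proof -
  note basic = solid_polytope_basic[OF K]
  have [measurable]: "f \<in> borel_measurable borel" "deriv_along b f \<in> borel_measurable borel"
    using f b by (auto intro: smooth_borel_measurable smooth_deriv_along)
  have [measurable]: "F \<in> sets borel" if "F \<in> facets K" for F using borel_closed[OF closed_facet[OF K that]] .
  obtain B where B: "\<And>x. x \<in> K \<Longrightarrow> \<bar>f x\<bar> \<le> B" using smooth_bounded_on[OF f basic(2)] by metis
  have "(\<integral>x. deriv_along b f x \<partial>lebesgue_on (interior K)) = (\<integral>x. indicator (interior K) x * deriv_along b f x \<partial>lborel)"
    by (rule integral_lebesgue_on_borel) (use basic in auto)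
  also have "\<dots> = (\<integral>x. indicator K x * deriv_along b f x \<partial>lborel)"
  proof (rule integral_cong_AE)
    have "frontier K \<in> null_sets lborel"
      using basic(8,9) by (simp add: negligible_iff_null_sets null_sets_completion_iff)
    then have "AE x in lborel. x \<notin> frontier K" by (rule AE_not_in)
    then show "AE x in lborel. indicator (interior K) x * deriv_along b f x = indicator K x * deriv_along b f x"
    proof eventually_elim
      case (elim x)
      then have "x \<in> interior K \<longleftrightarrow> x \<in> K" using basic(10) by blast
      then show ?case by (simp add: indicator_def)
    qed
  qed (use basic in auto)
  also have "\<dots> = (\<Sum>F\<in>facets K. (outer_normal K F \<bullet> b) *
      (\<integral>y. indicator {y. outer_normal K F \<bullet> y = facet_offset K F} y * (indicator K y * f y) \<partial>surface_measure))"
    by (rule divergence_theorem_halfspaces[OF finite_facets[OF K] solid_polytope_facets(1)[OF K]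
          facet_hyperplane_inj[OF K] solid_polytope_facets(3)[OF K] basic(2) f b])
  also have "\<dots> = (\<Sum>F\<in>facets K. (\<integral>y. (outer_normal K F \<bullet> b) * (indicator F y * f y) \<partial>surface_measure))"
  proof (intro sum.cong refl)
    fix F assume F: "F \<in> facets K"
    have "indicator {y. outer_normal K F \<bullet> y = facet_offset K F} y * (indicator K y * f y) = indicator F y * f y" for y
    proof -
      have "y \<in> F \<longleftrightarrow> y \<in> K \<and> outer_normal K F \<bullet> y = facet_offset K F"
        using solid_polytope_facets(2)[OF K F] by blast
      then show ?thesis by (auto simp: indicator_def)
    qed
    then show "(outer_normal K F \<bullet> b) * (\<integral>y. indicator {y. outer_normal K F \<bullet> y = facet_offset K F} y * (indicator K y * f y) \<partial>surface_measure)
      = (\<integral>y. (outer_normal K F \<bullet> b) * (indicator F y * f y) \<partial>surface_measure)" by (simp only: integral_mult_right_zero)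
  qed
  also have "\<dots> = (\<integral>y. (\<Sum>F\<in>facets K. (outer_normal K F \<bullet> b) * (indicator F y * f y)) \<partial>surface_measure)"
  proof (rule Bochner_Integration.integral_sum[symmetric])
    fix F assume F: "F \<in> facets K"
    have "integrable surface_measure (\<lambda>y. indicator F y * f y)"
      using B facet_hyperplane(4)[OF K F] F by (intro integrable_surface_bounded[of _ _ B] emeasure_surface_facet[OF K]) auto
    then show "integrable surface_measure (\<lambda>y. (outer_normal K F \<bullet> b) * (indicator F y * f y))" by simp
  qed
  also have "\<dots> = (\<integral>y. indicator (frontier K) y * (f y * normal_field K b y) \<partial>surface_measure)"
  proof (intro Bochner_Integration.integral_cong refl)
    fix y
    have "(outer_normal K F \<bullet> b) * (indicator F y * f y) = indicator (frontier K) y * (f y * (indicator F y * (outer_normal K F \<bullet> b)))"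
      if "F \<in> facets K" for F
    proof -
      have "y \<in> F \<Longrightarrow> y \<in> frontier K" using that frontier_solid_polytope(1)[OF K] by blast
      then show ?thesis by (cases "y \<in> F") auto
    qed
    then show "(\<Sum>F\<in>facets K. (outer_normal K F \<bullet> b) * (indicator F y * f y)) = indicator (frontier K) y * (f y * normal_field K b y)"
      unfolding normal_field_def sum_distrib_left by (intro sum.cong refl)
  qed
  also have "\<dots> = (\<integral>y. f y * normal_field K b y \<partial>surface_on (frontier K))"
    using basic(8) by (intro integral_surface_on(1)[symmetric]) auto
  finally show ?thesis .
qed

lemma smooth_L2_surface_on:
  fixes f :: "'a::euclidean_space \<Rightarrow> real"
  assumes "smooth f" "bounded A" "A \<in> sets borel" "emeasure surface_measure A < \<infinity>"
  shows "f \<in> L2 (surface_on A)"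
proof -
  obtain B where B: "\<And>x. x \<in> A \<Longrightarrow> \<bar>f x\<bar> \<le> B" using smooth_bounded_on[OF assms(1,2)] by metis
  show ?thesis
    by (rule L2_bounded[OF finite_surface_on[OF assms(3,4)] borel_measurable_surface_on[OF smooth_borel_measurable[OF assms(1)]], of B])
      (use B in \<open>auto simp: space_restrict_space\<close>)
qed

lemma frontier_solid_polytope_basic:
  assumes "solid_polytope K"
  shows "frontier K \<in> sets borel" "bounded (frontier K)" "finite_measure (surface_on (frontier K))"
proof -
  show 1: "frontier K \<in> sets borel" using solid_polytope_basic(8)[OF assms] by simp
  show "bounded (frontier K)"
    using solid_polytope_basic(10)[OF assms] bounded_subset[OF solid_polytope_basic(2)[OF assms]] by blast
  show "finite_measure (surface_on (frontier K))"
    by (rule finite_surface_on[OF 1 emeasure_surface_frontier[OF assms]])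
qed

lemmas smooth_L2_frontier = smooth_L2_surface_on[OF _ frontier_solid_polytope_basic(2,1) emeasure_surface_frontier]

section \<open>The trace inequality for smooth functions\<close>

lemma deriv_along_power2_times_coordinate:
  assumes f: "smooth f" and b: "b \<in> Basis"
  shows "deriv_along b (\<lambda>x. (f x)\<^sup>2 * ((x - a) \<bullet> b)) x = (f x)\<^sup>2 + 2 * f x * deriv_along b f x * ((x - a) \<bullet> b)"
proof -
  have "(f has_derivative frechet_derivative f (at x)) (at x)"
    using smooth_differentiable[OF f] frechet_derivative_works by blast
  then have "((\<lambda>x. (f x)\<^sup>2 * ((x - a) \<bullet> b)) has_derivative
     (\<lambda>h. (f x)\<^sup>2 * (h \<bullet> b) + (2 * f x * frechet_derivative f (at x) h) * ((x - a) \<bullet> b))) (at x)"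
    by (auto intro!: derivative_eq_intros simp: fun_eq_iff)
  from deriv_along_eq[OF this, of b] show ?thesis using b by (simp add: deriv_along_def)
qed

text \<open>Apply the divergence theorem to \<open>\<phi>\<^sup>2 (x - x\<^sub>0)\<close> with \<open>x\<^sub>0\<close> in the interior: on a facet with outer normal
  \<open>n\<close> and offset \<open>c\<close> the normal component of \<open>x - x\<^sub>0\<close> is the positive constant \<open>c - n \<bullet> x\<^sub>0\<close>.\<close>

lemma trace_inequality:
  fixes K :: "'a::euclidean_space set"
  assumes K: "solid_polytope K"
  obtains C where "0 \<le> C" "\<And>\<phi>. smooth \<phi> \<Longrightarrow> L2_norm_sq (surface_on (frontier K)) \<phi> \<le>
    C * (L2_norm_sq (lebesgue_on (interior K)) \<phi> + (\<Sum>b\<in>Basis. L2_norm_sq (lebesgue_on (interior K)) (deriv_along b \<phi>)))"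
proof -
  note basic = solid_polytope_basic[OF K]
  let ?G = "interior K" let ?S = "surface_on (frontier K)"
  obtain x0 where x0: "x0 \<in> ?G" using basic(7) by blast
  have fne: "facets K \<noteq> {}"
  proof
    assume "facets K = {}"
    then have "K = UNIV" by (subst solid_polytope_facets(3)[OF K]) simp
    then show False using basic(2) by simp
  qed
  \<comment> \<open>The smallest distance from \<open>x0\<close> to a facet plane, as the normals
    are unit vectors. It bounds the normal component of \<open>y - x0\<close> from below on the
    whole frontier.\<close>
  define d where "d = Min ((\<lambda>F. facet_offset K F - outer_normal K F \<bullet> x0) ` facets K)"
  have d_le: "d \<le> facet_offset K F - outer_normal K F \<bullet> x0" if "F \<in> facets K" for F
    unfolding d_def using that finite_facets[OF K] by (intro Min_le) auto
  have d0: "d > 0"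
    unfolding d_def using finite_facets[OF K] fne x0 frontier_solid_polytope(2)[OF K] by (subst Min_gr_iff) auto
  obtain R where R: "R \<ge> 0" "\<And>x. x \<in> K \<Longrightarrow> norm (x - x0) \<le> R"
  proof -
    obtain B where B: "B > 0" "\<forall>x\<in>K. norm x \<le> B" using basic(2) bounded_pos by blast
    show ?thesis
    proof (rule that[of "B + norm x0"])
      show "norm (x - x0) \<le> B + norm x0" if "x \<in> K" for x
        using norm_triangle_ineq4[of x x0] B(2) that by fastforce
    qed (use B in simp)
  qed
  define D where "D = real DIM('a)"
  \<comment> \<open>\<open>D\<close> is the divergence of \<open>x - x0\<close>. The terms with
    \<open>R\<close> come from splitting \<open>2 \<phi> \<partial>\<phi>\<close> into squares, each
    coordinate of \<open>x - x0\<close> being at most \<open>R\<close>.\<close>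
  define C where "C = (D + D * R + R) / d"
  have C0: "C \<ge> 0" unfolding C_def D_def using d0 R by (intro divide_nonneg_pos add_nonneg_nonneg) auto
  have "L2_norm_sq ?S \<phi> \<le> C * (L2_norm_sq (lebesgue_on ?G) \<phi> + (\<Sum>b\<in>Basis. L2_norm_sq (lebesgue_on ?G) (deriv_along b \<phi>)))"
    if \<phi>: "smooth \<phi>" for \<phi>
  proof -
    define f where "f b x = (\<phi> x)\<^sup>2 * ((x - x0) \<bullet> b)" for b x
    have fsm: "smooth (f b)" for b
      unfolding f_def[abs_def] inner_diff_left by (intro smooth_mult smooth_power smooth_diff smooth_inner \<phi> smooth_const)
    have fder: "deriv_along b (f b) x = (\<phi> x)\<^sup>2 + 2 * \<phi> x * deriv_along b \<phi> x * ((x - x0) \<bullet> b)" if "b \<in> Basis" for b x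
      unfolding f_def[abs_def] by (rule deriv_along_power2_times_coordinate[OF \<phi> that])
    have L2G: "\<phi> \<in> L2 (lebesgue_on ?G)" "\<And>b. b \<in> Basis \<Longrightarrow> deriv_along b \<phi> \<in> L2 (lebesgue_on ?G)"
      using \<phi> basic by (auto intro!: smooth_L2_lebesgue_on smooth_deriv_along)
    have L2S: "\<phi> \<in> L2 ?S" by (rule smooth_L2_frontier[OF \<phi> K K K])
    have int_f: "integrable ?S (\<lambda>y. f b y * normal_field K b y)" if b: "b \<in> Basis" for b
      by (rule L2_integrable[OF frontier_solid_polytope_basic(3)[OF K]
          L2_mult_bounded[OF smooth_L2_frontier[OF fsm K K K] borel_measurable_surface_on[OF normal_field_measurable[OF K]] normal_field_bounded[OF K b]]])
    have "d * L2_norm_sq ?S \<phi> = (\<integral>y. d * (\<phi> y)\<^sup>2 \<partial>?S)" by (simp add: L2_norm_sq_def)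
    also have "\<dots> \<le> (\<integral>y. (\<Sum>b\<in>Basis. f b y * normal_field K b y) \<partial>?S)"
    proof (rule integral_mono_AE)
      show "integrable ?S (\<lambda>y. d * (\<phi> y)\<^sup>2)" using L2S by (simp add: L2_def)
      show "integrable ?S (\<lambda>y. \<Sum>b\<in>Basis. f b y * normal_field K b y)" using int_f by (intro Bochner_Integration.integrable_sum)
      show "AE y in ?S. d * (\<phi> y)\<^sup>2 \<le> (\<Sum>b\<in>Basis. f b y * normal_field K b y)"
      proof (intro AE_I2)
        fix y assume "y \<in> space ?S"
        then have y: "y \<in> frontier K" by (simp add: space_restrict_space)
        then obtain F0 where F0: "F0 \<in> facets K" "y \<in> F0" using frontier_solid_polytope(1)[OF K] by blast
        have eqF: "indicator F y * (outer_normal K F \<bullet> (y - x0)) = indicator F y * (facet_offset K F - outer_normal K F \<bullet> x0)"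
          if F: "F \<in> facets K" for F
          using facet_hyperplane(3)[OF K F] by (auto simp: indicator_def inner_diff_right)
        have nn: "0 \<le> indicator F y * (facet_offset K F - outer_normal K F \<bullet> x0)" if F: "F \<in> facets K" for F
          using d_le[OF F] d0 by simp
        have "d \<le> indicator F0 y * (facet_offset K F0 - outer_normal K F0 \<bullet> x0)" using F0 d_le[OF F0(1)] by simp
        also have "\<dots> \<le> (\<Sum>F\<in>facets K. indicator F y * (facet_offset K F - outer_normal K F \<bullet> x0))"
          by (rule member_le_sum[OF F0(1) _ finite_facets[OF K]]) (use nn in auto)
        also have "\<dots> = (\<Sum>F\<in>facets K. indicator F y * (\<Sum>b\<in>Basis. (outer_normal K F \<bullet> b) * ((y - x0) \<bullet> b)))"
          by (intro sum.cong refl) (simp only: eqF[symmetric] euclidean_inner[of _ "y - x0"])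
        also have "\<dots> = (\<Sum>b\<in>Basis. ((y - x0) \<bullet> b) * normal_field K b y)"
          unfolding normal_field_def sum_distrib_left by (subst sum.swap) (intro sum.cong refl, simp add: mult_ac)
        finally have "(\<phi> y)\<^sup>2 * d \<le> (\<phi> y)\<^sup>2 * (\<Sum>b\<in>Basis. ((y - x0) \<bullet> b) * normal_field K b y)"
          by (intro mult_left_mono) auto
        moreover have "(\<phi> y)\<^sup>2 * (\<Sum>b\<in>Basis. ((y - x0) \<bullet> b) * normal_field K b y) = (\<Sum>b\<in>Basis. f b y * normal_field K b y)"
          unfolding f_def sum_distrib_left by (intro sum.cong refl) (simp only: mult.assoc)
        ultimately show "d * (\<phi> y)\<^sup>2 \<le> (\<Sum>b\<in>Basis. f b y * normal_field K b y)"
          by (simp only: mult.commute[of d])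
      qed
    qed
    also have "\<dots> = (\<Sum>b\<in>Basis. \<integral>y. f b y * normal_field K b y \<partial>?S)"
      using int_f by (rule Bochner_Integration.integral_sum)
    also have "\<dots> = (\<Sum>b\<in>Basis. \<integral>x. deriv_along b (f b) x \<partial>lebesgue_on ?G)"
      using divergence_solid_polytope[OF K fsm] by (intro sum.cong refl) simp
    also have "\<dots> \<le> (\<Sum>b\<in>(Basis::'a set). (1 + R) * L2_norm_sq (lebesgue_on ?G) \<phi> + R * L2_norm_sq (lebesgue_on ?G) (deriv_along b \<phi>))"
    proof (rule sum_mono)
      fix b :: 'a assume b: "b \<in> Basis"
      have "(\<integral>x. deriv_along b (f b) x \<partial>lebesgue_on ?G) \<le> (\<integral>x. (1 + R) * (\<phi> x)\<^sup>2 + R * (deriv_along b \<phi> x)\<^sup>2 \<partial>lebesgue_on ?G)"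
      proof (rule integral_mono_AE)
        show "integrable (lebesgue_on ?G) (deriv_along b (f b))"
          by (intro L2_integrable finite_measure_lebesgue_on lmeasurable_bounded_open smooth_L2_lebesgue_on smooth_deriv_along fsm b basic)
        show "integrable (lebesgue_on ?G) (\<lambda>x. (1 + R) * (\<phi> x)\<^sup>2 + R * (deriv_along b \<phi> x)\<^sup>2)"
          using L2G(1) L2G(2)[OF b] by (intro Bochner_Integration.integrable_add) (auto simp: L2_def)
        show "AE x in lebesgue_on ?G. deriv_along b (f b) x \<le> (1 + R) * (\<phi> x)\<^sup>2 + R * (deriv_along b \<phi> x)\<^sup>2"
        proof (intro AE_I2)
          fix x assume "x \<in> space (lebesgue_on ?G)"
          then have "x \<in> K" using interior_subset by auto
          then have "\<bar>(x - x0) \<bullet> b\<bar> \<le> R" using R(2) Basis_le_norm[OF b, of "x - x0"] by fastforce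
          then have "\<bar>2 * \<phi> x * deriv_along b \<phi> x\<bar> * \<bar>(x - x0) \<bullet> b\<bar> \<le> ((\<phi> x)\<^sup>2 + (deriv_along b \<phi> x)\<^sup>2) * R"
            using sum_squares_bound[of "\<bar>\<phi> x\<bar>" "\<bar>deriv_along b \<phi> x\<bar>"]
            by (intro mult_mono) (auto simp: abs_mult)
          moreover have "2 * \<phi> x * deriv_along b \<phi> x * ((x - x0) \<bullet> b) \<le> \<bar>2 * \<phi> x * deriv_along b \<phi> x\<bar> * \<bar>(x - x0) \<bullet> b\<bar>"
            unfolding abs_mult[symmetric] by (rule abs_ge_self)
          ultimately show "deriv_along b (f b) x \<le> (1 + R) * (\<phi> x)\<^sup>2 + R * (deriv_along b \<phi> x)\<^sup>2"
            unfolding fder[OF b] by (simp add: algebra_simps)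
        qed
      qed
      also have "\<dots> = (1 + R) * L2_norm_sq (lebesgue_on ?G) \<phi> + R * L2_norm_sq (lebesgue_on ?G) (deriv_along b \<phi>)"
        using L2G(1) L2G(2)[OF b] by (simp add: L2_def L2_norm_sq_def)
      finally show "(\<integral>x. deriv_along b (f b) x \<partial>lebesgue_on ?G) \<le> (1 + R) * L2_norm_sq (lebesgue_on ?G) \<phi> + R * L2_norm_sq (lebesgue_on ?G) (deriv_along b \<phi>)" .
    qed
    also have "\<dots> = (D + D * R) * L2_norm_sq (lebesgue_on ?G) \<phi> + R * (\<Sum>b\<in>Basis. L2_norm_sq (lebesgue_on ?G) (deriv_along b \<phi>))"
      by (simp add: sum.distrib sum_distrib_left D_def algebra_simps)
    also have "\<dots> \<le> (D + D * R + R) * L2_norm_sq (lebesgue_on ?G) \<phi> + (D + D * R + R) * (\<Sum>b\<in>Basis. L2_norm_sq (lebesgue_on ?G) (deriv_along b \<phi>))"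
    proof -
      have c: "D + D * R \<le> D + D * R + R" "R \<le> D + D * R + R" using R(1) by (auto simp: D_def)
      show ?thesis by (intro add_mono[OF mult_right_mono[OF c(1)] mult_right_mono[OF c(2)]] sum_nonneg) auto
    qed
    finally have "L2_norm_sq ?S \<phi> * d \<le> (D + D * R + R) * (L2_norm_sq (lebesgue_on ?G) \<phi> + (\<Sum>b\<in>Basis. L2_norm_sq (lebesgue_on ?G) (deriv_along b \<phi>)))"
      by (simp add: algebra_simps)
    then show ?thesis unfolding C_def using d0 by (simp add: pos_le_divide_eq)
  qed
  with C0 show ?thesis using that by blast
qed

section \<open>Traces as limits of smooth approximations\<close>

definition sobolev_converges :: "'a::euclidean_space set \<Rightarrow> (nat \<Rightarrow> 'a \<Rightarrow> real) \<Rightarrow> ('a \<Rightarrow> real) \<Rightarrow> bool" where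
  "sobolev_converges G \<phi> u \<longleftrightarrow> (\<forall>n. smooth (\<phi> n)) \<and>
     (\<lambda>n. L2_norm_sq (lebesgue_on G) (\<lambda>x. \<phi> n x - u x)) \<longlonglongrightarrow> 0 \<and>
     (\<forall>b\<in>Basis. (\<lambda>n. L2_norm_sq (lebesgue_on G) (\<lambda>x. deriv_along b (\<phi> n) x - weak_deriv G b u x)) \<longlonglongrightarrow> 0)"

lemma has_trace_Basis_iff:
  "has_trace Basis G u \<Gamma> g \<longleftrightarrow> u \<in> sobolev Basis G \<and> g \<in> L2 (surface_on \<Gamma>) \<and>
     (\<exists>\<phi>. sobolev_converges G \<phi> u \<and> (\<lambda>n. L2_norm_sq (surface_on \<Gamma>) (\<lambda>x. \<phi> n x - g x)) \<longlonglongrightarrow> 0)"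
  unfolding has_trace_def sobolev_converges_def by blast

text \<open>The squared distance in the first-order Sobolev norm, with classical derivatives of the
  smooth function against the chosen weak derivatives of \<open>u\<close>.\<close>

definition sobolev_dist :: "'a::euclidean_space set \<Rightarrow> ('a \<Rightarrow> real) \<Rightarrow> ('a \<Rightarrow> real) \<Rightarrow> real" where
  "sobolev_dist G \<phi> u = L2_norm_sq (lebesgue_on G) (\<lambda>x. \<phi> x - u x) +
     (\<Sum>b\<in>Basis. L2_norm_sq (lebesgue_on G) (\<lambda>x. deriv_along b \<phi> x - weak_deriv G b u x))"

text \<open>Two approximants are compared through their distances to \<open>u\<close>. The estimate
  yields both the Cauchy property on the frontier and the independence of the limit from the
  sequence.\<close>

lemma trace_inequality_difference:
  fixes K :: "'a::euclidean_space set"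
  assumes K: "solid_polytope K" and u: "u \<in> sobolev Basis (interior K)"
  shows "\<exists>C\<ge>0. \<forall>\<phi> \<psi>. smooth \<phi> \<longrightarrow> smooth \<psi> \<longrightarrow> L2_norm_sq (surface_on (frontier K)) (\<lambda>x. \<phi> x - \<psi> x) \<le>
     C * (sobolev_dist (interior K) \<phi> u + sobolev_dist (interior K) \<psi> u)"
proof -
  note basic = solid_polytope_basic[OF K]
  let ?G = "lebesgue_on (interior K)"
  obtain C where C: "0 \<le> C" "\<And>\<phi>. smooth \<phi> \<Longrightarrow> L2_norm_sq (surface_on (frontier K)) \<phi> \<le>
    C * (L2_norm_sq ?G \<phi> + (\<Sum>b\<in>Basis. L2_norm_sq ?G (deriv_along b \<phi>)))"
    using trace_inequality[OF K] by metis
  have "L2_norm_sq (surface_on (frontier K)) (\<lambda>x. \<phi> x - \<psi> x) \<le> (2 * C) * (sobolev_dist (interior K) \<phi> u + sobolev_dist (interior K) \<psi> u)"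
    if sm: "smooth \<phi>" "smooth \<psi>" for \<phi> \<psi>
  proof -
    have tri: "L2_norm_sq ?G (\<lambda>x. f x - g x) \<le> 2 * L2_norm_sq ?G (\<lambda>x. f x - k x) + 2 * L2_norm_sq ?G (\<lambda>x. g x - k x)"
      if "smooth f" "smooth g" "k \<in> L2 ?G" for f g k
      using L2_norm_sq_triangle[of f ?G k g] smooth_L2_lebesgue_on[OF that(1) basic(6,4)] smooth_L2_lebesgue_on[OF that(2) basic(6,4)] that(3)
      by (simp add: L2_norm_sq_diff_commute[of ?G g k])
    have dd: "deriv_along b (\<lambda>x. \<phi> x - \<psi> x) = (\<lambda>x. deriv_along b \<phi> x - deriv_along b \<psi> x)" for b
      by (intro ext deriv_along_diff sm)
    have "L2_norm_sq (surface_on (frontier K)) (\<lambda>x. \<phi> x - \<psi> x) \<le>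
       C * (L2_norm_sq ?G (\<lambda>x. \<phi> x - \<psi> x) + (\<Sum>b\<in>Basis. L2_norm_sq ?G (\<lambda>x. deriv_along b \<phi> x - deriv_along b \<psi> x)))"
      using C(2)[OF smooth_diff[OF sm]] unfolding dd .
    also have "\<dots> \<le>
      C * ((2 * L2_norm_sq ?G (\<lambda>x. \<phi> x - u x) + 2 * L2_norm_sq ?G (\<lambda>x. \<psi> x - u x)) +
       (\<Sum>b\<in>Basis. 2 * L2_norm_sq ?G (\<lambda>x. deriv_along b \<phi> x - weak_deriv (interior K) b u x) + 2 * L2_norm_sq ?G (\<lambda>x. deriv_along b \<psi> x - weak_deriv (interior K) b u x)))"
      by (intro mult_left_mono C(1) add_mono sum_mono tri smooth_deriv_along sm sobolevD[OF u])
    also have "\<dots> = (2 * C) * (sobolev_dist (interior K) \<phi> u + sobolev_dist (interior K) \<psi> u)"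
      by (simp add: sobolev_dist_def sum.distrib sum_distrib_left[symmetric] algebra_simps)
    finally show ?thesis .
  qed
  with C(1) show ?thesis by (intro exI[of _ "2 * C"]) simp
qed

lemma sobolev_converges_dist:
  fixes u :: "'a::euclidean_space \<Rightarrow> real"
  assumes "sobolev_converges G \<phi> u"
  shows "(\<lambda>n. sobolev_dist G (\<phi> n) u) \<longlonglongrightarrow> 0"
proof -
  have "(\<lambda>n. sobolev_dist G (\<phi> n) u) \<longlonglongrightarrow> 0 + (\<Sum>b\<in>(Basis::'a set). 0)"
    using assms unfolding sobolev_converges_def sobolev_dist_def by (intro tendsto_add tendsto_sum) auto
  then show ?thesis by simp
qed

text \<open>The definition of a trace supplies one sequence. By the difference estimate any other
  approximating sequence has the same limit on the frontier, so sequences can be chosen to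
  suit.\<close>

lemma sobolev_converges_frontier:
  fixes K :: "'a::euclidean_space set"
  assumes K: "solid_polytope K" and tr: "has_trace Basis (interior K) u (frontier K) g" and \<psi>: "sobolev_converges (interior K) \<psi> u"
  shows "(\<lambda>n. L2_norm_sq (surface_on (frontier K)) (\<lambda>x. \<psi> n x - g x)) \<longlonglongrightarrow> 0"
proof -
  let ?S = "surface_on (frontier K)"
  have u: "u \<in> sobolev Basis (interior K)" and g: "g \<in> L2 ?S" using tr by (auto simp: has_trace_Basis_iff)
  obtain \<phi> where \<phi>: "sobolev_converges (interior K) \<phi> u" "(\<lambda>n. L2_norm_sq ?S (\<lambda>x. \<phi> n x - g x)) \<longlonglongrightarrow> 0"
    using tr by (auto simp: has_trace_Basis_iff)
  define a where "a \<phi> n = sobolev_dist (interior K) (\<phi> n) u" for \<phi> :: "nat \<Rightarrow> 'a \<Rightarrow> real" and n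
  obtain C where C: "0 \<le> C" "\<forall>f h. smooth f \<longrightarrow> smooth h \<longrightarrow> L2_norm_sq ?S (\<lambda>x. f x - h x) \<le>
     C * (sobolev_dist (interior K) f u + sobolev_dist (interior K) h u)"
    using trace_inequality_difference[OF K u] by blast
  have sm: "smooth (\<phi> n)" "smooth (\<psi> n)" for n using \<phi>(1) \<psi> by (auto simp: sobolev_converges_def)
  have bound: "L2_norm_sq ?S (\<lambda>x. \<psi> n x - g x) \<le> 2 * (C * (a \<psi> n + a \<phi> n)) + 2 * L2_norm_sq ?S (\<lambda>x. \<phi> n x - g x)" for n
    using L2_norm_sq_triangle[OF smooth_L2_frontier[OF sm(2) K K K] smooth_L2_frontier[OF sm(1) K K K] g, of n n]
      C(2)[rule_format, OF sm(2) sm(1), of n n] unfolding a_def by linarith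
  have "(\<lambda>n. 2 * (C * (a \<psi> n + a \<phi> n)) + 2 * L2_norm_sq ?S (\<lambda>x. \<phi> n x - g x)) \<longlonglongrightarrow> 2 * (C * (0 + 0)) + 2 * 0"
    unfolding a_def by (intro tendsto_intros sobolev_converges_dist \<psi> \<phi>)
  then have "(\<lambda>n. 2 * (C * (a \<psi> n + a \<phi> n)) + 2 * L2_norm_sq ?S (\<lambda>x. \<phi> n x - g x)) \<longlonglongrightarrow> 0" by simp
  then show ?thesis by (rule Lim_null_comparison[rotated]) (use bound in \<open>auto intro!: always_eventually\<close>)
qed

text \<open>The choice in \<open>trace\<close> is legitimate: smooth approximations exist because
  the interior is convex, the trace inequality makes them Cauchy on the frontier, and
  \<open>L2\<close> there is complete.\<close>

lemma has_trace_trace: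
  fixes K :: "'a::euclidean_space set"
  assumes K: "solid_polytope K" and u: "u \<in> sobolev Basis (interior K)"
  shows "has_trace Basis (interior K) u (frontier K) (trace K u)"
proof -
  note basic = solid_polytope_basic[OF K]
  let ?S = "surface_on (frontier K)"
  have "\<exists>\<phi>. sobolev_converges (interior K) \<phi> u"
    by (rule sobolev_smooth_approximation[OF basic(4,5,6,7) u]) (auto simp: sobolev_converges_def)
  then obtain \<phi> where \<phi>: "sobolev_converges (interior K) \<phi> u" by blast
  then have sm: "smooth (\<phi> n)" for n by (simp add: sobolev_converges_def)
  define a where "a n = sobolev_dist (interior K) (\<phi> n) u" for n
  have a: "a \<longlonglongrightarrow> 0" unfolding a_def[abs_def] by (rule sobolev_converges_dist[OF \<phi>])
  obtain C where C: "0 \<le> C" "\<forall>f h. smooth f \<longrightarrow> smooth h \<longrightarrow> L2_norm_sq ?S (\<lambda>x. f x - h x) \<le>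
     C * (sobolev_dist (interior K) f u + sobolev_dist (interior K) h u)"
    using trace_inequality_difference[OF K u] by blast
  have bound: "L2_norm_sq ?S (\<lambda>x. \<phi> m x - \<phi> n x) \<le> C * (a m + a n)" for m n
    unfolding a_def by (rule C(2)[rule_format, OF sm sm])
  have "\<exists>g. g \<in> L2 ?S \<and> (\<lambda>n. L2_norm_sq ?S (\<lambda>x. \<phi> n x - g x)) \<longlonglongrightarrow> 0"
  proof (rule L2_complete[OF frontier_solid_polytope_basic(3)[OF K]])
    show "\<phi> n \<in> L2 ?S" for n by (rule smooth_L2_frontier[OF sm K K K])
    fix e :: real assume e: "e > 0"
    \<comment> \<open>\<open>C + 1\<close> instead of \<open>C\<close> covers the case
      \<open>C = 0\<close>; two distances below \<open>e'\<close> then keep the boundary difference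
      below \<open>e\<close>.\<close>
    define e' where "e' = (e / 2) / (C + 1)"
    have "e' > 0" using e C(1) by (simp add: e'_def)
    with a have "\<forall>\<^sub>F n in sequentially. a n < e'" by (rule order_tendstoD)
    then obtain N where N: "\<And>n. n \<ge> N \<Longrightarrow> a n < e'" using eventually_sequentially by auto
    have "L2_norm_sq ?S (\<lambda>x. \<phi> m x - \<phi> n x) < e" if "m \<ge> N" "n \<ge> N" for m n
    proof -
      have "C * (a m + a n) \<le> C * (2 * e')" using N[OF that(1)] N[OF that(2)] C(1) by (intro mult_left_mono) auto
      also have "\<dots> < (C + 1) * (2 * e')" using \<open>e' > 0\<close> by simp
      also have "(C + 1) * (2 * e') = e"
      proof -
        have "C + 1 \<noteq> 0" using C(1) by simp
        from iffD1[OF nonzero_eq_divide_eq[OF this] e'_def] have "e' * (C + 1) = e / 2" .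
        then show ?thesis by (simp add: algebra_simps)
      qed
      finally show ?thesis using bound[of m n] by simp
    qed
    then show "\<exists>N. \<forall>m\<ge>N. \<forall>n\<ge>N. L2_norm_sq ?S (\<lambda>x. \<phi> m x - \<phi> n x) < e" by blast
  qed blast
  then have "\<exists>g. has_trace Basis (interior K) u (frontier K) g" using u \<phi> by (auto simp: has_trace_Basis_iff)
  from someI_ex[OF this] show ?thesis unfolding trace_def .
qed

lemmas trace_L2 = has_trace_trace[unfolded has_trace_Basis_iff, THEN conjunct2, THEN conjunct1]

text \<open>The tool for computing traces: a limit found along a single convenient approximating
  sequence is the trace almost everywhere.\<close>

lemma has_trace_unique:
  assumes K: "solid_polytope K" and g: "has_trace Basis (interior K) u (frontier K) g"
    and g': "g' \<in> L2 (surface_on (frontier K))" "sobolev_converges (interior K) \<psi> u"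
      "(\<lambda>n. L2_norm_sq (surface_on (frontier K)) (\<lambda>x. \<psi> n x - g' x)) \<longlonglongrightarrow> 0"
  shows "AE y in surface_on (frontier K). g y = g' y"
proof -
  let ?S = "surface_on (frontier K)"
  have gL2: "g \<in> L2 ?S" using g by (simp add: has_trace_Basis_iff)
  have sm: "smooth (\<psi> n)" for n using g'(2) by (simp add: sobolev_converges_def)
  have 1: "(\<lambda>n. L2_norm_sq ?S (\<lambda>x. \<psi> n x - g x)) \<longlonglongrightarrow> 0" by (rule sobolev_converges_frontier[OF K g g'(2)])
  have bound: "L2_norm_sq ?S (\<lambda>x. g x - g' x) \<le> 2 * L2_norm_sq ?S (\<lambda>x. \<psi> n x - g x) + 2 * L2_norm_sq ?S (\<lambda>x. \<psi> n x - g' x)" for n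
    using L2_norm_sq_triangle[OF gL2 smooth_L2_frontier[OF sm K K K] g'(1), of n] by (simp add: L2_norm_sq_diff_commute[of ?S g])
  have "(\<lambda>n. 2 * L2_norm_sq ?S (\<lambda>x. \<psi> n x - g x) + 2 * L2_norm_sq ?S (\<lambda>x. \<psi> n x - g' x)) \<longlonglongrightarrow> 2 * 0 + 2 * 0"
    by (intro tendsto_intros 1 g')
  then have "L2_norm_sq ?S (\<lambda>x. g x - g' x) \<le> 2 * 0 + 2 * 0"
    by (rule LIMSEQ_le_const) (use bound in auto)
  then have "L2_norm_sq ?S (\<lambda>x. g x - g' x) = 0" using L2_norm_sq_nonneg[of ?S "\<lambda>x. g x - g' x"] by simp
  then have "AE y in ?S. g y - g' y = 0" using L2_norm_sq_eq_0_iff[OF L2_diff[OF gL2 g'(1)]] by simp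
  then show ?thesis by eventually_elim simp
qed

text \<open>The divergence theorem for \<open>q * \<phi>\<close>, whose boundary term vanishes
  because a test function of the interior is zero on the frontier.\<close>

lemma smooth_is_weak_deriv:
  assumes K: "solid_polytope K" and q: "smooth q" and b: "b \<in> Basis"
  shows "is_weak_deriv (interior K) b q (deriv_along b q)"
  unfolding is_weak_deriv_def
proof
  note basic = solid_polytope_basic[OF K]
  fix \<phi> assume \<phi>: "\<phi> \<in> test_functions (interior K)"
  have \<phi>s: "smooth \<phi>" by (rule test_functions_smooth[OF \<phi>])
  have dd: "deriv_along b (\<lambda>x. q x * \<phi> x) x = q x * deriv_along b \<phi> x + deriv_along b q x * \<phi> x" for x
    by (intro deriv_along_mult smooth_differentiable q \<phi>s)
  have "(\<integral>x. deriv_along b (\<lambda>x. q x * \<phi> x) x \<partial>lebesgue_on (interior K)) = (\<integral>y. (q y * \<phi> y) * normal_field K b y \<partial>surface_on (frontier K))"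
    by (rule divergence_solid_polytope[OF K smooth_mult[OF q \<phi>s] b])
  also have "\<dots> = (\<integral>y. 0 \<partial>surface_on (frontier K))"
  proof (intro Bochner_Integration.integral_cong refl)
    fix y assume "y \<in> space (surface_on (frontier K))"
    then have "y \<notin> interior K" using basic(11) by (auto simp: space_restrict_space)
    then show "q y * \<phi> y * normal_field K b y = 0" using test_functions_support(1)[OF \<phi>] by simp
  qed
  finally have "(\<integral>x. q x * deriv_along b \<phi> x + deriv_along b q x * \<phi> x \<partial>lebesgue_on (interior K)) = 0" unfolding dd by simp
  moreover have "(\<integral>x. q x * deriv_along b \<phi> x + deriv_along b q x * \<phi> x \<partial>lebesgue_on (interior K)) =
     (\<integral>x. q x * deriv_along b \<phi> x \<partial>lebesgue_on (interior K)) + (\<integral>x. deriv_along b q x * \<phi> x \<partial>lebesgue_on (interior K))"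
    by (intro Bochner_Integration.integral_add L2_mult_integrable smooth_L2_lebesgue_on smooth_deriv_along q \<phi>s b basic)
  ultimately show "(\<integral>x. q x * deriv_along b \<phi> x \<partial>lebesgue_on (interior K)) = - (\<integral>x. deriv_along b q x * \<phi> x \<partial>lebesgue_on (interior K))"
    by simp
qed

lemma smooth_sobolev:
  assumes K: "solid_polytope K" and q: "smooth q"
  shows "q \<in> sobolev Basis (interior K)"
    and "b \<in> Basis \<Longrightarrow> AE x in lebesgue_on (interior K). weak_deriv (interior K) b q x = deriv_along b q x"
proof -
  note basic = solid_polytope_basic[OF K]
  have *: "has_L2_weak_deriv (interior K) b q" "AE x in lebesgue_on (interior K). weak_deriv (interior K) b q x = deriv_along b q x"
    if b: "b \<in> Basis" for b
    using weak_deriv_AE_eq[OF basic(4,6) b smooth_L2_lebesgue_on[OF smooth_deriv_along[OF q b] basic(6,4)] smooth_is_weak_deriv[OF K q b]] by auto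
  then show "q \<in> sobolev Basis (interior K)"
    using smooth_L2_lebesgue_on[OF q basic(6,4)] by (simp add: sobolev_def)
  show "b \<in> Basis \<Longrightarrow> AE x in lebesgue_on (interior K). weak_deriv (interior K) b q x = deriv_along b q x"
    by (rule *)
qed

text \<open>The constant sequence approximates \<open>q\<close>. The point to check is that the
  chosen weak derivative agrees with the classical one almost everywhere.\<close>

lemma trace_smooth:
  assumes K: "solid_polytope K" and q: "smooth q"
  shows "AE y in surface_on (frontier K). trace K q y = q y"
proof (rule has_trace_unique[OF K has_trace_trace[OF K smooth_sobolev(1)[OF K q]]])
  note basic = solid_polytope_basic[OF K]
  show "q \<in> L2 (surface_on (frontier K))" by (rule smooth_L2_frontier[OF q K K K])
  have "L2_norm_sq (lebesgue_on (interior K)) (\<lambda>x. deriv_along b q x - weak_deriv (interior K) b q x) = 0" if b: "b \<in> Basis" for b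
  proof -
    have "(\<lambda>x. deriv_along b q x - weak_deriv (interior K) b q x) \<in> L2 (lebesgue_on (interior K))"
      by (intro L2_diff smooth_L2_lebesgue_on smooth_deriv_along q b basic sobolevD[OF smooth_sobolev(1)[OF K q]])
    moreover have "AE x in lebesgue_on (interior K). deriv_along b q x - weak_deriv (interior K) b q x = 0"
      using smooth_sobolev(2)[OF K q b] by eventually_elim simp
    ultimately show ?thesis using L2_norm_sq_eq_0_iff by blast
  qed
  then show "sobolev_converges (interior K) (\<lambda>n. q) q"
    using q by (simp add: sobolev_converges_def) (simp add: L2_norm_sq_def)
  show "(\<lambda>n. L2_norm_sq (surface_on (frontier K)) (\<lambda>x. q x - q x)) \<longlonglongrightarrow> 0" by (simp add: L2_norm_sq_def)
qed

lemma tendsto_L2_norm_sq_add: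
  assumes "\<And>n. f n \<in> L2 M" "\<And>n. g n \<in> L2 M" "(\<lambda>n. L2_norm_sq M (f n)) \<longlonglongrightarrow> 0" "(\<lambda>n. L2_norm_sq M (g n)) \<longlonglongrightarrow> 0"
  shows "(\<lambda>n. L2_norm_sq M (\<lambda>x. f n x + g n x)) \<longlonglongrightarrow> 0"
proof (rule Lim_null_comparison)
  show "\<forall>\<^sub>F n in sequentially. norm (L2_norm_sq M (\<lambda>x. f n x + g n x)) \<le> 2 * L2_norm_sq M (f n) + 2 * L2_norm_sq M (g n)"
    using L2_norm_sq_add_le[OF assms(1,2)] by (intro always_eventually allI) simp
  have "(\<lambda>n. 2 * L2_norm_sq M (f n) + 2 * L2_norm_sq M (g n)) \<longlonglongrightarrow> 2 * 0 + 2 * 0"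
    by (intro tendsto_intros assms)
  then show "(\<lambda>n. 2 * L2_norm_sq M (f n) + 2 * L2_norm_sq M (g n)) \<longlonglongrightarrow> 0" by simp
qed

lemma sobolev_converges_add:
  assumes G: "open G" "bounded G" and u: "u \<in> sobolev Basis G" and v: "v \<in> sobolev Basis G"
    and \<phi>: "sobolev_converges G \<phi> u" and \<psi>: "sobolev_converges G \<psi> v"
  shows "sobolev_converges G (\<lambda>n x. \<phi> n x + \<psi> n x) (\<lambda>x. u x + v x)"
  unfolding sobolev_converges_def
proof (intro conjI allI ballI)
  have sm: "smooth (\<phi> n)" "smooth (\<psi> n)" for n using \<phi> \<psi> by (auto simp: sobolev_converges_def)
  show "smooth (\<lambda>x. \<phi> n x + \<psi> n x)" for n by (intro smooth_add sm)
  have "(\<lambda>n. L2_norm_sq (lebesgue_on G) (\<lambda>x. (\<phi> n x - u x) + (\<psi> n x - v x))) \<longlonglongrightarrow> 0"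
    using \<phi> \<psi> by (intro tendsto_L2_norm_sq_add L2_diff smooth_L2_lebesgue_on sm G sobolevD[OF u] sobolevD[OF v]) (auto simp: sobolev_converges_def)
  moreover have "(\<phi> n x - u x) + (\<psi> n x - v x) = (\<phi> n x + \<psi> n x) - (u x + v x)" for n x by simp
  ultimately show "(\<lambda>n. L2_norm_sq (lebesgue_on G) (\<lambda>x. (\<phi> n x + \<psi> n x) - (u x + v x))) \<longlonglongrightarrow> 0" by simp
  fix b :: 'a assume b: "b \<in> Basis"
  have 1: "(\<lambda>n. L2_norm_sq (lebesgue_on G) (\<lambda>x. (deriv_along b (\<phi> n) x - weak_deriv G b u x) + (deriv_along b (\<psi> n) x - weak_deriv G b v x))) \<longlonglongrightarrow> 0"
    using \<phi> \<psi> b by (intro tendsto_L2_norm_sq_add L2_diff smooth_L2_lebesgue_on smooth_deriv_along sm G sobolevD(2)[OF u] sobolevD(2)[OF v] b) (auto simp: sobolev_converges_def)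
  have "L2_norm_sq (lebesgue_on G) (\<lambda>x. (deriv_along b (\<phi> n) x - weak_deriv G b u x) + (deriv_along b (\<psi> n) x - weak_deriv G b v x)) =
     L2_norm_sq (lebesgue_on G) (\<lambda>x. deriv_along b (\<lambda>x. \<phi> n x + \<psi> n x) x - weak_deriv G b (\<lambda>x. u x + v x) x)" for n
  proof (rule L2_norm_sq_cong_AE)
    show "(\<lambda>x. (deriv_along b (\<phi> n) x - weak_deriv G b u x) + (deriv_along b (\<psi> n) x - weak_deriv G b v x)) \<in> borel_measurable (lebesgue_on G)"
      by (intro L2_measurable L2_add L2_diff smooth_L2_lebesgue_on smooth_deriv_along sm G sobolevD(2)[OF u] sobolevD(2)[OF v] b)
    show "(\<lambda>x. deriv_along b (\<lambda>x. \<phi> n x + \<psi> n x) x - weak_deriv G b (\<lambda>x. u x + v x) x) \<in> borel_measurable (lebesgue_on G)"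
      by (intro L2_measurable L2_diff smooth_L2_lebesgue_on smooth_deriv_along smooth_add sm G sobolevD(2)[OF sobolev_add(1)[OF G subset_refl u v]] b)
    show "AE x in lebesgue_on G. (deriv_along b (\<phi> n) x - weak_deriv G b u x) + (deriv_along b (\<psi> n) x - weak_deriv G b v x) =
        deriv_along b (\<lambda>x. \<phi> n x + \<psi> n x) x - weak_deriv G b (\<lambda>x. u x + v x) x"
      using sobolev_add(2)[OF G subset_refl u v b]
      by eventually_elim (simp add: deriv_along_add[OF smooth_differentiable[OF sm(1)] smooth_differentiable[OF sm(2)]])
  qed
  then show "(\<lambda>n. L2_norm_sq (lebesgue_on G) (\<lambda>x. deriv_along b (\<lambda>x. \<phi> n x + \<psi> n x) x - weak_deriv G b (\<lambda>x. u x + v x) x)) \<longlonglongrightarrow> 0"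
    using 1 by simp
qed

lemma trace_add:
  assumes K: "solid_polytope K" and u: "u \<in> sobolev Basis (interior K)" and v: "v \<in> sobolev Basis (interior K)"
  shows "AE y in surface_on (frontier K). trace K (\<lambda>x. u x + v x) y = trace K u y + trace K v y"
proof -
  note basic = solid_polytope_basic[OF K]
  let ?S = "surface_on (frontier K)"
  obtain \<phi> where \<phi>: "sobolev_converges (interior K) \<phi> u" "(\<lambda>n. L2_norm_sq ?S (\<lambda>x. \<phi> n x - trace K u x)) \<longlonglongrightarrow> 0"
    using has_trace_trace[OF K u] by (auto simp: has_trace_Basis_iff)
  obtain \<psi> where \<psi>: "sobolev_converges (interior K) \<psi> v" "(\<lambda>n. L2_norm_sq ?S (\<lambda>x. \<psi> n x - trace K v x)) \<longlonglongrightarrow> 0"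
    using has_trace_trace[OF K v] by (auto simp: has_trace_Basis_iff)
  have sm: "smooth (\<phi> n)" "smooth (\<psi> n)" for n using \<phi>(1) \<psi>(1) by (auto simp: sobolev_converges_def)
  show ?thesis
  proof (rule has_trace_unique[OF K has_trace_trace[OF K sobolev_add(1)[OF basic(4,6) subset_refl u v]]])
    show "(\<lambda>y. trace K u y + trace K v y) \<in> L2 ?S" by (intro L2_add trace_L2 K u v)
    show "sobolev_converges (interior K) (\<lambda>n x. \<phi> n x + \<psi> n x) (\<lambda>x. u x + v x)"
      by (rule sobolev_converges_add[OF basic(4,6) u v \<phi>(1) \<psi>(1)])
    have "(\<lambda>n. L2_norm_sq ?S (\<lambda>x. (\<phi> n x - trace K u x) + (\<psi> n x - trace K v x))) \<longlonglongrightarrow> 0"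
      by (intro tendsto_L2_norm_sq_add L2_diff smooth_L2_frontier sm trace_L2 K u v \<phi> \<psi>)
    moreover have "(\<phi> n x - trace K u x) + (\<psi> n x - trace K v x) = (\<phi> n x + \<psi> n x) - (trace K u x + trace K v x)" for n x by simp
    ultimately show "(\<lambda>n. L2_norm_sq ?S (\<lambda>x. (\<phi> n x + \<psi> n x) - (trace K u x + trace K v x))) \<longlonglongrightarrow> 0" by simp
  qed
qed

text \<open>Almost everywhere equal functions have identical chosen weak derivatives, so an
  approximating sequence for one approximates the other.\<close>

lemma trace_cong_AE:
  assumes K: "solid_polytope K" and u: "u \<in> sobolev Basis (interior K)"
    and eq: "AE x in lebesgue_on (interior K). u x = v x" and v: "v \<in> borel_measurable (lebesgue_on (interior K))"
  shows "AE y in surface_on (frontier K). trace K u y = trace K v y"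
proof -
  let ?S = "surface_on (frontier K)" let ?G = "lebesgue_on (interior K)"
  have vs: "v \<in> sobolev Basis (interior K)" and wd: "\<And>b. b \<in> Basis \<Longrightarrow> weak_deriv (interior K) b v = weak_deriv (interior K) b u"
    using sobolev_cong_AE[OF eq v subset_refl u] by auto
  note basic = solid_polytope_basic[OF K]
  obtain \<psi> where \<psi>: "sobolev_converges (interior K) \<psi> v" "(\<lambda>n. L2_norm_sq ?S (\<lambda>x. \<psi> n x - trace K v x)) \<longlonglongrightarrow> 0"
    using has_trace_trace[OF K vs] by (auto simp: has_trace_Basis_iff)
  have sm: "smooth (\<psi> n)" for n using \<psi>(1) by (simp add: sobolev_converges_def)
  show ?thesis
  proof (rule has_trace_unique[OF K has_trace_trace[OF K u] trace_L2[OF K vs] _ \<psi>(2)])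
    have "L2_norm_sq ?G (\<lambda>x. \<psi> n x - v x) = L2_norm_sq ?G (\<lambda>x. \<psi> n x - u x)" for n
    proof (rule L2_norm_sq_cong_AE)
      show "AE x in ?G. \<psi> n x - v x = \<psi> n x - u x" using eq by eventually_elim simp
      show "(\<lambda>x. \<psi> n x - v x) \<in> borel_measurable ?G" "(\<lambda>x. \<psi> n x - u x) \<in> borel_measurable ?G"
        by (intro L2_measurable L2_diff smooth_L2_lebesgue_on sm basic sobolevD[OF u] sobolevD[OF vs])+
    qed
    then show "sobolev_converges (interior K) \<psi> u" using \<psi>(1) wd by (simp add: sobolev_converges_def)
  qed
qed

text \<open>The divergence theorem for \<open>\<phi> n * v\<close> passes to the limit: each factor
  paired with \<open>\<phi> n\<close> or its derivative is a fixed square integrable function, and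
  the normal field is bounded.\<close>

lemma integration_by_parts:
  assumes K: "solid_polytope K" and u: "u \<in> sobolev Basis (interior K)" and v: "smooth v" and b: "b \<in> Basis"
  shows "(\<integral>x. weak_deriv (interior K) b u x * v x + u x * deriv_along b v x \<partial>lebesgue_on (interior K)) =
     (\<integral>y. trace K u y * v y * normal_field K b y \<partial>surface_on (frontier K))"
proof -
  note basic = solid_polytope_basic[OF K]
  let ?S = "surface_on (frontier K)" let ?G = "lebesgue_on (interior K)"
  obtain \<phi> where \<phi>: "sobolev_converges (interior K) \<phi> u" "(\<lambda>n. L2_norm_sq ?S (\<lambda>x. \<phi> n x - trace K u x)) \<longlonglongrightarrow> 0"
    using has_trace_trace[OF K u] by (auto simp: has_trace_Basis_iff)
  have sm: "smooth (\<phi> n)" for n using \<phi>(1) by (simp add: sobolev_converges_def)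
  have L2v: "v \<in> L2 ?G" "deriv_along b v \<in> L2 ?G" by (intro smooth_L2_lebesgue_on smooth_deriv_along v b basic)+
  have L2\<phi>: "\<phi> n \<in> L2 ?G" "deriv_along b (\<phi> n) \<in> L2 ?G" for n by (intro smooth_L2_lebesgue_on smooth_deriv_along sm b basic)+
  have l1: "(\<lambda>n. (\<integral>x. deriv_along b (\<phi> n) x * v x \<partial>?G) + (\<integral>x. \<phi> n x * deriv_along b v x \<partial>?G)) \<longlonglongrightarrow>
     (\<integral>x. weak_deriv (interior K) b u x * v x \<partial>?G) + (\<integral>x. u x * deriv_along b v x \<partial>?G)"
    using \<phi>(1) b by (intro tendsto_add tendsto_integral_mult_L2 L2v L2\<phi> sobolevD[OF u] b) (auto simp: sobolev_converges_def)
  have eq: "(\<integral>x. deriv_along b (\<phi> n) x * v x \<partial>?G) + (\<integral>x. \<phi> n x * deriv_along b v x \<partial>?G) = (\<integral>y. \<phi> n y * (v y * normal_field K b y) \<partial>?S)" for n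
  proof -
    have "(\<integral>x. deriv_along b (\<phi> n) x * v x \<partial>?G) + (\<integral>x. \<phi> n x * deriv_along b v x \<partial>?G) = (\<integral>x. deriv_along b (\<phi> n) x * v x + \<phi> n x * deriv_along b v x \<partial>?G)"
      by (intro Bochner_Integration.integral_add[symmetric] L2_mult_integrable L2v L2\<phi>)
    also have "\<dots> = (\<integral>x. deriv_along b (\<lambda>x. \<phi> n x * v x) x \<partial>?G)"
      by (simp add: deriv_along_mult smooth_differentiable sm v add.commute)
    also have "\<dots> = (\<integral>y. (\<phi> n y * v y) * normal_field K b y \<partial>?S)"
      by (rule divergence_solid_polytope[OF K smooth_mult[OF sm v] b])
    finally show ?thesis by (simp add: mult.assoc)
  qed
  have l2: "(\<lambda>n. \<integral>y. \<phi> n y * (v y * normal_field K b y) \<partial>?S) \<longlonglongrightarrow> (\<integral>y. trace K u y * (v y * normal_field K b y) \<partial>?S)"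
    by (intro tendsto_integral_mult_L2 smooth_L2_frontier sm v trace_L2 K u \<phi>(2)
        L2_mult_bounded[OF smooth_L2_frontier[OF v K K K] borel_measurable_surface_on[OF normal_field_measurable[OF K]] normal_field_bounded[OF K b]])
  have "(\<integral>x. weak_deriv (interior K) b u x * v x \<partial>?G) + (\<integral>x. u x * deriv_along b v x \<partial>?G) = (\<integral>y. trace K u y * (v y * normal_field K b y) \<partial>?S)"
    by (rule LIMSEQ_unique[OF l1[unfolded eq] l2])
  then show ?thesis
    using L2_mult_integrable[OF sobolevD(2)[OF u b] L2v(1)] L2_mult_integrable[OF sobolevD(1)[OF u] L2v(2)]
    by (simp add: mult.assoc)
qed

section \<open>Decompositions into polytopes\<close>

text \<open>A Lipschitz domain has no slits: below the graph there is an open set free of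
  \<open>G\<close> next to any boundary point. The mesh covers the closure of \<open>Q\<close>, and
  this is what places points interior to a union of elements in \<open>Q\<close> itself.\<close>

lemma lipschitz_boundary_interior_closure:
  fixes G :: "'a::euclidean_space set"
  assumes G: "open G" "lipschitz_boundary G"
  shows "interior (closure G) = G"
proof
  show "G \<subseteq> interior (closure G)" by (rule interior_maximal[OF closure_subset G(1)])
  show "interior (closure G) \<subseteq> G"
  proof (rule ccontr)
    assume "\<not> interior (closure G) \<subseteq> G"
    then obtain x where x: "x \<in> interior (closure G)" "x \<notin> G" by blast
    then have "x \<in> frontier G" using interior_subset[of "closure G"] G(1) by (auto simp: frontier_def interior_open)
    then obtain r \<nu> L and \<gamma> :: "'a \<Rightarrow> real" where r: "r > 0" and \<nu>: "norm \<nu> = 1" and \<gamma>: "L-lipschitz_on UNIV \<gamma>"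
      and eq: "G \<inter> ball x r = {y \<in> ball x r. \<nu> \<bullet> y > \<gamma> (y - (\<nu> \<bullet> y) *\<^sub>R \<nu>)}"
      using G(2) unfolding lipschitz_boundary_def by meson
    define p where "p y = y - (\<nu> \<bullet> y) *\<^sub>R \<nu>" for y
    have \<nu>1: "\<nu> \<bullet> \<nu> = 1" using \<nu> by (simp add: dot_square_norm)
    define U where "U = ball x r \<inter> {y. \<nu> \<bullet> y < \<gamma> (p y)}"
    have "continuous_on UNIV \<gamma>" using \<gamma> by (rule lipschitz_on_continuous_on)
    then have "continuous_on UNIV (\<lambda>y. \<gamma> (p y))"
      unfolding p_def by (rule continuous_on_compose2) (auto intro!: continuous_intros)
    then have "open {y. \<nu> \<bullet> y < \<gamma> (p y)}" by (intro open_Collect_less continuous_intros)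
    then have "open U" by (simp add: U_def open_Int)
    moreover have "U \<inter> G = {}"
    proof -
      have "\<not> \<nu> \<bullet> y < \<gamma> (p y)" if "y \<in> G" "y \<in> ball x r" for y
      proof -
        have "y \<in> {y \<in> ball x r. \<nu> \<bullet> y > \<gamma> (y - (\<nu> \<bullet> y) *\<^sub>R \<nu>)}" using that eq by blast
        then show ?thesis by (simp add: p_def)
      qed
      then show ?thesis by (auto simp: U_def)
    qed
    ultimately have U: "U \<inter> closure G = {}" by (simp add: open_Int_closure_eq_empty)
    have "\<not> \<nu> \<bullet> x > \<gamma> (p x)"
    proof
      assume "\<nu> \<bullet> x > \<gamma> (p x)"
      then have "x \<in> {y \<in> ball x r. \<nu> \<bullet> y > \<gamma> (y - (\<nu> \<bullet> y) *\<^sub>R \<nu>)}" using r unfolding p_def by simp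
      then show False using x(2) eq by blast
    qed
    then have xle: "\<nu> \<bullet> x \<le> \<gamma> (p x)" by simp
    obtain e where e: "e > 0" "ball x e \<subseteq> closure G"
      using x(1) by (auto simp: mem_interior)
    define s where "s = min e r / 2"
    have s: "s > 0" "s < e" "s < r" using e r by (auto simp: s_def)
    \<comment> \<open>Moving against \<open>\<nu>\<close> leaves the projection unchanged, so
      \<open>z\<close> is strictly below the graph although \<open>x\<close> may lie on it.\<close>
    define z where "z = x - s *\<^sub>R \<nu>"
    have "dist x z = s" using \<nu> s by (simp add: z_def dist_norm)
    then have "z \<in> closure G" "z \<in> ball x r" using e s by auto
    moreover have "p z = p x" "\<nu> \<bullet> z = \<nu> \<bullet> x - s"
      using \<nu>1 by (simp_all add: p_def z_def inner_diff_right algebra_simps)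
    ultimately have "z \<in> U \<inter> closure G" using xle s by (simp add: U_def)
    then show False using U by blast
  qed
qed

text \<open>Near a relatively interior point of the facet both polytopes contain the same half ball,
  whose open part is nonempty.\<close>

lemma facets_same_side:
  assumes K: "solid_polytope K" "solid_polytope K'" and F: "F \<in> facets K" "F \<in> facets K'"
    and same: "outer_normal K F = outer_normal K' F"
  shows "interior K \<inter> interior K' \<noteq> {}"
proof -
  let ?n = "outer_normal K F"
  obtain y where y: "y \<in> rel_interior F" using rel_interior_facet(1)[OF K(1) F(1)] by blast
  then have yF: "y \<in> F" using rel_interior_subset by blast
  obtain e where e: "e > 0" "\<And>x. x \<in> ball y e \<Longrightarrow> ?n \<bullet> x \<le> facet_offset K F \<Longrightarrow> x \<in> K"
    using half_ball_subset_solid_polytope[OF K(1) F(1) yF] rel_interior_facet(2)[OF K(1) F(1) y] by metis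
  obtain e' where e': "e' > 0" "\<And>x. x \<in> ball y e' \<Longrightarrow> outer_normal K' F \<bullet> x \<le> facet_offset K' F \<Longrightarrow> x \<in> K'"
    using half_ball_subset_solid_polytope[OF K(2) F(2) yF] rel_interior_facet(2)[OF K(2) F(2) y] by metis
  have c: "?n \<bullet> y = facet_offset K F" "?n \<bullet> y = facet_offset K' F"
    using facet_hyperplane(3)[OF K(1) F(1)] facet_hyperplane(3)[OF K(2) F(2)] yF same by auto
  have n1: "norm ?n = 1" by (rule solid_polytope_facets(1)[OF K(1) F(1)])
  let ?U = "ball y (min e e') \<inter> {x. ?n \<bullet> x < facet_offset K F}"
  have "open ?U" by (intro open_Int open_ball open_halfspace_lt)
  moreover have "?U \<subseteq> K" "?U \<subseteq> K'" using e(2) e'(2) c same by (auto intro: less_imp_le)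
  ultimately have "?U \<subseteq> interior K \<inter> interior K'" by (simp add: interior_maximal)
  moreover have "y - (min e e' / 2) *\<^sub>R ?n \<in> ?U"
  proof -
    have "dist y (y - (min e e' / 2) *\<^sub>R ?n) = min e e' / 2" using e(1) e'(1) n1 by (simp add: dist_norm)
    moreover have "?n \<bullet> (y - (min e e' / 2) *\<^sub>R ?n) = facet_offset K F - min e e' / 2"
      using n1 c(1) by (simp add: inner_diff_right dot_square_norm)
    moreover have "0 < min e e'" using e(1) e'(1) by simp
    ultimately show ?thesis unfolding Int_iff mem_ball mem_Collect_eq by linarith
  qed
  ultimately show ?thesis by blast
qed

text \<open>The facet spans one plane, so the normals agree up to sign, and equal signs would make
  the interiors overlap.\<close>

lemma shared_facet_normal:
  assumes K: "solid_polytope K" "solid_polytope K'" and F: "F \<in> facets K" "F \<in> facets K'"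
    and disj: "interior K \<inter> interior K' = {}"
  shows "outer_normal K' F = - outer_normal K F" "facet_offset K' F = - facet_offset K F"
proof -
  have "{y. outer_normal K F \<bullet> y = facet_offset K F} = {y. outer_normal K' F \<bullet> y = facet_offset K' F}"
    using facet_hyperplane(2)[OF K(1) F(1)] facet_hyperplane(2)[OF K(2) F(2)] by simp
  from hyperplane_eq_normal[OF solid_polytope_facets(1)[OF K(1) F(1)] solid_polytope_facets(1)[OF K(2) F(2)] this]
  have "outer_normal K' F = outer_normal K F \<or> (outer_normal K' F = - outer_normal K F \<and> facet_offset K' F = - facet_offset K F)"
    by blast
  moreover have "outer_normal K' F \<noteq> outer_normal K F"
    using facets_same_side[OF K F] disj by metis
  ultimately show "outer_normal K' F = - outer_normal K F" "facet_offset K' F = - facet_offset K F" by auto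
qed

section \<open>Almost every boundary point lies on a single facet\<close>

lemma null_sets_facets_Int:
  assumes K: "solid_polytope K" and F: "F \<in> facets K" "F' \<in> facets K" "F \<noteq> F'"
  shows "F \<inter> F' \<in> null_sets surface_measure"
proof (rule null_sets_subset[OF null_sets_surface_Int[OF facet_hyperplane(1)[OF K F(1)] facet_hyperplane(1)[OF K F(2)] facet_hyperplane_inj[OF K F]]])
  show "F \<inter> F' \<in> sets surface_measure"
    using closed_facet[OF K F(1)] closed_facet[OF K F(2)] by (auto intro: borel_closed)
  show "F \<inter> F' \<subseteq> {y. outer_normal K F \<bullet> y = facet_offset K F} \<inter> {y. outer_normal K F' \<bullet> y = facet_offset K F'}"
    using facet_hyperplane(3)[OF K F(1)] facet_hyperplane(3)[OF K F(2)] by blast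
qed

lemma AE_facets_disjoint:
  assumes K: "solid_polytope K"
  shows "AE y in surface_measure. \<forall>F\<in>facets K. \<forall>F'\<in>facets K. F \<noteq> F' \<longrightarrow> \<not> (y \<in> F \<and> y \<in> F')"
proof (intro AE_finite_allI finite_facets[OF K])
  fix F F' assume F: "F \<in> facets K" "F' \<in> facets K"
  show "AE y in surface_measure. F \<noteq> F' \<longrightarrow> \<not> (y \<in> F \<and> y \<in> F')"
  proof (cases "F = F'")
    case False
    have "AE y in surface_measure. y \<notin> F \<inter> F'" by (rule AE_not_in[OF null_sets_facets_Int[OF K F False]])
    then show ?thesis by eventually_elim auto
  qed simp
qed

lemma normal_field_on_facet:
  assumes K: "solid_polytope K" and F: "F \<in> facets K" "y \<in> F"
    and reg: "\<And>F'. F' \<in> facets K \<Longrightarrow> F' \<noteq> F \<Longrightarrow> y \<notin> F'"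
  shows "normal_field K b y = outer_normal K F \<bullet> b"
proof -
  have "normal_field K b y = (\<Sum>F'\<in>facets K. if F' = F then outer_normal K F \<bullet> b else 0)"
    unfolding normal_field_def using reg F by (intro sum.cong) (auto simp: indicator_def)
  then show ?thesis using F finite_facets[OF K] by simp
qed

text \<open>The two elements lie on opposite sides of the plane of \<open>F\<close>; near a point on
  no other facet they contain complementary half balls, which make up a full ball.\<close>

lemma shared_facet_interior:
  assumes K: "solid_polytope K" "solid_polytope K'" and F: "F \<in> facets K" "F \<in> facets K'"
    and disj: "interior K \<inter> interior K' = {}" and y: "y \<in> F"
    and reg: "\<And>F'. F' \<in> facets K \<Longrightarrow> F' \<noteq> F \<Longrightarrow> y \<notin> F'" "\<And>F'. F' \<in> facets K' \<Longrightarrow> F' \<noteq> F \<Longrightarrow> y \<notin> F'"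
  shows "y \<in> interior (K \<union> K')"
proof -
  obtain e where e: "e > 0" "\<And>x. x \<in> ball y e \<Longrightarrow> outer_normal K F \<bullet> x \<le> facet_offset K F \<Longrightarrow> x \<in> K"
    using half_ball_subset_solid_polytope[OF K(1) F(1) y reg(1)] by metis
  obtain e' where e': "e' > 0" "\<And>x. x \<in> ball y e' \<Longrightarrow> outer_normal K' F \<bullet> x \<le> facet_offset K' F \<Longrightarrow> x \<in> K'"
    using half_ball_subset_solid_polytope[OF K(2) F(2) y reg(2)] by metis
  have "ball y (min e e') \<subseteq> K \<union> K'"
  proof
    fix x assume x: "x \<in> ball y (min e e')"
    show "x \<in> K \<union> K'"
    proof (cases "outer_normal K F \<bullet> x \<le> facet_offset K F")
      case True
      then show ?thesis using e(2) x by auto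
    next
      case False
      then have "outer_normal K' F \<bullet> x \<le> facet_offset K' F" unfolding shared_facet_normal[OF K F disj] by simp
      then show ?thesis using e'(2) x by auto
    qed
  qed
  then show ?thesis using e(1) e'(1) by (auto simp: mem_interior intro!: exI[of _ "min e e'"])
qed

text \<open>Facets may overlap in parts. The notion serves for \<open>Q\<close> with its whole mesh
  and also for the interior of the union of two neighbouring elements.\<close>

definition polytope_decomposition :: "'a::euclidean_space set \<Rightarrow> 'a set set \<Rightarrow> bool" where
  "polytope_decomposition G \<C> \<longleftrightarrow> open G \<and> bounded G \<and> finite \<C> \<and> (\<forall>K\<in>\<C>. solid_polytope K \<and> interior K \<subseteq> G) \<and>
     G \<subseteq> \<Union>\<C> \<and> (\<forall>K\<in>\<C>. \<forall>K'\<in>\<C>. K \<noteq> K' \<longrightarrow> interior K \<inter> interior K' = {})"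

text \<open>Off the negligible frontiers each point of \<open>G\<close> belongs to the interior of
  exactly one polytope, so the indicators add up to that of \<open>G\<close>.\<close>

lemma integral_polytope_decomposition:
  fixes f :: "'a::euclidean_space \<Rightarrow> real"
  assumes D: "polytope_decomposition G \<C>" and f: "integrable (lebesgue_on G) f"
  shows "(\<integral>x. f x \<partial>lebesgue_on G) = (\<Sum>K\<in>\<C>. \<integral>x. f x \<partial>lebesgue_on (interior K))"
proof -
  have G: "open G" "finite \<C>" "G \<subseteq> \<Union>\<C>" using D by (auto simp: polytope_decomposition_def)
  have s: "G \<inter> space lebesgue \<in> sets lebesgue" "\<And>K. interior K \<inter> space lebesgue \<in> sets lebesgue" using G by auto
  have fG: "integrable lebesgue (\<lambda>x. indicator G x *\<^sub>R f x)" using f integrable_restrict_space[OF s(1), of f] by simp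
  have sub: "interior K \<subseteq> G" if "K \<in> \<C>" for K using D that by (auto simp: polytope_decomposition_def)
  have eqK: "indicator (interior K) x *\<^sub>R (indicator G x *\<^sub>R f x) = indicator (interior K) x *\<^sub>R f x" if "K \<in> \<C>" for K x
    using sub[OF that] by (auto simp: indicator_def)
  have fK: "integrable lebesgue (\<lambda>x. indicator (interior K) x *\<^sub>R f x)" if "K \<in> \<C>" for K
    using integrable_mult_indicator[of "interior K" lebesgue, OF _ fG] unfolding eqK[OF that] by simp
  have "AE x in lebesgue. \<forall>K\<in>\<C>. x \<notin> frontier K"
  proof (intro AE_finite_allI G)
    fix K assume "K \<in> \<C>"
    then have "negligible (frontier K)" using D solid_polytope_basic(9) by (auto simp: polytope_decomposition_def)
    then show "AE x in lebesgue. x \<notin> frontier K" by (intro AE_not_in) (simp add: negligible_iff_null_sets)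
  qed
  then have ae: "AE x in lebesgue. indicator G x *\<^sub>R f x = (\<Sum>K\<in>\<C>. indicator (interior K) x *\<^sub>R f x)"
  proof eventually_elim
    case (elim x)
    show ?case
    proof (cases "x \<in> G")
      case True
      then obtain K where K: "K \<in> \<C>" "x \<in> K" using G by blast
      then have xK: "x \<in> interior K" using elim D solid_polytope_basic(10)[of K] by (auto simp: polytope_decomposition_def)
      have "x \<in> interior K' \<longleftrightarrow> K' = K" if "K' \<in> \<C>" for K'
        using D K xK that unfolding polytope_decomposition_def by blast
      then have "(\<Sum>K'\<in>\<C>. indicator (interior K') x *\<^sub>R f x) = (\<Sum>K'\<in>\<C>. if K' = K then f x else 0)"
        by (intro sum.cong) (auto simp: indicator_def)
      then show ?thesis using True K G by simp
    next
      case False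
      then have "x \<notin> interior K" if "K \<in> \<C>" for K using sub[OF that] by blast
      then have "(\<Sum>K\<in>\<C>. indicator (interior K) x *\<^sub>R f x) = (\<Sum>K\<in>\<C>. 0)"
        by (intro sum.cong) auto
      then show ?thesis using False by simp
    qed
  qed
  have "(\<integral>x. f x \<partial>lebesgue_on G) = (\<integral>x. indicator G x *\<^sub>R f x \<partial>lebesgue)"
    by (rule integral_restrict_space[OF s(1)])
  also have "\<dots> = (\<integral>x. (\<Sum>K\<in>\<C>. indicator (interior K) x *\<^sub>R f x) \<partial>lebesgue)"
    using fG fK by (intro integral_cong_AE ae borel_measurable_sum) (auto intro: borel_measurable_integrable)
  also have "\<dots> = (\<Sum>K\<in>\<C>. \<integral>x. indicator (interior K) x *\<^sub>R f x \<partial>lebesgue)"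
    by (rule Bochner_Integration.integral_sum) (rule fK)
  also have "\<dots> = (\<Sum>K\<in>\<C>. \<integral>x. f x \<partial>lebesgue_on (interior K))"
    by (intro sum.cong refl integral_restrict_space[OF s(2), symmetric])
  finally show ?thesis .
qed

lemma polytope_decompositionD:
  assumes "polytope_decomposition G \<C>" "K \<in> \<C>"
  shows "solid_polytope K" "interior K \<subseteq> G"
  using assms by (auto simp: polytope_decomposition_def)

text \<open>Testing the elementwise integration by parts with test functions of \<open>G\<close> shows that the
  normal traces from the elements meeting at an interior boundary point cancel.\<close>

lemma AE_normal_traces_cancel:
  fixes u :: "'a::euclidean_space \<Rightarrow> real"
  assumes D: "polytope_decomposition G \<C>" and u: "u \<in> sobolev Basis G" and b: "b \<in> Basis"
  shows "AE y in surface_measure. y \<in> G \<longrightarrow> (\<Sum>K\<in>\<C>. indicator (frontier K) y * (trace K u y * normal_field K b y)) = 0"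
proof (rule AE_eq_0_if_integral_test_functions_eq_0)
  have G: "open G" "bounded G" "finite \<C>" using D by (auto simp: polytope_decomposition_def)
  have K: "solid_polytope K" "interior K \<subseteq> G" "open (interior K)" if "K \<in> \<C>" for K
    using polytope_decompositionD[OF D that] by auto
  have uK: "u \<in> sobolev Basis (interior K)" if "K \<in> \<C>" for K
    by (rule sobolev_subset(1)[OF G(1) K(3,2)[OF that] G(2) subset_refl u])
  have trL2: "(\<lambda>y. trace K u y * normal_field K b y) \<in> L2 (surface_on (frontier K))" if "K \<in> \<C>" for K
    by (rule L2_mult_bounded[OF trace_L2[OF K(1)[OF that] uK[OF that]]
          borel_measurable_surface_on[OF normal_field_measurable[OF K(1)[OF that]]] normal_field_bounded[OF K(1)[OF that] b]])
  have int: "integrable surface_measure (\<lambda>y. indicator (frontier K) y * (trace K u y * normal_field K b y))" if "K \<in> \<C>" for K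
    using L2_integrable[OF frontier_solid_polytope_basic(3)[OF K(1)[OF that]] trL2[OF that]]
      integral_surface_on(2)[OF frontier_solid_polytope_basic(1)[OF K(1)[OF that]]] by simp
  show "sets surface_measure = sets borel" by simp
  show "open G" by (rule G)
  show "integrable surface_measure (\<lambda>y. \<Sum>K\<in>\<C>. indicator (frontier K) y * (trace K u y * normal_field K b y))"
    by (intro Bochner_Integration.integrable_sum int)
  fix \<phi> assume \<phi>: "\<phi> \<in> test_functions G"
  have \<phi>s: "smooth \<phi>" by (rule test_functions_smooth[OF \<phi>])
  have intK: "integrable surface_measure (\<lambda>y. indicator (frontier K) y * (trace K u y * \<phi> y * normal_field K b y))"
    if "K \<in> \<C>" for K
  proof -
    have "integrable (surface_on (frontier K)) (\<lambda>y. (trace K u y * normal_field K b y) * \<phi> y)"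
      by (rule L2_mult_integrable[OF trL2[OF that] smooth_L2_frontier[OF \<phi>s K(1)[OF that] K(1)[OF that] K(1)[OF that]]])
    then have "integrable (surface_on (frontier K)) (\<lambda>y. trace K u y * \<phi> y * normal_field K b y)"
      by (simp add: mult_ac)
    then show ?thesis using integral_surface_on(2)[OF frontier_solid_polytope_basic(1)[OF K(1)[OF that]]] by simp
  qed
  have "(\<integral>y. (\<Sum>K\<in>\<C>. indicator (frontier K) y * (trace K u y * normal_field K b y)) * \<phi> y \<partial>surface_measure) =
     (\<integral>y. (\<Sum>K\<in>\<C>. indicator (frontier K) y * (trace K u y * \<phi> y * normal_field K b y)) \<partial>surface_measure)"
    by (intro Bochner_Integration.integral_cong refl) (simp only: sum_distrib_right, intro sum.cong refl, simp only: mult_ac)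
  also have "\<dots> = (\<Sum>K\<in>\<C>. \<integral>y. indicator (frontier K) y * (trace K u y * \<phi> y * normal_field K b y) \<partial>surface_measure)"
    by (rule Bochner_Integration.integral_sum) (rule intK)
  also have "\<dots> = (\<Sum>K\<in>\<C>. \<integral>x. weak_deriv G b u x * \<phi> x + u x * deriv_along b \<phi> x \<partial>lebesgue_on (interior K))"
  proof (intro sum.cong refl)
    fix K assume KC: "K \<in> \<C>"
    note Kb = solid_polytope_basic[OF K(1)[OF KC]]
    have "(\<integral>y. indicator (frontier K) y * (trace K u y * \<phi> y * normal_field K b y) \<partial>surface_measure) =
      (\<integral>y. trace K u y * \<phi> y * normal_field K b y \<partial>surface_on (frontier K))"
      by (rule integral_surface_on(1)[symmetric]) (rule frontier_solid_polytope_basic(1)[OF K(1)[OF KC]])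
    also have "\<dots> = (\<integral>x. weak_deriv (interior K) b u x * \<phi> x + u x * deriv_along b \<phi> x \<partial>lebesgue_on (interior K))"
      by (rule integration_by_parts[OF K(1)[OF KC] uK[OF KC] \<phi>s b, symmetric])
    also have "\<dots> = (\<integral>x. weak_deriv G b u x * \<phi> x + u x * deriv_along b \<phi> x \<partial>lebesgue_on (interior K))"
    proof (rule integral_cong_AE)
      have m: "\<phi> \<in> borel_measurable (lebesgue_on (interior K))" "deriv_along b \<phi> \<in> borel_measurable (lebesgue_on (interior K))"
        "u \<in> borel_measurable (lebesgue_on (interior K))" "weak_deriv (interior K) b u \<in> borel_measurable (lebesgue_on (interior K))"
        "weak_deriv G b u \<in> borel_measurable (lebesgue_on (interior K))"
        by (intro L2_measurable smooth_L2_lebesgue_on smooth_deriv_along \<phi>s b Kb sobolevD[OF uK[OF KC]]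
            L2_lebesgue_on_subset(1)[OF G(1) K(3,2)[OF KC] sobolevD(2)[OF u b]])+
      then show "(\<lambda>x. weak_deriv (interior K) b u x * \<phi> x + u x * deriv_along b \<phi> x) \<in> borel_measurable (lebesgue_on (interior K))"
        "(\<lambda>x. weak_deriv G b u x * \<phi> x + u x * deriv_along b \<phi> x) \<in> borel_measurable (lebesgue_on (interior K))"
        by auto
      show "AE x in lebesgue_on (interior K). weak_deriv (interior K) b u x * \<phi> x + u x * deriv_along b \<phi> x = weak_deriv G b u x * \<phi> x + u x * deriv_along b \<phi> x"
        using sobolev_subset(2)[OF G(1) K(3,2)[OF KC] G(2) subset_refl u b] by eventually_elim simp
    qed
    finally show "(\<integral>y. indicator (frontier K) y * (trace K u y * \<phi> y * normal_field K b y) \<partial>surface_measure) =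
      (\<integral>x. weak_deriv G b u x * \<phi> x + u x * deriv_along b \<phi> x \<partial>lebesgue_on (interior K))" .
  qed
  also have "\<dots> = (\<integral>x. weak_deriv G b u x * \<phi> x + u x * deriv_along b \<phi> x \<partial>lebesgue_on G)"
    by (intro integral_polytope_decomposition[OF D, symmetric] Bochner_Integration.integrable_add L2_mult_integrable
        sobolevD[OF u] b test_function_L2[OF \<phi> G(1,2) b])
  also have "\<dots> = (\<integral>x. weak_deriv G b u x * \<phi> x \<partial>lebesgue_on G) + (\<integral>x. u x * deriv_along b \<phi> x \<partial>lebesgue_on G)"
    by (intro Bochner_Integration.integral_add L2_mult_integrable
        sobolevD[OF u] b test_function_L2[OF \<phi> G(1,2) b])
  also have "\<dots> = 0" using sobolevD(3)[OF u b] \<phi> by (simp add: is_weak_deriv_def)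
  finally show "(\<integral>y. (\<Sum>K\<in>\<C>. indicator (frontier K) y * (trace K u y * normal_field K b y)) * \<phi> y \<partial>surface_measure) = 0" .
qed

text \<open>On the patch of the two elements the normal traces cancel in every direction
  \<open>b\<close>. As the normals are opposite, the difference of the traces times
  \<open>n \<bullet> b\<close> vanishes, and some \<open>b\<close> has \<open>n \<bullet> b\<close>
  nonzero.\<close>

lemma AE_traces_equal_on_shared_facet:
  fixes u :: "'a::euclidean_space \<Rightarrow> real"
  assumes K: "solid_polytope K" "solid_polytope K'" and F: "F \<in> facets K" "F \<in> facets K'"
    and disj: "interior K \<inter> interior K' = {}" and G: "open G" "bounded G" "interior (K \<union> K') \<subseteq> G"
    and u: "u \<in> sobolev Basis G"
  shows "AE y in surface_measure. y \<in> F \<longrightarrow> trace K u y = trace K' u y"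
proof -
  let ?G = "interior (K \<union> K')" let ?n = "outer_normal K F"
  have sub: "interior K \<subseteq> ?G" "interior K' \<subseteq> ?G" by (rule interior_mono[OF Un_upper1], rule interior_mono[OF Un_upper2])
  have ne: "K \<noteq> K'" using disj solid_polytope_basic(7)[OF K(1)] by auto
  have bd: "bounded ?G" using G bounded_subset by blast
  have D: "polytope_decomposition ?G {K, K'}"
    unfolding polytope_decomposition_def using K sub disj bd interior_subset[of "K \<union> K'"] by auto
  have uG: "u \<in> sobolev Basis ?G" by (rule sobolev_subset(1)[OF G(1) open_interior G(3,2) subset_refl u])
  have "AE y in surface_measure. \<forall>b\<in>Basis. y \<in> ?G \<longrightarrow>
     indicator (frontier K) y * (trace K u y * normal_field K b y) + indicator (frontier K') y * (trace K' u y * normal_field K' b y) = 0"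
  proof (intro AE_finite_allI finite_Basis)
    fix b :: 'a assume b: "b \<in> Basis"
    have pair: "(\<Sum>L\<in>{K, K'}. f L) = f K + f K'" for f :: "'a set \<Rightarrow> real" using ne by simp
    from AE_normal_traces_cancel[OF D uG b]
    show "AE y in surface_measure. y \<in> ?G \<longrightarrow>
     indicator (frontier K) y * (trace K u y * normal_field K b y) + indicator (frontier K') y * (trace K' u y * normal_field K' b y) = 0"
      unfolding pair .
  qed
  with AE_facets_disjoint[OF K(1)] AE_facets_disjoint[OF K(2)] show ?thesis
  proof eventually_elim
    case (elim y)
    show ?case
    proof
      assume y: "y \<in> F"
      have reg: "F' \<in> facets K \<Longrightarrow> F' \<noteq> F \<Longrightarrow> y \<notin> F'" "F' \<in> facets K' \<Longrightarrow> F' \<noteq> F \<Longrightarrow> y \<notin> F'" for F'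
        using elim(1,2) y F by blast+
      have yG: "y \<in> ?G" by (rule shared_facet_interior[OF K F disj y reg])
      have fr: "y \<in> frontier K" "y \<in> frontier K'" using y F frontier_solid_polytope(1)[OF K(1)] frontier_solid_polytope(1)[OF K(2)] by auto
      have "(trace K u y - trace K' u y) * (?n \<bullet> b) = 0" if b: "b \<in> Basis" for b
      proof -
        have "normal_field K b y = ?n \<bullet> b" by (rule normal_field_on_facet[OF K(1) F(1) y]) (rule reg(1))
        moreover have "normal_field K' b y = - (?n \<bullet> b)"
          unfolding inner_minus_left[symmetric] shared_facet_normal(1)[OF K F disj, symmetric]
          by (rule normal_field_on_facet[OF K(2) F(2) y]) (rule reg(2))
        moreover have "indicator (frontier K) y * (trace K u y * normal_field K b y) + indicator (frontier K') y * (trace K' u y * normal_field K' b y) = 0"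
          using elim(3) b yG by blast
        ultimately show ?thesis using fr by (simp add: left_diff_distrib)
      qed
      moreover have "?n \<noteq> 0" using solid_polytope_facets(1)[OF K(1) F(1)] by auto
      then obtain b where "b \<in> Basis" "?n \<bullet> b \<noteq> 0" using euclidean_all_zero_iff[of ?n] by auto
      ultimately show "trace K u y = trace K' u y" by fastforce
    qed
  qed
qed

text \<open>The difference \<open>q - q'\<close> vanishes on the convex set \<open>F\<close>, so its
  gradient is orthogonal to all \<open>z - y\<close> with \<open>z\<close> in \<open>F\<close>.
  These directions span the plane of the facet, which leaves only the normal direction.\<close>

lemma gradient_jump_on_facet:
  fixes q q' :: "'a::euclidean_space \<Rightarrow> real"
  assumes K: "solid_polytope K" and F: "F \<in> facets K" and q: "smooth q" "smooth q'"
    and eq: "\<And>y. y \<in> F \<Longrightarrow> q y = q' y" and y: "y \<in> F"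
  shows "\<exists>c. \<forall>b\<in>Basis. deriv_along b q y - deriv_along b q' y = c * (outer_normal K F \<bullet> b)"
proof -
  let ?n = "outer_normal K F"
  define g where "g = (\<Sum>b\<in>Basis. (deriv_along b q y - deriv_along b q' y) *\<^sub>R b)"
  have gb: "g \<bullet> b = deriv_along b q y - deriv_along b q' y" if "b \<in> Basis" for b
    unfolding g_def using that by simp
  define r where "r x = q x - q' x" for x
  have r0: "r x = 0" if "x \<in> F" for x using eq[OF that] by (simp add: r_def)
  have dr: "(r has_derivative (\<lambda>h. h \<bullet> g)) (at y)"
  proof -
    have "(r has_derivative (\<lambda>h. (\<Sum>b\<in>Basis. (h \<bullet> b) * deriv_along b q y) - (\<Sum>b\<in>Basis. (h \<bullet> b) * deriv_along b q' y))) (at y)"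
      unfolding r_def[abs_def] by (intro has_derivative_diff smooth_has_derivative q)
    moreover have "(\<Sum>b\<in>Basis. (h \<bullet> b) * deriv_along b q y) - (\<Sum>b\<in>Basis. (h \<bullet> b) * deriv_along b q' y) = h \<bullet> g" for h
      by (simp add: g_def inner_sum_right sum_subtractf[symmetric] algebra_simps)
    ultimately show ?thesis by simp
  qed
  have "convex F" using F K by (auto simp: facets_def facet_of_def solid_polytope_def intro: face_of_imp_convex polytope_imp_convex)
  have orth: "(z - y) \<bullet> g = 0" if z: "z \<in> F" for z
  proof -
    have "((\<lambda>s. y + s *\<^sub>R (z - y)) has_derivative (\<lambda>s. s *\<^sub>R (z - y))) (at 0)"
      by (auto intro!: derivative_eq_intros)
    moreover have "(r has_derivative (\<lambda>h. h \<bullet> g)) (at (y + 0 *\<^sub>R (z - y)))" using dr by simp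
    ultimately have "((\<lambda>s. r (y + s *\<^sub>R (z - y))) has_derivative (\<lambda>s. (s *\<^sub>R (z - y)) \<bullet> g)) (at 0)"
      by (rule has_derivative_compose)
    then have "((\<lambda>s. r (y + s *\<^sub>R (z - y))) has_real_derivative ((z - y) \<bullet> g)) (at 0)"
      by (simp only: has_field_derivative_def inner_scaleR_left mult_commute_abs)
    then have "((\<lambda>h. (r (y + h *\<^sub>R (z - y)) - r y) / h) \<longlongrightarrow> (z - y) \<bullet> g) (at 0)"
      by (simp add: DERIV_def)
    \<comment> \<open>Only steps into the facet stay where the difference vanishes, and
      \<open>y\<close> may be a relative boundary point; hence the one-sided limit.\<close>
    then have l: "((\<lambda>h. (r (y + h *\<^sub>R (z - y)) - r y) / h) \<longlongrightarrow> (z - y) \<bullet> g) (at_right 0)"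
      by (rule filterlim_mono) (auto simp: at_le)
    have "\<forall>\<^sub>F h in at_right 0. h < (1::real)"
      unfolding eventually_at_right_field by (intro exI[of _ 1]) auto
    then have "\<forall>\<^sub>F h in at_right (0::real). (r (y + h *\<^sub>R (z - y)) - r y) / h = 0"
      using eventually_at_right_less[of "0::real"]
    proof eventually_elim
      case (elim h)
      have "y + h *\<^sub>R (z - y) = (1 - h) *\<^sub>R y + h *\<^sub>R z" by (simp add: algebra_simps)
      moreover have "\<dots> \<in> F" using \<open>convex F\<close> y z elim by (auto simp: convex_alt)
      ultimately show ?case using r0 y by simp
    qed
    then have "((\<lambda>h. (r (y + h *\<^sub>R (z - y)) - r y) / h) \<longlongrightarrow> 0) (at_right 0)" by (rule tendsto_eventually)
    from tendsto_unique[OF _ l this] show ?thesis by simp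
  qed
  have "\<exists>c. g = c *\<^sub>R ?n"
  proof (cases "g = 0")
    case False
    define m where "m = g /\<^sub>R norm g"
    have m: "norm m = 1" using False by (simp add: m_def)
    have g: "g = norm g *\<^sub>R m" using False by (simp add: m_def)
    have "F \<subseteq> {z. m \<bullet> z = m \<bullet> y}"
    proof
      fix z assume "z \<in> F"
      then have "z \<bullet> g = y \<bullet> g" using orth[of z] by (simp add: inner_diff_left)
      then show "z \<in> {z. m \<bullet> z = m \<bullet> y}" by (simp add: m_def inner_commute[of g])
    qed
    then have "affine hull F = {z. m \<bullet> z = m \<bullet> y}" using m by (intro affine_hull_facet[OF K F]) auto
    then have "{z. ?n \<bullet> z = facet_offset K F} = {z. m \<bullet> z = m \<bullet> y}" using facet_hyperplane(2)[OF K F] by simp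
    from hyperplane_eq_normal[OF solid_polytope_facets(1)[OF K F] m this]
    have "m = ?n \<or> m = - ?n" by blast
    then show ?thesis using g by (metis scaleR_minus_left scaleR_minus_right)
  qed (auto intro: exI[of _ 0])
  then obtain c where "g = c *\<^sub>R ?n" by blast
  then have "\<forall>b\<in>Basis. deriv_along b q y - deriv_along b q' y = c * (?n \<bullet> b)" using gb by (metis inner_scaleR_left)
  then show ?thesis by blast
qed

text \<open>Facets are disjoint up to null sets, so almost everywhere at most one of the summed
  indicators is nonzero.\<close>

lemma sum_L2_norm_sq_facets_le:
  fixes f :: "'a::euclidean_space \<Rightarrow> 'b::euclidean_space"
  assumes K: "solid_polytope K" and f: "square_integrable (surface_on (frontier K)) f"
  shows "(\<Sum>F\<in>facets K. L2_norm_sq (surface_on F) f) \<le> L2_norm_sq (surface_on (frontier K)) f"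
proof -
  have F: "F \<in> sets borel" "F \<subseteq> frontier K" if "F \<in> facets K" for F
    using borel_closed[OF closed_facet[OF K that]] frontier_solid_polytope(1)[OF K] that by auto
  note fr = frontier_solid_polytope_basic(1)[OF K]
  have intF: "integrable surface_measure (\<lambda>y. indicator F y * (norm (f y))\<^sup>2)" if "F \<in> facets K" for F
    using L2_restrict_space_mono(1)[OF f F(2)[OF that]] fr F(1)[OF that] integral_surface_on(2)[OF F(1)[OF that], of "\<lambda>y. (norm (f y))\<^sup>2"]
    by (simp add: square_integrable_def)
  have intK: "integrable surface_measure (\<lambda>y. indicator (frontier K) y * (norm (f y))\<^sup>2)"
    using f integral_surface_on(2)[OF fr, of "\<lambda>y. (norm (f y))\<^sup>2"] by (simp add: square_integrable_def)
  have "(\<Sum>F\<in>facets K. L2_norm_sq (surface_on F) f) = (\<Sum>F\<in>facets K. \<integral>y. indicator F y * (norm (f y))\<^sup>2 \<partial>surface_measure)"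
    unfolding L2_norm_sq_def by (intro sum.cong refl integral_surface_on(1) F)
  also have "\<dots> = (\<integral>y. (\<Sum>F\<in>facets K. indicator F y * (norm (f y))\<^sup>2) \<partial>surface_measure)"
    by (rule Bochner_Integration.integral_sum[symmetric]) (rule intF)
  also have "\<dots> \<le> (\<integral>y. indicator (frontier K) y * (norm (f y))\<^sup>2 \<partial>surface_measure)"
  proof (rule integral_mono_AE)
    show "AE y in surface_measure. (\<Sum>F\<in>facets K. indicator F y * (norm (f y))\<^sup>2) \<le> indicator (frontier K) y * (norm (f y))\<^sup>2"
      using AE_facets_disjoint[OF K]
    proof eventually_elim
      case (elim y)
      show ?case
      proof (cases "y \<in> frontier K")
        case True
        then obtain F where F: "F \<in> facets K" "y \<in> F" using frontier_solid_polytope(1)[OF K] by blast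
        then have "(\<Sum>F'\<in>facets K. indicator F' y * (norm (f y))\<^sup>2) = (\<Sum>F'\<in>facets K. if F' = F then (norm (f y))\<^sup>2 else 0)"
          using elim by (intro sum.cong) (auto simp: indicator_def)
        also have "\<dots> = (norm (f y))\<^sup>2" using F finite_facets[OF K] by simp
        finally show ?thesis using True by simp
      next
        case False
        then have "(\<Sum>F'\<in>facets K. indicator F' y * (norm (f y))\<^sup>2) = (\<Sum>F'\<in>facets K. 0)"
          using frontier_solid_polytope(1)[OF K] by (intro sum.cong) (auto simp: indicator_def)
        then show ?thesis by simp
      qed
    qed
  qed (use intF intK in auto)
  also have "\<dots> = L2_norm_sq (surface_on (frontier K)) f"
    unfolding L2_norm_sq_def by (rule integral_surface_on(1)[OF fr, symmetric])
  finally show ?thesis .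
qed

section \<open>Space-time meshes\<close>

lemma Basis_spacetime: "(Basis :: 'd::finite spacetime set) = range e_x \<union> {e_t}"
  unfolding Basis_prod_def Basis_vec_def e_x_def e_t_def by auto

lemma e_x_Basis [simp]: "e_x i \<in> Basis" and e_t_Basis [simp]: "e_t \<in> Basis"
  by (auto simp: Basis_spacetime)

lemma inner_e_x [simp]: "n \<bullet> e_x i = fst n $ i" and inner_e_t [simp]: "n \<bullet> e_t = snd n"
  by (simp_all add: e_x_def e_t_def inner_prod_def inner_axis)

lemma square_integrable_vec:
  fixes g :: "'a \<Rightarrow> real ^ 'd::finite"
  assumes g: "\<And>i. (\<lambda>y. g y $ i) \<in> L2 M"
  shows "square_integrable M g" and "L2_norm_sq M g = (\<Sum>i\<in>UNIV. L2_norm_sq M (\<lambda>y. g y $ i))"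
proof -
  have n: "(norm (g y))\<^sup>2 = (\<Sum>i\<in>UNIV. (g y $ i)\<^sup>2)" for y
    by (simp add: norm_vec_def L2_set_def sum_nonneg)
  have m: "g \<in> borel_measurable M"
  proof (subst borel_measurable_euclidean_space, intro ballI)
    fix b :: "real ^ 'd" assume "b \<in> Basis"
    then obtain i where "b = axis i 1" by (auto simp: Basis_vec_def)
    then show "(\<lambda>y. g y \<bullet> b) \<in> borel_measurable M" using L2_measurable[OF g[of i]] by (simp add: inner_axis)
  qed
  have int: "integrable M (\<lambda>y. (g y $ i)\<^sup>2)" for i using g[of i] by (simp add: L2_def)
  show "square_integrable M g" unfolding square_integrable_def n using m int by simp
  show "L2_norm_sq M g = (\<Sum>i\<in>UNIV. L2_norm_sq M (\<lambda>y. g y $ i))"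
    unfolding L2_norm_sq_def n using Bochner_Integration.integral_sum[OF int] by simp
qed

lemma simplex_solid_polytope:
  fixes K :: "'d::finite spacetime set"
  assumes "(int CARD('d) + 1) simplex K"
  shows "solid_polytope K"
proof -
  have "aff_dim K = int (DIM('d spacetime))" using aff_dim_simplex[OF assms] by simp
  then have "rel_interior K = interior K" by (intro rel_interior_interior) (simp only: aff_dim_eq_full)
  moreover have "K \<noteq> {}" using \<open>aff_dim K = _\<close> by auto
  moreover have P: "polytope K" using simplex_imp_polytope[OF assms] .
  ultimately show ?thesis using rel_interior_eq_empty[OF polytope_imp_convex[OF P]] by (auto simp: solid_polytope_def)
qed

lemma diameter_solid_polytope_pos:
  assumes K: "solid_polytope K" shows "0 < diameter K"
proof -
  obtain x where "x \<in> interior K" using solid_polytope_basic(7)[OF K] by blast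
  then obtain e where x: "e > 0" "ball x e \<subseteq> K" by (auto simp: mem_interior)
  obtain b :: 'a where b: "b \<in> Basis" using nonempty_Basis by blast
  have "x \<in> K" "x + (e / 2) *\<^sub>R b \<in> K" using x b by (auto intro!: subsetD[OF x(2)] simp: dist_norm)
  then have "dist x (x + (e / 2) *\<^sub>R b) \<le> diameter K"
    by (rule diameter_bounded_bound[OF solid_polytope_basic(2)[OF K]])
  then show ?thesis using x b by (simp add: dist_norm)
qed

section \<open>Measurability of the parts of the space-time boundary\<close>

lemma Sigma_bot_borel:
  assumes "open (\<Omega> 0)" shows "Sigma_bot \<Omega> \<in> sets (borel :: 'd::finite spacetime measure)"
proof -
  have "Sigma_bot \<Omega> = (\<Omega> 0 \<times> UNIV) \<inter> (UNIV \<times> {0})" by (auto simp: Sigma_bot_def)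
  then show ?thesis using sets.Int[OF borel_open[OF open_Times[OF assms open_UNIV]] borel_closed[OF closed_Times[OF closed_UNIV closed_singleton]]] by metis
qed

lemma Sigma_top_borel:
  assumes "open (\<Omega> T)" shows "Sigma_top \<Omega> T \<in> sets (borel :: 'd::finite spacetime measure)"
proof -
  have "Sigma_top \<Omega> T = (\<Omega> T \<times> UNIV) \<inter> (UNIV \<times> {T})" by (auto simp: Sigma_top_def)
  then show ?thesis using sets.Int[OF borel_open[OF open_Times[OF assms open_UNIV]] borel_closed[OF closed_Times[OF closed_UNIV closed_singleton]]] by metis
qed

text \<open>The slicewise closure of \<open>Q\<close> is the intersection of the open sets swept out by the spatial
  translates of \<open>Q\<close> of length less than \<open>1 / n\<close>.\<close>

lemma Sigma_lat_borel:
  assumes \<Omega>: "\<And>t. 0 < t \<Longrightarrow> t < T \<Longrightarrow> open (\<Omega> t)" and Q: "open (Q_dom \<Omega> T)"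
  shows "Sigma_lat \<Omega> T \<in> sets (borel :: 'd::finite spacetime measure)"
proof -
  define U where "U n = (\<Union>a\<in>ball 0 (1 / real (Suc n)). (\<lambda>y. y - (a, 0)) ` Q_dom \<Omega> T)" for n
  have mem: "(x, t) \<in> U n \<longleftrightarrow> 0 < t \<and> t < T \<and> (\<exists>y\<in>\<Omega> t. dist y x < 1 / real (Suc n))" for x t n
  proof
    assume "(x, t) \<in> U n"
    then show "0 < t \<and> t < T \<and> (\<exists>y\<in>\<Omega> t. dist y x < 1 / real (Suc n))"
      by (force simp: U_def Q_dom_def dist_norm)
  next
    assume *: "0 < t \<and> t < T \<and> (\<exists>y\<in>\<Omega> t. dist y x < 1 / real (Suc n))"
    then obtain y where y: "y \<in> \<Omega> t" "dist y x < 1 / real (Suc n)" by blast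
    have "(x, t) = (y, t) - (y - x, 0)" by simp
    moreover have "(y, t) \<in> Q_dom \<Omega> T" using * y by (simp add: Q_dom_def)
    moreover have "y - x \<in> ball 0 (1 / real (Suc n))" unfolding mem_ball_0 using y by (simp add: dist_norm)
    ultimately show "(x, t) \<in> U n" unfolding U_def by blast
  qed
  have "open (U n)" for n
    unfolding U_def using open_translation_subtract[OF Q] by (intro open_UN) auto
  moreover have "Sigma_lat \<Omega> T = (\<Inter>n. U n) - Q_dom \<Omega> T"
  proof (intro set_eqI)
    fix z :: "'d spacetime"
    obtain x t where z: "z = (x, t)" by fastforce
    have "(\<forall>n. (x, t) \<in> U n) \<longleftrightarrow> 0 < t \<and> t < T \<and> x \<in> closure (\<Omega> t)"
      unfolding mem closure_approachable
    proof safe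
      fix e :: real assume *: "\<forall>n. 0 < t \<and> t < T \<and> (\<exists>y\<in>\<Omega> t. dist y x < 1 / real (Suc n))" and "0 < e"
      then obtain n where "1 / real (Suc n) < e" using nat_approx_posE by blast
      then show "\<exists>y\<in>\<Omega> t. dist y x < e" using * by (meson less_trans)
    qed auto
    then show "z \<in> Sigma_lat \<Omega> T \<longleftrightarrow> z \<in> (\<Inter>n. U n) - Q_dom \<Omega> T"
      using \<Omega> unfolding z by (auto simp: Sigma_lat_def Q_dom_def frontier_def interior_open)
  qed
  ultimately show ?thesis using Q by (auto intro!: sets.Diff sets.countable_INT)
qed

text \<open>Every interior facet is listed in one order only. With both orders present, an oriented
  pair is determined by an element and a facet of it, because the neighbour across a facet is
  unique; so no summand on the right is charged twice.\<close>

lemma sum_pairs_le: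
  fixes g :: "'b \<Rightarrow> 'c \<Rightarrow> real"
  assumes fin: "finite \<C>" "\<And>K. K \<in> \<C> \<Longrightarrow> finite (\<F> K)" and nonneg: "\<And>K F. 0 \<le> g K F"
    and I: "finite I" "\<And>K K'. (K, K') \<in> I \<Longrightarrow> K \<in> \<C> \<and> K' \<in> \<C> \<and> f K K' \<in> \<F> K \<and> f K K' \<in> \<F> K' \<and> K \<noteq> K' \<and> (K', K) \<notin> I"
    and sym: "\<And>K K'. f K K' = f K' K"
    and unique: "\<And>K K' L F. K \<in> \<C> \<Longrightarrow> K' \<in> \<C> \<Longrightarrow> L \<in> \<C> \<Longrightarrow> F \<in> \<F> K \<Longrightarrow> F \<in> \<F> K' \<Longrightarrow> F \<in> \<F> L \<Longrightarrow> K' \<noteq> K \<Longrightarrow> L \<noteq> K \<Longrightarrow> K' = L"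
  shows "(\<Sum>(K, K')\<in>I. g K (f K K') + g K' (f K K')) \<le> (\<Sum>K\<in>\<C>. \<Sum>F\<in>\<F> K. g K F)"
proof -
  let ?h = "\<lambda>(K, K'). (K, f K K')"
  \<comment> \<open>The pairs in reverse order account for the second summand
    \<open>g K' (f K K')\<close>.\<close>
  let ?J = "prod.swap ` I"
  have J: "K \<in> \<C> \<and> K' \<in> \<C> \<and> f K K' \<in> \<F> K \<and> f K K' \<in> \<F> K' \<and> K \<noteq> K'" if "(K, K') \<in> I \<union> ?J" for K K'
  proof -
    have "(K, K') \<in> I \<or> (K', K) \<in> I" using that by auto
    then show ?thesis using I(2)[of K K'] I(2)[of K' K] sym[of K K'] by auto
  qed
  have disj: "I \<inter> ?J = {}" using I(2) by auto
  have inj: "inj_on ?h (I \<union> ?J)"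
  proof (rule inj_onI)
    fix a b assume *: "a \<in> I \<union> ?J" "b \<in> I \<union> ?J" "?h a = ?h b"
    obtain K K' L L' where ab: "a = (K, K')" "b = (L, L')" by (cases a, cases b)
    then have "K = L" "f K K' = f L L'" using * by auto
    then show "a = b" using J[of K K'] J[of L L'] * ab unique[of K K' L' "f K K'"] by auto
  qed
  have "(\<Sum>(K, K')\<in>I. g K (f K K') + g K' (f K K')) = (\<Sum>(K, K')\<in>I. g K (f K K')) + (\<Sum>(K, K')\<in>I. g K' (f K' K))"
    by (simp add: sum.distrib case_prod_unfold sym[of "snd _"])
  also have "(\<Sum>(K, K')\<in>I. g K' (f K' K)) = (\<Sum>(K, K')\<in>?J. g K (f K K'))"
    by (subst sum.reindex) (auto simp: case_prod_unfold)
  also have "(\<Sum>(K, K')\<in>I. g K (f K K')) + (\<Sum>(K, K')\<in>?J. g K (f K K')) = (\<Sum>(K, K')\<in>I \<union> ?J. g K (f K K'))"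
    using I(1) disj by (intro sum.union_disjoint[symmetric]) auto
  also have "\<dots> = (\<Sum>(K, F)\<in>?h ` (I \<union> ?J). g K F)"
    by (subst sum.reindex[OF inj]) (auto simp: case_prod_unfold)
  also have "\<dots> \<le> (\<Sum>(K, F)\<in>Sigma \<C> \<F>. g K F)"
  proof (rule sum_mono2)
    show "finite (Sigma \<C> \<F>)" using fin by auto
    show "?h ` (I \<union> ?J) \<subseteq> Sigma \<C> \<F>" using J by fastforce
    show "0 \<le> (case x of (K, F) \<Rightarrow> g K F)" for x using nonneg by (simp add: case_prod_unfold)
  qed
  also have "\<dots> = (\<Sum>K\<in>\<C>. \<Sum>F\<in>\<F> K. g K F)" using fin by (subst sum.Sigma) auto
  finally show ?thesis .
qed

section \<open>Elements, facets and boundary parts of a space-time mesh\<close>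

locale space_time_mesh =
  fixes \<Omega> :: "real \<Rightarrow> (real ^ 'd::finite) set" and T :: real and \<K> :: "'d mesh"
  assumes T_pos: "T > 0" and domain: "space_time_domain \<Omega> T" and decomposition: "decomposition (Q_dom \<Omega> T) \<K>"
begin

abbreviation Q :: "'d spacetime set" where "Q \<equiv> Q_dom \<Omega> T"

lemma Q_facts: "open Q" "bounded Q" "Q \<noteq> {}" "interior (closure Q) = Q"
  using domain lipschitz_boundary_interior_closure[of Q] by (auto simp: space_time_domain_def)

lemma solid_element: "K \<in> set \<K> \<Longrightarrow> solid_polytope K"
  using decomposition by (auto simp: decomposition_def intro: simplex_solid_polytope)

lemma closure_Q: "closure Q = \<Union>(set \<K>)" using decomposition by (simp add: decomposition_def)

lemma interior_Un_subset:
  assumes "K \<in> set \<K>" "K' \<in> set \<K>" shows "interior (K \<union> K') \<subseteq> Q"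
proof -
  have "K \<union> K' \<subseteq> closure Q" using assms closure_Q by auto
  then show ?thesis using interior_mono[of "K \<union> K'" "closure Q"] Q_facts(4) by simp
qed

lemma interior_element_subset: "K \<in> set \<K> \<Longrightarrow> interior K \<subseteq> Q"
  using interior_Un_subset[of K K] by simp

lemma nth_elements_disjoint:
  "i < length \<K> \<Longrightarrow> j < length \<K> \<Longrightarrow> i \<noteq> j \<Longrightarrow> interior (\<K> ! i) \<inter> interior (\<K> ! j) = {}"
  using decomposition by (simp add: decomposition_def)

lemma distinct_elements: "distinct \<K>"
  unfolding distinct_conv_nth
proof (intro allI impI)
  fix i j assume "i < length \<K>" "j < length \<K>" "i \<noteq> j"
  then show "\<K> ! i \<noteq> \<K> ! j"
    using nth_elements_disjoint[of i j] solid_polytope_basic(7)[OF solid_element[of "\<K> ! i"]] by auto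
qed

lemma elements_disjoint:
  assumes "K \<in> set \<K>" "K' \<in> set \<K>" "K \<noteq> K'" shows "interior K \<inter> interior K' = {}"
  using assms nth_elements_disjoint by (metis in_set_conv_nth)

lemma decomposition_Q: "polytope_decomposition Q (set \<K>)"
  using Q_facts solid_element interior_element_subset elements_disjoint closure_Q closure_subset[of Q]
  by (auto simp: polytope_decomposition_def)

lemma frontier_Q_subset: "frontier Q \<subseteq> (\<Union>K\<in>set \<K>. frontier K)"
proof
  fix y assume y: "y \<in> frontier Q"
  then obtain K where K: "K \<in> set \<K>" "y \<in> K" using closure_Q by (auto simp: frontier_def)
  have "y \<notin> Q" using y Q_facts(1) by (simp add: frontier_def interior_open)
  then have "y \<notin> interior K" using interior_element_subset[OF K(1)] by blast
  then show "y \<in> (\<Union>K\<in>set \<K>. frontier K)" using K solid_polytope_basic(10)[OF solid_element[OF K(1)]] by blast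
qed

lemma emeasure_boundary_part:
  assumes "A \<in> sets borel" "A \<subseteq> frontier Q" shows "emeasure surface_measure A < \<infinity>"
proof -
  have "emeasure surface_measure A \<le> emeasure surface_measure (\<Union>K\<in>set \<K>. frontier K)"
    using assms frontier_Q_subset solid_element
    by (intro emeasure_mono) (auto intro!: sets.finite_UN frontier_solid_polytope_basic(1))
  also have "\<dots> \<le> (\<Sum>K\<in>set \<K>. emeasure surface_measure (frontier K))"
    by (intro emeasure_subadditive_finite) (auto intro!: frontier_solid_polytope_basic(1) solid_element)
  also have "\<dots> < \<infinity>" using emeasure_surface_frontier[OF solid_element] by simp
  finally show ?thesis .
qed

lemma boundary_parts:
  "Sigma_lat \<Omega> T \<in> sets borel" "Sigma_lat \<Omega> T \<subseteq> frontier Q"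
  "Sigma_bot \<Omega> \<in> sets borel" "Sigma_bot \<Omega> \<subseteq> frontier Q"
  "Sigma_top \<Omega> T \<in> sets borel" "Sigma_top \<Omega> T \<subseteq> frontier Q"
  "AE y in surface_measure. y \<in> frontier Q \<longrightarrow> y \<in> Sigma_lat \<Omega> T \<or> y \<in> Sigma_bot \<Omega> \<or> y \<in> Sigma_top \<Omega> T"
proof -
  have o: "open (\<Omega> t)" if "0 \<le> t" "t \<le> T" for t using domain that by (simp add: space_time_domain_def)
  show "Sigma_lat \<Omega> T \<in> sets borel" by (rule Sigma_lat_borel[OF _ Q_facts(1)]) (simp add: o)
  show "Sigma_bot \<Omega> \<in> sets borel" "Sigma_top \<Omega> T \<in> sets borel"
    using T_pos by (auto intro!: Sigma_bot_borel Sigma_top_borel o)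
  show "Sigma_lat \<Omega> T \<subseteq> frontier Q" "Sigma_bot \<Omega> \<subseteq> frontier Q" "Sigma_top \<Omega> T \<subseteq> frontier Q"
    using domain by (auto simp: space_time_domain_def)
  have "frontier Q - (Sigma_lat \<Omega> T \<union> Sigma_bot \<Omega> \<union> Sigma_top \<Omega> T) \<in> null_sets surface_measure"
    using domain by (simp add: space_time_domain_def)
  from AE_not_in[OF this]
  show "AE y in surface_measure. y \<in> frontier Q \<longrightarrow> y \<in> Sigma_lat \<Omega> T \<or> y \<in> Sigma_bot \<Omega> \<or> y \<in> Sigma_top \<Omega> T"
    by eventually_elim auto
qed

lemma interior_facetsD:
  assumes "(K, K') \<in> interior_facets \<K>"
  shows "K \<in> set \<K>" "K' \<in> set \<K>" "K \<noteq> K'" "K \<inter> K' \<in> facets K" "K \<inter> K' \<in> facets K'" "interior K \<inter> interior K' = {}"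
    "(K', K) \<notin> interior_facets \<K>"
proof -
  obtain i j where ij: "K = \<K> ! i" "K' = \<K> ! j" "i < j" "j < length \<K>" "K \<inter> K' facet_of K" "K \<inter> K' facet_of K'"
    using assms by (auto simp: interior_facets_def)
  show "K \<in> set \<K>" "K' \<in> set \<K>" "K \<inter> K' \<in> facets K" "K \<inter> K' \<in> facets K'" using ij by (auto simp: facets_def)
  show "interior K \<inter> interior K' = {}" using nth_elements_disjoint[of i j] ij by simp
  show "K \<noteq> K'" using distinct_elements ij by (simp add: nth_eq_iff_index_eq)
  show "(K', K) \<notin> interior_facets \<K>"
  proof
    assume "(K', K) \<in> interior_facets \<K>"
    then obtain i' j' where "K' = \<K> ! i'" "K = \<K> ! j'" "i' < j'" "j' < length \<K>"
      by (auto simp: interior_facets_def)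
    then show False using ij distinct_elements by (metis less_trans nth_eq_iff_index_eq less_not_sym)
  qed
qed

lemma finite_interior_facets: "finite (interior_facets \<K>)"
  by (rule finite_subset[of _ "set \<K> \<times> set \<K>"]) (use interior_facetsD in auto)

text \<open>Two neighbours of \<open>K\<close> across the same facet would both have the normal
  opposite to that of \<open>K\<close>, and elements on the same side of a shared facet
  overlap.\<close>

lemma facet_neighbour_unique:
  assumes "K \<in> set \<K>" "K' \<in> set \<K>" "L \<in> set \<K>" and F: "F \<in> facets K" "F \<in> facets K'" "F \<in> facets L" and ne: "K' \<noteq> K" "L \<noteq> K"
  shows "K' = L"
proof (rule ccontr)
  assume "K' \<noteq> L"
  note S = assms(1-3)[THEN solid_element]
  have "outer_normal K' F = outer_normal L F"
    using shared_facet_normal(1)[OF S(1,2) F(1,2) elements_disjoint[OF assms(1,2)]]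
      shared_facet_normal(1)[OF S(1,3) F(1,3) elements_disjoint[OF assms(1,3)]] ne by metis
  from facets_same_side[OF S(2,3) F(2,3) this] show False
    using elements_disjoint[OF assms(2,3) \<open>K' \<noteq> L\<close>] by simp
qed

text \<open>Converts facet sums of one-sided traces into sums over element boundaries without an
  extra factor. It serves both the jumps of the time derivative of \<open>u\<close> and the upwind
  gradients of \<open>v\<close>.\<close>

lemma sum_interior_facets_le:
  fixes f :: "'d spacetime set \<Rightarrow> 'd spacetime \<Rightarrow> 'b::euclidean_space"
  assumes f: "\<And>K. K \<in> set \<K> \<Longrightarrow> square_integrable (surface_on (frontier K)) (f K)"
  shows "(\<Sum>(K, K')\<in>interior_facets \<K>. L2_norm_sq (surface_on (K \<inter> K')) (f K) + L2_norm_sq (surface_on (K \<inter> K')) (f K')) \<le>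
    (\<Sum>K\<in>set \<K>. L2_norm_sq (surface_on (frontier K)) (f K))"
proof -
  have "(\<Sum>(K, K')\<in>interior_facets \<K>. L2_norm_sq (surface_on (K \<inter> K')) (f K) + L2_norm_sq (surface_on (K \<inter> K')) (f K')) \<le>
    (\<Sum>K\<in>set \<K>. \<Sum>F\<in>facets K. L2_norm_sq (surface_on F) (f K))"
  proof (rule sum_pairs_le[where g = "\<lambda>K F. L2_norm_sq (surface_on F) (f K)"])
    show "K \<in> set \<K> \<and> K' \<in> set \<K> \<and> K \<inter> K' \<in> facets K \<and> K \<inter> K' \<in> facets K' \<and> K \<noteq> K' \<and> (K', K) \<notin> interior_facets \<K>"
      if "(K, K') \<in> interior_facets \<K>" for K K' using interior_facetsD[OF that] by blast
    show "K' = L" if "K \<in> set \<K>" "K' \<in> set \<K>" "L \<in> set \<K>" "F \<in> facets K" "F \<in> facets K'" "F \<in> facets L" "K' \<noteq> K" "L \<noteq> K"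
      for K K' L F using facet_neighbour_unique[OF that] .
  qed (simp_all add: finite_interior_facets finite_facets solid_element Int_commute)
  also have "\<dots> \<le> (\<Sum>K\<in>set \<K>. L2_norm_sq (surface_on (frontier K)) (f K))"
    by (intro sum_mono sum_L2_norm_sq_facets_le solid_element f)
  finally show ?thesis .
qed

text \<open>A facet that is transversal to the hyperplane \<open>t = T\<close> meets it in a null set only.\<close>

lemma AE_normal_Sigma_top:
  assumes K: "K \<in> set \<K>"
  shows "AE y in surface_measure. y \<in> frontier K \<longrightarrow> y \<in> Sigma_top \<Omega> T \<longrightarrow> normal_field K e_t y = 1"
proof -
  note S = solid_element[OF K]
  let ?H = "{y :: 'd spacetime. e_t \<bullet> y = T}"
  have H: "?H \<in> hyperplanes" by (rule hyperplanesI) (simp add: norm_Basis)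
  have KT: "snd y \<le> T" if "y \<in> K" for y
  proof -
    have "closure Q \<subseteq> {y. e_t \<bullet> y \<le> T}"
      by (intro closure_minimal closed_halfspace_le) (auto simp: Q_dom_def inner_commute[of e_t])
    then show ?thesis using that K closure_Q by (auto simp: inner_commute[of e_t])
  qed
  have "AE y in surface_measure. \<forall>F\<in>facets K. {y. outer_normal K F \<bullet> y = facet_offset K F} \<noteq> ?H \<longrightarrow> y \<in> F \<longrightarrow> y \<notin> ?H"
  proof (intro AE_finite_allI finite_facets[OF S])
    fix F assume F: "F \<in> facets K"
    let ?HF = "{y. outer_normal K F \<bullet> y = facet_offset K F}"
    show "AE y in surface_measure. ?HF \<noteq> ?H \<longrightarrow> y \<in> F \<longrightarrow> y \<notin> ?H"
    proof (cases "?HF = ?H")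
      case False
      have "AE y in surface_measure. y \<notin> ?HF \<inter> ?H"
        by (rule AE_not_in[OF null_sets_surface_Int[OF facet_hyperplane(1)[OF S F] H False]])
      then show ?thesis
      proof eventually_elim
        case (elim y) then show ?case using facet_hyperplane(3)[OF S F] by blast
      qed
    qed simp
  qed
  with AE_facets_disjoint[OF S] show ?thesis
  proof eventually_elim
    case (elim y)
    show ?case
    proof (intro impI)
      assume y: "y \<in> frontier K" "y \<in> Sigma_top \<Omega> T"
      then obtain F where F: "F \<in> facets K" "y \<in> F" using frontier_solid_polytope(1)[OF S] by blast
      have "y \<in> ?H" using y by (auto simp: Sigma_top_def inner_commute[of e_t])
      then have "{y. outer_normal K F \<bullet> y = facet_offset K F} = ?H" using elim(2) F by blast
      then have "F \<subseteq> ?H" using facet_hyperplane(3)[OF S F(1)] by simp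
      \<comment> \<open>The facet lies in the plane \<open>t = T\<close> and the element below it,
        so \<open>e_t\<close> satisfies the characterisation of the outer normal.\<close>
      then have "outer_normal K F = e_t"
        using KT by (intro outer_normal_eq[OF S F(1)])
          (auto simp: norm_Basis inner_commute[of e_t] inner_diff_left)
      moreover have "normal_field K e_t y = outer_normal K F \<bullet> e_t"
        using elim(1) F by (intro normal_field_on_facet[OF S F]) blast
      ultimately show "normal_field K e_t y = 1" by (simp add: e_t_def)
    qed
  qed
qed

end

text \<open>The bilinear form and the norms integrate over closed elements, while weak derivatives
  live on the interiors; the frontier between them is negligible.\<close>

lemma lebesgue_on_solid_polytope:
  fixes f :: "'a::euclidean_space \<Rightarrow> 'b::euclidean_space"
  assumes K: "solid_polytope K" and f: "f \<in> borel_measurable (lebesgue_on (interior K))"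
  shows "f \<in> borel_measurable (lebesgue_on K)" "(\<integral>x. f x \<partial>lebesgue_on K) = (\<integral>x. f x \<partial>lebesgue_on (interior K))"
    "integrable (lebesgue_on K) f \<longleftrightarrow> integrable (lebesgue_on (interior K)) f"
proof -
  have s: "K \<inter> space lebesgue \<in> sets lebesgue" "interior K \<inter> space lebesgue \<in> sets lebesgue"
    using solid_polytope_basic(1,4)[OF K] by (auto intro: borel_closed)
  have "AE x in lebesgue. x \<notin> frontier K"
    by (intro AE_not_in) (simp add: negligible_iff_null_sets[symmetric] solid_polytope_basic(9)[OF K])
  then have ae: "AE x in lebesgue. indicator (interior K) x *\<^sub>R f x = indicator K x *\<^sub>R f x"
  proof eventually_elim
    case (elim x) then show ?case using solid_polytope_basic(10)[OF K] by (auto simp: indicator_def)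
  qed
  have m: "(\<lambda>x. indicator (interior K) x *\<^sub>R f x) \<in> borel_measurable lebesgue"
    using f borel_measurable_restrict_space_iff[OF s(2), of f] by simp
  note m' = borel_measurable_AE[OF m ae]
  show "f \<in> borel_measurable (lebesgue_on K)"
    using m' borel_measurable_restrict_space_iff[OF s(1), of f] by simp
  show "(\<integral>x. f x \<partial>lebesgue_on K) = (\<integral>x. f x \<partial>lebesgue_on (interior K))"
    unfolding integral_restrict_space[OF s(1)] integral_restrict_space[OF s(2)]
    by (rule integral_cong_AE[OF m m' ae, symmetric])
  show "integrable (lebesgue_on K) f \<longleftrightarrow> integrable (lebesgue_on (interior K)) f"
    unfolding integrable_restrict_space[OF s(1)] integrable_restrict_space[OF s(2)]
    by (rule integrable_cong_AE[OF m m' ae, symmetric])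
qed

lemma square_integrable_lebesgue_on_solid_polytope:
  fixes f :: "'a::euclidean_space \<Rightarrow> 'b::euclidean_space"
  assumes K: "solid_polytope K" and f: "square_integrable (lebesgue_on (interior K)) f"
  shows "square_integrable (lebesgue_on K) f" "L2_norm_sq (lebesgue_on K) f = L2_norm_sq (lebesgue_on (interior K)) f"
proof -
  have m: "f \<in> borel_measurable (lebesgue_on (interior K))" "(\<lambda>x. (norm (f x))\<^sup>2) \<in> borel_measurable (lebesgue_on (interior K))"
    using f by (auto simp: square_integrable_def)
  show "square_integrable (lebesgue_on K) f"
    using f lebesgue_on_solid_polytope(1)[OF K m(1)] lebesgue_on_solid_polytope(3)[OF K m(2)]
    unfolding square_integrable_def by blast
  show "L2_norm_sq (lebesgue_on K) f = L2_norm_sq (lebesgue_on (interior K)) f"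
    unfolding L2_norm_sq_def by (rule lebesgue_on_solid_polytope(2)[OF K m(2)])
qed

lemma sobolev_converges_subset:
  assumes G: "open G" "open G'" "G' \<subseteq> G" "bounded G" and u: "u \<in> sobolev Basis G" and conv: "sobolev_converges G \<phi> u"
  shows "sobolev_converges G' \<phi> u"
  unfolding sobolev_converges_def
proof (intro conjI ballI)
  have \<phi>: "\<And>n. smooth (\<phi> n)" "(\<lambda>n. L2_norm_sq (lebesgue_on G) (\<lambda>x. \<phi> n x - u x)) \<longlonglongrightarrow> 0"
    "\<And>b. b \<in> Basis \<Longrightarrow> (\<lambda>n. L2_norm_sq (lebesgue_on G) (\<lambda>x. deriv_along b (\<phi> n) x - weak_deriv G b u x)) \<longlonglongrightarrow> 0"
    using conv by (auto simp: sobolev_converges_def)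
  show "\<forall>n. smooth (\<phi> n)" using \<phi>(1) by blast
  have "L2_norm_sq (lebesgue_on G') (\<lambda>x. \<phi> n x - u x) \<le> L2_norm_sq (lebesgue_on G) (\<lambda>x. \<phi> n x - u x)" for n
    by (rule L2_lebesgue_on_subset(2)[OF G(1-3) L2_diff[OF smooth_L2_lebesgue_on[OF \<phi>(1) G(4,1)] sobolevD(1)[OF u]]])
  then show "(\<lambda>n. L2_norm_sq (lebesgue_on G') (\<lambda>x. \<phi> n x - u x)) \<longlonglongrightarrow> 0"
    by (intro tendsto_sandwich[OF _ _ tendsto_const \<phi>(2)]) auto
  fix b :: 'a assume b: "b \<in> Basis"
  note d = smooth_deriv_along[OF \<phi>(1) b]
  note ds = L2_diff[OF smooth_L2_lebesgue_on[OF d G(4,1)] sobolevD(2)[OF u b]]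
  note uG' = sobolev_subset(1)[OF G subset_refl u]
  have bd: "bounded G'" using G bounded_subset by blast
  have "L2_norm_sq (lebesgue_on G') (\<lambda>x. deriv_along b (\<phi> n) x - weak_deriv G' b u x) =
      L2_norm_sq (lebesgue_on G') (\<lambda>x. deriv_along b (\<phi> n) x - weak_deriv G b u x)" for n
  proof (rule L2_norm_sq_cong_AE)
    show "(\<lambda>x. deriv_along b (\<phi> n) x - weak_deriv G' b u x) \<in> borel_measurable (lebesgue_on G')"
      by (rule L2_measurable[OF L2_diff[OF smooth_L2_lebesgue_on[OF d bd G(2)] sobolevD(2)[OF uG' b]]])
    show "(\<lambda>x. deriv_along b (\<phi> n) x - weak_deriv G b u x) \<in> borel_measurable (lebesgue_on G')"
      by (rule L2_measurable[OF L2_lebesgue_on_subset(1)[OF G(1-3) ds]])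
    show "AE x in lebesgue_on G'. deriv_along b (\<phi> n) x - weak_deriv G' b u x = deriv_along b (\<phi> n) x - weak_deriv G b u x"
      using sobolev_subset(2)[OF G subset_refl u b] by eventually_elim simp
  qed
  then have "L2_norm_sq (lebesgue_on G') (\<lambda>x. deriv_along b (\<phi> n) x - weak_deriv G' b u x) \<le>
      L2_norm_sq (lebesgue_on G) (\<lambda>x. deriv_along b (\<phi> n) x - weak_deriv G b u x)" for n
    using L2_lebesgue_on_subset(2)[OF G(1-3) ds] by simp
  then show "(\<lambda>n. L2_norm_sq (lebesgue_on G') (\<lambda>x. deriv_along b (\<phi> n) x - weak_deriv G' b u x)) \<longlonglongrightarrow> 0"
    by (intro tendsto_sandwich[OF _ _ tendsto_const \<phi>(3)[OF b]]) auto
qed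

lemma AE_surface_on_iff:
  assumes "A \<in> sets borel"
  shows "(AE y in surface_on A. P y) \<longleftrightarrow> (AE y in surface_measure. y \<in> A \<longrightarrow> P y)"
  using assms by (subst AE_restrict_space_iff) auto

text \<open>One sequence of smooth functions converges to \<open>g\<close> on \<open>A\<close> and,
  restricted to the element, to the element trace on its frontier; on the common part the limits
  agree. This carries the boundary conditions on \<open>Q\<close> to the elements.\<close>

lemma (in space_time_mesh) trace_eq_boundary_trace:
  assumes K: "K \<in> set \<K>" and A: "A \<in> sets borel" "A \<subseteq> frontier Q" and tr: "has_trace Basis Q u A g"
  shows "AE y in surface_measure. y \<in> frontier K \<longrightarrow> y \<in> A \<longrightarrow> trace K u y = g y"
proof -
  note S = solid_element[OF K]
  note fr = frontier_solid_polytope_basic[OF S]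
  obtain \<phi> where \<phi>: "sobolev_converges Q \<phi> u" "(\<lambda>n. L2_norm_sq (surface_on A) (\<lambda>x. \<phi> n x - g x)) \<longlonglongrightarrow> 0"
    and u: "u \<in> sobolev Basis Q" and g: "g \<in> L2 (surface_on A)"
    using tr unfolding has_trace_Basis_iff by blast
  have sm: "smooth (\<phi> n)" for n using \<phi>(1) by (simp add: sobolev_converges_def)
  note sub = Q_facts(1) solid_polytope_basic(4)[OF S] interior_element_subset[OF K] Q_facts(2)
  have uK: "u \<in> sobolev Basis (interior K)" by (rule sobolev_subset(1)[OF sub subset_refl u])
  let ?B = "frontier K \<inter> A"
  have B: "?B \<in> sets borel" "?B \<subseteq> frontier K" "?B \<subseteq> A" using fr A by auto
  have bdA: "bounded A" using A Q_facts(2) by (meson compact_frontier_bounded compact_imp_bounded bounded_subset)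
  have c1: "(\<lambda>n. L2_norm_sq (surface_on (frontier K)) (\<lambda>x. \<phi> n x - trace K u x)) \<longlonglongrightarrow> 0"
    by (rule sobolev_converges_frontier[OF S has_trace_trace[OF S uK] sobolev_converges_subset[OF sub u \<phi>(1)]])
  have l1: "(\<lambda>x. \<phi> n x - trace K u x) \<in> L2 (surface_on (frontier K))" for n
    by (rule L2_diff[OF smooth_L2_frontier[OF sm S S S] trace_L2[OF S uK]])
  have l2: "(\<lambda>x. \<phi> n x - g x) \<in> L2 (surface_on A)" for n
    by (rule L2_diff[OF smooth_L2_surface_on[OF sm bdA A(1) emeasure_boundary_part[OF A]] g])
  have B1: "(\<lambda>x. \<phi> n x - trace K u x) \<in> L2 (surface_on ?B)"
    "L2_norm_sq (surface_on ?B) (\<lambda>x. \<phi> n x - trace K u x) \<le> L2_norm_sq (surface_on (frontier K)) (\<lambda>x. \<phi> n x - trace K u x)" for n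
    using L2_restrict_space_mono[OF l1[of n, unfolded L2_iff_square_integrable] B(2)] B fr by (auto simp: L2_iff_square_integrable)
  have B2: "(\<lambda>x. \<phi> n x - g x) \<in> L2 (surface_on ?B)"
    "L2_norm_sq (surface_on ?B) (\<lambda>x. \<phi> n x - g x) \<le> L2_norm_sq (surface_on A) (\<lambda>x. \<phi> n x - g x)" for n
    using L2_restrict_space_mono[OF l2[of n, unfolded L2_iff_square_integrable] B(3)] B A by (auto simp: L2_iff_square_integrable)
  have d: "(\<lambda>x. trace K u x - g x) \<in> L2 (surface_on ?B)"
    using L2_diff[OF B2(1)[of 0] B1(1)[of 0]] by simp
  have "L2_norm_sq (surface_on ?B) (\<lambda>x. trace K u x - g x) \<le>
     2 * L2_norm_sq (surface_on (frontier K)) (\<lambda>x. \<phi> n x - trace K u x) + 2 * L2_norm_sq (surface_on A) (\<lambda>x. \<phi> n x - g x)" for n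
  proof -
    have "L2_norm_sq (surface_on ?B) (\<lambda>x. trace K u x - g x) = L2_norm_sq (surface_on ?B) (\<lambda>x. (\<phi> n x - g x) - (\<phi> n x - trace K u x))"
      by simp
    also have "\<dots> \<le> 2 * L2_norm_sq (surface_on ?B) (\<lambda>x. \<phi> n x - g x) + 2 * L2_norm_sq (surface_on ?B) (\<lambda>x. \<phi> n x - trace K u x)"
      by (rule square_integrable_diff(2)[OF B2(1)[unfolded L2_iff_square_integrable] B1(1)[unfolded L2_iff_square_integrable]])
    finally show ?thesis using B1(2)[of n] B2(2)[of n] by linarith
  qed
  moreover have "(\<lambda>n. 2 * L2_norm_sq (surface_on (frontier K)) (\<lambda>x. \<phi> n x - trace K u x) + 2 * L2_norm_sq (surface_on A) (\<lambda>x. \<phi> n x - g x)) \<longlonglongrightarrow> 0"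
    using tendsto_add[OF tendsto_mult_left[OF c1, of 2] tendsto_mult_left[OF \<phi>(2), of 2]] by simp
  ultimately have "L2_norm_sq (surface_on ?B) (\<lambda>x. trace K u x - g x) \<le> 0"
    by (intro LIMSEQ_le_const) auto
  then have "L2_norm_sq (surface_on ?B) (\<lambda>x. trace K u x - g x) = 0" using L2_norm_sq_nonneg antisym by blast
  then have "AE y in surface_on ?B. trace K u y - g y = 0" using L2_norm_sq_eq_0_iff[OF d] by simp
  then show ?thesis unfolding AE_surface_on_iff[OF B(1)] by eventually_elim auto
qed

section \<open>Gradient jumps and integration by parts in time\<close>

context space_time_mesh
begin

text \<open>The chosen weak derivative on \<open>Q\<close> agrees on an element with the classical
  derivative of the local representative almost everywhere, and therefore has its boundary values as
  trace.\<close>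

lemma piecewise_smooth_deriv:
  assumes K: "K \<in> set \<K>" and u: "u \<in> sobolev Basis Q" and q: "smooth q" "\<And>y. y \<in> K \<Longrightarrow> u y = q y"
  shows "AE y in surface_on (frontier K). trace K u y = q y"
    and "b \<in> Basis \<Longrightarrow> AE x in lebesgue_on (interior K). weak_deriv Q b u x = deriv_along b q x"
    and "b \<in> Basis \<Longrightarrow> weak_deriv Q b u \<in> sobolev Basis (interior K)"
    and "b \<in> Basis \<Longrightarrow> AE y in surface_on (frontier K). trace K (weak_deriv Q b u) y = deriv_along b q y"
proof -
  note S = solid_element[OF K]
  note sub = Q_facts(1) solid_polytope_basic(4)[OF S] interior_element_subset[OF K] Q_facts(2)
  have uK: "u \<in> sobolev Basis (interior K)" by (rule sobolev_subset(1)[OF sub subset_refl u])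
  note um = L2_measurable[OF sobolevD(1)[OF uK]]
  have qu: "AE x in lebesgue_on (interior K). q x = u x"
    using q(2) interior_subset[of K] by (intro AE_I2) (auto simp: space_restrict_space)
  from trace_cong_AE[OF S smooth_sobolev(1)[OF S q(1)] qu um] trace_smooth[OF S q(1)]
  show "AE y in surface_on (frontier K). trace K u y = q y" by eventually_elim simp
  fix b :: "'d spacetime" assume b: "b \<in> Basis"
  have "weak_deriv (interior K) b u = weak_deriv (interior K) b q"
    by (rule sobolev_cong_AE(2)[OF qu um subset_refl smooth_sobolev(1)[OF S q(1)] b])
  with smooth_sobolev(2)[OF S q(1) b] sobolev_subset(2)[OF sub subset_refl u b]
  have "AE x in lebesgue_on (interior K). deriv_along b q x = weak_deriv Q b u x" by auto
  moreover note d = smooth_deriv_along[OF q(1) b]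
  moreover have m: "weak_deriv Q b u \<in> borel_measurable (lebesgue_on (interior K))"
    by (rule L2_measurable[OF L2_lebesgue_on_subset(1)[OF sub(1-3) sobolevD(2)[OF u b]]])
  ultimately have eq: "AE x in lebesgue_on (interior K). deriv_along b q x = weak_deriv Q b u x" by blast
  then show "AE x in lebesgue_on (interior K). weak_deriv Q b u x = deriv_along b q x" by eventually_elim simp
  show "weak_deriv Q b u \<in> sobolev Basis (interior K)"
    by (rule sobolev_cong_AE(1)[OF eq m subset_refl smooth_sobolev(1)[OF S d]])
  from trace_cong_AE[OF S smooth_sobolev(1)[OF S d] eq m] trace_smooth[OF S d]
  show "AE y in surface_on (frontier K). trace K (weak_deriv Q b u) y = deriv_along b q y" by eventually_elim simp
qed

abbreviation normal_jump :: "('d spacetime \<Rightarrow> real) \<Rightarrow> 'd spacetime set \<Rightarrow> 'd spacetime set \<Rightarrow> 'd spacetime \<Rightarrow> bool" where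
  "normal_jump u K K' y \<equiv> \<exists>c. \<forall>b\<in>Basis. trace K (weak_deriv Q b u) y - trace K' (weak_deriv Q b u) y = c * (outer_normal K (K \<inter> K') \<bullet> b)"

text \<open>The regularity shared by \<open>H\<^sup>2\<close> functions and by continuous piecewise polynomials: across an
  interior facet the gradient jumps in the normal direction only.\<close>

definition normal_gradient_jumps :: "('d spacetime \<Rightarrow> real) \<Rightarrow> bool" where
  "normal_gradient_jumps u \<longleftrightarrow> u \<in> sobolev Basis Q \<and>
     (\<forall>K\<in>set \<K>. \<forall>b\<in>Basis. weak_deriv Q b u \<in> sobolev Basis (interior K)) \<and>
     (\<forall>(K, K')\<in>interior_facets \<K>. AE y in surface_measure. y \<in> K \<inter> K' \<longrightarrow> normal_jump u K K' y)"

lemma facet_subset_frontiers: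
  assumes "(K, K') \<in> interior_facets \<K>"
  shows "K \<inter> K' \<subseteq> frontier K" "K \<inter> K' \<subseteq> frontier K'" "K \<inter> K' \<in> sets borel"
  using interior_facetsD[OF assms] frontier_solid_polytope(1)[OF solid_element] closed_facet[OF solid_element]
  by (auto intro: borel_closed)

lemma AE_facet_if_AE_frontier:
  assumes K: "(K, K') \<in> interior_facets \<K>" and ae: "AE y in surface_on (frontier K). P y" "AE y in surface_on (frontier K'). P' y"
  shows "AE y in surface_measure. y \<in> K \<inter> K' \<longrightarrow> P y \<and> P' y"
proof -
  note fr = frontier_solid_polytope_basic(1)[OF solid_element[OF interior_facetsD(1)[OF K]]]
    frontier_solid_polytope_basic(1)[OF solid_element[OF interior_facetsD(2)[OF K]]]
  from ae show ?thesis unfolding AE_surface_on_iff[OF fr(1)] AE_surface_on_iff[OF fr(2)]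
    by eventually_elim (use facet_subset_frontiers[OF K] in blast)
qed

text \<open>All first derivatives lie in the first-order Sobolev space of \<open>Q\<close>, so their
  traces from both sides coincide and the factor \<open>c\<close> can be taken as 0.\<close>

lemma sobolev2_normal_gradient_jumps:
  assumes u: "u \<in> sobolev2 Q" shows "normal_gradient_jumps u"
  unfolding normal_gradient_jumps_def
proof (intro conjI ballI)
  have d: "weak_deriv Q b u \<in> sobolev Basis Q" if "b \<in> Basis" for b using u that by (simp add: sobolev2_def)
  show "u \<in> sobolev Basis Q" using u by (simp add: sobolev2_def)
  show "weak_deriv Q b u \<in> sobolev Basis (interior K)" if "K \<in> set \<K>" "b \<in> Basis" for K b
    by (rule sobolev_subset(1)[OF Q_facts(1) open_interior interior_element_subset[OF that(1)] Q_facts(2) subset_refl d[OF that(2)]])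
  fix KK assume "KK \<in> interior_facets \<K>"
  then obtain K K' where KK: "KK = (K, K')" and K: "(K, K') \<in> interior_facets \<K>" by (cases KK) auto
  note F = interior_facetsD[OF K]
  have "AE y in surface_measure. \<forall>b\<in>Basis. y \<in> K \<inter> K' \<longrightarrow> trace K (weak_deriv Q b u) y = trace K' (weak_deriv Q b u) y"
    by (intro AE_finite_allI finite_Basis
        AE_traces_equal_on_shared_facet[OF solid_element[OF F(1)] solid_element[OF F(2)] F(4-6) Q_facts(1,2) interior_Un_subset[OF F(1,2)] d])
  then show "case KK of (K, K') \<Rightarrow> AE y in surface_measure. y \<in> K \<inter> K' \<longrightarrow> normal_jump u K K' y"
    unfolding KK prod.case by eventually_elim (auto intro!: exI[of _ 0])
qed

lemma V_0h_elements:
  assumes v: "v \<in> V_0h \<Omega> T p \<K>"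
  shows "v \<in> sobolev Basis Q" "\<exists>q. \<forall>K\<in>set \<K>. q K \<in> polynomials p \<and> (\<forall>y\<in>K. v y = q K y)"
    "has_trace Basis Q v (Sigma_lat \<Omega> T) (\<lambda>_. 0)" "has_trace Basis Q v (Sigma_bot \<Omega>) (\<lambda>_. 0)"
proof -
  show tr: "has_trace Basis Q v (Sigma_lat \<Omega> T) (\<lambda>_. 0)" "has_trace Basis Q v (Sigma_bot \<Omega>) (\<lambda>_. 0)"
    using v by (auto simp: V_0h_def H11_00_def Basis_spacetime)
  show "v \<in> sobolev Basis Q" using tr(1) by (simp add: has_trace_def)
  have "\<forall>K\<in>set \<K>. \<exists>q. q \<in> polynomials p \<and> (\<forall>y\<in>K. v y = q y)" using v by (auto simp: V_0h_def V_h_def)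
  then show "\<exists>q. \<forall>K\<in>set \<K>. q K \<in> polynomials p \<and> (\<forall>y\<in>K. v y = q K y)" by (rule bchoice)
qed

text \<open>The polynomials of two neighbours represent the same function on the common facet, so
  their difference vanishes there and has a normal gradient.\<close>

lemma V_0h_normal_gradient_jumps:
  assumes v: "v \<in> V_0h \<Omega> T p \<K>" shows "normal_gradient_jumps v"
  unfolding normal_gradient_jumps_def
proof (intro conjI ballI)
  note vs = V_0h_elements(1)[OF v]
  obtain q where "\<forall>K\<in>set \<K>. q K \<in> polynomials p \<and> (\<forall>y\<in>K. v y = q K y)" using V_0h_elements(2)[OF v] by blast
  then have q: "smooth (q K)" "\<And>y. y \<in> K \<Longrightarrow> v y = q K y" if "K \<in> set \<K>" for K using that polynomials_smooth by blast+
  show "v \<in> sobolev Basis Q" by (rule vs)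
  show "weak_deriv Q b v \<in> sobolev Basis (interior K)" if "K \<in> set \<K>" "b \<in> Basis" for K b
    by (rule piecewise_smooth_deriv(3)[OF that(1) vs q[OF that(1)] that(2)])
  fix KK assume "KK \<in> interior_facets \<K>"
  then obtain K K' where KK: "KK = (K, K')" and K: "(K, K') \<in> interior_facets \<K>" by (cases KK) auto
  note F = interior_facetsD[OF K]
  have "AE y in surface_measure. \<forall>b\<in>Basis. y \<in> K \<inter> K' \<longrightarrow>
      trace K (weak_deriv Q b v) y = deriv_along b (q K) y \<and> trace K' (weak_deriv Q b v) y = deriv_along b (q K') y"
    by (intro AE_finite_allI finite_Basis AE_facet_if_AE_frontier[OF K]
        piecewise_smooth_deriv(4)[OF F(1) vs q[OF F(1)]] piecewise_smooth_deriv(4)[OF F(2) vs q[OF F(2)]])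
  then show "case KK of (K, K') \<Rightarrow> AE y in surface_measure. y \<in> K \<inter> K' \<longrightarrow> normal_jump v K K' y"
    unfolding KK prod.case
  proof eventually_elim
    case (elim y)
    show ?case
    proof
      assume y: "y \<in> K \<inter> K'"
      have "q K z = q K' z" if "z \<in> K \<inter> K'" for z using that q(2)[OF F(1), of z] q(2)[OF F(2), of z] by simp
      from gradient_jump_on_facet[OF solid_element[OF F(1)] F(4) q(1)[OF F(1)] q(1)[OF F(2)] this y]
      show "normal_jump v K K' y"
        using elim y by auto
    qed
  qed
qed

text \<open>The derivative of a sum is a fresh choice, equal to the sum of the chosen derivatives
  only almost everywhere; the traces are transported along this equality before the factors are
  added.\<close>

lemma normal_gradient_jumps_add:
  assumes u: "normal_gradient_jumps u" and w: "normal_gradient_jumps w"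
  shows "normal_gradient_jumps (\<lambda>y. u y + w y)"
  unfolding normal_gradient_jumps_def
proof (intro conjI ballI)
  have us: "u \<in> sobolev Basis Q" and ws: "w \<in> sobolev Basis Q" using u w by (auto simp: normal_gradient_jumps_def)
  have dK: "weak_deriv Q b u \<in> sobolev Basis (interior K)" "weak_deriv Q b w \<in> sobolev Basis (interior K)" if "K \<in> set \<K>" "b \<in> Basis" for K b
    using u w that by (auto simp: normal_gradient_jumps_def)
  note add = sobolev_add[OF Q_facts(1,2) subset_refl us ws]
  have eq: "AE x in lebesgue_on (interior K). weak_deriv Q b u x + weak_deriv Q b w x = weak_deriv Q b (\<lambda>y. u y + w y) x"
    and m: "weak_deriv Q b (\<lambda>y. u y + w y) \<in> borel_measurable (lebesgue_on (interior K))" if K: "K \<in> set \<K>" and b: "b \<in> Basis" for K b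
  proof -
    note sub = Q_facts(1) open_interior interior_element_subset[OF K]
    have "AE x in lebesgue. x \<in> Q \<longrightarrow> weak_deriv Q b (\<lambda>y. u y + w y) x = weak_deriv Q b u x + weak_deriv Q b w x"
      using add(2)[OF b] Q_facts(1) by (subst (asm) AE_restrict_space_iff) auto
    then have "AE x in lebesgue. x \<in> interior K \<longrightarrow> weak_deriv Q b u x + weak_deriv Q b w x = weak_deriv Q b (\<lambda>y. u y + w y) x"
      by eventually_elim (use sub(3) in auto)
    then show "AE x in lebesgue_on (interior K). weak_deriv Q b u x + weak_deriv Q b w x = weak_deriv Q b (\<lambda>y. u y + w y) x"
      by (subst AE_restrict_space_iff) auto
    show "weak_deriv Q b (\<lambda>y. u y + w y) \<in> borel_measurable (lebesgue_on (interior K))"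
      by (rule L2_measurable[OF L2_lebesgue_on_subset(1)[OF sub sobolevD(2)[OF add(1) b]]])
  qed
  have sum: "(\<lambda>x. weak_deriv Q b u x + weak_deriv Q b w x) \<in> sobolev Basis (interior K)" if K: "K \<in> set \<K>" and b: "b \<in> Basis" for K b
    by (rule sobolev_add(1)[OF open_interior solid_polytope_basic(6)[OF solid_element[OF K]] subset_refl dK[OF that]])
  have tr: "AE y in surface_on (frontier K). trace K (weak_deriv Q b (\<lambda>y. u y + w y)) y = trace K (weak_deriv Q b u) y + trace K (weak_deriv Q b w) y"
    if K: "K \<in> set \<K>" and b: "b \<in> Basis" for K b
    using trace_add[OF solid_element[OF K] dK[OF that]] trace_cong_AE[OF solid_element[OF K] sum[OF that] eq[OF that] m[OF that]]
    by eventually_elim simp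
  show "(\<lambda>y. u y + w y) \<in> sobolev Basis Q" by (rule add(1))
  show "weak_deriv Q b (\<lambda>y. u y + w y) \<in> sobolev Basis (interior K)" if K: "K \<in> set \<K>" and b: "b \<in> Basis" for K b
    by (rule sobolev_cong_AE(1)[OF eq[OF that] m[OF that] subset_refl sum[OF that]])
  fix KK assume "KK \<in> interior_facets \<K>"
  then obtain K K' where KK: "KK = (K, K')" and K: "(K, K') \<in> interior_facets \<K>" by (cases KK) auto
  note F = interior_facetsD[OF K]
  have "AE y in surface_measure. \<forall>b\<in>Basis. y \<in> K \<inter> K' \<longrightarrow>
      trace K (weak_deriv Q b (\<lambda>y. u y + w y)) y = trace K (weak_deriv Q b u) y + trace K (weak_deriv Q b w) y \<and>
      trace K' (weak_deriv Q b (\<lambda>y. u y + w y)) y = trace K' (weak_deriv Q b u) y + trace K' (weak_deriv Q b w) y"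
    by (intro AE_finite_allI finite_Basis AE_facet_if_AE_frontier[OF K] tr F(1,2))
  moreover have "AE y in surface_measure. y \<in> K \<inter> K' \<longrightarrow> normal_jump u K K' y"
    "AE y in surface_measure. y \<in> K \<inter> K' \<longrightarrow> normal_jump w K K' y"
    using u w K unfolding normal_gradient_jumps_def by blast+
  ultimately show "case KK of (K, K') \<Rightarrow> AE y in surface_measure. y \<in> K \<inter> K' \<longrightarrow> normal_jump (\<lambda>y. u y + w y) K K' y"
    unfolding KK prod.case
  proof eventually_elim
    case (elim y)
    show ?case
    proof
      assume y: "y \<in> K \<inter> K'"
      obtain c where c: "\<forall>b\<in>Basis. trace K (weak_deriv Q b u) y - trace K' (weak_deriv Q b u) y = c * (outer_normal K (K \<inter> K') \<bullet> b)"
        using elim(2) y by blast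
      obtain c' where c': "\<forall>b\<in>Basis. trace K (weak_deriv Q b w) y - trace K' (weak_deriv Q b w) y = c' * (outer_normal K (K \<inter> K') \<bullet> b)"
        using elim(3) y by blast
      have "trace K (weak_deriv Q b (\<lambda>y. u y + w y)) y - trace K' (weak_deriv Q b (\<lambda>y. u y + w y)) y = (c + c') * (outer_normal K (K \<inter> K') \<bullet> b)"
        if "b \<in> Basis" for b
        using elim(1) y that c[rule_format, OF that] c'[rule_format, OF that] by (simp add: distrib_right)
      then show "normal_jump (\<lambda>y. u y + w y) K K' y"
        by blast
    qed
  qed
qed

lemma V_0h_star_normal_gradient_jumps:
  assumes "u \<in> V_0h_star \<Omega> T p \<K>" shows "normal_gradient_jumps u"
  using assms sobolev2_normal_gradient_jumps V_0h_normal_gradient_jumps normal_gradient_jumps_add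
  unfolding V_0h_star_def by blast

text \<open>Integration by parts on each element, against its polynomial, leaves boundary terms of
  four kinds. Inside \<open>Q\<close> they cancel, on the lateral part and at the bottom the trace
  of \<open>v\<close> is zero, and on the top the normal points in time direction. The traces of
  \<open>u\<close> on the lateral part and at the bottom play into nothing because they are
  multiplied by those of \<open>v\<close>.\<close>

lemma time_integration_by_parts:
  assumes u: "u \<in> sobolev Basis Q" and v: "v \<in> V_0h \<Omega> T p \<K>"
  shows "(\<integral>y. weak_deriv Q e_t u y * v y + u y * weak_deriv Q e_t v y \<partial>lebesgue_on Q) =
    (\<Sum>K\<in>set \<K>. \<integral>y. trace K u y * trace K v y \<partial>surface_on (frontier K \<inter> Sigma_top \<Omega> T))"
proof -
  note vs = V_0h_elements(1)[OF v]
  obtain q where "\<forall>K\<in>set \<K>. q K \<in> polynomials p \<and> (\<forall>y\<in>K. v y = q K y)" using V_0h_elements(2)[OF v] by blast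
  then have q: "smooth (q K)" "\<And>y. y \<in> K \<Longrightarrow> v y = q K y" if "K \<in> set \<K>" for K using that polynomials_smooth by blast+
  note S = solid_element
  have sub: "open Q" "open (interior K)" "interior K \<subseteq> Q" "bounded Q" if "K \<in> set \<K>" for K
    using Q_facts interior_element_subset[OF that] by auto
  have uK: "u \<in> sobolev Basis (interior K)" and vK: "v \<in> sobolev Basis (interior K)" if "K \<in> set \<K>" for K
    by (rule sobolev_subset(1)[OF sub[OF that] subset_refl u], rule sobolev_subset(1)[OF sub[OF that] subset_refl vs])
  have fr: "frontier K \<in> sets borel" "frontier K \<inter> Sigma_top \<Omega> T \<in> sets borel" if "K \<in> set \<K>" for K
    using frontier_solid_polytope_basic(1)[OF S[OF that]] boundary_parts(5) by auto
  \<comment> \<open>\<open>?I\<close> is the boundary integrand produced on one element,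
    \<open>?J\<close> the top contribution. At points of \<open>Q\<close> the two are compared only
    after summation over the elements.\<close>
  let ?I = "\<lambda>K y. indicator (frontier K) y * (trace K u y * q K y * normal_field K e_t y)"
  let ?J = "\<lambda>K y. indicator (frontier K \<inter> Sigma_top \<Omega> T) y * (trace K u y * trace K v y)"
  have intI: "integrable surface_measure (?I K)" if K: "K \<in> set \<K>" for K
  proof -
    have "(\<lambda>y. trace K u y * normal_field K e_t y) \<in> L2 (surface_on (frontier K))"
      by (rule L2_mult_bounded[OF trace_L2[OF S[OF K] uK[OF K]]
          borel_measurable_surface_on[OF normal_field_measurable[OF S[OF K]]] normal_field_bounded[OF S[OF K] e_t_Basis]])
    then have "integrable (surface_on (frontier K)) (\<lambda>y. (trace K u y * normal_field K e_t y) * q K y)"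
      by (rule L2_mult_integrable[OF _ smooth_L2_frontier[OF q(1)[OF K] S[OF K] S[OF K] S[OF K]]])
    then have "integrable (surface_on (frontier K)) (\<lambda>y. trace K u y * q K y * normal_field K e_t y)"
      by (simp only: mult_ac)
    then show ?thesis using integral_surface_on(2)[OF fr(1)[OF K]] by simp
  qed
  have intJ: "integrable surface_measure (?J K)" if K: "K \<in> set \<K>" for K
  proof -
    have "square_integrable (surface_on (frontier K \<inter> Sigma_top \<Omega> T)) (trace K u)" "square_integrable (surface_on (frontier K \<inter> Sigma_top \<Omega> T)) (trace K v)"
      using trace_L2[OF S[OF K] uK[OF K]] trace_L2[OF S[OF K] vK[OF K]] fr[OF K] unfolding L2_iff_square_integrable
      by (auto intro: L2_restrict_space_mono(1))
    then have "integrable (surface_on (frontier K \<inter> Sigma_top \<Omega> T)) (\<lambda>y. trace K u y * trace K v y)"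
      by (intro L2_mult_integrable) (simp_all add: L2_iff_square_integrable)
    then show ?thesis using integral_surface_on(2)[OF fr(2)[OF K]] by simp
  qed
  have L2s: "weak_deriv Q e_t u \<in> L2 (lebesgue_on Q)" "weak_deriv Q e_t v \<in> L2 (lebesgue_on Q)" "u \<in> L2 (lebesgue_on Q)" "v \<in> L2 (lebesgue_on Q)"
    using sobolevD(1,2)[OF u] sobolevD(1,2)[OF vs] by auto
  have "(\<integral>y. weak_deriv Q e_t u y * v y + u y * weak_deriv Q e_t v y \<partial>lebesgue_on Q) =
    (\<Sum>K\<in>set \<K>. \<integral>y. weak_deriv Q e_t u y * v y + u y * weak_deriv Q e_t v y \<partial>lebesgue_on (interior K))"
    by (intro integral_polytope_decomposition[OF decomposition_Q] Bochner_Integration.integrable_add L2_mult_integrable L2s)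
  also have "\<dots> = (\<Sum>K\<in>set \<K>. \<integral>y. ?I K y \<partial>surface_measure)"
  proof (intro sum.cong refl)
    fix K assume K: "K \<in> set \<K>"
    have "(\<integral>y. weak_deriv Q e_t u y * v y + u y * weak_deriv Q e_t v y \<partial>lebesgue_on (interior K)) =
      (\<integral>y. weak_deriv (interior K) e_t u y * q K y + u y * deriv_along e_t (q K) y \<partial>lebesgue_on (interior K))"
    proof (rule integral_cong_AE)
      have m: "u \<in> borel_measurable (lebesgue_on (interior K))" "weak_deriv Q e_t u \<in> borel_measurable (lebesgue_on (interior K))"
        "v \<in> borel_measurable (lebesgue_on (interior K))" "weak_deriv Q e_t v \<in> borel_measurable (lebesgue_on (interior K))"
        by (rule L2_measurable[OF L2_lebesgue_on_subset(1)[OF sub(1-3)[OF K]]], rule L2s)+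
      have m': "weak_deriv (interior K) e_t u \<in> borel_measurable (lebesgue_on (interior K))"
        by (rule L2_measurable[OF sobolevD(2)[OF uK[OF K] e_t_Basis]])
      have mq: "q K \<in> borel_measurable (lebesgue_on (interior K))" "deriv_along e_t (q K) \<in> borel_measurable (lebesgue_on (interior K))"
        using smooth_borel_measurable q(1)[OF K] smooth_deriv_along[OF q(1)[OF K] e_t_Basis] borel_measurable_lebesgue_on by blast+
      show "(\<lambda>y. weak_deriv Q e_t u y * v y + u y * weak_deriv Q e_t v y) \<in> borel_measurable (lebesgue_on (interior K))"
        "(\<lambda>y. weak_deriv (interior K) e_t u y * q K y + u y * deriv_along e_t (q K) y) \<in> borel_measurable (lebesgue_on (interior K))"
        using m m' mq by auto
      have "AE y in lebesgue_on (interior K). y \<in> interior K" by (rule AE_I2) (simp add: space_restrict_space)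
      moreover have "AE x in lebesgue_on (interior K). weak_deriv Q e_t v x = deriv_along e_t (q K) x"
        by (rule piecewise_smooth_deriv(2)[OF K vs q[OF K] e_t_Basis])
      moreover note sobolev_subset(2)[OF sub[OF K] subset_refl u e_t_Basis]
      ultimately show "AE y in lebesgue_on (interior K). weak_deriv Q e_t u y * v y + u y * weak_deriv Q e_t v y =
        weak_deriv (interior K) e_t u y * q K y + u y * deriv_along e_t (q K) y"
      proof eventually_elim
        case (elim y)
        then have "v y = q K y" using q(2)[OF K] interior_subset[of K] by blast
        then show ?case using elim by simp
      qed
    qed
    also have "\<dots> = (\<integral>y. trace K u y * q K y * normal_field K e_t y \<partial>surface_on (frontier K))"
      by (rule integration_by_parts[OF S[OF K] uK[OF K] q(1)[OF K] e_t_Basis])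
    also have "\<dots> = (\<integral>y. ?I K y \<partial>surface_measure)" by (rule integral_surface_on(1)[OF fr(1)[OF K]])
    finally show "(\<integral>y. weak_deriv Q e_t u y * v y + u y * weak_deriv Q e_t v y \<partial>lebesgue_on (interior K)) = (\<integral>y. ?I K y \<partial>surface_measure)" .
  qed
  also have "\<dots> = (\<integral>y. (\<Sum>K\<in>set \<K>. ?I K y) \<partial>surface_measure)"
    by (rule Bochner_Integration.integral_sum[symmetric]) (rule intI)
  also have "\<dots> = (\<integral>y. (\<Sum>K\<in>set \<K>. ?J K y) \<partial>surface_measure)"
  proof (rule integral_cong_AE)
    show "(\<lambda>y. \<Sum>K\<in>set \<K>. ?I K y) \<in> borel_measurable surface_measure" "(\<lambda>y. \<Sum>K\<in>set \<K>. ?J K y) \<in> borel_measurable surface_measure"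
      by (intro borel_measurable_integrable Bochner_Integration.integrable_sum intI intJ, assumption)+
    have zero: "has_trace Basis Q v A (\<lambda>_. 0) \<Longrightarrow> A \<in> sets borel \<Longrightarrow> A \<subseteq> frontier Q \<Longrightarrow>
        AE y in surface_measure. \<forall>K\<in>set \<K>. y \<in> frontier K \<longrightarrow> y \<in> A \<longrightarrow> trace K v y = 0" for A
      using trace_eq_boundary_trace[of _ A v "\<lambda>_. 0"] by (intro AE_finite_allI) auto
    have "AE y in surface_measure. \<forall>K\<in>set \<K>. y \<in> frontier K \<longrightarrow> trace K v y = q K y"
    proof (intro AE_finite_allI)
      fix K assume K: "K \<in> set \<K>"
      show "AE y in surface_measure. y \<in> frontier K \<longrightarrow> trace K v y = q K y"
        unfolding AE_surface_on_iff[OF fr(1)[OF K], symmetric] by (rule piecewise_smooth_deriv(1)[OF K vs q[OF K]])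
    qed simp
    moreover have "AE y in surface_measure. \<forall>K\<in>set \<K>. y \<in> frontier K \<longrightarrow> y \<in> Sigma_top \<Omega> T \<longrightarrow> normal_field K e_t y = 1"
      by (intro AE_finite_allI AE_normal_Sigma_top) simp
    moreover note zero[OF V_0h_elements(3)[OF v] boundary_parts(1,2)] zero[OF V_0h_elements(4)[OF v] boundary_parts(3,4)]
      AE_normal_traces_cancel[OF decomposition_Q u e_t_Basis] boundary_parts(7)
    ultimately show "AE y in surface_measure. (\<Sum>K\<in>set \<K>. ?I K y) = (\<Sum>K\<in>set \<K>. ?J K y)"
    proof eventually_elim
      case (elim y)
      have vy: "q K y = v y" if "K \<in> set \<K>" "y \<in> frontier K" for K
      proof -
        have "y \<in> K" using that solid_polytope_basic(10)[OF S[OF that(1)]] by blast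
        then show ?thesis using q(2)[OF that(1)] by simp
      qed
      show ?case
      \<comment> \<open>Inside \<open>Q\<close> all elements share the value \<open>v y\<close>,
        which factors out and leaves the cancelling normal traces of \<open>u\<close>. Elsewhere a
        point on an element frontier is on the frontier of \<open>Q\<close>, and the summands agree
        one by one.\<close>
      proof (cases "y \<in> Q")
        case True
        then have nt: "y \<notin> Sigma_top \<Omega> T" using boundary_parts(6) Q_facts(1) by (auto simp: frontier_def interior_open)
        have "(\<Sum>K\<in>set \<K>. ?I K y) = (\<Sum>K\<in>set \<K>. v y * (indicator (frontier K) y * (trace K u y * normal_field K e_t y)))"
          using vy by (intro sum.cong refl) (auto simp: indicator_def)
        also have "\<dots> = v y * (\<Sum>K\<in>set \<K>. indicator (frontier K) y * (trace K u y * normal_field K e_t y))"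
          by (rule sum_distrib_left[symmetric])
        also have "\<dots> = 0" using elim(5) True by simp
        finally show ?thesis using nt by simp
      next
        case False
        show ?thesis
        proof (intro sum.cong refl)
          fix K assume K: "K \<in> set \<K>"
          show "?I K y = ?J K y"
          proof (cases "y \<in> frontier K")
            case True
            then have "y \<in> frontier Q"
              using False K closure_Q solid_polytope_basic(10)[OF S[OF K]] Q_facts(1) by (auto simp: frontier_def interior_open)
            then consider "y \<in> Sigma_lat \<Omega> T \<or> y \<in> Sigma_bot \<Omega>" | "y \<in> Sigma_top \<Omega> T" using elim(6) by blast
            then show ?thesis
            proof cases
              case 1
              then have "trace K v y = 0" using elim(3,4) K True by blast
              then show ?thesis using elim(1) K True by simp
            next
              case 2
              then show ?thesis using elim(1,2) K True by simp
            qed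
          qed simp
        qed
      qed
    qed
  qed
  also have "\<dots> = (\<Sum>K\<in>set \<K>. \<integral>y. ?J K y \<partial>surface_measure)"
    by (rule Bochner_Integration.integral_sum) (rule intJ)
  also have "\<dots> = (\<Sum>K\<in>set \<K>. \<integral>y. trace K u y * trace K v y \<partial>surface_on (frontier K \<inter> Sigma_top \<Omega> T))"
    by (intro sum.cong refl integral_surface_on(1)[OF fr(2), symmetric])
  finally show ?thesis .
qed

end

section \<open>Boundedness of the bilinear form\<close>

text \<open>Young with \<open>t = m / 2 - 1\<close> weighs \<open>(a + b)^2\<close> by
  \<open>1 + t\<close>, and doubling for the split into \<open>a^2\<close> and \<open>b^2\<close>
  gives exactly \<open>m\<close>. The weight of \<open>c^2\<close> becomes
  \<open>1 + 1 / t = m / (m - 2)\<close>, which is what the condition on \<open>X\<close>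
  dominates.\<close>

lemma weighted_square_le:
  fixes a b c m X :: real
  assumes m: "m > 2" and X: "m \<le> X * (m - 2)"
  shows "(a + b + c)\<^sup>2 \<le> m * (a\<^sup>2 + b\<^sup>2) + X * c\<^sup>2"
proof -
  define t where "t = m / 2 - 1"
  have t: "t > 0" "m = 2 * t + 2" using m by (auto simp: t_def)
  have "0 \<le> (t * (a + b) - c)\<^sup>2 / t" using t by simp
  also have "\<dots> = t * (a + b)\<^sup>2 - 2 * (a + b) * c + c\<^sup>2 / t" using t by (simp add: field_simps power2_eq_square)
  finally have "(a + b + c)\<^sup>2 \<le> (1 + t) * (a + b)\<^sup>2 + (1 + 1 / t) * c\<^sup>2"
    by (simp add: algebra_simps power2_eq_square)
  also have "(1 + t) * (a + b)\<^sup>2 \<le> (1 + t) * (2 * a\<^sup>2 + 2 * b\<^sup>2)"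
    using t power2_norm_add_le[of a b] by (intro mult_left_mono) (simp_all add: power2_norm_eq_inner power2_eq_square)
  also have "(1 + 1 / t) * c\<^sup>2 \<le> X * c\<^sup>2"
    using X t by (intro mult_right_mono) (simp_all add: field_simps)
  finally show ?thesis using t by (simp add: algebra_simps)
qed

text \<open>The bracket is the weight that remains for the interface term:
  \<open>m * \<delta>\<close> from the penalty part of the norm less one \<open>\<delta>\<close>
  reserved for the penalty term itself, and \<open>m / (2 * k)\<close> from the norm on the element
  boundaries. It is at least 2, which suffices for \<open>m > 4\<close>.\<close>

lemma bound_constant:
  fixes \<delta> k m :: real
  assumes \<delta>: "\<delta> > 0" and k: "k > 0" and m: "m = max (inverse \<delta> * k / 2) (4 + inverse \<delta> / 2)"
  shows "m > 2" "m \<le> ((m - 1) * \<delta> + m / (2 * k)) * (m - 2)"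
proof -
  have m1: "inverse \<delta> * k / 2 \<le> m" and m2: "4 + inverse \<delta> / 2 \<le> m" using m by auto
  have "inverse \<delta> > 0" using \<delta> by simp
  then have m4: "m > 4" using m2 by linarith
  then show "m > 2" by simp
  \<comment> \<open>Here the first entry of the maximum enters; the second one gives the bound
    \<open>3 * \<delta> + 1 / 2\<close> below.\<close>
  have "1 / (4 * \<delta>) = inverse \<delta> * k / 2 / (2 * k)" using k \<delta> by (simp add: field_simps)
  also have "\<dots> \<le> m / (2 * k)" using m1 k by (intro divide_right_mono) auto
  finally have a: "1 / (4 * \<delta>) \<le> m / (2 * k)" .
  have "(4 + inverse \<delta> / 2) * \<delta> \<le> m * \<delta>" using m2 \<delta> by (intro mult_right_mono) auto
  then have b: "3 * \<delta> + 1 / 2 \<le> (m - 1) * \<delta>" using \<delta> by (simp add: algebra_simps)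
  \<comment> \<open>Completing the square gives
    \<open>3 * \<delta> + 1 / (4 * \<delta>) \<ge> 3 / 2\<close> after division by
    \<open>4 * \<delta>\<close>.\<close>
  have "12 * \<delta>\<^sup>2 + 1 - 6 * \<delta> = 12 * (\<delta> - 1 / 4)\<^sup>2 + 1 / 4" by (simp add: power2_eq_square field_simps)
  then have "6 * \<delta> \<le> 12 * \<delta>\<^sup>2 + 1" using zero_le_power2[of "\<delta> - 1 / 4"] by linarith
  then have "3 / 2 \<le> 3 * \<delta> + 1 / (4 * \<delta>)" using \<delta> by (simp add: field_simps power2_eq_square)
  then have "2 \<le> (m - 1) * \<delta> + m / (2 * k)" using a b by linarith
  then have "2 * (m - 2) \<le> ((m - 1) * \<delta> + m / (2 * k)) * (m - 2)" using m4 by (intro mult_right_mono) auto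
  moreover have "m \<le> 2 * (m - 2)" using m4 by simp
  ultimately show "m \<le> ((m - 1) * \<delta> + m / (2 * k)) * (m - 2)" by (rule order_trans[rotated])
qed

lemma Cauchy_Schwarz_5:
  fixes x1 :: real
  shows "x1 * y1 + x2 * y2 + x3 * y3 + x4 * y4 + x5 * y5 \<le>
    sqrt (x1\<^sup>2 + x2\<^sup>2 + x3\<^sup>2 + x4\<^sup>2 + x5\<^sup>2) * sqrt (y1\<^sup>2 + y2\<^sup>2 + y3\<^sup>2 + y4\<^sup>2 + y5\<^sup>2)"
  using norm_cauchy_schwarz[of "(x1, x2, x3, x4, x5)" "(y1, y2, y3, y4, y5)"]
  by (simp add: norm_eq_sqrt_inner power2_eq_square add.assoc)

text \<open>\<open>A1\<close> to \<open>A10\<close> are the squared parts of the stronger norm of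
  \<open>u\<close>, with \<open>\<delta> * J\<close> in the sixth place, and \<open>B1\<close> to
  \<open>B6\<close> those of the norm of \<open>v\<close>. Since \<open>J\<close> is also bounded by
  \<open>2 * k * A10\<close>, it can be charged to two parts at once.\<close>

lemma combine_bounds:
  fixes \<delta> k :: real
  assumes \<delta>: "\<delta> > 0" and k: "k > 0" and m: "m = max (inverse \<delta> * k / 2) (4 + inverse \<delta> / 2)"
    and A: "0 \<le> A1" "0 \<le> A2" "0 \<le> A3" "0 \<le> A4" "0 \<le> A5" "0 \<le> A7" "0 \<le> A8" "0 \<le> A9" "0 \<le> J" "J \<le> 2 * k * A10"
    and B: "0 \<le> B1" "0 \<le> B2" "0 \<le> B3" "0 \<le> B4" "0 \<le> B5" "0 \<le> B6"
    and t: "\<bar>t1\<bar> \<le> sqrt A7 * sqrt B2 + sqrt (2 * A3) * sqrt (2 * B3)" "\<bar>t2\<bar> \<le> sqrt A2 * sqrt B2" "\<bar>t3\<bar> \<le> sqrt A1 * sqrt B1"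
      "\<bar>t4\<bar> \<le> sqrt A8 * sqrt B1" "\<bar>t5\<bar> \<le> sqrt A4 * sqrt (2 * B4)" "\<bar>t6\<bar> \<le> sqrt J * sqrt B1 + sqrt (\<delta> * J) * sqrt B6"
  shows "\<bar>t1 + t2 + t3 - t4 + t5 + t6\<bar> \<le>
    sqrt m * sqrt (A1 + A2 + A3 + A4 + A5 + \<delta> * J + A7 + A8 + A9 + A10) * sqrt (B1 + B2 + B3 + B4 + B5 + B6)"
proof -
  note mm = bound_constant[OF \<delta> k m]
  have "4 \<le> 4 + inverse \<delta> / 2" using \<delta> by simp
  also have "\<dots> \<le> m" using m by simp
  finally have m4: "4 \<le> m" .
  have A10: "0 \<le> A10" using A(9,10) k by (smt (verit) mult_pos_neg)
  define X where "X = (m - 1) * \<delta> + m / (2 * k)"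
  let ?x = "sqrt A1 + sqrt A8 + sqrt J"
  have "\<bar>t1 + t2 + t3 - t4 + t5 + t6\<bar> \<le> \<bar>t1\<bar> + \<bar>t2\<bar> + \<bar>t3\<bar> + \<bar>t4\<bar> + \<bar>t5\<bar> + \<bar>t6\<bar>" by linarith
  \<comment> \<open>Collected by the parts of \<open>v\<close>: the gradient of \<open>v\<close>
    meets the gradient, the mixed derivative and the interface jump of \<open>u\<close>; its time
    derivative meets \<open>u\<close> and the time derivative of \<open>u\<close>.\<close>
  also have "\<dots> \<le> ?x * sqrt B1 + (sqrt A7 + sqrt A2) * sqrt B2 + (2 * sqrt A3) * sqrt B3
      + (sqrt 2 * sqrt A4) * sqrt B4 + sqrt (\<delta> * J) * sqrt B6"
  proof -
    have s2: "sqrt (2 * z) = sqrt 2 * sqrt z" for z by (rule real_sqrt_mult)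
    have "sqrt (2 * A3) * sqrt (2 * B3) = 2 * sqrt A3 * sqrt B3" unfolding s2 by simp
    moreover have "sqrt A4 * sqrt (2 * B4) = sqrt 2 * sqrt A4 * sqrt B4" unfolding s2 by simp
    ultimately show ?thesis using t by (simp only: distrib_right)
  qed
  also have "\<dots> \<le> sqrt (?x\<^sup>2 + (sqrt A7 + sqrt A2)\<^sup>2 + (2 * sqrt A3)\<^sup>2 + (sqrt 2 * sqrt A4)\<^sup>2 + (sqrt (\<delta> * J))\<^sup>2) *
      sqrt ((sqrt B1)\<^sup>2 + (sqrt B2)\<^sup>2 + (sqrt B3)\<^sup>2 + (sqrt B4)\<^sup>2 + (sqrt B6)\<^sup>2)"
    by (rule Cauchy_Schwarz_5)
  also have "\<dots> \<le> sqrt (m * (A1 + A2 + A3 + A4 + A5 + \<delta> * J + A7 + A8 + A9 + A10)) * sqrt (B1 + B2 + B3 + B4 + B5 + B6)"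
  proof (intro mult_mono real_sqrt_le_mono)
    have sq: "(sqrt z)\<^sup>2 = z" if "0 \<le> z" for z using that by simp
    have "?x\<^sup>2 \<le> m * (A1 + A8) + X * J"
      using weighted_square_le[OF mm[folded X_def], of "sqrt A1" "sqrt A8" "sqrt J"] A by simp
    \<comment> \<open>The budget of \<open>J\<close> is split between its two occurrences in the
      norm; one unit of \<open>\<delta> * J\<close> is left over for the penalty term.\<close>
    also have "X * J = (m - 1) * (\<delta> * J) + m / (2 * k) * J" by (simp add: X_def algebra_simps)
    also have "m / (2 * k) * J \<le> m / (2 * k) * (2 * k * A10)" using A m4 k by (intro mult_left_mono) auto
    also have "\<dots> = m * A10" using k by simp
    finally have 1: "?x\<^sup>2 + \<delta> * J \<le> m * (A1 + A8 + \<delta> * J + A10)" by (simp add: algebra_simps)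
    have "(sqrt A7 + sqrt A2)\<^sup>2 \<le> 2 * (A7 + A2)"
      using power2_norm_add_le[of "sqrt A7" "sqrt A2"] A by simp
    also have "\<dots> \<le> m * (A7 + A2)" using A m4 by (intro mult_right_mono) auto
    finally have 2: "(sqrt A7 + sqrt A2)\<^sup>2 \<le> m * (A7 + A2)" .
    have 3: "(2 * sqrt A3)\<^sup>2 \<le> m * A3" unfolding power_mult_distrib sq[OF A(3)] using A m4 by (intro mult_right_mono) auto
    have 4: "(sqrt 2 * sqrt A4)\<^sup>2 \<le> m * A4" unfolding power_mult_distrib sq[OF A(4)] using A m4 by (intro mult_right_mono) auto
    have 5: "0 \<le> m * (A5 + A9)" using A m4 by simp
    have 6: "(sqrt (\<delta> * J))\<^sup>2 = \<delta> * J" using A \<delta> by simp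
    show "?x\<^sup>2 + (sqrt A7 + sqrt A2)\<^sup>2 + (2 * sqrt A3)\<^sup>2 + (sqrt 2 * sqrt A4)\<^sup>2 + (sqrt (\<delta> * J))\<^sup>2 \<le>
        m * (A1 + A2 + A3 + A4 + A5 + \<delta> * J + A7 + A8 + A9 + A10)"
      using 1 2 3 4 5 6 by (simp add: distrib_left)
    show "(sqrt B1)\<^sup>2 + (sqrt B2)\<^sup>2 + (sqrt B3)\<^sup>2 + (sqrt B4)\<^sup>2 + (sqrt B6)\<^sup>2 \<le> B1 + B2 + B3 + B4 + B5 + B6"
      using B by simp
  qed (use A10 A B \<delta> m4 in auto)
  finally show ?thesis by (simp add: real_sqrt_mult)
qed

lemma sum_integral_inner_le:
  fixes f g :: "'i \<Rightarrow> 'a \<Rightarrow> 'b::euclidean_space"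
  assumes "\<And>i. i \<in> I \<Longrightarrow> square_integrable (M i) (f i)" "\<And>i. i \<in> I \<Longrightarrow> square_integrable (M i) (g i)"
  shows "\<bar>\<Sum>i\<in>I. \<integral>y. f i y \<bullet> g i y \<partial>M i\<bar> \<le> sqrt (\<Sum>i\<in>I. L2_norm_sq (M i) (f i)) * sqrt (\<Sum>i\<in>I. L2_norm_sq (M i) (g i))"
proof -
  have "\<bar>\<Sum>i\<in>I. \<integral>y. f i y \<bullet> g i y \<partial>M i\<bar> \<le> (\<Sum>i\<in>I. \<bar>\<integral>y. f i y \<bullet> g i y \<partial>M i\<bar>)" by (rule sum_abs)
  also have "\<dots> \<le> (\<Sum>i\<in>I. \<bar>sqrt (L2_norm_sq (M i) (f i))\<bar> * \<bar>sqrt (L2_norm_sq (M i) (g i))\<bar>)"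
    using integral_inner_le[OF assms] by (intro sum_mono) auto
  also have "\<dots> \<le> L2_set (\<lambda>i. sqrt (L2_norm_sq (M i) (f i))) I * L2_set (\<lambda>i. sqrt (L2_norm_sq (M i) (g i))) I"
    by (rule L2_set_mult_ineq)
  finally show ?thesis by (simp add: L2_set_def)
qed

text \<open>The interface terms without \<open>\<delta>\<close> collapse to one: all jumps are multiples of the normal.\<close>

lemma facet_terms_collapse:
  fixes a a' b b' n :: "'a::real_inner" and s s' r r' c d \<tau> :: real
  assumes "a - a' = c *\<^sub>R n" "s - s' = c * \<tau>" "b - b' = d *\<^sub>R n" "r - r' = d * \<tau>"
  shows "(if \<tau> \<ge> 0 then a else a') \<bullet> (\<tau> *\<^sub>R b + (- \<tau>) *\<^sub>R b') - ((1/2) *\<^sub>R (a + a')) \<bullet> (r *\<^sub>R n + r' *\<^sub>R (- n))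
      + ((1/2) *\<^sub>R (b + b')) \<bullet> (s *\<^sub>R n + s' *\<^sub>R (- n)) = (if \<tau> \<ge> 0 then b else b') \<bullet> (s *\<^sub>R n + s' *\<^sub>R (- n))"
proof -
  have eq: "\<tau> *\<^sub>R b + (- \<tau>) *\<^sub>R b' = (d * \<tau>) *\<^sub>R n" "r *\<^sub>R n + r' *\<^sub>R (- n) = (d * \<tau>) *\<^sub>R n" "s *\<^sub>R n + s' *\<^sub>R (- n) = (c * \<tau>) *\<^sub>R n"
  proof -
    have "\<tau> *\<^sub>R b + (- \<tau>) *\<^sub>R b' = \<tau> *\<^sub>R (b - b')" by (simp add: scaleR_diff_right)
    then show "\<tau> *\<^sub>R b + (- \<tau>) *\<^sub>R b' = (d * \<tau>) *\<^sub>R n" using assms(3) by (simp add: mult.commute)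
    have "x *\<^sub>R n + x' *\<^sub>R (- n) = (x - x') *\<^sub>R n" for x x' by (simp add: scaleR_diff_left)
    then show "r *\<^sub>R n + r' *\<^sub>R (- n) = (d * \<tau>) *\<^sub>R n" "s *\<^sub>R n + s' *\<^sub>R (- n) = (c * \<tau>) *\<^sub>R n" using assms by simp_all
  qed
  have ab: "a = a' + c *\<^sub>R n" "b = b' + d *\<^sub>R n" using assms by (simp_all add: algebra_simps)
  show ?thesis unfolding eq unfolding ab by (simp add: inner_add_left algebra_simps)
qed

section \<open>Integrability on elements and evaluation of the facet integrals\<close>

context space_time_mesh
begin

lemma vec_components [simp]:
  "(\<lambda>z. grad_x G w z $ i) = weak_deriv G (e_x i) w" "trace_vec K g y $ i = trace K (\<lambda>z. g z $ i) y"
  "d_t_grad_x G K w y $ i = weak_deriv (interior K) e_t (weak_deriv G (e_x i) w) y"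
  by (simp_all add: grad_x_def[abs_def] trace_vec_def d_t_grad_x_def d_t_def)

lemma grad_x_square_integrable:
  assumes "w \<in> sobolev Basis G" shows "square_integrable (lebesgue_on G) (grad_x G w)"
  using sobolevD(2)[OF assms] by (intro square_integrable_vec(1)) (simp add: vec_components)

lemma normal_gradient_jumpsD:
  assumes w: "normal_gradient_jumps w"
  shows "w \<in> sobolev Basis Q"
    and "K \<in> set \<K> \<Longrightarrow> b \<in> Basis \<Longrightarrow> weak_deriv Q b w \<in> sobolev Basis (interior K)"
    and "K \<in> set \<K> \<Longrightarrow> trace K w \<in> L2 (surface_on (frontier K))"
    and "K \<in> set \<K> \<Longrightarrow> trace K (d_t Q w) \<in> L2 (surface_on (frontier K))"
    and "K \<in> set \<K> \<Longrightarrow> square_integrable (surface_on (frontier K)) (trace_vec K (grad_x Q w))"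
    and "K \<in> set \<K> \<Longrightarrow> square_integrable (lebesgue_on K) (d_t_grad_x Q K w)"
    and "K \<in> set \<K> \<Longrightarrow> square_integrable (lebesgue_on K) (grad_x Q w)"
    and "(\<Sum>K\<in>set \<K>. L2_norm_sq (lebesgue_on K) (grad_x Q w)) = L2_norm_sq (lebesgue_on Q) (grad_x Q w)"
proof -
  show ws: "w \<in> sobolev Basis Q" using w by (simp add: normal_gradient_jumps_def)
  note gQ = grad_x_square_integrable[OF ws]
  have gK: "square_integrable (lebesgue_on (interior K)) (grad_x Q w)" if "K \<in> set \<K>" for K
  proof (rule square_integrable_vec(1), simp only: vec_components)
    show "weak_deriv Q (e_x i) w \<in> L2 (lebesgue_on (interior K))" for i
      by (rule L2_lebesgue_on_subset(1)[OF Q_facts(1) open_interior interior_element_subset[OF that] sobolevD(2)[OF ws e_x_Basis]])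
  qed
  show dK: "weak_deriv Q b w \<in> sobolev Basis (interior K)" if "K \<in> set \<K>" "b \<in> Basis" for K b
    using w that by (auto simp: normal_gradient_jumps_def)
  {
    assume K: "K \<in> set \<K>"
    note S = solid_element[OF K]
    have "w \<in> sobolev Basis (interior K)"
      by (rule sobolev_subset(1)[OF Q_facts(1) open_interior interior_element_subset[OF K] Q_facts(2) subset_refl ws])
    then show "trace K w \<in> L2 (surface_on (frontier K))" by (rule trace_L2[OF S])
    show "trace K (d_t Q w) \<in> L2 (surface_on (frontier K))"
      unfolding d_t_def by (rule trace_L2[OF S dK[OF K e_t_Basis]])
    show "square_integrable (surface_on (frontier K)) (trace_vec K (grad_x Q w))"
      using trace_L2[OF S dK[OF K e_x_Basis]] by (intro square_integrable_vec(1)) simp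
    have "square_integrable (lebesgue_on (interior K)) (d_t_grad_x Q K w)"
      using sobolevD(2)[OF dK[OF K e_x_Basis] e_t_Basis] by (intro square_integrable_vec(1)) simp
    then show "square_integrable (lebesgue_on K) (d_t_grad_x Q K w)"
      by (rule square_integrable_lebesgue_on_solid_polytope(1)[OF S])
    show "square_integrable (lebesgue_on K) (grad_x Q w)"
      by (rule square_integrable_lebesgue_on_solid_polytope(1)[OF S gK[OF K]])
  }
  have "L2_norm_sq (lebesgue_on Q) (grad_x Q w) = (\<Sum>K\<in>set \<K>. L2_norm_sq (lebesgue_on (interior K)) (grad_x Q w))"
    unfolding L2_norm_sq_def using gQ by (intro integral_polytope_decomposition[OF decomposition_Q]) (simp add: square_integrable_def)
  also have "\<dots> = (\<Sum>K\<in>set \<K>. L2_norm_sq (lebesgue_on K) (grad_x Q w))"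
    by (intro sum.cong refl square_integrable_lebesgue_on_solid_polytope(2)[symmetric] solid_element gK)
  finally show "(\<Sum>K\<in>set \<K>. L2_norm_sq (lebesgue_on K) (grad_x Q w)) = L2_norm_sq (lebesgue_on Q) (grad_x Q w)" ..
qed

lemma facet_square_integrable:
  fixes f :: "'d spacetime \<Rightarrow> 'b::euclidean_space"
  assumes K: "(K, K') \<in> interior_facets \<K>"
  shows "square_integrable (surface_on (frontier K)) f \<Longrightarrow> square_integrable (surface_on (K \<inter> K')) f"
    and "square_integrable (surface_on (frontier K')) f \<Longrightarrow> square_integrable (surface_on (K \<inter> K')) f"
  using facet_subset_frontiers[OF K] frontier_solid_polytope_basic(1)[OF solid_element] interior_facetsD(1,2)[OF K]
  by (auto intro: L2_restrict_space_mono(1))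

text \<open>The normal is constant on a facet, so the upwind value is the trace from one fixed side
  on all of it.\<close>

lemma upwind_estimate:
  assumes K: "(K, K') \<in> interior_facets \<K>" and w: "normal_gradient_jumps w"
  shows "square_integrable (surface_on (K \<inter> K')) (upwind K K' (grad_x Q w))"
    and "L2_norm_sq (surface_on (K \<inter> K')) (upwind K K' (grad_x Q w)) \<le>
      L2_norm_sq (surface_on (K \<inter> K')) (trace_vec K (grad_x Q w)) + L2_norm_sq (surface_on (K \<inter> K')) (trace_vec K' (grad_x Q w))"
proof -
  note F = interior_facetsD(1,2)[OF K]
  have "upwind K K' (grad_x Q w) = trace_vec K (grad_x Q w) \<or> upwind K K' (grad_x Q w) = trace_vec K' (grad_x Q w)"
    by (cases "0 \<le> snd (outer_normal K (K \<inter> K'))") (simp_all add: upwind_def fun_eq_iff)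
  then show "square_integrable (surface_on (K \<inter> K')) (upwind K K' (grad_x Q w))"
    "L2_norm_sq (surface_on (K \<inter> K')) (upwind K K' (grad_x Q w)) \<le>
      L2_norm_sq (surface_on (K \<inter> K')) (trace_vec K (grad_x Q w)) + L2_norm_sq (surface_on (K \<inter> K')) (trace_vec K' (grad_x Q w))"
    using facet_square_integrable(1)[OF K normal_gradient_jumpsD(5)[OF w F(1)]]
      facet_square_integrable(2)[OF K normal_gradient_jumpsD(5)[OF w F(2)]] by auto
qed

text \<open>The spatial part of a unit normal has length at most 1, and the square of a sum is at
  most twice the sum of the squares. This is the 2 in the bound of the interface jumps by the
  element boundaries.\<close>

lemma jump_x_estimate:
  assumes K: "(K, K') \<in> interior_facets \<K>"
    and r: "trace K r \<in> L2 (surface_on (frontier K))" "trace K' r \<in> L2 (surface_on (frontier K'))"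
  shows "square_integrable (surface_on (K \<inter> K')) (jump_x K K' r)"
    and "L2_norm_sq (surface_on (K \<inter> K')) (jump_x K K' r) \<le>
      2 * (L2_norm_sq (surface_on (K \<inter> K')) (trace K r) + L2_norm_sq (surface_on (K \<inter> K')) (trace K' r))"
proof -
  note F = interior_facetsD[OF K]
  let ?M = "surface_on (K \<inter> K')"
  have scale: "square_integrable ?M (\<lambda>y. f y *\<^sub>R fst n)" "L2_norm_sq ?M (\<lambda>y. f y *\<^sub>R fst n) \<le> L2_norm_sq ?M f"
    if f: "square_integrable ?M f" and n: "norm n = 1" for f :: "'d spacetime \<Rightarrow> real" and n :: "'d spacetime"
  proof -
    have n1: "(norm (fst n))\<^sup>2 \<le> 1" using norm_fst_le[of "fst n" "snd n"] n by (simp add: power_le_one)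
    have eq: "(norm (f y *\<^sub>R fst n))\<^sup>2 = (norm (fst n))\<^sup>2 * (norm (f y))\<^sup>2" for y by (simp add: power_mult_distrib)
    show "square_integrable ?M (\<lambda>y. f y *\<^sub>R fst n)" using f unfolding square_integrable_def eq by (auto intro!: borel_measurable_scaleR)
    have "L2_norm_sq ?M (\<lambda>y. f y *\<^sub>R fst n) = (norm (fst n))\<^sup>2 * L2_norm_sq ?M f" unfolding L2_norm_sq_def eq by simp
    then show "L2_norm_sq ?M (\<lambda>y. f y *\<^sub>R fst n) \<le> L2_norm_sq ?M f" using n1 L2_norm_sq_nonneg[of ?M f] by (simp add: mult_left_le_one_le)
  qed
  note s1 = scale[OF facet_square_integrable(1)[OF K r(1)[unfolded L2_iff_square_integrable]] solid_polytope_facets(1)[OF solid_element[OF F(1)] F(4)]]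
  note s2 = scale[OF facet_square_integrable(2)[OF K r(2)[unfolded L2_iff_square_integrable]] solid_polytope_facets(1)[OF solid_element[OF F(2)] F(5)]]
  note add = square_integrable_add[OF s1(1) s2(1)]
  show "square_integrable ?M (jump_x K K' r)" unfolding jump_x_def[abs_def] by (rule add(1))
  have "L2_norm_sq ?M (jump_x K K' r) \<le> 2 * L2_norm_sq ?M (\<lambda>y. trace K r y *\<^sub>R fst (outer_normal K (K \<inter> K'))) +
      2 * L2_norm_sq ?M (\<lambda>y. trace K' r y *\<^sub>R fst (outer_normal K' (K \<inter> K')))"
    unfolding jump_x_def[abs_def] by (rule add(2))
  also have "\<dots> \<le> 2 * L2_norm_sq ?M (trace K r) + 2 * L2_norm_sq ?M (trace K' r)"
    by (intro add_mono mult_left_mono s1(2) s2(2)) auto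
  finally show "L2_norm_sq ?M (jump_x K K' r) \<le> 2 * (L2_norm_sq ?M (trace K r) + L2_norm_sq ?M (trace K' r))" by simp
qed

text \<open>The collapse holds pointwise almost everywhere on the facet. The two remaining products
  have square integrable factors, which permits splitting the integral.\<close>

lemma facet_integral:
  assumes K: "(K, K') \<in> interior_facets \<K>" and u: "normal_gradient_jumps u" and v: "normal_gradient_jumps v"
  defines "M \<equiv> surface_on (K \<inter> K')"
  shows "(\<integral>y. upwind K K' (grad_x Q u) y \<bullet> jump_t K K' (grad_x Q v) y - average K K' (grad_x Q u) y \<bullet> jump_x K K' (d_t Q v) y
      + average K K' (grad_x Q v) y \<bullet> jump_x K K' (d_t Q u) y + \<delta> * (jump_x K K' (d_t Q u) y \<bullet> jump_x K K' (d_t Q v) y) \<partial>M) =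
    (\<integral>y. upwind K K' (grad_x Q v) y \<bullet> jump_x K K' (d_t Q u) y \<partial>M) + \<delta> * (\<integral>y. jump_x K K' (d_t Q u) y \<bullet> jump_x K K' (d_t Q v) y \<partial>M)"
    (is "?L = _")
proof -
  note F = interior_facetsD[OF K]
  note n' = shared_facet_normal(1)[OF solid_element[OF F(1)] solid_element[OF F(2)] F(4-6)]
  let ?n = "outer_normal K (K \<inter> K')"
  note ju = jump_x_estimate(1)[OF K normal_gradient_jumpsD(4)[OF u F(1)] normal_gradient_jumpsD(4)[OF u F(2)], folded M_def]
  note jv = jump_x_estimate(1)[OF K normal_gradient_jumpsD(4)[OF v F(1)] normal_gradient_jumpsD(4)[OF v F(2)], folded M_def]
  note uv = upwind_estimate(1)[OF K v, folded M_def] and uu = upwind_estimate(1)[OF K u, folded M_def]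
  have tm: "trace_vec K (grad_x Q w) \<in> borel_measurable M" "trace_vec K' (grad_x Q w) \<in> borel_measurable M"
    if w: "normal_gradient_jumps w" for w
    using facet_square_integrable(1)[OF K normal_gradient_jumpsD(5)[OF w F(1)]]
      facet_square_integrable(2)[OF K normal_gradient_jumpsD(5)[OF w F(2)]] by (auto simp: M_def square_integrable_def)
  have am: "jump_t K K' (grad_x Q w) \<in> borel_measurable M" "average K K' (grad_x Q w) \<in> borel_measurable M"
    if w: "normal_gradient_jumps w" for w
    using tm[OF w] unfolding jump_t_def[abs_def] average_def[abs_def] by (auto intro!: borel_measurable_add borel_measurable_scaleR)
  have "AE y in surface_measure. y \<in> K \<inter> K' \<longrightarrow>
    (\<exists>c. \<forall>b\<in>Basis. trace K (weak_deriv Q b u) y - trace K' (weak_deriv Q b u) y = c * (?n \<bullet> b))"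
    "AE y in surface_measure. y \<in> K \<inter> K' \<longrightarrow>
    (\<exists>c. \<forall>b\<in>Basis. trace K (weak_deriv Q b v) y - trace K' (weak_deriv Q b v) y = c * (?n \<bullet> b))"
    using u v K unfolding normal_gradient_jumps_def by blast+
  then have ae: "AE y in surface_measure. y \<in> K \<inter> K' \<longrightarrow>
    upwind K K' (grad_x Q u) y \<bullet> jump_t K K' (grad_x Q v) y - average K K' (grad_x Q u) y \<bullet> jump_x K K' (d_t Q v) y
      + average K K' (grad_x Q v) y \<bullet> jump_x K K' (d_t Q u) y = upwind K K' (grad_x Q v) y \<bullet> jump_x K K' (d_t Q u) y"
  proof eventually_elim
    case (elim y)
    show ?case
    proof
      assume y: "y \<in> K \<inter> K'"
      have split: "trace_vec K (grad_x Q w) y - trace_vec K' (grad_x Q w) y = c *\<^sub>R fst ?n" "trace K (d_t Q w) y - trace K' (d_t Q w) y = c * snd ?n"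
        if "\<forall>b\<in>Basis. trace K (weak_deriv Q b w) y - trace K' (weak_deriv Q b w) y = c * (?n \<bullet> b)" for w c
        using that by (simp_all add: vec_eq_iff d_t_def Basis_spacetime)
      obtain c d where c: "\<forall>b\<in>Basis. trace K (weak_deriv Q b u) y - trace K' (weak_deriv Q b u) y = c * (?n \<bullet> b)"
        and d: "\<forall>b\<in>Basis. trace K (weak_deriv Q b v) y - trace K' (weak_deriv Q b v) y = d * (?n \<bullet> b)"
        using elim y by blast
      show "upwind K K' (grad_x Q u) y \<bullet> jump_t K K' (grad_x Q v) y - average K K' (grad_x Q u) y \<bullet> jump_x K K' (d_t Q v) y
        + average K K' (grad_x Q v) y \<bullet> jump_x K K' (d_t Q u) y = upwind K K' (grad_x Q v) y \<bullet> jump_x K K' (d_t Q u) y"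
        unfolding upwind_def jump_t_def average_def jump_x_def n' fst_uminus snd_uminus
        by (rule facet_terms_collapse[OF split[OF c] split[OF d]])
    qed
  qed
  have "?L = (\<integral>y. upwind K K' (grad_x Q v) y \<bullet> jump_x K K' (d_t Q u) y + \<delta> * (jump_x K K' (d_t Q u) y \<bullet> jump_x K K' (d_t Q v) y) \<partial>M)"
  proof (rule integral_cong_AE)
    note ms = ju[THEN square_integrable_measurable] jv[THEN square_integrable_measurable] uv[THEN square_integrable_measurable]
      uu[THEN square_integrable_measurable] am[OF u] am[OF v]
    show "(\<lambda>y. upwind K K' (grad_x Q u) y \<bullet> jump_t K K' (grad_x Q v) y - average K K' (grad_x Q u) y \<bullet> jump_x K K' (d_t Q v) y
      + average K K' (grad_x Q v) y \<bullet> jump_x K K' (d_t Q u) y + \<delta> * (jump_x K K' (d_t Q u) y \<bullet> jump_x K K' (d_t Q v) y)) \<in> borel_measurable M"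
      "(\<lambda>y. upwind K K' (grad_x Q v) y \<bullet> jump_x K K' (d_t Q u) y + \<delta> * (jump_x K K' (d_t Q u) y \<bullet> jump_x K K' (d_t Q v) y)) \<in> borel_measurable M"
      by (intro borel_measurable_add borel_measurable_diff borel_measurable_inner borel_measurable_times borel_measurable_const ms)+
    from ae show "AE y in M. upwind K K' (grad_x Q u) y \<bullet> jump_t K K' (grad_x Q v) y - average K K' (grad_x Q u) y \<bullet> jump_x K K' (d_t Q v) y
      + average K K' (grad_x Q v) y \<bullet> jump_x K K' (d_t Q u) y + \<delta> * (jump_x K K' (d_t Q u) y \<bullet> jump_x K K' (d_t Q v) y) =
      upwind K K' (grad_x Q v) y \<bullet> jump_x K K' (d_t Q u) y + \<delta> * (jump_x K K' (d_t Q u) y \<bullet> jump_x K K' (d_t Q v) y)"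
      unfolding M_def AE_surface_on_iff[OF facet_subset_frontiers(3)[OF K]] by eventually_elim simp
  qed
  then show ?thesis
    using integrable_inner_if_square_integrable[OF uv ju] integrable_inner_if_square_integrable[OF ju jv] by simp
qed

lemma diameter_element: "K \<in> set \<K> \<Longrightarrow> 0 < diameter K"
  by (rule diameter_solid_polytope_pos[OF solid_element])

text \<open>The inverse inequality is applied to the derivative of the polynomial \<open>v\<^bsub>K\<^esub>\<close>, regarded as
  a polynomial on all of \<open>Q\<close>.\<close>

lemma gradient_inverse_inequality:
  assumes v: "v \<in> V_0h \<Omega> T p \<K>" and C: "inverse_inequality C Q p \<K>" and K: "K \<in> set \<K>"
  shows "L2_norm_sq (surface_on (frontier K)) (trace_vec K (grad_x Q v)) \<le> C\<^sup>2 / diameter K * L2_norm_sq (lebesgue_on K) (grad_x Q v)"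
proof -
  note S = solid_element[OF K] and vs = V_0h_elements(1)[OF v] and V = V_0h_normal_gradient_jumps[OF v]
  obtain q where q: "q \<in> polynomials p" "\<And>y. y \<in> K \<Longrightarrow> v y = q y" using V_0h_elements(2)[OF v] K by blast
  note qs = polynomials_smooth[OF q(1)]
  have comp: "L2_norm_sq (surface_on (frontier K)) (trace K (weak_deriv Q (e_x i) v)) \<le>
      C\<^sup>2 / diameter K * L2_norm_sq (lebesgue_on K) (weak_deriv Q (e_x i) v)" for i
  proof -
    let ?d = "deriv_along (e_x i) q"
    have ds: "smooth ?d" by (rule smooth_deriv_along[OF qs e_x_Basis])
    have ae: "AE y in surface_on (frontier K). trace K (weak_deriv Q (e_x i) v) y = ?d y"
      by (rule piecewise_smooth_deriv(4)[OF K vs qs q(2) e_x_Basis])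
    have ae': "AE y in lebesgue_on (interior K). weak_deriv Q (e_x i) v y = ?d y"
      by (rule piecewise_smooth_deriv(2)[OF K vs qs q(2) e_x_Basis])
    have l: "weak_deriv Q (e_x i) v \<in> L2 (lebesgue_on (interior K))" "?d \<in> L2 (lebesgue_on (interior K))"
      using sobolevD(1)[OF normal_gradient_jumpsD(2)[OF V K e_x_Basis]] smooth_L2_lebesgue_on[OF ds solid_polytope_basic(6,4)[OF S]] by auto
    have 1: "L2_norm_sq (surface_on (frontier K)) (trace K (weak_deriv Q (e_x i) v)) = L2_norm_sq (surface_on (frontier K)) ?d"
      by (rule L2_norm_sq_cong_AE[OF L2_measurable[OF trace_L2[OF S normal_gradient_jumpsD(2)[OF V K e_x_Basis]]]
            L2_measurable[OF smooth_L2_frontier[OF ds S S S]] ae])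
    have "L2_norm_sq (lebesgue_on (interior K)) (weak_deriv Q (e_x i) v) = L2_norm_sq (lebesgue_on (interior K)) ?d"
      by (rule L2_norm_sq_cong_AE[OF L2_measurable[OF l(1)] L2_measurable[OF l(2)] ae'])
    then have 2: "L2_norm_sq (lebesgue_on K) (weak_deriv Q (e_x i) v) = L2_norm_sq (lebesgue_on K) ?d"
      using l by (simp add: square_integrable_lebesgue_on_solid_polytope(2)[OF S] L2_iff_square_integrable)
    have "?d \<in> V_h Q p \<K>"
      using polynomials_deriv_along[OF q(1) e_x_Basis, of i] smooth_continuous_on[OF ds] by (auto simp: V_h_def)
    then have "sqrt (L2_norm_sq (surface_on (frontier K)) ?d) \<le> C * diameter K powr (-1/2) * sqrt (L2_norm_sq (lebesgue_on K) ?d)"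
      using C K by (auto simp: inverse_inequality_def)
    then have "(sqrt (L2_norm_sq (surface_on (frontier K)) ?d))\<^sup>2 \<le> (C * diameter K powr (-1/2) * sqrt (L2_norm_sq (lebesgue_on K) ?d))\<^sup>2"
      by (intro power_mono) auto
    also have "\<dots> = C\<^sup>2 * (diameter K powr (-1/2))\<^sup>2 * L2_norm_sq (lebesgue_on K) ?d" by (simp add: power_mult_distrib)
    also have "(diameter K powr (-1/2))\<^sup>2 = 1 / diameter K"
      using diameter_element[OF K] powr_add[of "diameter K" "-1/2" "-1/2"] by (simp add: power2_eq_square powr_minus_divide)
    finally show ?thesis unfolding 1 2 by simp
  qed
  have l: "weak_deriv Q (e_x i) v \<in> L2 (lebesgue_on K)" for i
    unfolding L2_iff_square_integrable
    by (rule square_integrable_lebesgue_on_solid_polytope(1)[OF S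
          sobolevD(1)[OF normal_gradient_jumpsD(2)[OF V K e_x_Basis], unfolded L2_iff_square_integrable]])
  have "L2_norm_sq (surface_on (frontier K)) (trace_vec K (grad_x Q v)) = (\<Sum>i\<in>UNIV. L2_norm_sq (surface_on (frontier K)) (trace K (weak_deriv Q (e_x i) v)))"
    using trace_L2[OF S normal_gradient_jumpsD(2)[OF V K e_x_Basis]] by (subst square_integrable_vec(2)) simp_all
  also have "\<dots> \<le> (\<Sum>i\<in>UNIV. C\<^sup>2 / diameter K * L2_norm_sq (lebesgue_on K) (weak_deriv Q (e_x i) v))" by (rule sum_mono) (rule comp)
  also have "\<dots> = C\<^sup>2 / diameter K * L2_norm_sq (lebesgue_on K) (grad_x Q v)"
    using l by (subst square_integrable_vec(2)[of "grad_x Q v"]) (simp_all add: sum_distrib_left)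
  finally show ?thesis .
qed

end

section \<open>Assembling the estimate\<close>

context space_time_mesh
begin

text \<open>Stated for any \<open>u\<close> with normal gradient jumps, the common feature of the
  two summands of the trial space. The form is split into seven terms, each bounded by a product of
  one part of each norm or two such products; the constant arises only when they are
  combined.\<close>

lemma bilinear_form_bound:
  fixes C_inv C_u \<theta> \<delta> :: real
  assumes u: "normal_gradient_jumps u" and v: "v \<in> V_0h \<Omega> T p \<K>"
    and C_u: "C_u > 0" and qu: "quasi_uniform C_u \<K>" and C: "C_inv > 0" and inv: "inverse_inequality C_inv Q p \<K>"
    and \<delta>: "\<delta> > 0" and \<theta>: "0 < \<theta>" "\<theta> \<le> inverse (C_inv\<^sup>2 * C_u\<^sup>2)"
  shows "\<bar>a_h \<Omega> T \<theta> \<delta> \<K> u v\<bar> \<le> sqrt (max (inverse \<delta> * inverse (C_inv\<^sup>2) / 2) (4 + inverse \<delta> / 2)) *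
    norm_h_star \<Omega> T \<theta> \<delta> \<K> u * norm_h \<Omega> T \<theta> \<delta> \<K> v"
proof -
  define h where "h = mesh_size \<K>"
  define \<Gamma> where "\<Gamma> K = surface_on (frontier K \<inter> Sigma_top \<Omega> T)" for K
  define \<F> where "\<F> = interior_facets \<K>"
  define S where "S e = surface_on (fst e \<inter> snd e)" for e :: "'d spacetime set \<times> 'd spacetime set"
  define k where "k = inverse (C_inv\<^sup>2)"
  note V = V_0h_normal_gradient_jumps[OF v]
  note us = normal_gradient_jumpsD(1)[OF u] and vs = normal_gradient_jumpsD(1)[OF V]
  have k: "k > 0" using C by (simp add: k_def)
  obtain K0 where K0: "K0 \<in> set \<K>" using closure_Q Q_facts(3) closure_subset[of Q] by fastforce
  have dh: "diameter K \<le> h" "h \<le> C_u * diameter K" if "K \<in> set \<K>" for K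
    using qu that by (auto simp: quasi_uniform_def h_def)
  have h: "h > 0" using dh(1)[OF K0] diameter_element[OF K0] by linarith
  have "1 * diameter K0 \<le> C_u * diameter K0" using dh[OF K0] by linarith
  \<comment> \<open>Both bounds of quasi-uniformity on one element, together with its positive
    diameter, force the constant to be at least 1.\<close>
  then have C_u1: "1 \<le> C_u" using diameter_element[OF K0] by (simp only: mult_le_cancel_right_pos)
  have \<theta>h: "\<theta> * h > 0" using \<theta> h by simp
  \<comment> \<open>The bound on \<open>\<theta>\<close> contains the square of \<open>C_u\<close>:
    one factor is consumed in passing from \<open>h\<close> to the local diameter, the other is at
    least 1 and is dropped.\<close>
  have \<theta>hK: "\<theta> * h \<le> k * diameter K" if K: "K \<in> set \<K>" for K
  proof -
    have "\<theta> * h \<le> (k * inverse (C_u\<^sup>2)) * (C_u * diameter K)"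
      using \<theta> dh(2)[OF K] h k by (intro mult_mono) (auto simp: k_def)
    also have "\<dots> = (k * diameter K) * inverse C_u" using C_u by (simp add: field_simps power2_eq_square)
    also have "\<dots> \<le> (k * diameter K) * 1"
      using C_u1 k diameter_element[OF K] by (intro mult_left_mono) (auto simp: inverse_le_1_iff)
    finally show ?thesis by simp
  qed
  have IF: "(fst e, snd e) \<in> interior_facets \<K>" if "e \<in> \<F>" for e using that by (simp add: \<F>_def)
  note fK = interior_facetsD(1)[OF IF] and fK' = interior_facetsD(2)[OF IF]

  let ?gu = "grad_x Q u" and ?gv = "grad_x Q v" and ?du = "d_t Q u" and ?dv = "d_t Q v"
  define A1 where "A1 = L2_norm_sq (lebesgue_on Q) ?gu"
  define A2 where "A2 = \<theta> * h * L2_norm_sq (lebesgue_on Q) ?du"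
  define A3 where "A3 = 1/2 * (\<Sum>K\<in>set \<K>. L2_norm_sq (\<Gamma> K) (trace K u))"
  define A4 where "A4 = \<theta> * h * (\<Sum>K\<in>set \<K>. L2_norm_sq (\<Gamma> K) (trace_vec K ?gu))"
  define A5 where "A5 = \<theta> * h * (\<Sum>e\<in>\<F>. L2_norm_sq (S e) (jump_t (fst e) (snd e) ?gu))"
  define J where "J = \<theta> * h * (\<Sum>e\<in>\<F>. L2_norm_sq (S e) (jump_x (fst e) (snd e) ?du))"
  define A7 where "A7 = inverse (\<theta> * h) * L2_norm_sq (lebesgue_on Q) u"
  define A8 where "A8 = (\<theta> * h)\<^sup>2 * (\<Sum>K\<in>set \<K>. L2_norm_sq (lebesgue_on K) (d_t_grad_x Q K u))"
  define A9 where "A9 = \<theta> * h * (\<Sum>e\<in>\<F>. L2_norm_sq (S e) (upwind (fst e) (snd e) ?gu))"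
  define A10 where "A10 = (\<Sum>K\<in>set \<K>. diameter K * L2_norm_sq (surface_on (frontier K)) (trace K ?du))"
  define B1 where "B1 = L2_norm_sq (lebesgue_on Q) ?gv"
  define B2 where "B2 = \<theta> * h * L2_norm_sq (lebesgue_on Q) ?dv"
  define B3 where "B3 = 1/2 * (\<Sum>K\<in>set \<K>. L2_norm_sq (\<Gamma> K) (trace K v))"
  define B4 where "B4 = \<theta> * h / 2 * (\<Sum>K\<in>set \<K>. L2_norm_sq (\<Gamma> K) (trace_vec K ?gv))"
  define B5 where "B5 = \<theta> * h / 2 * (\<Sum>e\<in>\<F>. L2_norm_sq (S e) (jump_t (fst e) (snd e) ?gv))"
  define Jv where "Jv = (\<Sum>e\<in>\<F>. L2_norm_sq (S e) (jump_x (fst e) (snd e) ?dv))"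
  define B6 where "B6 = \<delta> * \<theta> * h * Jv"
  define t1 where "t1 = (\<integral>y. ?du y * v y \<partial>lebesgue_on Q)"
  define t2 where "t2 = \<theta> * h * (\<integral>y. ?du y * ?dv y \<partial>lebesgue_on Q)"
  define t3 where "t3 = (\<integral>y. ?gu y \<bullet> ?gv y \<partial>lebesgue_on Q)"
  define t4 where "t4 = \<theta> * h * (\<Sum>K\<in>set \<K>. \<integral>y. d_t_grad_x Q K u y \<bullet> ?gv y \<partial>lebesgue_on K)"
  define t5 where "t5 = \<theta> * h * (\<Sum>K\<in>set \<K>. \<integral>y. trace_vec K ?gu y \<bullet> trace_vec K ?gv y \<partial>\<Gamma> K)"
  define t6 where "t6 = \<theta> * h * (\<Sum>e\<in>\<F>. \<integral>y. upwind (fst e) (snd e) ?gv y \<bullet> jump_x (fst e) (snd e) ?du y \<partial>S e)"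
  define t7 where "t7 = \<theta> * h * \<delta> * (\<Sum>e\<in>\<F>. \<integral>y. jump_x (fst e) (snd e) ?du y \<bullet> jump_x (fst e) (snd e) ?dv y \<partial>S e)"

  have L2Q: "u \<in> L2 (lebesgue_on Q)" "v \<in> L2 (lebesgue_on Q)" "?du \<in> L2 (lebesgue_on Q)" "?dv \<in> L2 (lebesgue_on Q)"
    using sobolevD(1,2)[OF us] sobolevD(1,2)[OF vs] by (auto simp: d_t_def)
  have grads: "square_integrable (lebesgue_on Q) ?gu" "square_integrable (lebesgue_on Q) ?gv"
    by (rule grad_x_square_integrable[OF us], rule grad_x_square_integrable[OF vs])
  have top: "frontier K \<inter> Sigma_top \<Omega> T \<in> sets borel" "frontier K \<in> sets borel" if "K \<in> set \<K>" for K
    using frontier_solid_polytope_basic(1)[OF solid_element[OF that]] boundary_parts(5) by auto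
  have topI: "square_integrable (\<Gamma> K) f" if "K \<in> set \<K>" "square_integrable (surface_on (frontier K)) f"
    for K and f :: "'d spacetime \<Rightarrow> 'b::euclidean_space"
    using L2_restrict_space_mono(1)[OF that(2)] top[OF that(1)] by (simp add: \<Gamma>_def)
  have topI1: "square_integrable (\<Gamma> K) f" if "K \<in> set \<K>" "f \<in> L2 (surface_on (frontier K))" for K f
    using topI[of K f] that by (simp add: L2_iff_square_integrable)
  have jumps: "square_integrable (S e) (jump_x (fst e) (snd e) ?du)" "square_integrable (S e) (jump_x (fst e) (snd e) ?dv)"
    "square_integrable (S e) (upwind (fst e) (snd e) ?gv)" if "e \<in> \<F>" for e
    unfolding S_def by (rule jump_x_estimate(1)[OF IF[OF that]] upwind_estimate(1)[OF IF[OF that] V]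
        normal_gradient_jumpsD(4)[OF u fK[OF that]] normal_gradient_jumpsD(4)[OF u fK'[OF that]]
        normal_gradient_jumpsD(4)[OF V fK[OF that]] normal_gradient_jumpsD(4)[OF V fK'[OF that]])+

  have form: "a_h \<Omega> T \<theta> \<delta> \<K> u v = t1 + t2 + t3 - t4 + t5 + (t6 + t7)"
  proof -
    have "(\<integral>y. ?du y * (v y + \<theta> * h * ?dv y) + ?gu y \<bullet> ?gv y \<partial>lebesgue_on Q) = t1 + t2 + t3"
    proof -
      have "(\<integral>y. ?du y * (v y + \<theta> * h * ?dv y) + ?gu y \<bullet> ?gv y \<partial>lebesgue_on Q) =
        (\<integral>y. (?du y * v y + \<theta> * h * (?du y * ?dv y)) + ?gu y \<bullet> ?gv y \<partial>lebesgue_on Q)"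
        by (intro Bochner_Integration.integral_cong refl) (simp add: algebra_simps)
      then show ?thesis
        using L2_mult_integrable[OF L2Q(3,2)] L2_mult_integrable[OF L2Q(3,4)] integrable_inner_if_square_integrable[OF grads]
        by (simp add: t1_def t2_def t3_def)
    qed
    moreover have "\<theta> * h * (\<Sum>(K, K')\<in>interior_facets \<K>.
          \<integral>y. upwind K K' ?gu y \<bullet> jump_t K K' ?gv y - average K K' ?gu y \<bullet> jump_x K K' ?dv y
              + average K K' ?gv y \<bullet> jump_x K K' ?du y + \<delta> * (jump_x K K' ?du y \<bullet> jump_x K K' ?dv y) \<partial>surface_on (K \<inter> K')) = t6 + t7"
    proof -
      have "(\<Sum>(K, K')\<in>interior_facets \<K>.
          \<integral>y. upwind K K' ?gu y \<bullet> jump_t K K' ?gv y - average K K' ?gu y \<bullet> jump_x K K' ?dv y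
              + average K K' ?gv y \<bullet> jump_x K K' ?du y + \<delta> * (jump_x K K' ?du y \<bullet> jump_x K K' ?dv y) \<partial>surface_on (K \<inter> K')) =
        (\<Sum>e\<in>\<F>. (\<integral>y. upwind (fst e) (snd e) ?gv y \<bullet> jump_x (fst e) (snd e) ?du y \<partial>S e) +
          \<delta> * (\<integral>y. jump_x (fst e) (snd e) ?du y \<bullet> jump_x (fst e) (snd e) ?dv y \<partial>S e))"
        unfolding \<F>_def S_def case_prod_unfold
        by (rule sum.cong[OF refl]) (rule facet_integral[OF _ u V], simp)
      then show ?thesis by (simp add: t6_def t7_def sum.distrib sum_distrib_left distrib_left mult.assoc)
    qed
    ultimately show ?thesis by (simp add: a_h_def Let_def h_def t4_def t5_def \<Gamma>_def)
  qed

  have pos: "0 \<le> A1" "0 \<le> A2" "0 \<le> A3" "0 \<le> A4" "0 \<le> A5" "0 \<le> A7" "0 \<le> A8" "0 \<le> A9" "0 \<le> J"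
    "0 \<le> B1" "0 \<le> B2" "0 \<le> B3" "0 \<le> B4" "0 \<le> B5" "0 \<le> B6"
    unfolding A1_def A2_def A3_def A4_def A5_def A7_def A8_def A9_def J_def B1_def B2_def B3_def B4_def B5_def B6_def Jv_def
    using \<theta> h \<delta> by (auto intro!: mult_nonneg_nonneg sum_nonneg)

  \<comment> \<open>Jumps are bounded by one-sided traces with a factor 2, facet sums by element
    sums, and \<open>\<theta> * h\<close> by \<open>k\<close> times the diameter, which is the
    weight of the boundary term in the norm of \<open>u\<close>.\<close>
  have JA: "J \<le> 2 * k * A10"
  proof -
    have "(\<Sum>e\<in>\<F>. L2_norm_sq (S e) (jump_x (fst e) (snd e) ?du)) \<le>
      (\<Sum>e\<in>\<F>. 2 * (L2_norm_sq (S e) (trace (fst e) ?du) + L2_norm_sq (S e) (trace (snd e) ?du)))"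
      unfolding S_def using jump_x_estimate(2)[OF IF normal_gradient_jumpsD(4)[OF u fK] normal_gradient_jumpsD(4)[OF u fK']]
      by (intro sum_mono) auto
    also have "\<dots> = 2 * (\<Sum>(K, K')\<in>interior_facets \<K>. L2_norm_sq (surface_on (K \<inter> K')) (trace K ?du) + L2_norm_sq (surface_on (K \<inter> K')) (trace K' ?du))"
      by (simp add: sum_distrib_left \<F>_def S_def case_prod_unfold)
    also have "\<dots> \<le> 2 * (\<Sum>K\<in>set \<K>. L2_norm_sq (surface_on (frontier K)) (trace K ?du))"
      using normal_gradient_jumpsD(4)[OF u] unfolding L2_iff_square_integrable
      by (intro mult_left_mono sum_interior_facets_le) auto
    finally have "J \<le> \<theta> * h * (2 * (\<Sum>K\<in>set \<K>. L2_norm_sq (surface_on (frontier K)) (trace K ?du)))"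
      unfolding J_def using \<theta>h by (intro mult_left_mono) auto
    also have "\<dots> = (\<Sum>K\<in>set \<K>. 2 * ((\<theta> * h) * L2_norm_sq (surface_on (frontier K)) (trace K ?du)))"
      by (simp add: sum_distrib_left mult_ac)
    also have "\<dots> \<le> (\<Sum>K\<in>set \<K>. 2 * ((k * diameter K) * L2_norm_sq (surface_on (frontier K)) (trace K ?du)))"
      using \<theta>hK by (intro sum_mono mult_left_mono mult_right_mono) auto
    also have "\<dots> = 2 * k * A10" by (simp add: A10_def sum_distrib_left mult_ac)
    finally show ?thesis .
  qed
  \<comment> \<open>The inverse inequality costs \<open>C_inv\<^sup>2 / diameter K\<close>, which
    the bound on \<open>\<theta> * h\<close> cancels exactly. Hence this trace term of
    \<open>v\<close> is absorbed by its gradient with constant 1.\<close>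
  have UB: "\<theta> * h * (\<Sum>e\<in>\<F>. L2_norm_sq (S e) (upwind (fst e) (snd e) ?gv)) \<le> B1"
  proof -
    have "(\<Sum>e\<in>\<F>. L2_norm_sq (S e) (upwind (fst e) (snd e) ?gv)) \<le>
      (\<Sum>(K, K')\<in>interior_facets \<K>. L2_norm_sq (surface_on (K \<inter> K')) (trace_vec K ?gv) + L2_norm_sq (surface_on (K \<inter> K')) (trace_vec K' ?gv))"
      unfolding \<F>_def S_def case_prod_unfold using upwind_estimate(2)[OF _ V] by (intro sum_mono) simp
    also have "\<dots> \<le> (\<Sum>K\<in>set \<K>. L2_norm_sq (surface_on (frontier K)) (trace_vec K ?gv))"
      by (rule sum_interior_facets_le) (rule normal_gradient_jumpsD(5)[OF V])
    also have "\<dots> \<le> (\<Sum>K\<in>set \<K>. C_inv\<^sup>2 / diameter K * L2_norm_sq (lebesgue_on K) ?gv)"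
      by (rule sum_mono) (rule gradient_inverse_inequality[OF v inv])
    finally have "\<theta> * h * (\<Sum>e\<in>\<F>. L2_norm_sq (S e) (upwind (fst e) (snd e) ?gv)) \<le>
        \<theta> * h * (\<Sum>K\<in>set \<K>. C_inv\<^sup>2 / diameter K * L2_norm_sq (lebesgue_on K) ?gv)"
      using \<theta>h by (intro mult_left_mono) auto
    also have "\<dots> = (\<Sum>K\<in>set \<K>. (\<theta> * h * (C_inv\<^sup>2 / diameter K)) * L2_norm_sq (lebesgue_on K) ?gv)"
      by (simp add: sum_distrib_left mult_ac)
    also have "\<dots> \<le> (\<Sum>K\<in>set \<K>. 1 * L2_norm_sq (lebesgue_on K) ?gv)"
    proof (intro sum_mono mult_right_mono L2_norm_sq_nonneg)
      fix K assume K: "K \<in> set \<K>"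
      have "\<theta> * h * (C_inv\<^sup>2 / diameter K) \<le> k * diameter K * (C_inv\<^sup>2 / diameter K)"
        using \<theta>hK[OF K] diameter_element[OF K] by (intro mult_right_mono) auto
      also have "\<dots> = 1" using diameter_element[OF K] C by (simp add: k_def)
      finally show "\<theta> * h * (C_inv\<^sup>2 / diameter K) \<le> 1" .
    qed
    finally show ?thesis using normal_gradient_jumpsD(8)[OF V] by (simp add: B1_def)
  qed

  have scale: "\<bar>c * x\<bar> \<le> sqrt (c * a) * sqrt (c * b)" if "0 < c" "\<bar>x\<bar> \<le> sqrt a * sqrt b" for c x a b :: real
  proof -
    have "\<bar>c * x\<bar> \<le> c * (sqrt a * sqrt b)" using that by (simp add: abs_mult)
    also have "\<dots> = sqrt (c * a) * sqrt (c * b)" using that(1) by (simp add: real_sqrt_mult)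
    finally show ?thesis .
  qed
  \<comment> \<open>After integration by parts the weights \<open>inverse (\<theta> * h)\<close> of
    \<open>u\<close> and \<open>\<theta> * h\<close> of the time derivative of \<open>v\<close>
    cancel. The factors 2 undo the 1/2 in front of the top terms of both norms.\<close>
  have b1: "\<bar>t1\<bar> \<le> sqrt A7 * sqrt B2 + sqrt (2 * A3) * sqrt (2 * B3)"
  proof -
    have "t1 + (\<integral>y. u y * ?dv y \<partial>lebesgue_on Q) = (\<Sum>K\<in>set \<K>. \<integral>y. trace K u y * trace K v y \<partial>\<Gamma> K)"
      using time_integration_by_parts[OF us v] L2_mult_integrable[OF L2Q(3,2)] L2_mult_integrable[OF L2Q(1,4)]
      by (simp add: t1_def d_t_def \<Gamma>_def)
    moreover have "\<bar>\<integral>y. u y * ?dv y \<partial>lebesgue_on Q\<bar> \<le> sqrt A7 * sqrt B2"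
    proof -
      have "sqrt A7 * sqrt B2 = sqrt (L2_norm_sq (lebesgue_on Q) u) * sqrt (L2_norm_sq (lebesgue_on Q) ?dv)"
      proof -
        have "sqrt (inverse c * x) * sqrt (c * y) = sqrt x * sqrt y" if "0 < c" for c x y :: real
          using that by (simp add: real_sqrt_mult real_sqrt_inverse)
        from this[OF \<theta>h] show ?thesis unfolding A7_def B2_def .
      qed
      then show ?thesis using integral_mult_le[OF L2Q(1,4)] by simp
    qed
    moreover have "\<bar>\<Sum>K\<in>set \<K>. \<integral>y. trace K u y * trace K v y \<partial>\<Gamma> K\<bar> \<le> sqrt (2 * A3) * sqrt (2 * B3)"
      using sum_integral_inner_le[of "set \<K>" \<Gamma> "\<lambda>K. trace K u" "\<lambda>K. trace K v",
          OF topI1[OF _ normal_gradient_jumpsD(3)[OF u]] topI1[OF _ normal_gradient_jumpsD(3)[OF V]]]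
      by (simp add: A3_def B3_def)
    ultimately show ?thesis by linarith
  qed
  have b2: "\<bar>t2\<bar> \<le> sqrt A2 * sqrt B2"
    unfolding t2_def A2_def B2_def by (rule scale[OF \<theta>h integral_mult_le[OF L2Q(3,4)]])
  have b3: "\<bar>t3\<bar> \<le> sqrt A1 * sqrt B1"
    unfolding t3_def A1_def B1_def by (rule integral_inner_le[OF grads])
  have b4: "\<bar>t4\<bar> \<le> sqrt A8 * sqrt B1"
  proof -
    have "\<bar>t4\<bar> = \<theta> * h * \<bar>\<Sum>K\<in>set \<K>. \<integral>y. d_t_grad_x Q K u y \<bullet> ?gv y \<partial>lebesgue_on K\<bar>"
      using \<theta> h by (simp add: t4_def abs_mult)
    also have "\<dots> \<le> \<theta> * h * (sqrt (\<Sum>K\<in>set \<K>. L2_norm_sq (lebesgue_on K) (d_t_grad_x Q K u)) * sqrt (\<Sum>K\<in>set \<K>. L2_norm_sq (lebesgue_on K) ?gv))"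
      using \<theta>h by (intro mult_left_mono sum_integral_inner_le normal_gradient_jumpsD(6)[OF u] normal_gradient_jumpsD(7)[OF V]) auto
    also have "\<dots> = sqrt A8 * sqrt B1"
      using \<theta>h normal_gradient_jumpsD(8)[OF V] by (simp add: A8_def B1_def real_sqrt_mult)
    finally show ?thesis .
  qed
  have b5: "\<bar>t5\<bar> \<le> sqrt A4 * sqrt (2 * B4)"
  proof -
    have "2 * B4 = \<theta> * h * (\<Sum>K\<in>set \<K>. L2_norm_sq (\<Gamma> K) (trace_vec K ?gv))" by (simp add: B4_def)
    then show ?thesis unfolding t5_def A4_def
      using scale[OF \<theta>h sum_integral_inner_le[of "set \<K>" \<Gamma> "\<lambda>K. trace_vec K ?gu" "\<lambda>K. trace_vec K ?gv",
          OF topI[OF _ normal_gradient_jumpsD(5)[OF u]] topI[OF _ normal_gradient_jumpsD(5)[OF V]]]] by simp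
  qed
  have b6: "\<bar>t6\<bar> \<le> sqrt J * sqrt B1"
  proof -
    have "\<bar>t6\<bar> \<le> sqrt (\<theta> * h * (\<Sum>e\<in>\<F>. L2_norm_sq (S e) (upwind (fst e) (snd e) ?gv))) * sqrt J"
      unfolding t6_def J_def by (intro scale[OF \<theta>h] sum_integral_inner_le jumps)
    also have "\<dots> \<le> sqrt B1 * sqrt J" using UB pos by (intro mult_right_mono) auto
    finally show ?thesis by (simp add: mult.commute)
  qed
  have b7: "\<bar>t7\<bar> \<le> sqrt (\<delta> * J) * sqrt B6"
  proof -
    have "\<bar>t7\<bar> \<le> sqrt (\<theta> * h * \<delta> * (\<Sum>e\<in>\<F>. L2_norm_sq (S e) (jump_x (fst e) (snd e) ?du))) *
        sqrt (\<theta> * h * \<delta> * (\<Sum>e\<in>\<F>. L2_norm_sq (S e) (jump_x (fst e) (snd e) ?dv)))"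
      unfolding t7_def using \<theta>h \<delta> by (intro scale sum_integral_inner_le jumps) auto
    then show ?thesis by (simp add: J_def B6_def Jv_def mult_ac)
  qed
  have "\<bar>t6 + t7\<bar> \<le> sqrt J * sqrt B1 + sqrt (\<delta> * J) * sqrt B6" using b6 b7 by linarith
  note combine_bounds[OF \<delta> k refl pos(1-9) JA pos(10-15) b1 b2 b3 b4 b5 this]
  moreover have "norm_h_star \<Omega> T \<theta> \<delta> \<K> u = sqrt (A1 + A2 + A3 + A4 + A5 + \<delta> * J + A7 + A8 + A9 + A10)"
    by (simp add: norm_h_star_def Let_def A1_def A2_def A3_def A4_def A5_def J_def A7_def A8_def A9_def A10_def
        h_def \<Gamma>_def \<F>_def S_def case_prod_unfold mult.assoc)
  moreover have "norm_h \<Omega> T \<theta> \<delta> \<K> v = sqrt (B1 + B2 + B3 + B4 + B5 + B6)"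
    by (simp add: norm_h_def Let_def B1_def B2_def B3_def B4_def B5_def B6_def Jv_def
        h_def \<Gamma>_def \<F>_def S_def case_prod_unfold mult.assoc)
  ultimately show ?thesis unfolding form k_def by simp
qed

end

text \<open>The family \<open>\<M>\<close> stands for the meshes of all sizes \<open>h\<close>. The
  constant is fixed before a mesh is chosen, which expresses its independence of
  \<open>h\<close>.\<close>

theorem lemma6:
  fixes \<Omega> :: "real \<Rightarrow> (real ^ 'd::finite) set"
    and T \<theta> \<delta> C_u C_inv :: real
    and p :: nat
    and \<M> :: "'d mesh set"
  assumes "CARD('d) \<in> {1, 2, 3}"
    and "T > 0"
    and "space_time_domain \<Omega> T"
    and "p \<ge> 1"
    and "\<And>\<K>. \<K> \<in> \<M> \<Longrightarrow> decomposition (Q_dom \<Omega> T) \<K>"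
    and "C_u > 0"
    and "\<And>\<K>. \<K> \<in> \<M> \<Longrightarrow> quasi_uniform C_u \<K>"
    and "C_inv > 0"
    and "\<And>\<K>. \<K> \<in> \<M> \<Longrightarrow> inverse_inequality C_inv (Q_dom \<Omega> T) p \<K>"
    and "\<delta> > 0"
    and "0 < \<theta>" and "\<theta> \<le> inverse (C_inv\<^sup>2 * C_u\<^sup>2)"
  shows "\<exists>\<mu>>0. \<mu> = sqrt (max (inverse \<delta> * inverse (C_inv\<^sup>2) / 2) (4 + inverse \<delta> / 2)) \<and>
           (\<forall>\<K>\<in>\<M>. \<forall>u\<in>V_0h_star \<Omega> T p \<K>. \<forall>v\<in>V_0h \<Omega> T p \<K>.
              \<bar>a_h \<Omega> T \<theta> \<delta> \<K> u v\<bar> \<le> \<mu> * norm_h_star \<Omega> T \<theta> \<delta> \<K> u * norm_h \<Omega> T \<theta> \<delta> \<K> v)"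
proof (intro exI conjI ballI)
  have "0 < 4 + inverse \<delta> / 2" using \<open>\<delta> > 0\<close> by (simp add: add_pos_pos)
  then show "0 < sqrt (max (inverse \<delta> * inverse (C_inv\<^sup>2) / 2) (4 + inverse \<delta> / 2))" by (simp add: less_max_iff_disj)
  fix \<K> u v
  assume \<K>: "\<K> \<in> \<M>" and u: "u \<in> V_0h_star \<Omega> T p \<K>" and v: "v \<in> V_0h \<Omega> T p \<K>"
  interpret space_time_mesh \<Omega> T \<K>
    using assms(2,3,5) \<K> by (simp add: space_time_mesh_def)
  show "\<bar>a_h \<Omega> T \<theta> \<delta> \<K> u v\<bar> \<le> sqrt (max (inverse \<delta> * inverse (C_inv\<^sup>2) / 2) (4 + inverse \<delta> / 2)) *
      norm_h_star \<Omega> T \<theta> \<delta> \<K> u * norm_h \<Omega> T \<theta> \<delta> \<K> v"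
    using bilinear_form_bound[OF V_0h_star_normal_gradient_jumps[OF u] v] assms \<K> by blast
qed (rule refl)

end
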